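(* Let $f\in L^2(\Omega)$, $u_D\in L^2(\Gamma_D)$, $u_N\in L^2(\Gamma_N)$, and let $(\boldsymbol{p}_h,u_h,\hat u_h)\in\boldsymbol{\mathcal{V}}_h^k\times\mathcal{U}_h^k\times\mathcal{F}_h^k$ solve the HDG scheme $$(\boldsymbol{p}_h,\boldsymbol{q}_h)_{\mathcal{T}_h}=(u_h,\nabla\cdot\boldsymbol{q}_h)_{\mathcal{T}_h}-\langle\hat u_h,\boldsymbol{q}_h\cdot\boldsymbol{n}\rangle_{\partial\mathcal{T}_h},$$ $$\tau\langle u_h-\hat u_h,v_h-\hat v_h\rangle_{\partial\mathcal{T}_h}+(\nabla\cdot\boldsymbol{p}_h,v_h)_{\mathcal{T}_h}-\langle\boldsymbol{p}_h\cdot\boldsymbol{n},\hat v_h\rangle_{\partial\mathcal{T}_h}=(f,v_h)_{\mathcal{T}_h}+\langle u_N,\hat v_h\rangle_{\Gamma_N},$$ $$\langle\hat u_h,\hat v_h\rangle_{\Gamma_D}=\langle u_D,\hat v_h\rangle_{\Gamma_D},$$ for all $(\boldsymbol{q}_h,v_h,\hat v_h)\in\boldsymbol{\mathcal{V}}_h^k\times\mathcal{U}_h^k\times\mathcal{F}_h^k$. Then $$\|\boldsymbol{p}_h\|^2_{\boldsymbol{L}^2(\mathcal{T}_h)}+\tau\|u_h-\hat u_h\|^2_{L^2(\partial\mathcal{T}_h)}+\|\hat u_h\|_{L^2(\Gamma_D)}^2\le C(f,u_D,u_N),$$ where the constant $C(f,u_D,u_N)$ depends on $\|f\|_{L^2(\Omega)}$,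 $\|u_D\|_{L^2(\Gamma_D)}$, $\|u_N\|_{L^2(\Gamma_N)}$ and the domain (and on the fixed parameters listed in the context) but is independent of the mesh.
   Context: $\Omega\subset\mathbb{R}^d$, $d\in\{2,3\}$, is a connected, bounded, open polyhedral domain with $\partial\Omega=\bar\Gamma_D\cup\bar\Gamma_N$, $\Gamma_D\cap\Gamma_N=\emptyset$; $k\ge 0$ is an integer. $\mathcal{T}_h$ is a triangulation of $\Omega$ into simplices $K$ (triangles if $d=2$, tetrahedra if $d=3$), with no hanging nodes, which is shape regular, $\min_{K\in\mathcal{T}_h}|K|/\mathrm{diam}(K)^d\ge\kappa_{\mathcal{T}}>0$, and quasi-uniform, $\mathrm{diam}(K)/\mathrm{diam}(K')\le A_{\mathrm{qu}}$ for all $K,K'\in\mathcal{T}_h$, with constants $\kappa_{\mathcal{T}},A_{\mathrm{qu}}$ not depending on the mesh. The mesh is assumed to resolve $\Gamma_D$ and $\Gamma_N$: each is a union of boundary faces. $\partial\mathcal{T}_h$ is the set of all faces (the skeleton); $\boldsymbol{n}$ is the outward unit normal of the element under consideration. The stabilization parameter $\tau$ is a fixed positive constant. Spaces: $\mathcal{P}^k$ denotes polynomials of degree at most $k$ and $\boldsymbol{\mathcal{P}}^k$ the $\mathbb{R}^d$-valued ones; $\mathcal{U}_h^k=\{f\in L^2(\mathcal{T}_h): f|_K\in\mathcal{P}^k(K)\ \forall K\in\mathcal{T}_h\}$; $\mathcal{F}_h^k=\{\hat f\in L^2(\partial\mathcal{T}_h):\hat f|_e\in\mathcal{P}^k(e)\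 \forall e\in\partial\mathcal{T}_h\}$ (one value on each face); $\boldsymbol{\mathcal{V}}_h^k=\{\boldsymbol{f}\in\boldsymbol{L}^2(\mathcal{T}_h):\boldsymbol{f}|_K\in\boldsymbol{\mathcal{P}}^k(K)\ \forall K\}$. Inner products and norms: $(\cdot,\cdot)_{\mathcal{T}_h}=\sum_K(\cdot,\cdot)_{L^2(K)}$ with elementwise derivatives; $\langle\cdot,\cdot\rangle_{\partial\mathcal{T}_h}=\sum_K\langle\cdot,\cdot\rangle_{L^2(\partial K)}$; $\langle\cdot,\cdot\rangle_{\Gamma_D}$, $\langle\cdot,\cdot\rangle_{\Gamma_N}$ are the $L^2$ inner products on $\Gamma_D$, $\Gamma_N$; $\|\cdot\|_{\boldsymbol{L}^2(\mathcal{T}_h)}^2=\sum_K\|\cdot\|_{\boldsymbol{L}^2(K)}^2$; $\|w\|_{L^2(\partial\mathcal{T}_h)}^2=\sum_{K}\|w\|_{L^2(\partial K)}^2$, where on $\partial K$ the trace of $u_h|_K$ is used (so each interior face is counted twice, once from each side). The scheme discretizes the mixed boundary value problem $-\Delta u=f$ in $\Omega$, $u=u_D$ on $\Gamma_D$, $\nabla u\cdot\boldsymbol{n}=u_N$ on $\Gamma_N$, with $\boldsymbol{p}=-\nabla u$. The fixed parameters on which the constant may depend, besides the data norms and the domain (including its partition into $\Gamma_D$ and $\Gamma_N$), are $d$, $k$, $\tau$, $\kappa_{\mathcal{T}}$ and $A_{\mathrm{qu}}$. *)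

theory Defs
  imports "HOL-Analysis.Analysis"
begin

subsection \<open>Surface measure\<close>

definition hyperplanes :: "'a::euclidean_space set set" where
  "hyperplanes = {H. affine H \<and> aff_dim H = int DIM('a) - 1}"

text \<open>
  The \<open>(d - 1)\<close>-dimensional volume of a subset \<open>A\<close> of a hyperplane \<open>H\<close> is the \<open>d\<close>-dimensional volume
  of the plate of thickness 1 with mid-surface \<open>A\<close>. The points of that plate are those whose
  orthogonal projection to \<open>H\<close> (\<^const>\<open>closest_point\<close>) lies in \<open>A\<close> and which have distance at most
  \<open>1/2\<close> from it.
\<close>

definition plate :: "'a::euclidean_space set \<Rightarrow> 'a set \<Rightarrow> 'a set" where
  "plate H A = {y. closest_point H y \<in> A \<and> dist y (closest_point H y) \<le> 1/2}"

text \<open>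
  A single measure which restricts to the \<open>(d - 1)\<close>-dimensional Lebesgue measure on every
  hyperplane (see \<open>emeasure_surface_measure_hyperplane\<close>) and hence is the usual surface measure on
  every finite union of pieces of hyperplanes: one sums the contributions of \<^emph>\<open>all\<close> hyperplanes, and
  a subset of one hyperplane contributes zero to each of the others. The measure is completed, so
  that lower-dimensional parts of faces are irrelevant for measurability too.
\<close>

definition surface_measure :: "'a::euclidean_space measure" where
  "surface_measure = completion (measure_of UNIV (sets borel)
     (\<lambda>A. \<integral>\<^sup>+H. emeasure lborel (plate H A) \<partial>count_space hyperplanes))"

lemma plate_borel:
  fixes A H :: "'a::euclidean_space set"
  assumes "H \<in> hyperplanes" "A \<in> sets borel"
  shows "plate H A \<in> sets borel"
proof -
  have "affine H" "H \<noteq> {}" using assms by (auto simp: hyperplanes_def)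
  then have "continuous_on UNIV (closest_point H)"
    by (intro continuous_on_closest_point affine_imp_convex affine_closed)
  then have [measurable]: "closest_point H \<in> borel_measurable borel"
    by (rule borel_measurable_continuous_onI)
  have [measurable]: "A \<in> sets borel" by fact
  show ?thesis unfolding plate_def by measurable
qed

lemma emeasure_surface_measure:
  fixes A :: "'a::euclidean_space set"
  assumes A: "A \<in> sets borel"
  shows "emeasure surface_measure A = (\<integral>\<^sup>+H. emeasure lborel (plate H A) \<partial>count_space hyperplanes)"
proof -
  let ?\<mu> = "\<lambda>A::'a set. \<integral>\<^sup>+H. emeasure lborel (plate H A) \<partial>count_space hyperplanes"
  have "emeasure (measure_of UNIV (sets borel) ?\<mu>) A = ?\<mu> A"
  proof (rule emeasure_measure_of_sigma[OF _ _ _ A])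
    show "sigma_algebra UNIV (sets (borel :: 'a measure))"
      by (metis sets.sigma_algebra_axioms space_borel)
    show "positive (sets borel) ?\<mu>"
      by (simp add: positive_def plate_def)
    show "countably_additive (sets borel) ?\<mu>"
      unfolding countably_additive_def
    proof (intro allI impI)
      fix B :: "nat \<Rightarrow> 'a set"
      assume B: "range B \<subseteq> sets borel" "disjoint_family B" "\<Union> (range B) \<in> sets borel"
      have "emeasure lborel (plate H (\<Union> (range B))) = (\<Sum>i. emeasure lborel (plate H (B i)))"
        if "H \<in> hyperplanes" for H
      proof -
        have "plate H (\<Union> (range B)) = (\<Union>i. plate H (B i))"
          by (auto simp: plate_def)
        moreover have "disjoint_family (\<lambda>i. plate H (B i))"
          using B(2) by (auto simp: disjoint_family_on_def plate_def)
        moreover have "range (\<lambda>i. plate H (B i)) \<subseteq> sets lborel"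
          using plate_borel[OF that] B(1) by auto
        ultimately show ?thesis
          by (simp add: suminf_emeasure)
      qed
      then have "?\<mu> (\<Union> (range B))
        = (\<integral>\<^sup>+H. (\<Sum>i. emeasure lborel (plate H (B i))) \<partial>count_space hyperplanes)"
        by (intro nn_integral_cong) simp
      also have "\<dots> = (\<Sum>i. ?\<mu> (B i))"
        by (rule nn_integral_suminf) simp
      finally show "(\<Sum>i. ?\<mu> (B i)) = ?\<mu> (\<Union> (range B))" by simp
    qed
  qed
  moreover have "A \<in> sets (measure_of UNIV (sets borel) ?\<mu>)"
    using A sets.sigma_sets_eq[of "borel :: 'a measure"] by simp
  ultimately show ?thesis
    unfolding surface_measure_def by simp
qed

lemma closest_point_hyperplane:
  fixes a :: "'a::euclidean_space"
  assumes "a \<noteq> 0"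
  shows "closest_point {x. a \<bullet> x = b} y = y - ((a \<bullet> y - b) / (a \<bullet> a)) *\<^sub>R a" (is "_ = ?p")
proof (rule closest_point_unique[symmetric])
  show p: "?p \<in> {x. a \<bullet> x = b}" using assms by (simp add: inner_diff_right)
  show "\<forall>z\<in>{x. a \<bullet> x = b}. dist y ?p \<le> dist y z"
  proof
    fix z assume z: "z \<in> {x. a \<bullet> x = b}"
    have "(y - ?p) \<bullet> (?p - z) = 0"
    proof -
      have "a \<bullet> (?p - z) = 0"
        using p z by (subst inner_diff_right) simp
      moreover have "y - ?p = ((a \<bullet> y - b) / (a \<bullet> a)) *\<^sub>R a" by simp
      ultimately show ?thesis by (metis inner_scaleR_left mult_zero_right)
    qed
    then have "norm (y - z) ^ 2 = norm (y - ?p) ^ 2 + norm (?p - z) ^ 2"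
      using norm_add_Pythagorean[of "y - ?p" "?p - z"] by (simp add: orthogonal_def)
    then have "norm (y - ?p) ^ 2 \<le> norm (y - z) ^ 2" by simp
    then show "dist y ?p \<le> dist y z"
      unfolding dist_norm by (rule power2_le_imp_le) simp
  qed
qed (auto simp: convex_hyperplane closed_hyperplane)

lemma hyperplanesE:
  assumes "H \<in> hyperplanes"
  obtains a b where "a \<noteq> 0" "H = {x::'a::euclidean_space. a \<bullet> x = b}"
  using assms aff_dim_eq_hyperplane[of H] that
  by (auto simp: hyperplanes_def hull_same)

lemma emeasure_surface_measure_hyperplane:
  fixes A :: "'a::euclidean_space set"
  assumes A: "A \<in> sets borel" and H: "H \<in> hyperplanes" "A \<subseteq> H"
  shows "emeasure surface_measure A = emeasure lborel (plate H A)"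
proof -
  have null: "emeasure lborel (plate H' A) = 0" if H': "H' \<in> hyperplanes" "H' \<noteq> H" for H'
  proof -
    obtain a b where a: "a \<noteq> 0" "H' = {x. a \<bullet> x = b}" by (rule hyperplanesE[OF H'(1)])
    obtain c d where c: "c \<noteq> 0" "H = {x. c \<bullet> x = d}" by (rule hyperplanesE[OF H(1)])
    define t where "t = (c \<bullet> a) / (a \<bullet> a)"
    have sub: "plate H' A \<subseteq> {y. (c - t *\<^sub>R a) \<bullet> y = d - t * b}"
    proof
      fix y assume "y \<in> plate H' A"
      then have "c \<bullet> (y - ((a \<bullet> y - b) / (a \<bullet> a)) *\<^sub>R a) = d"
        using H(2) c(2) closest_point_hyperplane[OF a(1), of b y] a(2) by (auto simp: plate_def)
      then show "y \<in> {y. (c - t *\<^sub>R a) \<bullet> y = d - t * b}"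
        using a(1) by (simp add: t_def inner_diff_left inner_diff_right field_simps)
    qed
    show ?thesis
    proof (cases "c - t *\<^sub>R a = 0")
      case True
      then have ct: "c = t *\<^sub>R a" by simp
      have "d \<noteq> t * b"
        using H'(2) a c ct by auto
      then have "plate H' A = {}" using sub True by auto
      then show ?thesis by simp
    next
      case False
      then have "negligible (plate H' A)"
        using sub by (intro negligible_subset[OF negligible_hyperplane sub]) auto
      then have "emeasure lebesgue (plate H' A) = 0"
        by (simp only: negligible_iff_null_sets null_setsD1)
      then show ?thesis
        using plate_borel[OF H'(1) A] by simp
    qed
  qed
  have "emeasure surface_measure A
      = (\<integral>\<^sup>+H'. emeasure lborel (plate H A) * indicator {H} H' \<partial>count_space hyperplanes)"
    unfolding emeasure_surface_measure[OF A]
    by (intro nn_integral_cong) (auto simp: null indicator_def)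
  also have "\<dots> = emeasure lborel (plate H A)"
    using H(1) by (simp add: nn_integral_cmult_indicator)
  finally show ?thesis .
qed


subsection \<open>Square-integrable functions\<close>

definition L2_on :: "'a measure \<Rightarrow> 'a set \<Rightarrow> ('a \<Rightarrow> real) \<Rightarrow> bool" where
  "L2_on M S f \<longleftrightarrow> set_borel_measurable M S f \<and> set_integrable M S (\<lambda>x. (f x)\<^sup>2)"

definition L2norm_on :: "'a measure \<Rightarrow> 'a set \<Rightarrow> ('a \<Rightarrow> real) \<Rightarrow> real" where
  "L2norm_on M S f = sqrt (LINT x:S|M. (f x)\<^sup>2)"


subsection \<open>Domain and mesh\<close>

text \<open>
  A domain lies locally on one side of its boundary faces (no slits); this is what
  \<open>\<Omega> = interior (closure \<Omega>)\<close> says.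
\<close>

definition polyhedral_domain :: "'a::euclidean_space set \<Rightarrow> bool" where
  "polyhedral_domain \<Omega> \<longleftrightarrow>
     \<Omega> \<noteq> {} \<and> open \<Omega> \<and> connected \<Omega> \<and> bounded \<Omega> \<and> \<Omega> = interior (closure \<Omega>) \<and>
     (\<exists>\<P>. finite \<P> \<and> (\<forall>P\<in>\<P>. polytope P) \<and> closure \<Omega> = \<Union>\<P>)"

text \<open>
  Elements are closed simplices. \<^const>\<open>triangulation\<close> contains the absence of hanging nodes:
  any two elements meet in a common face.
\<close>

definition mesh :: "'a::euclidean_space set \<Rightarrow> 'a set set \<Rightarrow> bool" where
  "mesh \<Omega> \<T> \<longleftrightarrow>
     triangulation \<T> \<and> (\<forall>K\<in>\<T>. int DIM('a) simplex K) \<and> \<Union>\<T> = closure \<Omega>"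

definition shape_regular :: "real \<Rightarrow> 'a::euclidean_space set set \<Rightarrow> bool" where
  "shape_regular \<kappa> \<T> \<longleftrightarrow> (\<forall>K\<in>\<T>. measure lebesgue K / diameter K ^ DIM('a) \<ge> \<kappa>)"

definition quasi_uniform :: "real \<Rightarrow> 'a::euclidean_space set set \<Rightarrow> bool" where
  "quasi_uniform A \<T> \<longleftrightarrow> (\<forall>K\<in>\<T>. \<forall>K'\<in>\<T>. diameter K / diameter K' \<le> A)"

definition facets :: "'a::euclidean_space set \<Rightarrow> 'a set set" where
  "facets K = {e. e facet_of K}"

definition skeleton :: "'a::euclidean_space set set \<Rightarrow> 'a set set" where
  "skeleton \<T> = (\<Union>K\<in>\<T>. facets K)"

definition boundary_faces :: "'a::euclidean_space set \<Rightarrow> 'a set set \<Rightarrow> 'a set set" where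
  "boundary_faces \<Omega> \<T> = {e \<in> skeleton \<T>. e \<subseteq> frontier \<Omega>}"

text \<open>
  Faces in \<^const>\<open>skeleton\<close> are closed, so adjacent ones overlap in lower-dimensional sets, whereas
  \<open>\<Gamma>\<^sub>D\<close> and \<open>\<Gamma>\<^sub>N\<close> are disjoint. Hence ``\<open>\<Gamma>\<close> is a union of boundary faces'' leaves open which points
  of the relative boundaries of the faces belong to \<open>\<Gamma>\<close>.
\<close>

definition resolves :: "'a::euclidean_space set \<Rightarrow> 'a set set \<Rightarrow> 'a set \<Rightarrow> bool" where
  "resolves \<Omega> \<T> \<Gamma> \<longleftrightarrow>
     (\<exists>E \<subseteq> boundary_faces \<Omega> \<T>. (\<Union>e\<in>E. rel_interior e) \<subseteq> \<Gamma> \<and> \<Gamma> \<subseteq> \<Union>E)"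

definition faces_on :: "'a::euclidean_space set set \<Rightarrow> 'a set \<Rightarrow> 'a set set" where
  "faces_on \<T> \<Gamma> = {e \<in> skeleton \<T>. rel_interior e \<subseteq> \<Gamma>}"

text \<open>Outward unit normal of \<open>K\<close> on its facet \<open>e\<close>.\<close>

definition outward_normal :: "'a::euclidean_space set \<Rightarrow> 'a set \<Rightarrow> 'a" where
  "outward_normal K e = (THE n. norm n = 1 \<and> (\<forall>x\<in>e. \<forall>y\<in>K. n \<bullet> (y - x) \<le> 0))"


subsection \<open>Discrete spaces\<close>

text \<open>Polynomial functions of total degree at most \<open>k\<close>; \<open>\<alpha>\<close> ranges over multi-indices.\<close>

definition Poly :: "nat \<Rightarrow> (real^'d \<Rightarrow> real) set" where
  "Poly k = {p. \<exists>c. \<forall>x. p x =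
     (\<Sum>\<alpha> | (\<Sum>i\<in>UNIV. \<alpha> i) \<le> k. c \<alpha> * (\<Prod>i\<in>UNIV. (x $ i) ^ \<alpha> i))}"

definition vPoly :: "nat \<Rightarrow> (real^'d \<Rightarrow> real^'d) set" where
  "vPoly k = {q. \<forall>i. (\<lambda>x. q x $ i) \<in> Poly k}"

text \<open>
  A piecewise polynomial \<open>L\<^sup>2\<close> function is represented by the family of its pieces, indexed by the
  elements (or the faces). On an element \<open>K\<close> the piece \<open>u K\<close> is the polynomial \<open>u|\<^sub>K\<close> itself, so that
  its values on \<open>\<partial>K\<close> are the trace from \<open>K\<close>, and derivatives of the pieces are elementwise
  derivatives. On a face, which has empty interior, only the restriction matters.
\<close>

definition U_space :: "(real^'d) set set \<Rightarrow> nat \<Rightarrow> ((real^'d) set \<Rightarrow> real^'d \<Rightarrow> real) set" where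
  "U_space \<T> k = {u. \<forall>K\<in>\<T>. u K \<in> Poly k}"

definition V_space :: "(real^'d) set set \<Rightarrow> nat \<Rightarrow> ((real^'d) set \<Rightarrow> real^'d \<Rightarrow> real^'d) set" where
  "V_space \<T> k = {q. \<forall>K\<in>\<T>. q K \<in> vPoly k}"

definition F_space :: "(real^'d) set set \<Rightarrow> nat \<Rightarrow> ((real^'d) set \<Rightarrow> real^'d \<Rightarrow> real) set" where
  "F_space \<T> k = {w. \<forall>e\<in>skeleton \<T>. \<exists>p\<in>Poly k. \<forall>x\<in>e. w e x = p x}"

definition divergence :: "(real^'d \<Rightarrow> real^'d) \<Rightarrow> real^'d \<Rightarrow> real" where
  "divergence q x = (\<Sum>i\<in>UNIV. frechet_derivative q (at x) (axis i 1) $ i)"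


subsection \<open>Inner products and norms\<close>

text \<open>
  Functions on the element boundaries may take different values from the two sides of a face, so
  they are indexed by an element and one of its facets; interior faces are visited twice. On the
  real numbers \<open>\<bullet>\<close> is multiplication.
\<close>

definition vol_ip :: "'a::euclidean_space set set \<Rightarrow> ('a set \<Rightarrow> 'a \<Rightarrow> 'b::real_inner)
    \<Rightarrow> ('a set \<Rightarrow> 'a \<Rightarrow> 'b) \<Rightarrow> real" where
  "vol_ip \<T> f g = (\<Sum>K\<in>\<T>. LINT x:K|lebesgue. f K x \<bullet> g K x)"

definition skel_ip :: "'a::euclidean_space set set \<Rightarrow> ('a set \<Rightarrow> 'a set \<Rightarrow> 'a \<Rightarrow> real)
    \<Rightarrow> ('a set \<Rightarrow> 'a set \<Rightarrow> 'a \<Rightarrow> real) \<Rightarrow> real" where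
  "skel_ip \<T> f g = (\<Sum>K\<in>\<T>. \<Sum>e\<in>facets K. LINT x:e|surface_measure. f K e x * g K e x)"

definition bdry_ip :: "'a::euclidean_space set set \<Rightarrow> 'a set \<Rightarrow> ('a set \<Rightarrow> 'a \<Rightarrow> real)
    \<Rightarrow> ('a set \<Rightarrow> 'a \<Rightarrow> real) \<Rightarrow> real" where
  "bdry_ip \<T> \<Gamma> f g = (\<Sum>e\<in>faces_on \<T> \<Gamma>. LINT x:e|surface_measure. f e x * g e x)"

definition vol_norm :: "'a::euclidean_space set set \<Rightarrow> ('a set \<Rightarrow> 'a \<Rightarrow> 'b::real_inner) \<Rightarrow> real" where
  "vol_norm \<T> f = sqrt (vol_ip \<T> f f)"

definition skel_norm :: "'a::euclidean_space set set \<Rightarrow> ('a set \<Rightarrow> 'a set \<Rightarrow> 'a \<Rightarrow> real) \<Rightarrow> real" where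
  "skel_norm \<T> f = sqrt (skel_ip \<T> f f)"

definition bdry_norm :: "'a::euclidean_space set set \<Rightarrow> 'a set \<Rightarrow> ('a set \<Rightarrow> 'a \<Rightarrow> real) \<Rightarrow> real" where
  "bdry_norm \<T> \<Gamma> f = sqrt (bdry_ip \<T> \<Gamma> f f)"

text \<open>The numerical trace \<open>u\<close>-hat of the scheme is written \<open>w\<close>, its test function \<open>z\<close>.\<close>

definition jump :: "('a set \<Rightarrow> 'a \<Rightarrow> real) \<Rightarrow> ('a set \<Rightarrow> 'a \<Rightarrow> real) \<Rightarrow> 'a set \<Rightarrow> 'a set \<Rightarrow> 'a \<Rightarrow> real" where
  "jump u w K e x = u K x - w e x"

definition normal_trace :: "('a::euclidean_space set \<Rightarrow> 'a \<Rightarrow> 'a) \<Rightarrow> 'a set \<Rightarrow> 'a set \<Rightarrow> 'a \<Rightarrow> real" where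
  "normal_trace q K e x = q K x \<bullet> outward_normal K e"


subsection \<open>The HDG scheme\<close>

definition hdg_solution :: "(real^'d) set set \<Rightarrow> (real^'d) set \<Rightarrow> (real^'d) set \<Rightarrow> nat \<Rightarrow> real
    \<Rightarrow> (real^'d \<Rightarrow> real) \<Rightarrow> (real^'d \<Rightarrow> real) \<Rightarrow> (real^'d \<Rightarrow> real)
    \<Rightarrow> ((real^'d) set \<Rightarrow> real^'d \<Rightarrow> real^'d) \<Rightarrow> ((real^'d) set \<Rightarrow> real^'d \<Rightarrow> real)
    \<Rightarrow> ((real^'d) set \<Rightarrow> real^'d \<Rightarrow> real) \<Rightarrow> bool" where
  "hdg_solution \<T> \<Gamma>\<^sub>D \<Gamma>\<^sub>N k \<tau> f u\<^sub>D u\<^sub>N p u w \<longleftrightarrow>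
     p \<in> V_space \<T> k \<and> u \<in> U_space \<T> k \<and> w \<in> F_space \<T> k \<and>
     (\<forall>q \<in> V_space \<T> k. \<forall>v \<in> U_space \<T> k. \<forall>z \<in> F_space \<T> k.
        vol_ip \<T> p q
          = vol_ip \<T> u (\<lambda>K. divergence (q K)) - skel_ip \<T> (\<lambda>K. w) (normal_trace q) \<and>
        \<tau> * skel_ip \<T> (jump u w) (jump v z) + vol_ip \<T> (\<lambda>K. divergence (p K)) v
            - skel_ip \<T> (normal_trace p) (\<lambda>K. z)
          = vol_ip \<T> (\<lambda>K. f) v + bdry_ip \<T> \<Gamma>\<^sub>N (\<lambda>e. u\<^sub>N) z \<and>
        bdry_ip \<T> \<Gamma>\<^sub>D w z = bdry_ip \<T> \<Gamma>\<^sub>D (\<lambda>e. u\<^sub>D) z)"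

end

theory Submission
  imports Defs
begin

text \<open>
  Testing with the solution itself, shifted by a constant \<open>c\<close>, gives
  \<open>\<parallel>p\<parallel>\<^sup>2 + \<tau> \<parallel>u - w\<parallel>\<^sup>2 = (f, u - c) + \<langle>u\<^sub>N, w - c\<rangle>\<close> on \<open>\<Omega>\<close> and \<open>\<Gamma>\<^sub>N\<close>, because the trace test functions are not
  required to vanish on \<open>\<Gamma>\<^sub>D\<close>. So it suffices to find \<open>c\<close> with \<open>\<parallel>u - c\<parallel> \<le> C E\<close> on \<open>\<Omega>\<close> and
  \<open>\<parallel>w - c\<parallel> \<le> C E\<close> on the boundary, where \<open>E\<^sup>2 = \<parallel>p\<parallel>\<^sup>2 + \<parallel>u - w\<parallel>\<^sup>2\<close>, uniformly in the mesh.

  The first equation of the scheme says that \<open>-p\<close> is a weak gradient of \<open>u\<close> up to the jumps. On a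
  convex body \<open>S\<close> with a bump function \<open>\<omega>\<close> inside, let \<open>m(s, x)\<close> be the mean of \<open>u\<close> with respect to
  the bump dilated by \<open>s\<close> about \<open>x\<close>; it runs from \<open>u(x)\<close> at \<open>s = 0\<close> to a constant at \<open>s = 1\<close>, and
  its derivative in \<open>s\<close> is the weak divergence of an explicit kernel field. For \<open>s\<close> above the mesh
  size the field is compared with its value at a point of each element, for smaller \<open>s\<close> an inverse
  inequality is used. Integration over \<open>s\<close> estimates \<open>u\<close> minus a constant on \<open>S\<close>, with a gain
  \<open>sqrt \<delta>\<close> on families of elements that fill only a layer of thickness \<open>\<delta>\<close>. Chains of overlapping
  convex bodies give the Poincare inequality on \<open>\<Omega>\<close>; the gain for the layer of boundary elements,
  whose thickness is the mesh size, compensates the loss in the trace inequality.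
\<close>

subsection \<open>Lebesgue measure and linear maps\<close>

text \<open>The obstacle is the weight of the stabilization: the energy \<open>E\<close> contains
  the jumps without a factor 1/h. The elementwise gradient of u is therefore controlled only with a
  loss of order 1/h in its square, and Poincare inequalities for broken spaces, which ask for jumps
  weighted by 1/h, do not apply. The way out is that constant fields are exact: paired with a
  constant, the gradient and the jumps of u combine to p alone. The loss then meets only the
  oscillation of the kernel field over an element, which is of order h/s relative to the field, and
  the resulting bound is integrable in s uniformly in h.

  Uniformity in the mesh rests on the order of the choices. The convex bodies are balls and the
  elements of one fixed reference mesh. Their bumps, the chains that link them and all constants are
  chosen before the mesh under consideration enters; that mesh appears only through \<kappa> and
  \<open>A\<close>. Since its elements may stick out of a convex body, the norm over all of \<Omega>
  remains on the right until the bodies have been joined.\<close>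

lemma emeasure_linear_vimage_exchange:
  fixes L :: "'a::euclidean_space \<Rightarrow> 'a"
  assumes L: "linear L" "bij L" and A[measurable]: "A \<in> sets borel" and B[measurable]: "B \<in> sets borel"
  shows "emeasure lborel (L -` A) * emeasure lborel B = emeasure lborel (L -` B) * emeasure lborel A"
proof -
  have [measurable]: "L \<in> borel_measurable borel"
    using L(1) by (intro borel_measurable_continuous_onI linear_continuous_on linear_conv_bounded_linear[THEN iffD1])
  have sh: "(\<integral>\<^sup>+x. f (c + x) \<partial>lborel) = (\<integral>\<^sup>+x. f x \<partial>lborel)"
    if [measurable]: "f \<in> borel_measurable borel" for f :: "'a \<Rightarrow> ennreal" and c
    by (subst (2) lborel_distr_plus[symmetric, of c]) (simp add: nn_integral_distr)
  have refl: "(\<integral>\<^sup>+x. f (c - x) \<partial>lborel) = (\<integral>\<^sup>+x. f x \<partial>lborel)"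
    if [measurable]: "f \<in> borel_measurable borel" for f :: "'a \<Rightarrow> ennreal" and c
  proof -
    have "(\<integral>\<^sup>+x. f x \<partial>lborel) = (\<integral>\<^sup>+x. f x \<partial>density (distr lborel borel (\<lambda>x. c + (-1) *\<^sub>R x)) (\<lambda>_. ennreal (\<bar>-1\<bar> ^ DIM('a))))"
      by (subst (1) lborel_affine[of "-1" c]) simp_all
    then show ?thesis by (simp add: nn_integral_density nn_integral_distr)
  qed
  have vm: "L -` C \<in> sets borel" if "C \<in> sets borel" for C
    using measurable_sets[of L borel borel C] that by simp
  note [measurable] = vm[OF A] vm[OF B]
  \<comment> \<open>Fubini for the indicator of A at Lx times that of B at Lx + y. Integration over
    y first gives the left side. Shifting x by the preimage of y and then reflecting y gives the
    right side.\<close>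
  have "emeasure lborel (L -` A) * emeasure lborel B
      = (\<integral>\<^sup>+x. (\<integral>\<^sup>+y. indicator A (L x) * indicator B (L x + y) \<partial>lborel) \<partial>lborel)"
  proof -
    have "(\<integral>\<^sup>+y. indicator B (c + y) \<partial>lborel) = emeasure lborel B" for c
      using sh[of "indicator B" c] by simp
    then have "(\<integral>\<^sup>+x. (\<integral>\<^sup>+y. indicator A (L x) * indicator B (L x + y) \<partial>lborel) \<partial>lborel)
      = (\<integral>\<^sup>+x. indicator (L -` A) x * emeasure lborel B \<partial>lborel)"
      by (simp add: nn_integral_cmult) (simp add: indicator_def)
    then show ?thesis by (simp add: nn_integral_multc)
  qed
  also have "\<dots> = (\<integral>\<^sup>+y. (\<integral>\<^sup>+x. indicator A (L x) * indicator B (L x + y) \<partial>lborel) \<partial>lborel)"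
    by (rule lborel_pair.Fubini') measurable
  also have "\<dots> = (\<integral>\<^sup>+y. (\<integral>\<^sup>+x. indicator A (L x - y) * indicator B (L x) \<partial>lborel) \<partial>lborel)"
  proof (rule nn_integral_cong)
    fix y
    obtain z where z: "L z = y" using L(2) by (metis bij_pointE)
    have "(\<integral>\<^sup>+x. indicator A (L x) * indicator B (L x + y) \<partial>lborel)
        = (\<integral>\<^sup>+x. (\<lambda>x. indicator A (L x) * indicator B (L x + y) :: ennreal) ((- z) + x) \<partial>lborel)"
      by (rule sh[symmetric]) measurable
    then show "(\<integral>\<^sup>+x. indicator A (L x) * indicator B (L x + y) \<partial>lborel)
        = (\<integral>\<^sup>+x. indicator A (L x - y) * (indicator B (L x) :: ennreal) \<partial>lborel)"
      using z by (simp add: linear_diff[OF L(1)])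
  qed
  also have "\<dots> = (\<integral>\<^sup>+x. (\<integral>\<^sup>+y. indicator A (L x - y) * indicator B (L x) \<partial>lborel) \<partial>lborel)"
    by (rule lborel_pair.Fubini'[symmetric]) measurable
  also have "\<dots> = emeasure lborel (L -` B) * emeasure lborel A"
  proof -
    have "(\<integral>\<^sup>+y. indicator A (L x - y) * indicator B (L x) \<partial>lborel) = indicator (L -` B) x * emeasure lborel A" for x
      using refl[of "indicator A" "L x"] by (cases "L x \<in> B") simp_all
    then have "(\<integral>\<^sup>+x. (\<integral>\<^sup>+y. indicator A (L x - y) * indicator B (L x) \<partial>lborel) \<partial>lborel)
      = (\<integral>\<^sup>+x. indicator (L -` B) x * emeasure lborel A \<partial>lborel)"
      by simp
    then show ?thesis by (simp add: nn_integral_multc)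
  qed
  finally show ?thesis .
qed

text \<open>The exchange identity with the unit ball in place of B. The preimage of the ball is open
  and nonempty, hence of positive measure, and bounded, hence of finite measure. The factor is
  1/|det L|; for the special maps below it is identified without determinants.\<close>

lemma emeasure_linear_vimage_const:
  fixes L :: "'a::euclidean_space \<Rightarrow> 'a"
  assumes L: "linear L" "bij L"
  obtains c where "c > 0" "\<And>A. A \<in> sets borel \<Longrightarrow> emeasure lborel (L -` A) = ennreal c * emeasure lborel A"
proof -
  let ?B = "ball 0 1 :: 'a set"
  have cont: "continuous_on UNIV L"
    using L(1) by (intro linear_continuous_on linear_conv_bounded_linear[THEN iffD1])
  obtain b where b: "b > 0" "emeasure lborel ?B = ennreal b"
  proof
    show "0 < measure lborel ?B" using content_ball_pos[of 1 "0::'a"] by simp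
    show "emeasure lborel ?B = ennreal (measure lborel ?B)"
      using emeasure_lborel_ball_finite[of "0::'a" 1] by (intro emeasure_eq_ennreal_measure) auto
  qed
  have op: "open (L -` ?B)" using cont by (simp add: open_vimage)
  have bd: "bounded (L -` ?B)"
  proof -
    have "linear (inv L)" using L by (simp add: inj_linear_imp_inv_linear bij_is_inj)
    then have "bounded (inv L ` ?B)" by (intro bounded_linear_image) (auto simp: linear_conv_bounded_linear)
    then show ?thesis using L(2) by (simp add: bij_vimage_eq_inv_image)
  qed
  obtain a where a: "a > 0" "emeasure lborel (L -` ?B) = ennreal a"
  proof -
    have "emeasure lborel (L -` ?B) < \<infinity>" using emeasure_bounded_finite[OF bd] by simp
    moreover have "emeasure lborel (L -` ?B) \<noteq> 0"
    proof -
      have "0 \<in> L -` ?B" using L(1) by (simp add: linear_0)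
      then have "\<not> negligible (L -` ?B)" using op open_not_negligible by blast
      then show ?thesis using op by (auto simp: negligible_iff_emeasure0 emeasure_completion)
    qed
    ultimately show ?thesis using that[of "enn2real (emeasure lborel (L -` ?B))"]
      by (simp add: enn2real_positive_iff zero_less_iff_neq_zero)
  qed
  show ?thesis
  proof (rule that[of "a / b"])
    show "a / b > 0" using a b by simp
    fix A :: "'a set" assume A: "A \<in> sets borel"
    have "emeasure lborel (L -` A) * ennreal b = ennreal a * emeasure lborel A"
      using emeasure_linear_vimage_exchange[OF L A, of ?B] a b by simp
    then have "emeasure lborel (L -` A) * ennreal b * ennreal (1/b) = ennreal (1/b) * ennreal a * emeasure lborel A"
      by (simp add: ac_simps)
    then show "emeasure lborel (L -` A) = ennreal (a / b) * emeasure lborel A"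
      using a(1) b(1) by (simp add: mult.assoc ennreal_mult[symmetric])
  qed
qed

text \<open>The factor is read off from the unit ball, which is its own preimage.\<close>

lemma emeasure_orthogonal_vimage:
  fixes Q :: "'a::euclidean_space \<Rightarrow> 'a"
  assumes "orthogonal_transformation Q" "A \<in> sets borel"
  shows "emeasure lborel (Q -` A) = emeasure lborel A"
proof -
  have lQ: "linear Q" "bij Q"
    using assms(1) by (auto simp: orthogonal_transformation_linear orthogonal_transformation_bij)
  obtain c where c: "c > 0" "\<And>A. A \<in> sets borel \<Longrightarrow> emeasure lborel (Q -` A) = ennreal c * emeasure lborel A"
    using emeasure_linear_vimage_const[OF lQ] by blast
  let ?b = "measure lborel (ball 0 1 :: 'a set)"
  have b: "0 < ?b" using content_ball_pos[of 1 "0::'a"] by simp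
  have eb: "emeasure lborel (ball 0 1 :: 'a set) = ennreal ?b"
    using emeasure_lborel_ball_finite[of "0::'a" 1] by (intro emeasure_eq_ennreal_measure) auto
  have "Q -` ball 0 1 = ball 0 1"
    using assms(1) by (auto simp: orthogonal_transformation_norm)
  then have "ennreal ?b = ennreal c * ennreal ?b"
    using c(2)[of "ball 0 1"] eb by simp
  then have "?b = c * ?b"
    using b c(1) by (simp add: ennreal_mult[symmetric] ennreal_inj)
  then have "c = 1" using b by simp
  then show ?thesis using c(2)[OF assms(2)] by simp
qed

text \<open>A shear is conjugate to its own square: the linear map \<open>S\<close> that fixes n and
  doubles the orthogonal complement of n satisfies S W 1 = W 2 S, and W 2 is W 1 applied twice.
  Comparing the factors on both sides gives c = c^2, hence c = 1.\<close>

lemma emeasure_shear_vimage: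
  fixes v n :: "'a::euclidean_space"
  assumes "n \<bullet> v = 0" and A: "A \<in> sets borel"
  shows "emeasure lborel ((\<lambda>y. y + (n \<bullet> y) *\<^sub>R v) -` A) = emeasure lborel A"
proof (cases "n = 0")
  case False
  define n' where "n' = (1 / norm n) *\<^sub>R n"
  define S where "S y = 2 *\<^sub>R y - (n' \<bullet> y) *\<^sub>R n'" for y
  define W where "W s y = y + (s * (n \<bullet> y)) *\<^sub>R v" for s y
  have n': "n' \<bullet> n' = 1" "n' \<bullet> v = 0" "n = norm n *\<^sub>R n'" using False assms(1)
    by (auto simp: n'_def power2_norm_eq_inner[symmetric] power2_eq_square dot_square_norm)
  have SV: "S v = 2 *\<^sub>R v" using n'(2) by (simp add: S_def)
  have lS: "linear S" unfolding S_def by (intro linearI) (auto simp: algebra_simps)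
  have "S ((1/2) *\<^sub>R y + (n' \<bullet> y / 2) *\<^sub>R n') = y" for y
    by (simp add: S_def inner_add_right n'(1) algebra_simps)
  then have "surj S" unfolding surj_def by metis
  then have bS: "bij S" using lS linear_surjective_imp_injective by (auto simp: bij_def)
  have lW: "linear (W s)" for s unfolding W_def by (intro linearI) (auto simp: algebra_simps)
  have WW: "W s (W t y) = W (s + t) y" for s t y
    using assms(1) by (simp add: W_def algebra_simps)
  have bW: "bij (W s)" for s
    by (rule bij_betw_byWitness[of _ "W (-s)"]) (auto simp: WW, auto simp: W_def)
  have SW: "S (W 1 y) = W 2 (S y)" for y
  proof -
    have "n \<bullet> S y = n \<bullet> y"
    proof -
      have "n' \<bullet> S y = n' \<bullet> y" by (simp add: S_def inner_diff_right n'(1))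
      then have "(norm n *\<^sub>R n') \<bullet> S y = (norm n *\<^sub>R n') \<bullet> y" by simp
      then show ?thesis using n'(3) by simp
    qed
    then show ?thesis using SV by (simp add: W_def linear_add[OF lS] linear_cmul[OF lS])
  qed
  obtain c where c: "c > 0" "\<And>A. A \<in> sets borel \<Longrightarrow> emeasure lborel (W 1 -` A) = ennreal c * emeasure lborel A"
    using emeasure_linear_vimage_const[OF lW bW] by blast
  obtain s where s: "s > 0" "\<And>A. A \<in> sets borel \<Longrightarrow> emeasure lborel (S -` A) = ennreal s * emeasure lborel A"
    using emeasure_linear_vimage_const[OF lS bS] by blast
  have meas: "f -` C \<in> sets borel" if "linear f" "C \<in> sets borel" for f :: "'a \<Rightarrow> 'a" and C
    using measurable_sets[of f borel borel C] that
    by (simp add: borel_measurable_continuous_onI linear_continuous_on linear_conv_bounded_linear)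
  let ?B = "ball 0 1 :: 'a set"
  obtain b where b: "b > 0" "emeasure lborel ?B = ennreal b"
  proof
    show "0 < measure lborel ?B" using content_ball_pos[of 1 "0::'a"] by simp
    show "emeasure lborel ?B = ennreal (measure lborel ?B)"
      using emeasure_lborel_ball_finite[of "0::'a" 1] by (intro emeasure_eq_ennreal_measure) auto
  qed
  have "W 1 -` (S -` ?B) = S -` (W 1 -` (W 1 -` ?B))"
    by (auto simp: SW WW)
  then have "ennreal c * (ennreal s * ennreal b) = ennreal s * (ennreal c * (ennreal c * ennreal b))"
    using c(2)[of "S -` ?B"] c(2)[of "W 1 -` ?B"] c(2)[of ?B] s(2)[of ?B] s(2)[of "W 1 -` (W 1 -` ?B)"] b(2)
    by (simp add: meas lS lW)
  then have "c * s * b = c * s * c * b"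
    using b(1) c(1) s(1) by (simp add: ennreal_mult[symmetric] ennreal_inj)
  then have "c = 1" using c(1) s(1) b(1) by simp
  moreover have "(\<lambda>y. y + (n \<bullet> y) *\<^sub>R v) = W 1" by (simp add: fun_eq_iff W_def)
  ultimately show ?thesis using c(2)[OF A] by simp
qed simp

text \<open>The map is a stretching by 1 + n \<bullet> v in direction n, followed by a shear along a
  vector orthogonal to n, which preserves volume. Rotating a coordinate axis to n turns the
  stretching into a diagonal map. The factor is the determinant of the identity plus a matrix of
  rank one.\<close>

lemma emeasure_rank_one_vimage:
  fixes v n :: "real^'d"
  assumes n: "norm n = 1" and t: "1 + n \<bullet> v \<noteq> 0" and A: "A \<in> sets borel"
  shows "ennreal \<bar>1 + n \<bullet> v\<bar> * emeasure lborel ((\<lambda>y. y + (n \<bullet> y) *\<^sub>R v) -` A) = emeasure lborel A"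
proof -
  define t where "t = 1 + n \<bullet> v"
  have t0: "t \<noteq> 0" using assms by (simp add: t_def)
  define v' where "v' = (1/t) *\<^sub>R (v - (t - 1) *\<^sub>R n)"
  have avg: "n \<bullet> n = 1" using n by (simp add: norm_eq_1)
  have v': "n \<bullet> v' = 0" by (simp add: v'_def inner_diff_right avg t_def)
  define S where "S y = y + ((t - 1) * (n \<bullet> y)) *\<^sub>R n" for y
  define W where "W y = y + (n \<bullet> y) *\<^sub>R v'" for y
  have meas: "f -` C \<in> sets borel" if "linear f" "C \<in> sets borel" for f :: "real^'d \<Rightarrow> real^'d" and C
    using measurable_sets[of f borel borel C] that
    by (simp add: borel_measurable_continuous_onI linear_continuous_on linear_conv_bounded_linear)
  have lS: "linear S" unfolding S_def by (intro linearI) (auto simp: algebra_simps)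
  have lW: "linear W" unfolding W_def by (intro linearI) (auto simp: algebra_simps)
  have tv': "t *\<^sub>R v' = v - (t - 1) *\<^sub>R n" using t0 by (simp add: v'_def)
  have nS: "n \<bullet> S y = t * (n \<bullet> y)" for y by (simp add: S_def inner_add_right avg algebra_simps)
  have WS: "W (S y) = y + (n \<bullet> y) *\<^sub>R v" for y
  proof -
    have "W (S y) = S y + (n \<bullet> y) *\<^sub>R (t *\<^sub>R v')" by (simp add: W_def nS mult.commute)
    also have "\<dots> = y + (n \<bullet> y) *\<^sub>R v" by (simp add: tv' S_def algebra_simps)
    finally show ?thesis .
  qed
  have S: "ennreal \<bar>t\<bar> * emeasure lborel (S -` C) = emeasure lborel C" if C: "C \<in> sets borel" for C
  proof -
    obtain k :: 'd where True by simp
    obtain Q :: "real^'d \<Rightarrow> real^'d" where Q: "orthogonal_transformation Q" "Q (axis k 1) = n"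
      using orthogonal_transformation_exists_1[of "axis k (1::real)" n] n by (auto simp: norm_axis_1)
    define D where "D y = y + ((t - 1) * (y $ k)) *\<^sub>R axis k 1" for y :: "real^'d"
    have lD: "linear D" unfolding D_def by (intro linearI) (auto simp: algebra_simps)
    have lQ: "linear Q" using Q(1) by (simp add: orthogonal_transformation_linear)
    have "n \<bullet> Q y = y $ k" for y :: "real^'d"
    proof -
      have "Q (axis k 1) \<bullet> Q y = axis k 1 \<bullet> y"
        using Q(1) by (simp add: orthogonal_transformation_def)
      then show ?thesis using Q(2) by (simp add: inner_axis')
    qed
    then have SQ: "S (Q y) = Q (D y)" for y
      by (simp add: S_def D_def linear_add[OF lQ] linear_cmul[OF lQ] Q(2))
    have "lborel = density (distr lborel borel D) (\<lambda>_. ennreal \<bar>t\<bar>)"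
    proof -
      have "D = (\<lambda>x. 0 + (\<Sum>j\<in>Basis. ((if j = axis k 1 then t else 1) * (x \<bullet> j)) *\<^sub>R j))"
      proof
        fix x :: "real^'d"
        have ax: "axis k 1 \<in> (Basis :: (real^'d) set)" by (simp add: axis_in_Basis_iff)
        have "(\<Sum>j\<in>Basis. ((if j = axis k 1 then t else 1) * (x \<bullet> j)) *\<^sub>R j)
           = (\<Sum>j\<in>Basis. (x \<bullet> j) *\<^sub>R j + (if j = axis k 1 then ((t - 1) * (x \<bullet> j)) *\<^sub>R j else 0))"
          by (intro sum.cong) (auto simp: algebra_simps)
        also have "\<dots> = x + ((t - 1) * (x \<bullet> axis k 1)) *\<^sub>R axis k 1"
          using ax by (simp add: sum.distrib euclidean_representation)
        finally show "D x = 0 + (\<Sum>j\<in>Basis. ((if j = axis k 1 then t else 1) * (x \<bullet> j)) *\<^sub>R j)"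
          by (simp add: D_def inner_axis)
      qed
      moreover have "(\<Prod>j\<in>(Basis :: (real^'d) set). \<bar>if j = axis k 1 then t else 1\<bar>) = \<bar>t\<bar>"
        by (subst prod.cong[OF refl, of _ _ "\<lambda>j. if j = axis k 1 then \<bar>t\<bar> else 1"]) (auto simp: axis_in_Basis_iff)
      moreover have "\<And>j::real^'d. j \<in> Basis \<Longrightarrow> (if j = axis k 1 then t else 1) \<noteq> 0" using t0 by simp
      ultimately show ?thesis
        using lborel_affine_euclidean[of "\<lambda>j. if j = axis k 1 then t else 1" "0::real^'d"] by metis
    qed
    then have "emeasure lborel X = ennreal \<bar>t\<bar> * emeasure lborel (D -` X)" if "X \<in> sets borel" for X
    proof -
      have D: "D \<in> borel_measurable borel" using lD
        by (intro borel_measurable_continuous_onI linear_continuous_on linear_conv_bounded_linear[THEN iffD1])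
      have "emeasure lborel X = emeasure (density (distr lborel borel D) (\<lambda>_. ennreal \<bar>t\<bar>)) X"
        using \<open>lborel = _\<close> by simp
      also have "\<dots> = ennreal \<bar>t\<bar> * emeasure lborel (D -` X)"
        using that D by (simp add: emeasure_density_const emeasure_distr)
      finally show ?thesis .
    qed
    from this[OF meas[OF lQ C]] have "ennreal \<bar>t\<bar> * emeasure lborel (D -` (Q -` C)) = emeasure lborel (Q -` C)" by simp
    moreover have "D -` (Q -` C) = Q -` (S -` C)" by (auto simp: SQ)
    ultimately show ?thesis
      using emeasure_orthogonal_vimage[OF Q(1)] C meas[OF lS C] by simp
  qed
  have "(\<lambda>y. y + (n \<bullet> y) *\<^sub>R v) -` A = S -` (W -` A)" by (auto simp: WS)
  moreover have "(\<lambda>y. y + (n \<bullet> y) *\<^sub>R v') = W" by (simp add: fun_eq_iff W_def)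
  ultimately show ?thesis
    using S[OF meas[OF lW A]] emeasure_shear_vimage[OF v' A] by (simp add: t_def)
qed

subsection \<open>Surface measure of pieces of hyperplanes\<close>

lemma emeasure_lborel_translate:
  fixes c :: "'a::euclidean_space"
  assumes "Z \<in> sets borel"
  shows "emeasure lborel {y. c + y \<in> Z} = emeasure lborel Z"
proof -
  have "emeasure lborel Z = emeasure (distr lborel borel ((+) c)) Z" by (simp add: lborel_distr_plus)
  also have "\<dots> = emeasure lborel {y. c + y \<in> Z}"
    using assms by (subst emeasure_distr) (auto simp: vimage_def)
  finally show ?thesis by simp
qed

lemma prod_Basis_delta:
  fixes k :: "'d::finite" and a b :: real
  shows "(\<Prod>j\<in>(Basis :: (real^'d) set). if j = axis k 1 then a else b) = a * b ^ (CARD('d) - 1)"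
proof -
  have ax: "axis k 1 \<in> (Basis :: (real^'d) set)" by (simp add: axis_in_Basis_iff)
  have "(\<Prod>j\<in>(Basis :: (real^'d) set). if j = axis k 1 then a else b)
     = a * (\<Prod>j\<in>(Basis :: (real^'d) set) - {axis k 1}. if j = axis k 1 then a else b)"
    using ax by (subst prod.remove[OF _ ax]) auto
  also have "(\<Prod>j\<in>(Basis :: (real^'d) set) - {axis k 1}. if j = axis k 1 then a else b) = (\<Prod>j\<in>(Basis :: (real^'d) set) - {axis k 1}. b)"
    by (rule prod.cong) auto
  also have "\<dots> = b ^ (CARD('d) - 1)" using ax by (simp add: card_Diff_singleton)
  finally show ?thesis .
qed

text \<open>After a translation and a rotation of a coordinate axis to n, the cylinder lies in a box
  with one half-side s and all others r.\<close>

lemma emeasure_cylinder_le: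
  fixes n z :: "real^'d"
  assumes n: "norm n = 1" and "s \<ge> 0" "r \<ge> 0"
  shows "emeasure lborel {y. \<bar>n \<bullet> (y - z)\<bar> \<le> s \<and> norm (y - z - (n \<bullet> (y - z)) *\<^sub>R n) \<le> r}
    \<le> ennreal (2 * s * (2 * r) ^ (CARD('d) - 1))"
proof -
  obtain k :: 'd where True by simp
  obtain Q :: "real^'d \<Rightarrow> real^'d" where Q: "orthogonal_transformation Q" "Q (axis k 1) = n"
    using orthogonal_transformation_exists_1[of "axis k (1::real)" n] n by (auto simp: norm_axis_1)
  have lQ: "linear Q" using Q(1) by (simp add: orthogonal_transformation_linear)
  have nQ: "n \<bullet> Q y = y $ k" for y :: "real^'d"
  proof -
    have "Q (axis k 1) \<bullet> Q y = axis k 1 \<bullet> y"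
      using Q(1) by (simp add: orthogonal_transformation_def)
    then show ?thesis using Q(2) by (simp add: inner_axis')
  qed
  let ?C = "{y. \<bar>n \<bullet> (y - z)\<bar> \<le> s \<and> norm (y - z - (n \<bullet> (y - z)) *\<^sub>R n) \<le> r}"
  let ?D = "{y. \<bar>n \<bullet> y\<bar> \<le> s \<and> norm (y - (n \<bullet> y) *\<^sub>R n) \<le> r}"
  have C[measurable]: "?C \<in> sets borel" "?D \<in> sets borel" by measurable
  have 1: "emeasure lborel ?C = emeasure lborel {y. z + y \<in> ?C}"
    by (rule emeasure_lborel_translate[symmetric]) fact
  have 2: "{y. z + y \<in> ?C} = ?D" by simp
  have 3: "emeasure lborel (Q -` ?D) = emeasure lborel ?D"
    by (rule emeasure_orthogonal_vimage[OF Q(1)]) fact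
  have 4: "emeasure lborel (Q -` ?D) \<le> emeasure lborel (cbox (- (\<chi> i. if i = k then s else r)) (\<chi> i. if i = k then s else r))"
  proof (rule emeasure_mono)
    show "Q -` ?D \<subseteq> cbox (- (\<chi> i. if i = k then s else r)) (\<chi> i. if i = k then s else r)"
    proof
      fix y assume "y \<in> Q -` ?D"
      then have y: "\<bar>y $ k\<bar> \<le> s" "norm (Q y - (y $ k) *\<^sub>R Q (axis k 1)) \<le> r" by (simp_all add: nQ Q(2))
      have "norm (Q y - (y $ k) *\<^sub>R Q (axis k 1)) = norm (Q (y - (y $ k) *\<^sub>R axis k 1))"
        by (simp add: linear_diff[OF lQ] linear_cmul[OF lQ])
      also have "\<dots> = norm (y - (y $ k) *\<^sub>R axis k 1)"
        by (simp add: orthogonal_transformation_norm[OF Q(1)])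
      finally have "\<forall>i. \<bar>(y - (y $ k) *\<^sub>R axis k 1) $ i\<bar> \<le> r"
        using component_le_norm_cart[of "y - (y $ k) *\<^sub>R axis k 1"] y(2) by (metis order_trans)
      from this have "\<bar>y $ i\<bar> \<le> r" if "i \<noteq> k" for i
        using that spec[of "\<lambda>i. \<bar>(y - (y $ k) *\<^sub>R axis k 1) $ i\<bar> \<le> r" i] by (simp add: axis_def)
      then show "y \<in> cbox (- (\<chi> i. if i = k then s else r)) (\<chi> i. if i = k then s else r)"
        using y(1) by (auto simp: mem_box_cart abs_le_iff minus_le_iff)
    qed
  qed simp
  have 5: "emeasure lborel (cbox (- (\<chi> i. if i = k then s else r)) (\<chi> i. if i = k then s else r)) = ennreal (2 * s * (2 * r) ^ (CARD('d) - 1))"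
  proof -
    have c: "(\<chi> i. if i = k then s else r) \<bullet> j = (if j = axis k 1 then s else r)" if "j \<in> Basis" for j
      using that by (auto simp: Basis_vec_def inner_axis axis_eq_axis)
    have "emeasure lborel (cbox (- (\<chi> i. if i = k then s else r)) (\<chi> i. if i = k then s else r))
      = (\<Prod>j\<in>(Basis :: (real^'d) set). ((\<chi> i. if i = k then s else r) - (- (\<chi> i. if i = k then s else r))) \<bullet> j)"
      using assms by (subst emeasure_lborel_cbox) (auto simp: c inner_minus_left inner_diff_left)
    also have "(\<Prod>j\<in>(Basis :: (real^'d) set). ((\<chi> i. if i = k then s else r) - (- (\<chi> i. if i = k then s else r))) \<bullet> j)
       = (\<Prod>j\<in>(Basis :: (real^'d) set). if j = axis k 1 then 2 * s else 2 * r)"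
      by (rule prod.cong[OF refl]) (simp only: c inner_minus_left inner_diff_left, simp)
    finally show ?thesis by (simp add: prod_Basis_delta)
  qed
  show ?thesis using 4 unfolding 1 2 3 5 .
qed

lemma emeasure_slab_ball_le:
  fixes n z :: "real^'d"
  assumes n: "norm n = 1" and "s \<ge> 0" "r \<ge> 0"
  shows "emeasure lborel ({y. \<bar>n \<bullet> y - c\<bar> \<le> s} \<inter> cball z r) \<le> ennreal (2 * s * (2 * r) ^ (CARD('d) - 1))"
proof -
  \<comment> \<open>The centre is moved along n into the middle plane of the slab; this leaves the
    component of y - z orthogonal to n unchanged, and that component is no longer than y - z
    itself.\<close>
  define z' where "z' = z + (c - n \<bullet> z) *\<^sub>R n"
  have avg: "n \<bullet> n = 1" using n by (simp add: norm_eq_1)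
  have "{y. \<bar>n \<bullet> y - c\<bar> \<le> s} \<inter> cball z r \<subseteq> {y. \<bar>n \<bullet> (y - z')\<bar> \<le> s \<and> norm (y - z' - (n \<bullet> (y - z')) *\<^sub>R n) \<le> r}"
  proof
    fix y assume y: "y \<in> {y. \<bar>n \<bullet> y - c\<bar> \<le> s} \<inter> cball z r"
    have 1: "n \<bullet> (y - z') = n \<bullet> y - c" by (simp add: z'_def inner_diff_right inner_add_right avg)
    have 2: "y - z' - (n \<bullet> (y - z')) *\<^sub>R n = (y - z) - (n \<bullet> (y - z)) *\<^sub>R n"
      unfolding 1 by (simp add: z'_def algebra_simps)
    have "(norm (w - (n \<bullet> w) *\<^sub>R n))\<^sup>2 = (norm w)\<^sup>2 - (n \<bullet> w)\<^sup>2" for w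
    proof -
      have "orthogonal (w - (n \<bullet> w) *\<^sub>R n) ((n \<bullet> w) *\<^sub>R n)"
        by (simp add: orthogonal_def inner_diff_left inner_diff_right avg inner_commute)
      from norm_add_Pythagorean[OF this] show ?thesis using n by (simp add: power_mult_distrib)
    qed
    then have "(norm ((y - z) - (n \<bullet> (y - z)) *\<^sub>R n))\<^sup>2 \<le> (norm (y - z))\<^sup>2" by simp
    then have "norm ((y - z) - (n \<bullet> (y - z)) *\<^sub>R n) \<le> norm (y - z)" by (rule power2_le_imp_le) simp
    also have "\<dots> \<le> r" using y by (simp add: dist_norm norm_minus_commute)
    finally show "y \<in> {y. \<bar>n \<bullet> (y - z')\<bar> \<le> s \<and> norm (y - z' - (n \<bullet> (y - z')) *\<^sub>R n) \<le> r}"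
      using y by (simp add: 1 2[unfolded 1])
  qed
  then have "emeasure lborel ({y. \<bar>n \<bullet> y - c\<bar> \<le> s} \<inter> cball z r)
     \<le> emeasure lborel {y. \<bar>n \<bullet> (y - z')\<bar> \<le> s \<and> norm (y - z' - (n \<bullet> (y - z')) *\<^sub>R n) \<le> r}"
    by (rule emeasure_mono) measurable
  also have "\<dots> \<le> ennreal (2 * s * (2 * r) ^ (CARD('d) - 1))"
    by (rule emeasure_cylinder_le[OF assms])
  finally show ?thesis .
qed

text \<open>The surface measure before completion. Image measures, densities and measurability on
  products are handled on Borel sets; the completion is removed once for each integral.\<close>

definition surf0 :: "'a::euclidean_space measure" where
  "surf0 = measure_of UNIV (sets borel)
     (\<lambda>A. \<integral>\<^sup>+H. emeasure lborel (plate H A) \<partial>count_space hyperplanes)"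

lemma surface_measure_eq: "surface_measure = completion surf0"
  by (simp add: surface_measure_def surf0_def)

lemma sets_surf0[simp, measurable_cong]: "sets surf0 = sets (borel :: 'a::euclidean_space measure)"
  unfolding surf0_def using sets.sigma_sets_eq[of "borel :: 'a measure"] by simp

lemma space_surf0[simp]: "space surf0 = UNIV"
  by (simp add: surf0_def)

lemma emeasure_surf0: "A \<in> sets borel \<Longrightarrow> emeasure surf0 A = emeasure surface_measure A"
  by (simp add: surface_measure_eq emeasure_completion)

lemma hyperplane_in_hyperplanes: "\<alpha> \<noteq> 0 \<Longrightarrow> {x. \<alpha> \<bullet> x = c} \<in> hyperplanes"
  by (simp add: hyperplanes_def affine_hyperplane aff_dim_hyperplane)

lemma plate_hyperplane:
  fixes \<alpha> :: "'a::euclidean_space"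
  assumes "\<alpha> \<noteq> 0"
  shows "plate {x. \<alpha> \<bullet> x = - \<beta>} A
    = {y. y - ((\<alpha> \<bullet> y + \<beta>) / (\<alpha> \<bullet> \<alpha>)) *\<^sub>R \<alpha> \<in> A \<and> \<bar>\<alpha> \<bullet> y + \<beta>\<bar> / norm \<alpha> \<le> 1/2}"
proof -
  have "\<bar>(\<alpha> \<bullet> y + \<beta>) / (\<alpha> \<bullet> \<alpha>)\<bar> * norm \<alpha> = \<bar>\<alpha> \<bullet> y + \<beta>\<bar> / norm \<alpha>" for y
    using assms by (simp add: dot_square_norm power2_eq_square abs_mult field_simps)
  then show ?thesis
    unfolding plate_def using closest_point_hyperplane[OF assms, of "- \<beta>"] by (auto simp: dist_norm)
qed

text \<open>A rank-one map with factor 1 / norm \<alpha> carries the orthogonal plate over A to a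
  skew one: the points whose projection along b lands in A and whose value of the affine form lies
  in a unit interval. Since the skew plate is invariant under shifts along b apart from the position
  of the interval, the interval may start at any s. Gauss' theorem uses s = 0 and s = -1.\<close>

lemma emeasure_surface_sheared:
  fixes \<alpha> b :: "real^'d"
  assumes b: "\<alpha> \<bullet> b = -1" and A: "A \<in> sets borel" "A \<subseteq> {x. \<alpha> \<bullet> x + \<beta> = 0}"
  shows "emeasure surface_measure A
    = ennreal (norm \<alpha>) * emeasure lborel {y. \<alpha> \<bullet> y + \<beta> \<in> {s..<s+1} \<and> y + (\<alpha> \<bullet> y + \<beta>) *\<^sub>R b \<in> A}"
proof -
  have a0: "\<alpha> \<noteq> 0" using b by auto
  note [measurable] = A(1)
  define n where "n = (1 / norm \<alpha>) *\<^sub>R \<alpha>"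
  have n: "norm n = 1" "\<alpha> = norm \<alpha> *\<^sub>R n" using a0 by (auto simp: n_def)
  have avg: "n \<bullet> n = 1" using n by (simp add: norm_eq_1)
  \<comment> \<open>With this v, moving y by v times the signed distance to the hyperplane and then
    projecting along b has the same effect as projecting orthogonally.\<close>
  define v where "v = - n - b"
  have nb: "n \<bullet> b = - 1 / norm \<alpha>" using b by (simp add: n_def)
  have nv: "1 + n \<bullet> v = 1 / norm \<alpha>" by (simp add: v_def inner_diff_right avg nb)
  let ?l = "\<lambda>y. \<alpha> \<bullet> y + \<beta>"
  define Z where "Z = {y. \<bar>?l y\<bar> \<le> 1/2 \<and> y + ?l y *\<^sub>R b \<in> A}"
  define Zs where "Zs s = {y. ?l y \<in> {s..<s+1} \<and> y + ?l y *\<^sub>R b \<in> A}" for s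
  have [measurable]: "Z \<in> sets borel" "Zs s \<in> sets borel" for s unfolding Z_def Zs_def by measurable
  define c where "c = (\<beta> / norm \<alpha>) *\<^sub>R v"
  have T: "plate {x. \<alpha> \<bullet> x = - \<beta>} A = (\<lambda>y. y + (n \<bullet> y) *\<^sub>R v) -` {y. c + y \<in> Z}"
  proof -
    have 1: "c + (y + (n \<bullet> y) *\<^sub>R v) = y + (?l y / norm \<alpha>) *\<^sub>R v" for y
      using a0 by (simp add: c_def n_def add_divide_distrib scaleR_add_left)
    have 2: "?l (y + (?l y / norm \<alpha>) *\<^sub>R v) = ?l y / norm \<alpha>" for y
    proof -
      have av: "\<alpha> \<bullet> v = 1 - norm \<alpha>"
        using nv a0 by (subst n(2)) (simp add: field_simps)
      show ?thesis using a0 unfolding inner_add_right inner_scaleR_right av by (simp add: field_simps)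
    qed
    have 3: "y + (?l y / norm \<alpha>) *\<^sub>R v + (?l y / norm \<alpha>) *\<^sub>R b = y - (?l y / (\<alpha> \<bullet> \<alpha>)) *\<^sub>R \<alpha>" for y
    proof -
      have "(?l y / (\<alpha> \<bullet> \<alpha>)) *\<^sub>R \<alpha> = (?l y / norm \<alpha>) *\<^sub>R n"
        by (simp add: n_def dot_square_norm power2_eq_square)
      then show ?thesis by (simp add: v_def algebra_simps)
    qed
    show ?thesis
      unfolding plate_hyperplane[OF a0] Z_def vimage_def mem_Collect_eq 1 2 3
      by (auto simp: abs_divide)
  qed
  have "{x. \<alpha> \<bullet> x = - \<beta>} = {x. \<alpha> \<bullet> x + \<beta> = 0}" by auto
  then have "emeasure surface_measure A = emeasure lborel (plate {x. \<alpha> \<bullet> x = - \<beta>} A)"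
    using emeasure_surface_measure_hyperplane[OF A(1) hyperplane_in_hyperplanes[OF a0, of "- \<beta>"]] A(2) by auto
  also have "\<dots> = ennreal (norm \<alpha>) * (ennreal (1 / norm \<alpha>) * emeasure lborel ((\<lambda>y. y + (n \<bullet> y) *\<^sub>R v) -` {y. c + y \<in> Z}))"
    using a0 by (simp add: T mult.assoc[symmetric] ennreal_mult[symmetric])
  also have "ennreal (1 / norm \<alpha>) * emeasure lborel ((\<lambda>y. y + (n \<bullet> y) *\<^sub>R v) -` {y. c + y \<in> Z}) = emeasure lborel {y. c + y \<in> Z}"
    using emeasure_rank_one_vimage[OF n(1), of v "{y. c + y \<in> Z}"] a0 unfolding nv by simp
  also have "emeasure lborel {y. c + y \<in> Z} = emeasure lborel Z"
    by (rule emeasure_lborel_translate) simp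
  also have "emeasure lborel Z = emeasure lborel (Zs (-1/2))"
  proof (rule emeasure_eq_AE)
    have "negligible {x. \<alpha> \<bullet> x = 1/2 - \<beta>}" using a0 by (intro negligible_hyperplane) auto
    then have "{x. \<alpha> \<bullet> x = 1/2 - \<beta>} \<in> null_sets lebesgue" by (simp add: negligible_iff_null_sets)
    then have "{x. \<alpha> \<bullet> x = 1/2 - \<beta>} \<in> null_sets lborel"
      by (simp add: null_sets_def)
    then have "AE x in lborel. x \<notin> {x. \<alpha> \<bullet> x = 1/2 - \<beta>}" by (rule AE_not_in)
    then show "AE x in lborel. (x \<in> Z) = (x \<in> Zs (-1/2))"
    proof eventually_elim
      case (elim x)
      then have 1: "?l x \<noteq> 1/2" by auto
      have "(\<bar>t\<bar> \<le> 1/2) = (t \<in> {-1/2..<-1/2+1})" if "t \<noteq> 1/2" for t :: real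
        using that by (auto simp: abs_le_iff)
      from this[OF 1] show ?case unfolding Z_def Zs_def mem_Collect_eq by simp
    qed
  qed simp_all
  also have "emeasure lborel (Zs (-1/2)) = emeasure lborel (Zs s)"
  proof -
    have "{y. ((- s - 1/2) *\<^sub>R (- b)) + y \<in> Zs (-1/2)} = Zs s"
      using b by (auto simp: Zs_def inner_add_right inner_diff_right algebra_simps)
    then show ?thesis
      using emeasure_lborel_translate[of "Zs (-1/2)" "(- s - 1/2) *\<^sub>R (- b)"] by simp
  qed
  finally show ?thesis by (simp add: Zs_def)
qed

text \<open>The plate over A lies in the cylinder of half-height 1/2 and radius r about z.\<close>

lemma emeasure_surface_le:
  fixes \<alpha> z :: "real^'d"
  assumes a0: "\<alpha> \<noteq> 0" and A: "A \<in> sets borel" "A \<subseteq> {x. \<alpha> \<bullet> x = c}" "A \<subseteq> cball z r" and z: "z \<in> {x. \<alpha> \<bullet> x = c}" and "r \<ge> 0"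
  shows "emeasure surface_measure A \<le> ennreal ((2 * r) ^ (CARD('d) - 1))"
proof -
  define n where "n = (1 / norm \<alpha>) *\<^sub>R \<alpha>"
  have n: "norm n = 1" "\<alpha> = norm \<alpha> *\<^sub>R n" using a0 by (auto simp: n_def)
  have "emeasure surface_measure A = emeasure lborel (plate {x. \<alpha> \<bullet> x = - (- c)} A)"
    using emeasure_surface_measure_hyperplane[OF A(1) hyperplane_in_hyperplanes[OF a0] A(2)] by simp
  also have "\<dots> \<le> emeasure lborel {y. \<bar>n \<bullet> (y - z)\<bar> \<le> 1/2 \<and> norm (y - z - (n \<bullet> (y - z)) *\<^sub>R n) \<le> r}"
  proof (rule emeasure_mono)
    show "plate {x. \<alpha> \<bullet> x = - (- c)} A \<subseteq> {y. \<bar>n \<bullet> (y - z)\<bar> \<le> 1/2 \<and> norm (y - z - (n \<bullet> (y - z)) *\<^sub>R n) \<le> r}"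
    proof
      fix y assume y: "y \<in> plate {x. \<alpha> \<bullet> x = - (- c)} A"
      have 1: "n \<bullet> (y - z) = (\<alpha> \<bullet> y - c) / norm \<alpha>" using z by (simp add: n_def inner_diff_right diff_divide_distrib)
      have 2: "(n \<bullet> (y - z)) *\<^sub>R n = ((\<alpha> \<bullet> y - c) / (\<alpha> \<bullet> \<alpha>)) *\<^sub>R \<alpha>"
        unfolding 1 by (simp add: n_def dot_square_norm power2_eq_square)
      have 3: "y - z - (n \<bullet> (y - z)) *\<^sub>R n = (y - ((\<alpha> \<bullet> y - c) / (\<alpha> \<bullet> \<alpha>)) *\<^sub>R \<alpha>) - z"
        unfolding 2 by simp
      have "y - ((\<alpha> \<bullet> y - c) / (\<alpha> \<bullet> \<alpha>)) *\<^sub>R \<alpha> \<in> A" "\<bar>\<alpha> \<bullet> y - c\<bar> / norm \<alpha> \<le> 1/2"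
        using y unfolding plate_hyperplane[OF a0] by auto
      moreover from this(1) have "norm ((y - ((\<alpha> \<bullet> y - c) / (\<alpha> \<bullet> \<alpha>)) *\<^sub>R \<alpha>) - z) \<le> r"
        using A(3) by (auto simp: dist_norm norm_minus_commute)
      ultimately show "y \<in> {y. \<bar>n \<bullet> (y - z)\<bar> \<le> 1/2 \<and> norm (y - z - (n \<bullet> (y - z)) *\<^sub>R n) \<le> r}"
        unfolding mem_Collect_eq 3 unfolding 1 by simp
    qed
  qed measurable
  also have "\<dots> \<le> ennreal (2 * (1/2) * (2 * r) ^ (CARD('d) - 1))"
    by (rule emeasure_cylinder_le) (use n \<open>r \<ge> 0\<close> in auto)
  finally show ?thesis by simp
qed

text \<open>The restriction to e is put into a measure on the whole space, so that polynomials
  defined everywhere can be integrated over a face and general facts on finite measures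
  apply.\<close>

definition face_measure :: "'a::euclidean_space set \<Rightarrow> 'a measure" where
  "face_measure e = density surf0 (indicator e)"

lemma sets_face_measure[simp, measurable_cong]: "sets (face_measure e) = sets borel"
  by (simp add: face_measure_def)

lemma space_face_measure[simp]: "space (face_measure e) = UNIV"
  by (simp add: face_measure_def)

lemma emeasure_face_measure:
  assumes "e \<in> sets borel" "X \<in> sets borel"
  shows "emeasure (face_measure e) X = emeasure surface_measure (e \<inter> X)"
  using assms by (simp add: face_measure_def emeasure_density nn_integral_indicator emeasure_surf0 flip: indicator_inter_arith)

lemma surface_integral_eq_face_measure:
  fixes f :: "'a::euclidean_space \<Rightarrow> real"
  assumes [measurable]: "e \<in> sets borel" "f \<in> borel_measurable borel"
  shows "(LINT x:e|surface_measure. f x) = (LINT x|face_measure e. f x)"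
proof -
  have "(LINT x:e|surface_measure. f x) = (LINT x|surf0. indicator e x *\<^sub>R f x)"
    unfolding set_lebesgue_integral_def surface_measure_eq by (rule integral_completion) measurable
  also have "\<dots> = (LINT x|face_measure e. f x)"
    unfolding face_measure_def
    by (subst integral_density[symmetric]) (auto simp: ennreal_indicator)
  finally show ?thesis .
qed

text \<open>The face is the image of a skew plate of unit thickness under the projection along b.
  Surface integrals thereby become volume integrals, to which Fubini along b applies.\<close>

lemma face_measure_eq_distr:
  fixes \<alpha> b :: "real^'d"
  assumes b: "\<alpha> \<bullet> b = -1" and e: "e \<in> sets borel" "e \<subseteq> {x. \<alpha> \<bullet> x + \<beta> = 0}"
  shows "face_measure e = distr (density lborel
    (\<lambda>y. ennreal (norm \<alpha> * indicator {y. \<alpha> \<bullet> y + \<beta> \<in> {s..<s+1} \<and> y + (\<alpha> \<bullet> y + \<beta>) *\<^sub>R b \<in> e} y))) borel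
      (\<lambda>y. y + (\<alpha> \<bullet> y + \<beta>) *\<^sub>R b)"
proof (rule measure_eqI)
  fix X assume "X \<in> sets (face_measure e)"
  then have X[measurable]: "X \<in> sets borel" by simp
  note [measurable] = e(1)
  let ?Z = "\<lambda>A. {y. \<alpha> \<bullet> y + \<beta> \<in> {s..<s+1} \<and> y + (\<alpha> \<bullet> y + \<beta>) *\<^sub>R b \<in> A}"
  have "emeasure (face_measure e) X = ennreal (norm \<alpha>) * emeasure lborel (?Z (e \<inter> X))"
    unfolding emeasure_face_measure[OF e(1) X]
    by (rule emeasure_surface_sheared[OF b]) (use e in auto)
  also have "\<dots> = (\<integral>\<^sup>+y. ennreal (norm \<alpha>) * indicator (?Z (e \<inter> X)) y \<partial>lborel)"
    by (rule nn_integral_cmult_indicator[symmetric]) measurable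
  also have "\<dots> = (\<integral>\<^sup>+y. ennreal (norm \<alpha> * indicator (?Z e) y) * indicator ((\<lambda>y. y + (\<alpha> \<bullet> y + \<beta>) *\<^sub>R b) -` X) y \<partial>lborel)"
    by (intro nn_integral_cong) (auto simp: indicator_def)
  moreover have "(\<lambda>y. y + (\<alpha> \<bullet> y + \<beta>) *\<^sub>R b) -` X \<in> sets borel"
    using measurable_sets[of "\<lambda>y. y + (\<alpha> \<bullet> y + \<beta>) *\<^sub>R b" borel borel X] by simp
  ultimately show "emeasure (face_measure e) X = emeasure (distr (density lborel
    (\<lambda>y. ennreal (norm \<alpha> * indicator (?Z e) y))) borel (\<lambda>y. y + (\<alpha> \<bullet> y + \<beta>) *\<^sub>R b)) X"
    by (simp add: emeasure_distr emeasure_density)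
qed simp

lemma surface_integral_sheared:
  fixes \<alpha> b :: "real^'d" and f :: "real^'d \<Rightarrow> real"
  assumes b: "\<alpha> \<bullet> b = -1" and e: "e \<in> sets borel" "e \<subseteq> {x. \<alpha> \<bullet> x + \<beta> = 0}"
    and f: "f \<in> borel_measurable borel"
  shows "(LINT x:e|surface_measure. f x) = norm \<alpha> *
    (LINT y|lborel. indicator {y. \<alpha> \<bullet> y + \<beta> \<in> {s..<s+1} \<and> y + (\<alpha> \<bullet> y + \<beta>) *\<^sub>R b \<in> e} y * f (y + (\<alpha> \<bullet> y + \<beta>) *\<^sub>R b))"
proof -
  note [measurable] = e(1) f
  show ?thesis
    unfolding surface_integral_eq_face_measure[OF e(1) f] face_measure_eq_distr[OF b e, of s]
    by (simp add: integral_distr integral_density mult.assoc)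
qed

subsection \<open>Gauss' theorem on a simplex\<close>

text \<open>The affine forms \<open>\<alpha> a \<bullet> x + \<beta> a\<close> are the barycentric
  coordinates of x with respect to the vertices C, extended to the whole space; their gradients are
  normal to the facets.\<close>

locale simplex_coords =
  fixes K C :: "(real^'d) set" and \<alpha> :: "real^'d \<Rightarrow> real^'d" and \<beta> :: "real^'d \<Rightarrow> real"
  assumes finite_C: "finite C" and card_C: "card C = CARD('d) + 1"
    and hull: "K = convex hull C"
    and delta: "\<And>a b. a \<in> C \<Longrightarrow> b \<in> C \<Longrightarrow> \<alpha> a \<bullet> b + \<beta> a = (if a = b then 1 else 0)"
    and sum_coords: "\<And>x. (\<Sum>a\<in>C. \<alpha> a \<bullet> x + \<beta> a) = 1"
    and repr: "\<And>x. (\<Sum>a\<in>C. (\<alpha> a \<bullet> x + \<beta> a) *\<^sub>R a) = x"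
    and mem: "\<And>x. x \<in> K \<longleftrightarrow> (\<forall>a\<in>C. \<alpha> a \<bullet> x + \<beta> a \<ge> 0)"
    and facets_eq: "facets K = (\<lambda>a. {x \<in> K. \<alpha> a \<bullet> x + \<beta> a = 0}) ` C"

lemma simplex_coords_exist:
  fixes K :: "(real^'d) set"
  assumes "int CARD('d) simplex K"
  obtains C \<alpha> \<beta> where "simplex_coords K C \<alpha> \<beta>"
proof -
  obtain C where C: "\<not> affine_dependent C" "int (card C) = int CARD('d) + 1" "K = convex hull C"
    using assms by (auto simp: simplex_def)
  have cC: "card C = CARD('d) + 1" using C(2) by linarith
  have fC: "finite C" using C(1) aff_independent_finite by blast
  have affC: "affine hull C = UNIV"
  proof -
    have "aff_dim C = int CARD('d)" using C(1) cC by (simp add: affine_independent_iff_card)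
    then show ?thesis by (metis aff_dim_eq_full DIM_cart DIM_real mult.right_neutral)
  qed
  \<comment> \<open>The affine hull of the other vertices is a hyperplane that misses a. Its
    equation, scaled to the value 1 at a, is the coordinate that belongs to a.\<close>
  have "\<exists>\<alpha> \<beta>. \<forall>b\<in>C. \<alpha> \<bullet> b + \<beta> = (if a = b then 1 else (0::real))" if a: "a \<in> C" for a
  proof -
    have ind: "\<not> affine_dependent (C - {a})" using C(1) affine_dependent_subset by blast
    have "aff_dim (C - {a}) = int DIM(real^'d) - 1"
      using ind a cC fC by (simp add: affine_independent_iff_card)
    then obtain n c where n: "n \<noteq> 0" "affine hull (C - {a}) = {x. n \<bullet> x = c}"
      using aff_dim_eq_hyperplane[of "C - {a}"] by auto
    have "a \<notin> affine hull (C - {a})" using C(1) a by (auto simp: affine_dependent_def)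
    then have na: "n \<bullet> a - c \<noteq> 0" using n by auto
    have nb: "n \<bullet> b = c" if "b \<in> C" "b \<noteq> a" for b
      using that n(2) hull_subset[of "C - {a}" affine] by auto
    show ?thesis
      by (rule exI[of _ "(1 / (n \<bullet> a - c)) *\<^sub>R n"], rule exI[of _ "- c / (n \<bullet> a - c)"])
        (use na nb in \<open>auto simp: diff_divide_distrib[symmetric]\<close>)
  qed
  then obtain \<alpha> \<beta> where ab: "\<And>a b. a \<in> C \<Longrightarrow> b \<in> C \<Longrightarrow> \<alpha> a \<bullet> b + \<beta> a = (if a = b then 1 else (0::real))"
    by metis
  have coef: "\<alpha> a \<bullet> (\<Sum>b\<in>D. u b *\<^sub>R b) + \<beta> a = (\<Sum>b\<in>D. u b * (if a = b then 1 else 0))"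
    if "D \<subseteq> C" "a \<in> C" "sum u D = 1" for D u a
  proof -
    have "\<alpha> a \<bullet> (\<Sum>b\<in>D. u b *\<^sub>R b) + \<beta> a = (\<Sum>b\<in>D. u b * (\<alpha> a \<bullet> b)) + (\<Sum>b\<in>D. u b) * \<beta> a"
      using that(3) by (simp add: inner_sum_right)
    also have "\<dots> = (\<Sum>b\<in>D. u b * (\<alpha> a \<bullet> b + \<beta> a))"
      by (simp add: sum.distrib algebra_simps sum_distrib_left)
    also have "\<dots> = (\<Sum>b\<in>D. u b * (if a = b then 1 else 0))"
      using that ab by (intro sum.cong) auto
    finally show ?thesis .
  qed
  have coefC: "\<alpha> a \<bullet> (\<Sum>b\<in>C. u b *\<^sub>R b) + \<beta> a = u a" if "a \<in> C" "sum u C = 1" for u a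
  proof -
    have "(\<Sum>b\<in>C. u b * (if a = b then 1 else 0)) = (\<Sum>b\<in>C. if a = b then u b else 0)"
      by (intro sum.cong) auto
    then show ?thesis using coef[OF order_refl that] that(1) fC by simp
  qed
  have rep: "\<exists>u. sum u C = 1 \<and> (\<Sum>b\<in>C. u b *\<^sub>R b) = x" for x
    using affC affine_hull_finite[OF fC] by auto
  have S: "(\<Sum>a\<in>C. \<alpha> a \<bullet> x + \<beta> a) = 1" and R: "(\<Sum>a\<in>C. (\<alpha> a \<bullet> x + \<beta> a) *\<^sub>R a) = x" for x
  proof -
    obtain u where u: "sum u C = 1" "(\<Sum>b\<in>C. u b *\<^sub>R b) = x" using rep by blast
    have "\<And>a. a \<in> C \<Longrightarrow> \<alpha> a \<bullet> x + \<beta> a = u a" using coefC u by blast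
    then show "(\<Sum>a\<in>C. \<alpha> a \<bullet> x + \<beta> a) = 1" "(\<Sum>a\<in>C. (\<alpha> a \<bullet> x + \<beta> a) *\<^sub>R a) = x" using u by simp_all
  qed
  have M: "x \<in> convex hull C \<longleftrightarrow> (\<forall>a\<in>C. \<alpha> a \<bullet> x + \<beta> a \<ge> 0)" for x
  proof
    assume "x \<in> convex hull C"
    then obtain u where u: "\<forall>a\<in>C. 0 \<le> u a" "sum u C = 1" "(\<Sum>b\<in>C. u b *\<^sub>R b) = x"
      unfolding convex_hull_finite[OF fC] by auto
    then show "\<forall>a\<in>C. \<alpha> a \<bullet> x + \<beta> a \<ge> 0" using coefC by fastforce
  next
    assume "\<forall>a\<in>C. \<alpha> a \<bullet> x + \<beta> a \<ge> 0"
    then show "x \<in> convex hull C" unfolding convex_hull_finite[OF fC] using S[of x] R[of x]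
      by (auto intro!: exI[of _ "\<lambda>a. \<alpha> a \<bullet> x + \<beta> a"])
  qed
  have F: "convex hull (C - {a}) = {x \<in> convex hull C. \<alpha> a \<bullet> x + \<beta> a = 0}" if a: "a \<in> C" for a
  proof safe
    fix x assume x: "x \<in> convex hull (C - {a})"
    then show "x \<in> convex hull C" using hull_mono[of "C - {a}" C convex] by auto
    have fCa: "finite (C - {a})" using fC by simp
    obtain u where u: "sum u (C - {a}) = 1" "(\<Sum>b\<in>C - {a}. u b *\<^sub>R b) = x"
      using x unfolding convex_hull_finite[OF fCa] by auto
    have "(\<Sum>b\<in>C - {a}. u b * (if a = b then 1 else 0)) = 0" by (intro sum.neutral) auto
    then show "\<alpha> a \<bullet> x + \<beta> a = 0" using coef[OF Diff_subset a u(1)] u(2) by simp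
  next
    fix x assume x: "x \<in> convex hull C" "\<alpha> a \<bullet> x + \<beta> a = 0"
    have "finite (C - {a})" using fC by simp
    moreover have "(\<Sum>b\<in>C - {a}. \<alpha> b \<bullet> x + \<beta> b) = 1" "(\<Sum>b\<in>C - {a}. (\<alpha> b \<bullet> x + \<beta> b) *\<^sub>R b) = x"
      using S[of x] R[of x] x(2) fC a by (simp_all add: sum.remove[OF fC a])
    ultimately show "x \<in> convex hull (C - {a})"
      using x(1) M by (auto simp: convex_hull_finite intro!: exI[of _ "\<lambda>a. \<alpha> a \<bullet> x + \<beta> a"])
  qed
  have c2: "2 \<le> card C" using cC by (simp add: Suc_le_eq)
  have "facets K = (\<lambda>a. {x \<in> K. \<alpha> a \<bullet> x + \<beta> a = 0}) ` C"
    unfolding facets_def C(3) using F facet_of_convex_hull_affine_independent_alt[OF C(1)] c2 by auto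
  then have "simplex_coords K C \<alpha> \<beta>"
    using fC cC C(3) ab S R M by unfold_locales auto
  then show ?thesis by (rule that)
qed

text \<open>The domain is the intersection of [0, 1] and [A, B]. Its end values are sorted by
  origin: ends at 0 or 1 become terms that cancel under translation, ends at A or B become facet
  terms. The strict inequalities assign a coincidence, such as B = 1, to exactly one of
  them.\<close>

lemma FTC_indicator_unit:
  fixes F F' :: "real \<Rightarrow> real"
  assumes F: "\<And>x. DERIV F x :> F' x" and c: "continuous_on UNIV F'"
  shows "(LINT s|lborel. indicator {0..1} s * (indicator {A..B} s * F' s)) = (if A \<le> B then
      of_bool (A \<le> 1 \<and> 1 \<le> B) * F 1 - of_bool (A \<le> 0 \<and> 0 \<le> B) * F 0
      + of_bool (0 \<le> B \<and> B < 1) * F B - of_bool (0 < A \<and> A \<le> 1) * F A else 0)"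
proof -
  have eq: "indicator {0..1} s * (indicator {A..B} s * F' s) = F' s * indicator {max 0 A..min 1 B} s" for s
    by (auto simp: indicator_def)
  have ic: "isCont F' x" for x using c by (simp add: continuous_on_eq_continuous_at)
  show ?thesis
  proof (cases "max 0 A \<le> min 1 B")
    case True
    have "(LINT s|lborel. F' s * indicator {max 0 A..min 1 B} s) = F (min 1 B) - F (max 0 A)"
      by (rule integral_FTC_Icc_real[OF True]) (use F ic in auto)
    then show ?thesis unfolding eq using True by (auto simp: max_def min_def)
  next
    case False
    then have "{max 0 A..min 1 B} = {}" by simp
    then show ?thesis unfolding eq using False by (auto simp: max_def min_def split: if_splits)
  qed
qed

lemma integrable_bounded_support:
  fixes f :: "'a::euclidean_space \<Rightarrow> real"
  assumes "f \<in> borel_measurable borel" "bounded S" "\<And>x. x \<notin> S \<Longrightarrow> f x = 0" "\<And>x. \<bar>f x\<bar> \<le> B"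
  shows "integrable lborel f"
proof -
  obtain r where r: "S \<subseteq> cball 0 r" 
  proof -
    obtain r where "\<forall>x\<in>S. norm x \<le> r" using assms(2) unfolding bounded_iff by blast
    then have "S \<subseteq> cball 0 r" by auto
    then show ?thesis by (rule that)
  qed
  have "integrable lborel (\<lambda>x. indicator (cball 0 r) x *\<^sub>R f x)"
  proof (rule integrableI_bounded_set_indicator[where B = B])
    show "f \<in> borel_measurable lborel" using assms(1) by simp
    show "AE x in lborel. x \<in> cball 0 r \<longrightarrow> norm (f x) \<le> B" by (rule AE_I2) (simp add: assms(4))
    show "emeasure lborel (cball (0::'a) r) < \<infinity>" using emeasure_lborel_cball_finite[of "0::'a" r] by simp
  qed simp
  moreover have "(\<lambda>x. indicator (cball 0 r) x *\<^sub>R f x) = f"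
  proof
    fix x show "indicator (cball 0 r) x *\<^sub>R f x = f x"
    proof (cases "x \<in> cball 0 r")
      case False
      then have "x \<notin> S" using r by blast
      then show ?thesis using assms(3) by simp
    qed simp
  qed
  ultimately show ?thesis by simp
qed

lemma integrable_continuous_bounded_support:
  fixes f g :: "'a::euclidean_space \<Rightarrow> real"
  assumes Z: "Z \<in> sets borel" "bounded Z" and f: "continuous_on UNIV f"
  shows "integrable lborel (\<lambda>y. indicator Z y * f y)"
proof -
  have "bounded (f ` closure Z)"
    using Z f by (intro compact_imp_bounded compact_continuous_image) (auto intro: continuous_on_subset)
  then obtain B where B: "\<And>x. x \<in> closure Z \<Longrightarrow> \<bar>f x\<bar> \<le> B" by (auto simp: bounded_iff)
  have "\<bar>indicator Z y * f y\<bar> \<le> max B 0" for y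
    using B[of y] closure_subset[of Z] by (auto simp: indicator_def)
  then show ?thesis
    using Z borel_measurable_continuous_onI[OF f]
    by (intro integrable_bounded_support[of _ Z "max B 0"]) auto
qed

lemma integral_translate:
  fixes f :: "'a::euclidean_space \<Rightarrow> real"
  assumes "f \<in> borel_measurable borel"
  shows "(LINT y|lborel. f (y + c)) = (LINT y|lborel. f y)"
proof -
  have "(LINT y|lborel. f y) = (LINT y|distr lborel borel ((+) c). f y)" by (simp add: lborel_distr_plus)
  also have "\<dots> = (LINT y|lborel. f (c + y))" using assms by (subst integral_distr) auto
  finally show ?thesis by (simp add: add.commute)
qed

context simplex_coords
begin

definition lam :: "real^'d \<Rightarrow> real^'d \<Rightarrow> real" where "lam a x = \<alpha> a \<bullet> x + \<beta> a"
definition F :: "real^'d \<Rightarrow> (real^'d) set" where "F a = {x \<in> K. lam a x = 0}"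

lemma lam_vertex: "a \<in> C \<Longrightarrow> b \<in> C \<Longrightarrow> lam a b = (if a = b then 1 else 0)"
  by (simp add: lam_def delta)

lemma lam_add: "lam a (x + y) = lam a x + \<alpha> a \<bullet> y"
  by (simp add: lam_def inner_add_right)

lemma mem_lam: "x \<in> K \<longleftrightarrow> (\<forall>a\<in>C. lam a x \<ge> 0)"
  by (simp add: lam_def mem)

lemma facets_F: "facets K = F ` C"
  by (simp add: facets_eq F_def[abs_def] lam_def)

lemma compact_K: "compact K" and convex_K: "convex K"
  using hull finite_C by (auto simp: finite_imp_compact compact_convex_hull)

lemma C_subset: "C \<subseteq> K" using hull hull_subset by metis

lemma alpha_edge: "a \<in> C \<Longrightarrow> i \<in> C \<Longrightarrow> j \<in> C \<Longrightarrow> \<alpha> a \<bullet> (i - j) = of_bool (a = i) - of_bool (a = j)"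
  using delta[of a i] delta[of a j] by (auto simp: inner_diff_right split: if_splits)

lemma alpha_nonzero:
  assumes "a \<in> C" shows "\<alpha> a \<noteq> 0"
proof -
  have "card C \<noteq> 1" using card_C by simp
  then obtain b where "b \<in> C" "b \<noteq> a" using assms by (metis is_singletonI' is_singleton_altdef empty_iff)
  then show ?thesis using alpha_edge[of a a b] assms by auto
qed

lemma closed_F: "closed (F a)"
proof -
  have "F a = K \<inter> {x. \<alpha> a \<bullet> x = - \<beta> a}" by (auto simp: F_def lam_def)
  then show ?thesis using compact_K by (simp add: closed_Int compact_imp_closed closed_hyperplane)
qed

lemma bounded_F: "bounded (F a)"
  using compact_K by (auto simp: F_def intro: bounded_subset[OF compact_imp_bounded])

lemma inj_F: "inj_on F C"
proof (rule inj_onI)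
  fix a b assume ab: "a \<in> C" "b \<in> C" "F a = F b"
  show "a = b"
  proof (rule ccontr)
    assume "a \<noteq> b"
    then have "a \<in> F b" using ab C_subset by (auto simp: F_def lam_vertex)
    then have "a \<in> F a" using ab by simp
    then show False using lam_vertex[of a a] ab by (simp add: F_def)
  qed
qed

text \<open>Expand x in barycentric coordinates: a form with the same value k at all vertices but a
  is a multiple of \<open>lam a\<close> plus k, so its gradient is a multiple of
  \<open>\<alpha> a\<close>.\<close>

lemma const_on_facet:
  assumes a: "a \<in> C" and c: "\<And>b. b \<in> C \<Longrightarrow> b \<noteq> a \<Longrightarrow> n \<bullet> b = k"
  shows "n = (n \<bullet> a - k) *\<^sub>R \<alpha> a"
proof -
  define t where "t = n \<bullet> a - k"
  have nx: "n \<bullet> x = t * lam a x + k" for x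
  proof -
    have "n \<bullet> x = n \<bullet> (\<Sum>b\<in>C. lam b x *\<^sub>R b)" using repr[of x] by (simp add: lam_def)
    also have "\<dots> = (\<Sum>b\<in>C. lam b x * (n \<bullet> b))" by (simp add: inner_sum_right)
    also have "\<dots> = (\<Sum>b\<in>C. lam b x * k + (if b = a then lam a x * t else 0))"
      using c by (intro sum.cong) (auto simp: algebra_simps t_def)
    also have "\<dots> = (\<Sum>b\<in>C. lam b x) * k + lam a x * t"
      using a finite_C by (simp add: sum.distrib sum_distrib_right)
    finally show ?thesis using sum_coords[of x] by (simp add: lam_def mult.commute)
  qed
  have tk: "t * \<beta> a + k = 0" using nx[of 0] by (simp add: lam_def)
  have "n \<bullet> x = (t *\<^sub>R \<alpha> a) \<bullet> x" for x
  proof -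
    have "n \<bullet> x = t * (\<alpha> a \<bullet> x) + (t * \<beta> a + k)" unfolding nx[of x] lam_def by (simp add: distrib_left)
    then show ?thesis unfolding tk by simp
  qed
  then have "n = t *\<^sub>R \<alpha> a" using vector_eq_rdot[of n "t *\<^sub>R \<alpha> a"] by blast
  then show ?thesis unfolding t_def .
qed

lemma outward_normal_F:
  assumes a: "a \<in> C"
  shows "outward_normal K (F a) = - (1 / norm (\<alpha> a)) *\<^sub>R \<alpha> a"
  unfolding outward_normal_def
proof (rule the_equality)
  let ?n = "- (1 / norm (\<alpha> a)) *\<^sub>R \<alpha> a"
  have na: "norm (\<alpha> a) > 0" using alpha_nonzero[OF a] by simp
  show "norm ?n = 1 \<and> (\<forall>x\<in>F a. \<forall>y\<in>K. ?n \<bullet> (y - x) \<le> 0)"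
  proof (intro conjI ballI)
    show "norm ?n = 1" using na by simp
    fix x y assume "x \<in> F a" "y \<in> K"
    then have "\<alpha> a \<bullet> (y - x) \<ge> 0" using a by (auto simp: F_def lam_def mem inner_diff_right)
    then show "?n \<bullet> (y - x) \<le> 0" using na by (simp add: divide_nonneg_pos)
  qed
  fix n assume n: "norm n = 1 \<and> (\<forall>x\<in>F a. \<forall>y\<in>K. n \<bullet> (y - x) \<le> 0)"
  have "card C \<noteq> 1" using card_C by simp
  then obtain c where c: "c \<in> C" "c \<noteq> a" using a by (metis is_singletonI' is_singleton_altdef empty_iff)
  have bF: "b \<in> F a" if "b \<in> C" "b \<noteq> a" for b
    using that a C_subset by (auto simp: F_def lam_vertex)
  \<comment> \<open>Both points lie on the facet and in K, so the inequality that characterizes the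
    normal holds in both directions.\<close>
  have nb: "n \<bullet> b = n \<bullet> c" if "b \<in> C" "b \<noteq> a" for b
  proof -
    have "n \<bullet> (b - c) \<le> 0" "n \<bullet> (c - b) \<le> 0" using n bF[OF that] bF[OF c] by (auto simp: F_def)
    then show ?thesis by (simp add: inner_diff_right)
  qed
  define t where "t = n \<bullet> a - n \<bullet> c"
  have t: "n = t *\<^sub>R \<alpha> a" using const_on_facet[OF a nb] by (simp add: t_def)
  have "n \<bullet> (a - c) \<le> 0" using n bF[OF c] C_subset a by blast
  then have t0: "t \<le> 0" by (simp add: t_def inner_diff_right)
  have "\<bar>t\<bar> * norm (\<alpha> a) = 1" using n arg_cong[OF t, of norm] by (metis norm_scaleR)
  then have "t = - (1 / norm (\<alpha> a))" using t0 na by (simp add: field_simps)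
  then show "n = ?n" using t by simp
qed

text \<open>For a direction parallel to an edge, only two facets are crossed transversally. On each
  line in that direction the fundamental theorem of calculus applies, and averaging over a unit
  interval of translates turns the end values on the two facets into integrals over skew plates,
  that is, into surface integrals.\<close>

lemma gauss_edge:
  fixes f :: "real^'d \<Rightarrow> real"
  assumes f: "\<And>x. (f has_derivative f' x) (at x)" and c: "\<And>b. continuous_on UNIV (\<lambda>x. f' x b)"
    and ij: "i \<in> C" "j \<in> C" "i \<noteq> j"
  shows "(LINT x|lborel. indicator K x * f' x (i - j))
    = (1 / norm (\<alpha> j)) * (LINT x:F j|surface_measure. f x) - (1 / norm (\<alpha> i)) * (LINT x:F i|surface_measure. f x)"
proof -
  define b where "b = i - j"
  have ab: "\<alpha> a \<bullet> b = of_bool (a = i) - of_bool (a = j)" if "a \<in> C" for a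
    using alpha_edge[OF that ij(1,2)] by (simp add: b_def)
  have b1: "\<alpha> j \<bullet> b = -1" "\<alpha> i \<bullet> (- b) = -1" using ab ij by auto
  have cf: "continuous_on UNIV f" using f by (meson has_derivative_continuous continuous_at_imp_continuous_on)
  have [measurable]: "f \<in> borel_measurable borel" using cf by (rule borel_measurable_continuous_onI)
  have [measurable]: "(\<lambda>x. f' x b) \<in> borel_measurable borel" using c by (rule borel_measurable_continuous_onI)
  have [measurable]: "lam a \<in> borel_measurable borel" for a unfolding lam_def[abs_def] by measurable
  have [measurable]: "K \<in> sets borel" using compact_K by (simp add: borel_compact)
  have [measurable]: "F a \<in> sets borel" for a using closed_F by simp
  have contl: "continuous_on UNIV (lam a)" for a unfolding lam_def[abs_def] by (intro continuous_intros)
  have lb: "lam a (y + s *\<^sub>R b) = lam a y + s * (of_bool (a = i) - of_bool (a = j))" if "a \<in> C" for a y s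
    using ab[OF that] by (simp add: lam_add)
  define P where "P y \<longleftrightarrow> (\<forall>a\<in>C - {i,j}. 0 \<le> lam a y) \<and> - lam i y \<le> lam j y" for y
  \<comment> \<open>Along b only the coordinates of i and j change, at rates 1 and -1. The line
    through y therefore enters K through \<open>F i\<close> at time \<open>- lam i y\<close> and
    leaves it through \<open>F j\<close> at time \<open>lam j y\<close>, provided it meets K at all,
    which is what \<open>P\<close> says.\<close>
  have memK: "y + s *\<^sub>R b \<in> K \<longleftrightarrow> P y \<and> - lam i y \<le> s \<and> s \<le> lam j y" for y s
  proof -
    have "y + s *\<^sub>R b \<in> K \<longleftrightarrow> (\<forall>a\<in>C. lam a y + s * (of_bool (a = i) - of_bool (a = j)) \<ge> 0)"
      using lb by (simp add: mem_lam)
    also have "\<dots> \<longleftrightarrow> (\<forall>a\<in>C - {i,j}. 0 \<le> lam a y) \<and> 0 \<le> lam i y + s \<and> 0 \<le> lam j y - s"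
      using ij by auto
    finally show ?thesis by (auto simp: P_def)
  qed
  have hitj: "y + lam j y *\<^sub>R b \<in> F j \<longleftrightarrow> P y" for y
    using memK[of y "lam j y"] lb[OF ij(2), of y "lam j y"] ij by (auto simp: F_def P_def)
  have hiti: "y + lam i y *\<^sub>R (- b) \<in> F i \<longleftrightarrow> P y" for y
    using memK[of y "- lam i y"] lb[OF ij(1), of y "- lam i y"] ij by (auto simp: F_def P_def)
  \<comment> \<open>The half-open intervals match the strict inequalities of
    \<open>FTC_indicator_unit\<close>: an exit counts if \<open>lam j y\<close> is in [0, 1), an
    entry if \<open>- lam i y\<close> is in (0, 1].\<close>
  define Zj where "Zj = {y. lam j y \<in> {0..<0+1} \<and> y + lam j y *\<^sub>R b \<in> F j}"
  define Zi where "Zi = {y. lam i y \<in> {-1..<-1+1} \<and> y + lam i y *\<^sub>R (- b) \<in> F i}"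
  define T1 where "T1 y = indicator K (y + b) * f (y + b)" for y
  define T2 where "T2 y = indicator K y * f y" for y
  define T3 where "T3 y = indicator Zj y * f (y + lam j y *\<^sub>R b)" for y
  define T4 where "T4 y = indicator Zi y * f (y + lam i y *\<^sub>R (- b))" for y
  define g where "g y = indicator K y * f' y b" for y
  have line: "(LINT s|lborel. indicator {0..1} s * g (y + s *\<^sub>R b)) = T1 y - T2 y + T3 y - T4 y" for y
  proof -
    have d: "DERIV (\<lambda>s. f (y + s *\<^sub>R b)) s :> f' (y + s *\<^sub>R b) b" for s
    proof -
      have "((\<lambda>s. f (y + s *\<^sub>R b)) has_derivative (\<lambda>t. f' (y + s *\<^sub>R b) (t *\<^sub>R b))) (at s)"
        by (rule has_derivative_compose[OF _ f]) (auto intro!: derivative_eq_intros)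
      moreover have "f' (y + s *\<^sub>R b) (t *\<^sub>R b) = f' (y + s *\<^sub>R b) b * t" for t
        using linear_cmul[OF has_derivative_linear[OF f], of "y + s *\<^sub>R b" t b] by simp
      ultimately show ?thesis by (simp add: has_field_derivative_def)
    qed
    have cc: "continuous_on UNIV (\<lambda>s. f' (y + s *\<^sub>R b) b)"
      by (rule continuous_on_compose2[OF c]) (auto intro!: continuous_intros)
    have "(LINT s|lborel. indicator {0..1} s * g (y + s *\<^sub>R b))
      = (LINT s|lborel. of_bool (P y) * (indicator {0..1} s * (indicator {- lam i y..lam j y} s * f' (y + s *\<^sub>R b) b)))"
      by (intro Bochner_Integration.integral_cong) (auto simp: g_def indicator_def memK)
    also have "\<dots> = of_bool (P y) * (LINT s|lborel. indicator {0..1} s * (indicator {- lam i y..lam j y} s * f' (y + s *\<^sub>R b) b))"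
      by simp
    also have "\<dots> = T1 y - T2 y + T3 y - T4 y"
    proof (cases "P y")
      case True
      then have "- lam i y \<le> lam j y" by (simp add: P_def)
      then show ?thesis
        unfolding FTC_indicator_unit[OF d cc] T1_def T2_def T3_def T4_def Zi_def Zj_def
        using True memK[of y 1] memK[of y 0] hiti[of y] hitj[of y]
        by (simp add: indicator_def of_bool_def)
    next
      case False
      then show ?thesis
        using memK[of y 1] memK[of y 0] hiti[of y] hitj[of y]
        by (simp add: T1_def T2_def T3_def T4_def Zi_def Zj_def)
    qed
    finally show ?thesis .
  qed
  have bZ: "bounded {y. lam a y \<in> {s..<s+1} \<and> y + lam a y *\<^sub>R v \<in> F a}" for a v s
  proof -
    obtain r where r: "\<And>x. x \<in> F a \<Longrightarrow> norm x \<le> r" using bounded_F[of a] by (auto simp: bounded_iff)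
    show ?thesis
    proof (rule boundedI)
      fix y assume y: "y \<in> {y. lam a y \<in> {s..<s+1} \<and> y + lam a y *\<^sub>R v \<in> F a}"
      have "norm y \<le> norm (y + lam a y *\<^sub>R v) + norm (lam a y *\<^sub>R v)"
        by (metis add_diff_cancel_right' norm_triangle_ineq4)
      also have "\<dots> \<le> r + (\<bar>s\<bar> + 1) * norm v"
        using y r by (intro add_mono) (auto intro!: mult_right_mono)
      finally show "norm y \<le> r + (\<bar>s\<bar> + 1) * norm v" .
    qed
  qed
  obtain r where r: "\<And>x. x \<in> K \<Longrightarrow> norm x \<le> r" using compact_imp_bounded[OF compact_K] unfolding bounded_iff by blast
  have int: "integrable lborel T1" "integrable lborel T2" "integrable lborel T3" "integrable lborel T4"
  proof -
    show "integrable lborel T2" unfolding T2_def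
      using compact_K cf by (intro integrable_continuous_bounded_support) (auto simp: compact_imp_bounded)
    have "T1 = (\<lambda>y. indicator {y. y + b \<in> K} y * f (y + b))" by (rule ext) (simp add: T1_def indicator_def)
    moreover have "bounded {y. y + b \<in> K}"
    proof -
      show ?thesis
      proof (rule boundedI)
        fix y assume "y \<in> {y. y + b \<in> K}"
        then have "norm (y + b) \<le> r" using r by simp
        moreover have "norm y \<le> norm (y + b) + norm b" using norm_triangle_ineq4[of "y + b" b] by simp
        ultimately show "norm y \<le> r + norm b" by linarith
      qed
    qed
    moreover have "{y. y + b \<in> K} \<in> sets borel" by measurable
    moreover have "continuous_on UNIV (\<lambda>y. f (y + b))"
      by (rule continuous_on_compose2[OF cf]) (auto intro!: continuous_intros)
    ultimately show "integrable lborel T1"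
      using integrable_continuous_bounded_support[of "{y. y + b \<in> K}" "\<lambda>y. f (y + b)"] by simp
    have 3: "continuous_on UNIV (\<lambda>y. f (y + lam a y *\<^sub>R v))" for a v
      by (rule continuous_on_compose2[OF cf]) (auto intro!: continuous_intros contl)
    show "integrable lborel T3" unfolding T3_def
      by (rule integrable_continuous_bounded_support[OF _ _ 3])
         (use bZ[of j 0 b] in \<open>auto simp: Zj_def\<close>)
    show "integrable lborel T4" unfolding T4_def
      by (rule integrable_continuous_bounded_support[OF _ _ 3])
         (use bZ[of i "-1" "- b"] in \<open>auto simp: Zi_def\<close>)
  qed
  obtain B where B: "\<And>y. \<bar>g y\<bar> \<le> B" 
  proof -
    have "bounded ((\<lambda>x. f' x b) ` K)"
      using compact_K c by (intro compact_imp_bounded compact_continuous_image) (auto intro: continuous_on_subset)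
    then obtain B where "\<And>x. x \<in> K \<Longrightarrow> \<bar>f' x b\<bar> \<le> B" by (auto simp: bounded_iff)
    then have "\<bar>g y\<bar> \<le> max B 0" for y by (fastforce simp: g_def indicator_def)
    then show ?thesis using that by blast
  qed
  have [measurable]: "g \<in> borel_measurable borel" unfolding g_def by measurable
  have intp: "integrable (lborel \<Otimes>\<^sub>M lborel) (\<lambda>(s, y). indicator {0..1::real} s * g (y + s *\<^sub>R b))"
    unfolding lborel_prod
  proof (rule integrable_bounded_support[of _ "{0..1} \<times> cball 0 (r + norm b)" "B"])
    show "(\<lambda>(s, y). indicator {0..1::real} s * g (y + s *\<^sub>R b)) \<in> borel_measurable borel"
      unfolding borel_prod[symmetric] by measurable
    show "bounded ({0..1::real} \<times> cball (0::real^'d) (r + norm b))" by (intro bounded_Times) auto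
    fix x :: "real \<times> (real^'d)"
    have "\<bar>g (snd x + fst x *\<^sub>R b)\<bar> \<le> B" "0 \<le> B" using B[of "snd x + fst x *\<^sub>R b"] by auto
    then show "\<bar>case x of (s, y) \<Rightarrow> indicator {0..1} s * g (y + s *\<^sub>R b)\<bar> \<le> B"
      by (auto simp: case_prod_beta indicator_def)
    assume x: "x \<notin> {0..1} \<times> cball 0 (r + norm b)"
    have "fst x \<in> {0..1} \<longrightarrow> snd x + fst x *\<^sub>R b \<notin> K"
    proof (intro impI notI)
      assume f: "fst x \<in> {0..1}" and "snd x + fst x *\<^sub>R b \<in> K"
      then have "norm (snd x + fst x *\<^sub>R b) \<le> r" using r by blast
      moreover have "norm (snd x) \<le> norm (snd x + fst x *\<^sub>R b) + norm (fst x *\<^sub>R b)"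
        by (metis add_diff_cancel_right' norm_triangle_ineq4)
      moreover have "norm (fst x *\<^sub>R b) \<le> 1 * norm b" using f unfolding norm_scaleR by (intro mult_right_mono) auto
      ultimately show False using x f by (cases x) auto
    qed
    then show "(case x of (s, y) \<Rightarrow> indicator {0..1} s * g (y + s *\<^sub>R b)) = 0"
      by (auto simp: case_prod_beta indicator_def g_def)
  qed
  \<comment> \<open>The integral is averaged over the translates by s b with s in [0, 1], and Fubini
    reduces it to lines. The terms \<open>T1\<close> and \<open>T2\<close>, where a line is cut off
    at s = 1 or s = 0, have equal integrals.\<close>
  have "(LINT y|lborel. g y) = (LINT s|lborel. indicator {0..1::real} s * (LINT y|lborel. g y))"
    by simp
  also have "\<dots> = (LINT s|lborel. (LINT y|lborel. indicator {0..1::real} s * g (y + s *\<^sub>R b)))"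
    by (simp add: integral_translate)
  also have "\<dots> = (LINT y|lborel. (LINT s|lborel. indicator {0..1::real} s * g (y + s *\<^sub>R b)))"
    by (rule lborel_pair.Fubini_integral[symmetric]) (use intp in simp)
  also have "\<dots> = (LINT y|lborel. T1 y - T2 y + T3 y - T4 y)" by (simp add: line)
  also have "\<dots> = (LINT y|lborel. T1 y) - (LINT y|lborel. T2 y) + (LINT y|lborel. T3 y) - (LINT y|lborel. T4 y)"
    using int by simp
  also have "(LINT y|lborel. T1 y) = (LINT y|lborel. T2 y)"
    unfolding T1_def T2_def by (rule integral_translate) measurable
  also have "(LINT y|lborel. T3 y) = (1 / norm (\<alpha> j)) * (LINT x:F j|surface_measure. f x)"
    using surface_integral_sheared[OF b1(1), of "F j" "\<beta> j" f 0] alpha_nonzero[OF ij(2)]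
    by (simp add: T3_def Zj_def lam_def F_def Collect_conj_eq)
  also have "(LINT y|lborel. T4 y) = (1 / norm (\<alpha> i)) * (LINT x:F i|surface_measure. f x)"
    using surface_integral_sheared[OF b1(2), of "F i" "\<beta> i" f "-1"] alpha_nonzero[OF ij(1)]
    by (simp add: T4_def Zi_def lam_def F_def Collect_conj_eq)
  finally show ?thesis by (simp add: g_def b_def)
qed

text \<open>Any b is the combination of the edge vectors a - j with the weights
  \<open>\<alpha> a \<bullet> b\<close>. These weights sum to 0, so the contributions of the facet
  opposite j, which occur in every edge, cancel except for its own.\<close>

lemma gauss_coords:
  fixes f :: "real^'d \<Rightarrow> real"
  assumes f: "\<And>x. (f has_derivative f' x) (at x)" and c: "\<And>b. continuous_on UNIV (\<lambda>x. f' x b)"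
  shows "(LINT x|lborel. indicator K x * f' x b)
    = (\<Sum>e\<in>facets K. (b \<bullet> outward_normal K e) * (LINT x:e|surface_measure. f x))"
proof -
  obtain j where j: "j \<in> C" using card_C by fastforce
  have K: "K \<in> sets borel" "bounded K" using compact_K by (auto simp: borel_compact compact_imp_bounded)
  let ?I = "\<lambda>a. LINT x:F a|surface_measure. f x"
  have lin: "linear (f' x)" for x using f has_derivative_linear by blast
  have 0: "b = (\<Sum>a\<in>C. (\<alpha> a \<bullet> b) *\<^sub>R (a - j))"
  proof -
    have "(\<Sum>a\<in>C. (\<alpha> a \<bullet> b) *\<^sub>R a) + (\<Sum>a\<in>C. \<beta> a *\<^sub>R a) = b"
      using repr[of b] by (simp only: scaleR_add_left sum.distrib)
    moreover have "(\<Sum>a\<in>C. \<beta> a *\<^sub>R a) = 0" using repr[of 0] by simp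
    ultimately have 1: "(\<Sum>a\<in>C. (\<alpha> a \<bullet> b) *\<^sub>R a) = b" by simp
    have 2: "(\<Sum>a\<in>C. \<alpha> a \<bullet> b) = 0"
      using sum_coords[of b] sum_coords[of 0] by (simp add: sum.distrib)
    have "(\<Sum>a\<in>C. (\<alpha> a \<bullet> b) *\<^sub>R (a - j)) = (\<Sum>a\<in>C. (\<alpha> a \<bullet> b) *\<^sub>R a) - (\<Sum>a\<in>C. \<alpha> a \<bullet> b) *\<^sub>R j"
      by (simp only: scaleR_diff_right sum_subtractf scaleR_sum_left)
    then show ?thesis unfolding 1 2 by simp
  qed
  have edge: "(LINT x|lborel. indicator K x * f' x (a - j)) = ?I j / norm (\<alpha> j) - ?I a / norm (\<alpha> a)" if "a \<in> C" for a
    using gauss_edge[OF f c that j] linear_0[OF lin] by (cases "a = j") auto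
  have "(LINT x|lborel. indicator K x * f' x b) = (LINT x|lborel. (\<Sum>a\<in>C. (\<alpha> a \<bullet> b) * (indicator K x * f' x (a - j))))"
    by (subst 0) (simp add: linear_sum[OF lin] linear_cmul[OF lin] sum_distrib_left mult.left_commute)
  also have "\<dots> = (\<Sum>a\<in>C. (\<alpha> a \<bullet> b) * (LINT x|lborel. indicator K x * f' x (a - j)))"
    by (subst Bochner_Integration.integral_sum) (auto intro!: integrable_continuous_bounded_support K c)
  also have "\<dots> = (\<Sum>a\<in>C. (\<alpha> a \<bullet> b)) * (?I j / norm (\<alpha> j)) - (\<Sum>a\<in>C. (\<alpha> a \<bullet> b) * (?I a / norm (\<alpha> a)))"
    by (simp add: edge right_diff_distrib sum_subtractf sum_distrib_right sum_divide_distrib)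
  also have "(\<Sum>a\<in>C. \<alpha> a \<bullet> b) = 0"
    using sum_coords[of b] sum_coords[of 0] by (simp add: sum.distrib)
  also have "0 * (?I j / norm (\<alpha> j)) - (\<Sum>a\<in>C. (\<alpha> a \<bullet> b) * (?I a / norm (\<alpha> a)))
      = (\<Sum>a\<in>C. (b \<bullet> outward_normal K (F a)) * ?I a)"
    by (simp add: outward_normal_F inner_commute sum_negf[symmetric] cong: sum.cong)
  also have "\<dots> = (\<Sum>e\<in>facets K. (b \<bullet> outward_normal K e) * (LINT x:e|surface_measure. f x))"
    unfolding facets_F by (simp add: sum.reindex[OF inj_F])
  finally show ?thesis .
qed

end

theorem gauss_simplex:
  fixes f :: "real^'d \<Rightarrow> real"
  assumes "int CARD('d) simplex K"
    and f: "\<And>x. (f has_derivative f' x) (at x)" and c: "\<And>b. continuous_on UNIV (\<lambda>x. f' x b)"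
  shows "(LINT x:K|lebesgue. f' x b)
    = (\<Sum>e\<in>facets K. (b \<bullet> outward_normal K e) * (LINT x:e|surface_measure. f x))"
proof -
  obtain C \<alpha> \<beta> where "simplex_coords K C \<alpha> \<beta>" using simplex_coords_exist[OF assms(1)] .
  then interpret simplex_coords K C \<alpha> \<beta> .
  have [measurable]: "K \<in> sets borel" using compact_K by (simp add: borel_compact)
  have [measurable]: "(\<lambda>x. f' x b) \<in> borel_measurable borel" using c by (rule borel_measurable_continuous_onI)
  have "(LINT x:K|lebesgue. f' x b) = (LINT x|lborel. indicator K x * f' x b)"
    unfolding set_lebesgue_integral_def by (subst integral_completion) auto
  then show ?thesis using gauss_coords[OF f c] by simp
qed

subsection \<open>Polynomials\<close>

definition C1 :: "(real^'d \<Rightarrow> real) \<Rightarrow> (real^'d \<Rightarrow> real^'d) \<Rightarrow> bool" where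
  "C1 f g \<longleftrightarrow> (\<forall>x. (f has_derivative (\<lambda>h. g x \<bullet> h)) (at x)) \<and> continuous_on UNIV g"

lemma C1_continuous: "C1 f g \<Longrightarrow> continuous_on UNIV f"
  unfolding C1_def by (meson has_derivative_continuous continuous_at_imp_continuous_on)

lemma C1_mult:
  assumes "C1 f g" "C1 f' g'"
  shows "C1 (\<lambda>x. f x * f' x) (\<lambda>x. f x *\<^sub>R g' x + f' x *\<^sub>R g x)"
proof -
  have "((\<lambda>x. f x * f' x) has_derivative (\<lambda>h. (f x *\<^sub>R g' x + f' x *\<^sub>R g x) \<bullet> h)) (at x)" for x
  proof -
    have "((\<lambda>x. f x * f' x) has_derivative (\<lambda>h. f x * (g' x \<bullet> h) + (g x \<bullet> h) * f' x)) (at x)"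
      using assms by (intro has_derivative_mult) (auto simp: C1_def)
    then show ?thesis by (simp add: inner_add_left mult.commute)
  qed
  then show ?thesis
    using assms C1_continuous[OF assms(1)] C1_continuous[OF assms(2)]
    by (auto simp: C1_def intro!: continuous_intros)
qed

lemma C1_sum:
  assumes "finite I" "\<And>i. i \<in> I \<Longrightarrow> C1 (f i) (g i)"
  shows "C1 (\<lambda>x. \<Sum>i\<in>I. f i x) (\<lambda>x. \<Sum>i\<in>I. g i x)"
proof -
  have "((\<lambda>x. \<Sum>i\<in>I. f i x) has_derivative (\<lambda>h. (\<Sum>i\<in>I. g i x) \<bullet> h)) (at x)" for x
    unfolding inner_sum_left by (intro has_derivative_sum) (use assms in \<open>auto simp: C1_def\<close>)
  moreover have "continuous_on UNIV (\<lambda>x. \<Sum>i\<in>I. g i x)"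
    by (intro continuous_on_sum) (use assms in \<open>auto simp: C1_def\<close>)
  ultimately show ?thesis unfolding C1_def by blast
qed

lemma C1_cmult: "C1 f g \<Longrightarrow> C1 (\<lambda>x. c * f x) (\<lambda>x. c *\<^sub>R g x)"
  unfolding C1_def
  by (auto intro!: continuous_intros derivative_eq_intros)

lemma C1_const: "C1 (\<lambda>x. c) (\<lambda>x. 0)"
  by (simp add: C1_def)

lemma divergence_C1:
  fixes q :: "real^'d \<Rightarrow> real^'d"
  assumes "\<And>i. C1 (\<lambda>x. q x $ i) (gq i)"
  shows "divergence q x = (\<Sum>i\<in>UNIV. gq i x $ i)"
proof -
  have "(q has_derivative (\<lambda>h. \<chi> i. gq i x \<bullet> h)) (at x)"
    unfolding has_derivative_componentwise_within[of q]
    using assms by (auto simp: Basis_vec_def inner_axis C1_def)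
  then have "frechet_derivative q (at x) = (\<lambda>h. \<chi> i. gq i x \<bullet> h)"
    using frechet_derivative_at by metis
  then show ?thesis by (simp add: divergence_def inner_axis)
qed

definition multi_indices :: "nat \<Rightarrow> ('d::finite \<Rightarrow> nat) set" where
  "multi_indices k = {\<alpha>. (\<Sum>i\<in>UNIV. \<alpha> i) \<le> k}"

lemma finite_multi_indices: "finite (multi_indices k :: ('d::finite \<Rightarrow> nat) set)"
proof (rule finite_subset)
  show "finite {f :: 'd \<Rightarrow> nat. \<forall>x. (x \<in> UNIV \<longrightarrow> f x \<in> {..k}) \<and> (x \<notin> UNIV \<longrightarrow> f x = 0)}"
    by (rule finite_set_of_finite_funs) auto
  show "multi_indices k \<subseteq> {f :: 'd \<Rightarrow> nat. \<forall>x. (x \<in> UNIV \<longrightarrow> f x \<in> {..k}) \<and> (x \<notin> UNIV \<longrightarrow> f x = 0)}"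
  proof
    fix a :: "'d \<Rightarrow> nat" assume "a \<in> multi_indices k"
    then have "(\<Sum>i\<in>UNIV. a i) \<le> k" by (simp add: multi_indices_def)
    then have "a i \<le> k" for i using member_le_sum[of i UNIV a] by (meson UNIV_I finite order_trans zero_le)
    then show "a \<in> {f :: 'd \<Rightarrow> nat. \<forall>x. (x \<in> UNIV \<longrightarrow> f x \<in> {..k}) \<and> (x \<notin> UNIV \<longrightarrow> f x = 0)}" by auto
  qed
qed

definition monom_fun :: "('d::finite \<Rightarrow> nat) \<Rightarrow> real^'d \<Rightarrow> real" where
  "monom_fun \<alpha> x = (\<Prod>i\<in>UNIV. (x $ i) ^ \<alpha> i)"

lemma Poly_iff: "p \<in> Poly k \<longleftrightarrow> (\<exists>c. p = (\<lambda>x. \<Sum>\<alpha>\<in>multi_indices k. c \<alpha> * monom_fun \<alpha> x))"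
  by (auto simp: Poly_def multi_indices_def monom_fun_def fun_eq_iff)

lemma Poly_add: "p \<in> Poly k \<Longrightarrow> q \<in> Poly k \<Longrightarrow> (\<lambda>x. p x + q x) \<in> Poly k"
  unfolding Poly_iff
  by (auto simp: fun_eq_iff sum.distrib[symmetric] distrib_right[symmetric])

lemma Poly_cmult: "p \<in> Poly k \<Longrightarrow> (\<lambda>x. c * p x) \<in> Poly k"
  unfolding Poly_iff
  by (auto simp: fun_eq_iff sum_distrib_left mult.assoc[symmetric])

lemma monom_in_Poly: "\<alpha> \<in> multi_indices k \<Longrightarrow> monom_fun \<alpha> \<in> Poly k"
  unfolding Poly_iff
  by (rule exI[of _ "\<lambda>\<beta>. if \<beta> = \<alpha> then 1 else 0"], rule ext)
     (simp add: finite_multi_indices if_distrib[of "\<lambda>c. c * _"] cong: if_cong)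

lemma Poly_0: "(\<lambda>x. 0) \<in> Poly k"
  unfolding Poly_iff by (rule exI[of _ "\<lambda>_. 0"]) simp

lemma Poly_const: "(\<lambda>x. c) \<in> Poly k"
proof -
  have "(\<lambda>x. c * monom_fun (\<lambda>i. 0) x) \<in> Poly k"
    by (intro Poly_cmult monom_in_Poly) (simp add: multi_indices_def)
  then show ?thesis by (simp add: monom_fun_def)
qed

lemma Poly_sum: "finite I \<Longrightarrow> (\<And>i. i \<in> I \<Longrightarrow> p i \<in> Poly k) \<Longrightarrow> (\<lambda>x. \<Sum>i\<in>I. p i x) \<in> Poly k"
  by (induction I rule: finite_induct) (auto simp: Poly_0 Poly_add)

lemma Poly_diff: "p \<in> Poly k \<Longrightarrow> q \<in> Poly k \<Longrightarrow> (\<lambda>x. p x - q x) \<in> Poly k"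
  using Poly_add[of p k "\<lambda>x. (-1) * q x"] Poly_cmult[of q k "-1"] by simp

lemma monom_C1:
  assumes "\<alpha> \<in> multi_indices k"
  shows "\<exists>g \<in> vPoly k. C1 (monom_fun \<alpha>) g"
proof -
  \<comment> \<open>For \<open>\<alpha> i = 0\<close> the truncated difference leaves the exponent
    0, but the factor \<open>real (\<alpha> i)\<close> removes the term. The degree of the gradient
    is bounded by k again, which keeps it in the test space \<open>vPoly k\<close>.\<close>
  define g :: "real^'a \<Rightarrow> real^'a" where "g x = (\<chi> i. real (\<alpha> i) * monom_fun (\<alpha>(i := \<alpha> i - 1)) x)" for x
  have mi: "\<alpha>(i := \<alpha> i - 1) \<in> multi_indices k" for i
  proof -
    have "(\<Sum>j\<in>UNIV. (\<alpha>(i := \<alpha> i - 1)) j) \<le> (\<Sum>j\<in>UNIV. \<alpha> j)" by (rule sum_mono) simp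
    then show ?thesis using assms by (simp add: multi_indices_def)
  qed
  have "g \<in> vPoly k" unfolding vPoly_def g_def using mi by (auto intro!: Poly_cmult monom_in_Poly simp del: One_nat_def)
  moreover have "(monom_fun \<alpha> has_derivative (\<lambda>h. g x \<bullet> h)) (at x)" for x
  proof -
    have "((\<lambda>x. \<Prod>i\<in>UNIV. (x $ i) ^ \<alpha> i) has_derivative
      (\<lambda>h. \<Sum>i\<in>UNIV. (real (\<alpha> i) * h $ i * (x $ i) ^ (\<alpha> i - 1)) * (\<Prod>j\<in>UNIV - {i}. (x $ j) ^ \<alpha> j))) (at x)"
      by (intro has_derivative_prod has_derivative_power bounded_linear.has_derivative[OF bounded_linear_vec_nth] has_derivative_ident)
    moreover have "(x $ i) ^ (\<alpha> i - 1) * (\<Prod>j\<in>UNIV - {i}. (x $ j) ^ \<alpha> j) = monom_fun (\<alpha>(i := \<alpha> i - 1)) x" for i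
    proof -
      have "monom_fun (\<alpha>(i := \<alpha> i - 1)) x = (x $ i) ^ (\<alpha> i - 1) * (\<Prod>j\<in>UNIV - {i}. (x $ j) ^ (\<alpha>(i := \<alpha> i - 1)) j)"
        unfolding monom_fun_def by (subst prod.remove[of _ i]) auto
      also have "(\<Prod>j\<in>UNIV - {i}. (x $ j) ^ (\<alpha>(i := \<alpha> i - 1)) j) = (\<Prod>j\<in>UNIV - {i}. (x $ j) ^ \<alpha> j)"
        by (rule prod.cong) auto
      finally show ?thesis by (rule sym)
    qed
    ultimately show ?thesis
      unfolding monom_fun_def[abs_def, symmetric]
      by (simp add: monom_fun_def[symmetric, abs_def] inner_vec_def g_def mult.assoc mult.left_commute mult.commute)
  qed
  moreover have "continuous_on UNIV g"
    unfolding g_def monom_fun_def by (intro continuous_intros)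
  ultimately show ?thesis by (auto simp: C1_def)
qed

lemma Poly_C1:
  fixes p :: "real^'d \<Rightarrow> real"
  assumes "p \<in> Poly k"
  obtains g where "g \<in> vPoly k" "C1 p g"
proof -
  obtain c where p: "p = (\<lambda>x. \<Sum>\<alpha>\<in>multi_indices k. c \<alpha> * monom_fun \<alpha> x)" using assms Poly_iff by blast
  obtain g :: "('d \<Rightarrow> nat) \<Rightarrow> real^'d \<Rightarrow> real^'d" where g: "\<And>\<alpha>. \<alpha> \<in> multi_indices k \<Longrightarrow> g \<alpha> \<in> vPoly k \<and> C1 (monom_fun \<alpha>) (g \<alpha>)"
  proof -
    have "\<forall>\<alpha> :: 'd \<Rightarrow> nat. \<exists>g. \<alpha> \<in> multi_indices k \<longrightarrow> g \<in> vPoly k \<and> C1 (monom_fun \<alpha>) g"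
      using monom_C1 by blast
    then show ?thesis using that by metis
  qed
  have 1: "C1 p (\<lambda>x. \<Sum>\<alpha>\<in>multi_indices k. c \<alpha> *\<^sub>R g \<alpha> x)"
    unfolding p by (intro C1_sum finite_multi_indices C1_cmult) (use g in auto)
  have 2: "(\<lambda>x. \<Sum>\<alpha>\<in>multi_indices k. c \<alpha> *\<^sub>R g \<alpha> x) \<in> vPoly k"
    unfolding vPoly_def using g
    by (auto simp: vPoly_def sum_component intro!: Poly_sum finite_multi_indices Poly_cmult)
  show ?thesis by (rule that[OF 2 1])
qed

lemma Poly_continuous: "p \<in> Poly k \<Longrightarrow> continuous_on UNIV p"
  using Poly_C1 C1_continuous by metis

lemma vPoly_C1:
  assumes "q \<in> vPoly k"
  obtains gq where "\<And>i. gq i \<in> vPoly k" "\<And>i. C1 (\<lambda>x. q x $ i) (gq i)"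
proof -
  have "\<exists>g. g \<in> vPoly k \<and> C1 (\<lambda>x. q x $ i) g" for i
  proof -
    have "(\<lambda>x. q x $ i) \<in> Poly k" using assms by (simp add: vPoly_def)
    then obtain g where "g \<in> vPoly k" "C1 (\<lambda>x. q x $ i) g" by (rule Poly_C1)
    then show ?thesis by blast
  qed
  then show ?thesis using that by metis
qed

lemma vPoly_const: "(\<lambda>x. c) \<in> vPoly k"
  by (simp add: vPoly_def Poly_const)

lemma vPoly_continuous: "q \<in> vPoly k \<Longrightarrow> continuous_on UNIV q"
proof -
  assume "q \<in> vPoly k"
  then have "continuous_on UNIV (\<lambda>x. \<chi> i. q x $ i)"
    by (intro continuous_on_vec_lambda Poly_continuous[of _ k]) (auto simp: vPoly_def)
  then show ?thesis by simp
qed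

section \<open>Extrapolation along lines and the inverse inequality\<close>

lemma Poly_on_line:
  assumes "p \<in> Poly k"
  obtains P :: "real poly" where "degree P \<le> k" "\<And>t. p (x + t *\<^sub>R w) = poly P t"
proof -
  obtain c where p: "p = (\<lambda>x. \<Sum>\<alpha>\<in>multi_indices k. c \<alpha> * monom_fun \<alpha> x)" using assms Poly_iff by blast
  define Q :: "('a \<Rightarrow> nat) \<Rightarrow> real poly" where "Q \<alpha> = (\<Prod>i\<in>UNIV. [:x $ i, w $ i:] ^ \<alpha> i)" for \<alpha>
  define P where "P = (\<Sum>\<alpha>\<in>multi_indices k. smult (c \<alpha>) (Q \<alpha>))"
  have dQ: "degree (Q \<alpha>) \<le> k" if "\<alpha> \<in> multi_indices k" for \<alpha>
  proof -
    have "degree (Q \<alpha>) \<le> (\<Sum>i\<in>UNIV. degree ([:x $ i, w $ i:] ^ \<alpha> i))"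
      using degree_prod_sum_le[of UNIV "\<lambda>i. [:x $ i, w $ i:] ^ \<alpha> i"] by (simp add: Q_def o_def)
    also have "\<dots> \<le> (\<Sum>i\<in>UNIV. \<alpha> i)"
    proof (rule sum_mono)
      fix i
      have "degree [:x $ i, w $ i:] * \<alpha> i \<le> 1 * \<alpha> i" by (rule mult_right_mono) auto
      then show "degree ([:x $ i, w $ i:] ^ \<alpha> i) \<le> \<alpha> i" using degree_power_le[of "[:x $ i, w $ i:]" "\<alpha> i"] by linarith
    qed
    finally show ?thesis using that by (simp add: multi_indices_def)
  qed
  have "degree P \<le> k"
    unfolding P_def using dQ degree_smult_le order_trans by (intro degree_sum_le finite_multi_indices) blast
  moreover have "p (x + t *\<^sub>R w) = poly P t" for t
    by (simp add: p P_def Q_def poly_sum poly_prod monom_fun_def)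
  ultimately show ?thesis by (rule that)
qed

text \<open>Lagrange extrapolation to the point 0. The induction splits off the last node s by P =
  P(s) + (X - s) R; the quotient R has lower degree and is extrapolated from the remaining
  nodes.\<close>

lemma extrapolation_at_0:
  fixes t :: "nat \<Rightarrow> real"
  assumes "inj_on t {..k}" "\<And>j. j \<le> k \<Longrightarrow> t j \<noteq> 0"
  shows "\<exists>l. \<forall>P :: real poly. degree P \<le> k \<longrightarrow> poly P 0 = (\<Sum>j\<le>k. l j * poly P (t j))"
  using assms
proof (induction k)
  case 0
  have "poly P 0 = poly P (t 0)" if "degree P \<le> 0" for P :: "real poly"
    using that by (metis degree_0_id le_zero_eq poly_pCons mult_zero_right add_0_right degree_eq_zeroE poly_0 mult_zero_left)
  then show ?case by (intro exI[of _ "\<lambda>_. 1"]) auto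
next
  case (Suc k)
  have "inj_on t {..k}" using Suc.prems(1) by (rule inj_on_subset) auto
  then obtain l where l: "\<And>P :: real poly. degree P \<le> k \<Longrightarrow> poly P 0 = (\<Sum>j\<le>k. l j * poly P (t j))"
    using Suc by auto
  define s where "s = t (Suc k)"
  have ne: "t j - s \<noteq> 0" if "j \<le> k" for j
    using inj_onD[OF Suc.prems(1), of j "Suc k"] that by (auto simp: s_def)
  \<comment> \<open>Obtained by inserting R(t j) = (P(t j) - P(s)) / (t j - s) into P(0) = P(s) - s
    R(0) and collecting the values of P.\<close>
  define l' where "l' j = (if j = Suc k then 1 + s * (\<Sum>j\<le>k. l j / (t j - s)) else - s * l j / (t j - s))" for j
  have "poly P 0 = (\<Sum>j\<le>Suc k. l' j * poly P (t j))" if dP: "degree P \<le> Suc k" for P :: "real poly"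
  proof -
    define c where "c = poly P s"
    have "poly (P - [:c:]) s = 0" by (simp add: c_def)
    then have "[:- s, 1:] dvd P - [:c:]" by (simp only: poly_eq_0_iff_dvd)
    then obtain R where R: "P - [:c:] = [:- s, 1:] * R" by (rule dvdE)
    have dR: "degree R \<le> k"
    proof (cases "R = 0")
      case False
      then have "degree ([:- s, 1:] * R) = 1 + degree R" by (subst degree_mult_eq) auto
      moreover have "degree (P - [:c:]) \<le> Suc k" using dP by (intro degree_diff_le) auto
      ultimately show ?thesis using R by simp
    qed simp
    have PR: "poly P x = c + (x - s) * poly R x" for x
      using arg_cong[OF R, of "\<lambda>p. poly p x"] by (simp add: algebra_simps)
    have Rj: "poly R (t j) = (poly P (t j) - c) / (t j - s)" if "j \<le> k" for j
      using PR[of "t j"] ne[OF that] by simp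
    have "poly P 0 = c - s * (\<Sum>j\<le>k. l j * poly R (t j))" using PR[of 0] l[OF dR] by simp
    also have "(\<Sum>j\<le>k. l j * poly R (t j)) = (\<Sum>j\<le>k. l j / (t j - s) * poly P (t j) - c * (l j / (t j - s)))"
      by (intro sum.cong) (auto simp: Rj diff_divide_distrib algebra_simps)
    also have "\<dots> = (\<Sum>j\<le>k. l j / (t j - s) * poly P (t j)) - c * (\<Sum>j\<le>k. l j / (t j - s))"
      by (simp add: sum_subtractf sum_distrib_left)
    finally have "poly P 0 = (1 + s * (\<Sum>j\<le>k. l j / (t j - s))) * c + (\<Sum>j\<le>k. - s * l j / (t j - s) * poly P (t j))"
      by (simp add: algebra_simps sum_distrib_left sum_negf)
    moreover have "(\<Sum>j\<le>k. l' j * poly P (t j)) = (\<Sum>j\<le>k. - s * l j / (t j - s) * poly P (t j))"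
      by (intro sum.cong) (auto simp: l'_def)
    ultimately show ?thesis by (simp add: l'_def c_def s_def)
  qed
  then show ?case by blast
qed

lemma integral_affine:
  fixes f :: "'a::euclidean_space \<Rightarrow> real"
  assumes [measurable]: "f \<in> borel_measurable borel" and t: "t \<noteq> 0"
  shows "(LINT z|lborel. f z) = \<bar>t\<bar> ^ DIM('a) * (LINT y|lborel. f (c + t *\<^sub>R y))"
proof -
  have "(LINT z|lborel. f z) = (LINT z|density (distr lborel borel (\<lambda>x. c + t *\<^sub>R x)) (\<lambda>_. ennreal (\<bar>t\<bar> ^ DIM('a))). f z)"
    using lborel_affine[OF t, of c] by simp
  also have "\<dots> = \<bar>t\<bar> ^ DIM('a) * (LINT y|lborel. f (c + t *\<^sub>R y))"
    by (simp add: integral_density integral_distr)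
  finally show ?thesis .
qed

lemma set_integral_lebesgue_lborel:
  fixes f :: "'a::euclidean_space \<Rightarrow> real"
  assumes "K \<in> sets borel" "f \<in> borel_measurable borel"
  shows "(LINT x:K|lebesgue. f x) = (LINT x|lborel. indicator K x * f x)"
  unfolding set_lebesgue_integral_def using assms by (subst integral_completion) auto

text \<open>
  A polynomial is extrapolated to a point of a convex set along the segments to all other
  points. The nodes stay away from that point, so averaging over the end points of the segments
  costs only a constant.
\<close>

lemma poly_inverse_inequality:
  "\<exists>M\<ge>0. \<forall>K v x. compact K \<longrightarrow> convex K \<longrightarrow> v \<in> Poly k \<longrightarrow> x \<in> K \<longrightarrow>
     measure lebesgue K * (v x)\<^sup>2 \<le> M * (LINT x:(K :: (real^'d) set)|lebesgue. (v x)\<^sup>2)"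
proof -
  \<comment> \<open>Equidistant nodes in (0, 1], none closer to 0 than 1/(k + 1), so that undoing
    the contraction towards x by the factor \<open>t j\<close> costs at most (k + 1)^d in
    volume.\<close>
  define t where "t j = real (Suc j) / real (Suc k)" for j
  have t: "0 < t j" "1 / real (Suc k) \<le> t j" "t j \<noteq> 0" for j
    by (auto simp: t_def field_simps)
  have t1: "t j \<le> 1" if "j \<le> k" for j using that by (simp add: t_def)
  have "inj_on t {..k}" by (auto simp: inj_on_def t_def)
  then obtain l where l: "\<And>P :: real poly. degree P \<le> k \<Longrightarrow> poly P 0 = (\<Sum>j\<le>k. l j * poly P (t j))"
    using extrapolation_at_0[of t k] t(3) by blast
  define L where "L = (\<Sum>j\<le>k. (l j)\<^sup>2)"
  have L0: "0 \<le> L" by (simp add: L_def sum_nonneg)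
  \<comment> \<open>\<open>L\<close> comes from Cauchy-Schwarz for the extrapolation weights, one
    factor k + 1 from the number of nodes and the power from the changes of variables. The shape of
    K does not enter.\<close>
  define M where "M = L * (real (Suc k) * real (Suc k) ^ CARD('d))"
  have "measure lebesgue K * (v x)\<^sup>2 \<le> M * (LINT x:K|lebesgue. (v x)\<^sup>2)"
    if K: "compact K" "convex K" and v: "v \<in> Poly k" and x: "x \<in> K" for K :: "(real^'d) set" and v x
  proof -
    have cv: "continuous_on UNIV v" using v Poly_continuous by blast
    have Kb[measurable]: "K \<in> sets borel" "bounded K" using K by (auto simp: borel_compact compact_imp_bounded)
    have [measurable]: "v \<in> borel_measurable borel" using cv by (rule borel_measurable_continuous_onI)
    define I where "I = (LINT y|lborel. indicator K y * (v y)\<^sup>2)"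
    have I0: "0 \<le> I" unfolding I_def by (rule Bochner_Integration.integral_nonneg) auto
    have int1: "integrable lborel (\<lambda>y. indicator K y * (v (x + t j *\<^sub>R (y - x)))\<^sup>2)" for j
      using Kb by (intro integrable_continuous_bounded_support continuous_intros continuous_on_compose2[OF cv]) auto
    have line: "v x = (\<Sum>j\<le>k. l j * v (x + t j *\<^sub>R (y - x)))" for y
    proof -
      obtain P where "degree P \<le> k" "\<And>s. v (x + s *\<^sub>R (y - x)) = poly P s" using Poly_on_line[OF v] by blast
      then show ?thesis using l[of P] by (metis (no_types, lifting) add.right_neutral scaleR_zero_left sum.cong)
    qed
    have pw: "(v x)\<^sup>2 \<le> L * (\<Sum>j\<le>k. (v (x + t j *\<^sub>R (y - x)))\<^sup>2)" for y
      by (subst line[of y]) (use Cauchy_Schwarz_ineq_sum[of l "\<lambda>j. v (x + t j *\<^sub>R (y - x))" "{..k}"] in \<open>simp add: L_def\<close>)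
    \<comment> \<open>The substitution z = x + t j (y - x) maps K into itself by convexity.\<close>
    have node: "(LINT y|lborel. indicator K y * (v (x + t j *\<^sub>R (y - x)))\<^sup>2) \<le> real (Suc k) ^ CARD('d) * I" if "j \<le> k" for j
    proof -
      let ?c = "x - t j *\<^sub>R x"
      have e: "x + t j *\<^sub>R (y - x) = ?c + t j *\<^sub>R y" for y by (simp add: algebra_simps)
      have int2: "integrable lborel (\<lambda>y. indicator {y. ?c + t j *\<^sub>R y \<in> K} y * (v (?c + t j *\<^sub>R y))\<^sup>2)"
      proof (intro integrable_continuous_bounded_support continuous_intros continuous_on_compose2[OF cv])
        obtain r where r: "\<And>z. z \<in> K \<Longrightarrow> norm z \<le> r" using Kb(2) unfolding bounded_iff by blast
        show "bounded {y. ?c + t j *\<^sub>R y \<in> K}"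
        proof (rule boundedI)
          fix y assume "y \<in> {y. ?c + t j *\<^sub>R y \<in> K}"
          then have "norm (?c + t j *\<^sub>R y) \<le> r" using r by simp
          then have "norm (t j *\<^sub>R y) \<le> r + norm ?c" using norm_triangle_ineq4[of "?c + t j *\<^sub>R y" ?c] by simp
          then show "norm y \<le> (r + norm ?c) / t j" using t(1)[of j] by (simp add: field_simps)
        qed
        show "{y. ?c + t j *\<^sub>R y \<in> K} \<in> sets borel" by measurable
      qed auto
      have "(LINT y|lborel. indicator K y * (v (x + t j *\<^sub>R (y - x)))\<^sup>2)
         \<le> (LINT y|lborel. indicator {y. ?c + t j *\<^sub>R y \<in> K} y * (v (?c + t j *\<^sub>R y))\<^sup>2)"
      proof (rule integral_mono[OF int1 int2])
        fix y
        have "?c + t j *\<^sub>R y \<in> K" if "y \<in> K"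
        proof -
          have "(1 - t j) *\<^sub>R x + t j *\<^sub>R y \<in> K"
            using K(2) x that t(1)[of j] t1[OF \<open>j \<le> k\<close>] by (intro convexD) auto
          then show ?thesis by (simp add: algebra_simps)
        qed
        then show "indicator K y * (v (x + t j *\<^sub>R (y - x)))\<^sup>2 \<le> indicator {y. ?c + t j *\<^sub>R y \<in> K} y * (v (?c + t j *\<^sub>R y))\<^sup>2"
          unfolding e by (auto simp: indicator_def)
      qed
      also have "\<dots> = (LINT y|lborel. (\<lambda>z. indicator K z * (v z)\<^sup>2) (?c + t j *\<^sub>R y))"
        by (intro Bochner_Integration.integral_cong) (auto simp: indicator_def)
      finally have le: "(LINT y|lborel. indicator K y * (v (x + t j *\<^sub>R (y - x)))\<^sup>2) \<le> (LINT y|lborel. (\<lambda>z. indicator K z * (v z)\<^sup>2) (?c + t j *\<^sub>R y))" .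
      have "I = \<bar>t j\<bar> ^ DIM(real^'d) * (LINT y|lborel. (\<lambda>z. indicator K z * (v z)\<^sup>2) (?c + t j *\<^sub>R y))"
        unfolding I_def by (rule integral_affine) (use t in auto)
      then have "(LINT y|lborel. (\<lambda>z. indicator K z * (v z)\<^sup>2) (?c + t j *\<^sub>R y)) = (1 / t j) ^ CARD('d) * I"
        using t(1)[of j] by (simp add: power_divide field_simps)
      also have "\<dots> \<le> real (Suc k) ^ CARD('d) * I"
        using t(1,2)[of j] I0 by (intro mult_right_mono power_mono) (auto simp: field_simps)
      finally show ?thesis using le by linarith
    qed
    have "measure lebesgue K * (v x)\<^sup>2 = (LINT y|lborel. indicator K y * (v x)\<^sup>2)"
      using Kb by (simp add: measure_completion)
    also have "\<dots> \<le> (LINT y|lborel. (\<Sum>j\<le>k. L * (indicator K y * (v (x + t j *\<^sub>R (y - x)))\<^sup>2)))"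
    proof (rule integral_mono)
      show "integrable lborel (\<lambda>y. indicator K y * (v x)\<^sup>2)"
        using Kb by (intro integrable_continuous_bounded_support) auto
      show "integrable lborel (\<lambda>y. \<Sum>j\<le>k. L * (indicator K y * (v (x + t j *\<^sub>R (y - x)))\<^sup>2))"
        using int1 by simp
      fix y show "indicator K y * (v x)\<^sup>2 \<le> (\<Sum>j\<le>k. L * (indicator K y * (v (x + t j *\<^sub>R (y - x)))\<^sup>2))"
        using pw[of y] by (auto simp: indicator_def sum_distrib_left)
    qed
    also have "\<dots> = (\<Sum>j\<le>k. L * (LINT y|lborel. indicator K y * (v (x + t j *\<^sub>R (y - x)))\<^sup>2))"
      using int1 by simp
    also have "\<dots> \<le> (\<Sum>j\<le>k. L * (real (Suc k) ^ CARD('d) * I))"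
      using node L0 by (intro sum_mono mult_left_mono) auto
    also have "\<dots> = M * I" by (simp add: M_def)
    finally show ?thesis by (simp add: I_def set_integral_lebesgue_lborel)
  qed
  moreover have "0 \<le> M" using L0 by (simp add: M_def)
  ultimately show ?thesis by blast
qed

section \<open>Integrals over the facets of a simplex\<close>

lemma facet_props:
  fixes K :: "(real^'d) set"
  assumes "int CARD('d) simplex K" "e \<in> facets K"
  shows "compact e" "e \<subseteq> K" "e \<noteq> {}" "\<exists>n. norm n = 1 \<and> n = outward_normal K e \<and> (\<exists>c. e = K \<inter> {x. n \<bullet> x = c} \<and> K \<subseteq> {x. n \<bullet> x \<le> c})"
    "emeasure surface_measure e \<le> ennreal ((2 * diameter K) ^ (CARD('d) - 1))"
proof -
  obtain C \<alpha> \<beta> where "simplex_coords K C \<alpha> \<beta>" using simplex_coords_exist[OF assms(1)] .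
  then interpret simplex_coords K C \<alpha> \<beta> .
  obtain a where a: "a \<in> C" "e = F a" using assms(2) facets_F by auto
  have sub: "e \<subseteq> K" using a by (auto simp: F_def)
  then show "e \<subseteq> K" .
  show ce: "compact e" using closed_F bounded_F a by (auto simp: compact_eq_bounded_closed)
  have "card C \<noteq> 1" using card_C by simp
  then obtain b where b: "b \<in> C" "b \<noteq> a" using a by (metis is_singletonI' is_singleton_altdef empty_iff)
  then have be: "b \<in> e" using a C_subset by (auto simp: F_def lam_vertex)
  then show "e \<noteq> {}" by auto
  let ?n = "- (1 / norm (\<alpha> a)) *\<^sub>R \<alpha> a"
  have na: "norm (\<alpha> a) > 0" using alpha_nonzero[OF a(1)] by simp
  have 1: "norm ?n = 1" using na by simp
  have 2: "?n = outward_normal K e" using outward_normal_F[OF a(1)] a(2) by simp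
  have 3: "?n \<bullet> x = - lam a x / norm (\<alpha> a) + \<beta> a / norm (\<alpha> a)" for x
    using na by (simp add: lam_def field_simps)
  have "e = K \<inter> {x. ?n \<bullet> x = \<beta> a / norm (\<alpha> a)}"
    unfolding a(2) F_def 3 using na by auto
  moreover have "K \<subseteq> {x. ?n \<bullet> x \<le> \<beta> a / norm (\<alpha> a)}"
  proof
    fix x assume "x \<in> K"
    then have "0 \<le> lam a x" using a mem_lam by blast
    then show "x \<in> {x. ?n \<bullet> x \<le> \<beta> a / norm (\<alpha> a)}" using na unfolding mem_Collect_eq 3 by (simp add: divide_nonneg_pos)
  qed
  ultimately show "\<exists>n. norm n = 1 \<and> n = outward_normal K e \<and> (\<exists>c. e = K \<inter> {x. n \<bullet> x = c} \<and> K \<subseteq> {x. n \<bullet> x \<le> c})"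
    using 1 2 by blast
  have bK: "bounded K" using compact_K compact_imp_bounded by blast
  show "emeasure surface_measure e \<le> ennreal ((2 * diameter K) ^ (CARD('d) - 1))"
  proof (rule emeasure_surface_le)
    show "\<alpha> a \<noteq> 0" using alpha_nonzero a by blast
    show "e \<in> sets borel" using ce by (simp add: borel_compact)
    show "e \<subseteq> {x. \<alpha> a \<bullet> x = - \<beta> a}" "b \<in> {x. \<alpha> a \<bullet> x = - \<beta> a}" using be by (auto simp: a F_def lam_def)
    show "e \<subseteq> cball b (diameter K)"
    proof
      fix x assume "x \<in> e"
      then have "dist b x \<le> diameter K" using be sub by (intro diameter_bounded_bound[OF bK]) auto
      then show "x \<in> cball b (diameter K)" by simp
    qed
    show "0 \<le> diameter K" using bK by (rule diameter_ge_0)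
  qed
qed

lemma finite_face_measure:
  fixes K :: "(real^'d) set"
  assumes "int CARD('d) simplex K" "e \<in> facets K"
  shows "finite_measure (face_measure e)" "measure (face_measure e) UNIV \<le> (2 * diameter K) ^ (CARD('d) - 1)"
    "emeasure (face_measure e) (- e) = 0"
proof -
  have b: "e \<in> sets borel" using facet_props(1)[OF assms] by (simp add: borel_compact)
  have D: "0 \<le> diameter K" using assms(1) by (intro diameter_ge_0 compact_imp_bounded compact_simplex)
  have E: "emeasure (face_measure e) UNIV \<le> ennreal ((2 * diameter K) ^ (CARD('d) - 1))"
    using facet_props(5)[OF assms] b by (simp add: emeasure_face_measure)
  then have "emeasure (face_measure e) UNIV \<noteq> \<infinity>" by (auto simp: top_unique)
  then show "finite_measure (face_measure e)" by (intro finite_measureI) simp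
  show "measure (face_measure e) UNIV \<le> (2 * diameter K) ^ (CARD('d) - 1)"
    using E D unfolding measure_def by (intro enn2real_leI) auto
  show "emeasure (face_measure e) (- e) = 0" using b by (simp add: emeasure_face_measure)
qed

lemma AE_face_measure:
  fixes K :: "(real^'d) set"
  assumes "int CARD('d) simplex K" "e \<in> facets K"
  shows "AE x in face_measure e. x \<in> e"
proof (rule AE_I[of _ _ "- e"])
  show "emeasure (face_measure e) (- e) = 0" by (rule finite_face_measure(3)[OF assms])
  show "- e \<in> sets (face_measure e)" using facet_props(1)[OF assms] by (simp add: borel_open open_Compl compact_imp_closed)
qed auto

lemma integrable_face_measure:
  fixes K :: "(real^'d) set" and f :: "real^'d \<Rightarrow> real"
  assumes K: "int CARD('d) simplex K" "e \<in> facets K" and f: "continuous_on UNIV f"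
  shows "integrable (face_measure e) f"
proof -
  interpret finite_measure "face_measure e" by (rule finite_face_measure(1)[OF K])
  have "bounded (f ` e)" using facet_props(1)[OF K] f
    by (intro compact_imp_bounded compact_continuous_image) (auto intro: continuous_on_subset)
  then obtain B where B: "\<And>x. x \<in> e \<Longrightarrow> \<bar>f x\<bar> \<le> B" by (auto simp: bounded_iff)
  show ?thesis
  proof (rule integrable_const_bound[of _ B])
    show "AE x in face_measure e. norm (f x) \<le> B"
      using AE_face_measure[OF K] by eventually_elim (simp add: B)
    show "f \<in> borel_measurable (face_measure e)"
      using borel_measurable_continuous_onI[OF f] by simp
  qed
qed

text \<open>The members of \<open>F_space\<close> are prescribed on the face only. This replaces
  such a function by a polynomial that agrees with it there and is continuous on the whole
  space.\<close>

lemma surface_integral_face_cong: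
  fixes K :: "(real^'d) set" and f g :: "real^'d \<Rightarrow> real"
  assumes K: "int CARD('d) simplex K" "e \<in> facets K" and f: "continuous_on UNIV f"
    and eq: "\<And>x. x \<in> e \<Longrightarrow> g x = f x"
  shows "(LINT x:e|surface_measure. g x) = (LINT x|face_measure e. f x)"
proof -
  have "(LINT x:e|surface_measure. g x) = (LINT x:e|surface_measure. f x)"
    unfolding set_lebesgue_integral_def
    by (intro Bochner_Integration.integral_cong) (auto simp: indicator_def eq)
  also have "\<dots> = (LINT x|face_measure e. f x)"
    using facet_props(1)[OF K] borel_measurable_continuous_onI[OF f]
    by (intro surface_integral_eq_face_measure) (auto simp: borel_compact)
  finally show ?thesis .
qed

text \<open>Gauss' theorem in direction \<open>axis i 1\<close>, applied to u times the i-th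
  component of q and summed over i.\<close>

theorem gauss_product:
  fixes u :: "real^'d \<Rightarrow> real" and q :: "real^'d \<Rightarrow> real^'d"
  assumes K: "int CARD('d) simplex K" and u: "C1 u gu" and q: "\<And>i. C1 (\<lambda>x. q x $ i) (gq i)"
  shows "(LINT x|lborel. indicator K x * (u x * (\<Sum>i\<in>UNIV. gq i x $ i))) + (LINT x|lborel. indicator K x * (gu x \<bullet> q x))
    = (\<Sum>e\<in>facets K. LINT x|face_measure e. u x * (q x \<bullet> outward_normal K e))"
proof -
  have Kc: "compact K" using K compact_simplex by blast
  have Kb[measurable]: "K \<in> sets borel" "bounded K" using Kc by (auto simp: borel_compact compact_imp_bounded)
  have cu: "continuous_on UNIV u" using u by (rule C1_continuous)
  have cq: "continuous_on UNIV (\<lambda>x. q x $ i)" for i using q by (rule C1_continuous)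
  have "continuous_on UNIV (\<lambda>x. \<chi> i. q x $ i)" by (intro continuous_on_vec_lambda cq)
  then have cqv: "continuous_on UNIV q" by simp
  have cgu: "continuous_on UNIV gu" using u by (simp add: C1_def)
  have cgq: "continuous_on UNIV (gq i)" for i using q by (simp add: C1_def)
  have "(LINT x|lborel. indicator K x * (u x * gq i x $ i + q x $ i * gu x $ i))
      = (\<Sum>e\<in>facets K. outward_normal K e $ i * (LINT x|face_measure e. u x * q x $ i))" for i
  proof -
    let ?g = "\<lambda>x. u x *\<^sub>R gq i x + q x $ i *\<^sub>R gu x"
    have "C1 (\<lambda>x. u x * q x $ i) ?g" by (rule C1_mult[OF u q])
    then have "(LINT x:K|lebesgue. ?g x \<bullet> axis i 1)
       = (\<Sum>e\<in>facets K. (axis i 1 \<bullet> outward_normal K e) * (LINT x:e|surface_measure. u x * q x $ i))"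
      by (intro gauss_simplex[OF K]) (auto simp: C1_def intro!: continuous_intros)
    also have "(LINT x:K|lebesgue. ?g x \<bullet> axis i 1) = (LINT x|lborel. indicator K x * (?g x \<bullet> axis i 1))"
      using cu cq cqv cgu cgq Kb
      by (intro set_integral_lebesgue_lborel borel_measurable_continuous_onI continuous_intros) auto
    finally show ?thesis
      using surface_integral_face_cong[OF K, of _ "\<lambda>x. u x * q x $ i" "\<lambda>x. u x * q x $ i"] cu cq
      by (simp add: inner_axis inner_axis' inner_add_left continuous_on_mult)
  qed
  then have "(\<Sum>i\<in>UNIV. LINT x|lborel. indicator K x * (u x * gq i x $ i + q x $ i * gu x $ i))
      = (\<Sum>e\<in>facets K. \<Sum>i\<in>UNIV. outward_normal K e $ i * (LINT x|face_measure e. u x * q x $ i))"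
    by (simp add: sum.swap[of _ _ UNIV])
  also have "(\<Sum>i\<in>UNIV. LINT x|lborel. indicator K x * (u x * gq i x $ i + q x $ i * gu x $ i))
    = (LINT x|lborel. (\<Sum>i\<in>UNIV. indicator K x * (u x * gq i x $ i + q x $ i * gu x $ i)))"
    using cu cq cqv cgu cgq Kb
    by (subst Bochner_Integration.integral_sum) (auto intro!: integrable_continuous_bounded_support continuous_intros)
  also have "\<dots> = (LINT x|lborel. indicator K x * (u x * (\<Sum>i\<in>UNIV. gq i x $ i)) + indicator K x * (gu x \<bullet> q x))"
    by (intro Bochner_Integration.integral_cong)
       (auto simp: sum_distrib_left inner_vec_def sum.distrib distrib_left mult.commute)
  also have "\<dots> = (LINT x|lborel. indicator K x * (u x * (\<Sum>i\<in>UNIV. gq i x $ i))) + (LINT x|lborel. indicator K x * (gu x \<bullet> q x))"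
    using cu cqv cgu cgq Kb
    by (intro Bochner_Integration.integral_add)
       (auto simp: inner_vec_def intro!: integrable_continuous_bounded_support continuous_intros)
  also have "(\<Sum>e\<in>facets K. \<Sum>i\<in>UNIV. outward_normal K e $ i * (LINT x|face_measure e. u x * q x $ i))
     = (\<Sum>e\<in>facets K. LINT x|face_measure e. u x * (q x \<bullet> outward_normal K e))"
  proof (rule sum.cong[OF refl])
    fix e assume e: "e \<in> facets K"
    have "(LINT x|face_measure e. u x * (q x \<bullet> outward_normal K e))
      = (LINT x|face_measure e. (\<Sum>i\<in>UNIV. outward_normal K e $ i * (u x * q x $ i)))"
      by (intro Bochner_Integration.integral_cong) (auto simp: inner_vec_def sum_distrib_left mult_ac)
    also have "\<dots> = (\<Sum>i\<in>UNIV. outward_normal K e $ i * (LINT x|face_measure e. u x * q x $ i))"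
      using cu cq cqv by (subst Bochner_Integration.integral_sum) (auto intro!: integrable_mult_right integrable_face_measure[OF K e] continuous_intros)
    finally show "(\<Sum>i\<in>UNIV. outward_normal K e $ i * (LINT x|face_measure e. u x * q x $ i))
      = (LINT x|face_measure e. u x * (q x \<bullet> outward_normal K e))" by simp
  qed
  finally show ?thesis .
qed

subsection \<open>Simplicial meshes\<close>

context simplex_coords
begin

lemma pos_lam_interior: "(\<And>b. b \<in> C \<Longrightarrow> lam b x > 0) \<Longrightarrow> x \<in> interior K"
proof -
  assume x: "\<And>b. b \<in> C \<Longrightarrow> lam b x > 0"
  have "open (\<Inter>b\<in>C. {y. 0 < lam b y})"
    unfolding lam_def using finite_C by (intro open_INT ballI open_Collect_less continuous_intros) auto
  moreover have "(\<Inter>b\<in>C. {y. 0 < lam b y}) \<subseteq> K" using mem_lam by (auto intro: less_imp_le)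
  ultimately show ?thesis using x by (auto simp: interior_def)
qed

lemma frontier_subset: "K - interior K \<subseteq> (\<Union>b\<in>C. F b)"
proof
  fix x assume x: "x \<in> K - interior K"
  then obtain b where "b \<in> C" "\<not> 0 < lam b x" using pos_lam_interior by blast
  moreover have "0 \<le> lam b x" using x \<open>b \<in> C\<close> mem_lam by auto
  ultimately show "x \<in> (\<Union>b\<in>C. F b)" using x by (auto simp: F_def)
qed

text \<open>At a relative interior point of a facet all other barycentric coordinates are positive,
  and a step against the outward normal makes the remaining one positive too. This tells on which
  side of a facet an element lies.\<close>

lemma inner_half:
  assumes a: "a \<in> C" and x: "x \<in> rel_interior (F a)"
  obtains \<delta> where "\<delta> > 0" "\<And>s. 0 < s \<Longrightarrow> s < \<delta> \<Longrightarrow> x - s *\<^sub>R outward_normal K (F a) \<in> interior K"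
proof -
  have xF: "x \<in> F a" using x rel_interior_subset by blast
  have cF: "convex (F a)"
  proof -
    have "F a = K \<inter> {x. \<alpha> a \<bullet> x = - \<beta> a}" by (auto simp: F_def lam_def)
    then show ?thesis by (simp add: convex_Int convex_K convex_hyperplane)
  qed
  have pos: "lam b x > 0" if b: "b \<in> C" "b \<noteq> a" for b
  proof -
    \<comment> \<open>The segment from the vertex b to x can be prolonged beyond x within the facet.
      The coordinate of b is 1 at b and nonnegative at the new end, hence positive in
      between.\<close>
    have "b \<in> F a" using b a C_subset by (auto simp: F_def lam_vertex)
    then obtain r where r: "r > 1" "(1 - r) *\<^sub>R b + r *\<^sub>R x \<in> F a"
      using convex_rel_interior_iff[OF cF, of x] x xF by blast
    have "0 \<le> lam b ((1 - r) *\<^sub>R b + r *\<^sub>R x)" using r(2) b mem_lam by (auto simp: F_def)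
    also have "lam b ((1 - r) *\<^sub>R b + r *\<^sub>R x) = (1 - r) * lam b b + r * lam b x"
      by (simp add: lam_def inner_add_right algebra_simps)
    finally have "r - 1 \<le> r * lam b x" using lam_vertex[OF b(1) b(1)] by simp
    then have "0 < r * lam b x" using r by linarith
    then show ?thesis using r by (simp add: zero_less_mult_iff)
  qed
  define n where "n = outward_normal K (F a)"
  have na: "norm (\<alpha> a) > 0" using alpha_nonzero[OF a] by simp
  have n: "n = - (1 / norm (\<alpha> a)) *\<^sub>R \<alpha> a" unfolding n_def by (rule outward_normal_F[OF a])
  have "norm n = 1" using na unfolding n by simp
  have "open (\<Inter>b\<in>C - {a}. {y. 0 < lam b y})"
    unfolding lam_def using finite_C by (intro open_INT ballI open_Collect_less continuous_intros) auto
  moreover have "x \<in> (\<Inter>b\<in>C - {a}. {y. 0 < lam b y})" using pos by auto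
  ultimately obtain \<delta> where \<delta>: "\<delta> > 0" "ball x \<delta> \<subseteq> (\<Inter>b\<in>C - {a}. {y. 0 < lam b y})"
    using open_contains_ball by blast
  show ?thesis
  proof (rule that[OF \<delta>(1)])
    fix s assume s: "0 < s" "s < \<delta>"
    have "x - s *\<^sub>R n \<in> ball x \<delta>" using s \<open>norm n = 1\<close> by (simp add: dist_norm)
    then have 1: "0 < lam b (x - s *\<^sub>R n)" if "b \<in> C" "b \<noteq> a" for b using \<delta>(2) that by blast
    have "lam a (x - s *\<^sub>R n) = s * norm (\<alpha> a)"
      using xF na unfolding n by (simp add: lam_def F_def inner_diff_right dot_square_norm power2_eq_square algebra_simps)
    then have 2: "0 < lam a (x - s *\<^sub>R n)" using s na by simp
    show "x - s *\<^sub>R outward_normal K (F a) \<in> interior K"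
      unfolding n_def[symmetric] by (rule pos_lam_interior) (use 1 2 in blast)
  qed
qed

lemma unit_const_on_facet:
  assumes a: "a \<in> C" and n: "norm n = 1" "\<And>x. x \<in> F a \<Longrightarrow> n \<bullet> x = k"
  shows "n = outward_normal K (F a) \<or> n = - outward_normal K (F a)"
proof -
  have na: "norm (\<alpha> a) > 0" using alpha_nonzero[OF a] by simp
  define t where "t = n \<bullet> a - k"
  have "n = (n \<bullet> a - k) *\<^sub>R \<alpha> a"
  proof (rule const_on_facet[OF a])
    fix b assume "b \<in> C" "b \<noteq> a"
    then have "b \<in> F a" using a C_subset by (auto simp: F_def lam_vertex)
    then show "n \<bullet> b = k" by (rule n(2))
  qed
  then have t: "n = t *\<^sub>R \<alpha> a" unfolding t_def .
  have "\<bar>t\<bar> * norm (\<alpha> a) = 1" using n(1) arg_cong[OF t, of norm] by simp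
  then have "t = 1 / norm (\<alpha> a) \<or> t = - (1 / norm (\<alpha> a))" using na by (auto simp: field_simps abs_if split: if_splits)
  then show ?thesis unfolding outward_normal_F[OF a] using t by auto
qed

end

locale simplicial_mesh =
  fixes \<Omega> :: "(real^'d) set" and \<T> :: "(real^'d) set set"
  assumes domain: "polyhedral_domain \<Omega>" and mesh: "mesh \<Omega> \<T>"
begin

lemma simplex_T: "K \<in> \<T> \<Longrightarrow> int CARD('d) simplex K"
proof -
  assume "K \<in> \<T>"
  then have "int DIM(real^'d) simplex K" using mesh unfolding mesh_def by blast
  then show ?thesis by simp
qed

lemma finite_T: "finite \<T>"
  and Union_T: "\<Union>\<T> = closure \<Omega>"
  and face_T: "K \<in> \<T> \<Longrightarrow> K' \<in> \<T> \<Longrightarrow> (K \<inter> K') face_of K"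
  using mesh unfolding mesh_def triangulation_def by blast+

lemma open_Omega: "open \<Omega>" and bounded_Omega: "bounded \<Omega>" and regular_Omega: "\<Omega> = interior (closure \<Omega>)"
  and nonempty_Omega: "\<Omega> \<noteq> {}" and connected_Omega: "connected \<Omega>"
  using domain unfolding polyhedral_domain_def by blast+

lemma compact_T: "K \<in> \<T> \<Longrightarrow> compact K" and convex_T: "K \<in> \<T> \<Longrightarrow> convex K"
  using simplex_T compact_simplex convex_simplex by blast+

lemma bounded_T: "K \<in> \<T> \<Longrightarrow> bounded K" and closed_T: "K \<in> \<T> \<Longrightarrow> closed K"
  and borel_T: "K \<in> \<T> \<Longrightarrow> K \<in> sets borel"
  using compact_T by (auto simp: compact_imp_bounded compact_imp_closed borel_compact)

lemma aff_dim_T: "K \<in> \<T> \<Longrightarrow> aff_dim K = int CARD('d)"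
  using simplex_T aff_dim_simplex by blast

lemma subset_T: "K \<in> \<T> \<Longrightarrow> K \<subseteq> closure \<Omega>"
  using Union_T by blast

lemma interior_subset_T: "K \<in> \<T> \<Longrightarrow> interior K \<subseteq> \<Omega>"
  using interior_mono[OF subset_T] regular_Omega by simp

lemma nonempty_T: "\<T> \<noteq> {}"
  by (metis Union_T Union_empty closure_eq_empty nonempty_Omega)

lemma interior_T_nonempty: "K \<in> \<T> \<Longrightarrow> interior K \<noteq> {}"
proof -
  assume K: "K \<in> \<T>"
  have "affine hull K = UNIV" using aff_dim_T[OF K] aff_dim_eq_full[of K] by simp
  moreover have "K \<noteq> {}" using aff_dim_T[OF K] by auto
  ultimately show ?thesis
    using rel_interior_interior[of K] rel_interior_eq_empty[OF convex_T[OF K]] by simp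
qed

lemma subset_eq_T: "K \<in> \<T> \<Longrightarrow> K' \<in> \<T> \<Longrightarrow> K \<subseteq> K' \<Longrightarrow> K = K'"
proof (rule ccontr)
  assume K: "K \<in> \<T>" "K' \<in> \<T>" "K \<subseteq> K'" "K \<noteq> K'"
  have "K face_of K'" using face_T[OF K(2,1)] K(3) by (simp add: Int_absorb1)
  then have "aff_dim K < aff_dim K'" using face_of_aff_dim_lt[of K' K] K convex_T by blast
  then show False using aff_dim_T K by simp
qed

lemma Int_aff_dim: "K \<in> \<T> \<Longrightarrow> K' \<in> \<T> \<Longrightarrow> K \<noteq> K' \<Longrightarrow> aff_dim (K \<inter> K') < int CARD('d)"
  using face_of_aff_dim_lt[OF convex_T face_T, of K K'] subset_eq_T[of K K'] aff_dim_T by force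

lemma negligible_Int: "K \<in> \<T> \<Longrightarrow> K' \<in> \<T> \<Longrightarrow> K \<noteq> K' \<Longrightarrow> negligible (K \<inter> K')"
proof -
  assume "K \<in> \<T>" "K' \<in> \<T>" "K \<noteq> K'"
  then have "aff_dim (K \<inter> K') < DIM(real^'d)" using Int_aff_dim by simp
  then obtain a b where "a \<noteq> 0" "K \<inter> K' \<subseteq> {x. a \<bullet> x = b}"
    using aff_lowdim_subset_hyperplane by blast
  then show ?thesis using negligible_hyperplane negligible_subset by blast
qed

lemma interior_disjoint: "K \<in> \<T> \<Longrightarrow> K' \<in> \<T> \<Longrightarrow> x \<in> interior K \<Longrightarrow> x \<in> interior K' \<Longrightarrow> K = K'"
proof (rule ccontr)
  assume K: "K \<in> \<T>" "K' \<in> \<T>" "x \<in> interior K" "x \<in> interior K'" "K \<noteq> K'"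
  have "open (interior K \<inter> interior K')" "interior K \<inter> interior K' \<noteq> {}" using K by auto
  then have "\<not> negligible (interior K \<inter> interior K')" using open_not_negligible by blast
  moreover have "interior K \<inter> interior K' \<subseteq> K \<inter> K'" using interior_subset by auto
  ultimately show False using negligible_Int[OF K(1,2,5)] negligible_subset by blast
qed

text \<open>Points just beyond the facet, near a relative interior point in \<Omega>, belong to
  \<Omega> and hence to some further element, and conformity makes the facet its intersection with
  K. There are no third elements: only two unit normals are possible, and two elements on the same
  side would have interiors that meet.\<close>

lemma facets_shared:
  assumes K: "K \<in> \<T>" and e: "e \<in> facets K" and meets: "e \<inter> \<Omega> \<noteq> {}"
  obtains K' where "K' \<noteq> K" "{L \<in> \<T>. e \<in> facets L} = {K, K'}" "outward_normal K' e = - outward_normal K e"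
proof -
  define n where "n = outward_normal K e"
  have ce: "compact e" "e \<noteq> {}" "e \<subseteq> K" using facet_props[OF simplex_T[OF K] e] by auto
  have fe: "e face_of K" using e by (simp add: facets_def facet_of_def)
  have conve: "convex e" using fe face_of_imp_convex by blast
  have ade: "aff_dim e = int CARD('d) - 1" using e aff_dim_T[OF K] by (simp add: facets_def facet_of_def)
  have "closure (rel_interior e) = e"
    using convex_closure_rel_interior[OF conve] ce(1) by (simp add: compact_imp_closed)
  then have "\<Omega> \<inter> rel_interior e \<noteq> {}"
    using open_Int_closure_eq_empty[OF open_Omega, of "rel_interior e"] meets by auto
  then obtain x where x: "x \<in> \<Omega>" "x \<in> rel_interior e" by blast
  have xe: "x \<in> e" using x(2) rel_interior_subset by blast
  have half: "\<exists>\<delta>>0. \<forall>s. 0 < s \<longrightarrow> s < \<delta> \<longrightarrow> x - s *\<^sub>R outward_normal L e \<in> interior L" if L: "L \<in> \<T>" "e \<in> facets L" for L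
  proof -
    obtain C \<alpha> \<beta> where "simplex_coords L C \<alpha> \<beta>" using simplex_coords_exist[OF simplex_T[OF L(1)]] .
    then interpret simplex_coords L C \<alpha> \<beta> .
    obtain a where a: "a \<in> C" "e = F a" using L(2) facets_F by auto
    show ?thesis using inner_half[OF a(1), of x] x(2) a(2) by blast
  qed
  have eq_if_normal: "L = L'" if L: "L \<in> \<T>" "e \<in> facets L" "L' \<in> \<T>" "e \<in> facets L'"
    "outward_normal L e = outward_normal L' e" for L L'
  proof -
    obtain \<delta> where \<delta>: "\<delta> > 0" "\<And>s. 0 < s \<Longrightarrow> s < \<delta> \<Longrightarrow> x - s *\<^sub>R outward_normal L e \<in> interior L" using half[OF L(1,2)] by blast
    obtain \<delta>' where \<delta>': "\<delta>' > 0" "\<And>s. 0 < s \<Longrightarrow> s < \<delta>' \<Longrightarrow> x - s *\<^sub>R outward_normal L' e \<in> interior L'" using half[OF L(3,4)] by blast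
    define s where "s = min \<delta> \<delta>' / 2"
    have "0 < s" "s < \<delta>" "s < \<delta>'" using \<delta>(1) \<delta>'(1) by (auto simp: s_def)
    then show ?thesis using \<delta>(2)[of s] \<delta>'(2)[of s] L(5) interior_disjoint[OF L(1,3)] by simp
  qed
  have normals: "outward_normal L e = n \<or> outward_normal L e = - n" if L: "L \<in> \<T>" "e \<in> facets L" for L
  proof -
    obtain C \<alpha> \<beta> where "simplex_coords K C \<alpha> \<beta>" using simplex_coords_exist[OF simplex_T[OF K]] .
    then interpret simplex_coords K C \<alpha> \<beta> .
    obtain a where a: "a \<in> C" "e = F a" using e facets_F by auto
    obtain c where "norm (outward_normal L e) = 1" "e \<subseteq> {x. outward_normal L e \<bullet> x = c}"
      using facet_props(4)[OF simplex_T[OF L(1)] L(2)] by auto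
    then show ?thesis using unit_const_on_facet[OF a(1), of "outward_normal L e" c] a(2) by (auto simp: n_def)
  qed
  obtain c where nc: "norm n = 1" "e = K \<inter> {x. n \<bullet> x = c}" "K \<subseteq> {x. n \<bullet> x \<le> c}"
    using facet_props(4)[OF simplex_T[OF K] e] unfolding n_def by blast
  \<comment> \<open>The elements that miss x keep a positive distance from it. Any element found
    near x, beyond the facet, therefore contains x itself.\<close>
  have "closed (\<Union>{L \<in> \<T>. x \<notin> L})" using finite_T closed_T by (intro closed_Union) auto
  then have "open (\<Omega> - \<Union>{L \<in> \<T>. x \<notin> L})" using open_Omega by (rule open_Diff[rotated])
  then obtain \<delta> where \<delta>: "\<delta> > 0" "ball x \<delta> \<subseteq> \<Omega> - \<Union>{L \<in> \<T>. x \<notin> L}"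
    using x(1) open_contains_ball[of "\<Omega> - \<Union>{L \<in> \<T>. x \<notin> L}"] by blast
  define y where "y = x + (\<delta> / 2) *\<^sub>R n"
  have yb: "y \<in> ball x \<delta>" using \<delta>(1) nc(1) by (simp add: y_def dist_norm)
  have ny: "n \<bullet> y > c"
    using xe nc \<delta>(1) by (simp add: y_def inner_add_right norm_eq_1[symmetric] dot_square_norm)
  have "y \<in> closure \<Omega>" using yb \<delta>(2) closure_subset by blast
  then obtain K' where K': "K' \<in> \<T>" "y \<in> K'" using Union_T by blast
  then have xK': "x \<in> K'" using yb \<delta>(2) by blast
  have neq: "K' \<noteq> K" using K'(2) ny nc(3) by auto
  have fI: "(K \<inter> K') face_of K" "(K \<inter> K') face_of K'" using face_T[OF K K'(1)] face_T[OF K'(1) K] by (simp_all only: Int_commute)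
  \<comment> \<open>The common face contains a relative interior point of e, hence all of e. Being
    of dimension less than d, it cannot be larger than e.\<close>
  have "e \<subseteq> K \<inter> K'" using subset_of_face_of[OF fI(1) ce(3)] x(2) xe xK' ce(3) by blast
  then have "e face_of (K \<inter> K')" using face_of_subset[OF fe] by blast
  then have eI: "e = K \<inter> K'"
    using face_of_aff_dim_lt[of "K \<inter> K'" e] Int_aff_dim[OF K K'(1)] neq ade convex_T[OF K] convex_T[OF K'(1)] convex_Int
    by force
  have eK': "e \<in> facets K'"
    using fI(2) eI ce(2) ade aff_dim_T[OF K'(1)] by (simp add: facets_def facet_of_def)
  have on: "outward_normal K' e = - n"
    using normals[OF K'(1) eK'] eq_if_normal[OF K e K'(1) eK'] neq by (auto simp: n_def)
  have "{L \<in> \<T>. e \<in> facets L} = {K, K'}"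
  proof
    show "{L \<in> \<T>. e \<in> facets L} \<subseteq> {K, K'}"
    proof
      fix L assume L: "L \<in> {L \<in> \<T>. e \<in> facets L}"
      then consider "outward_normal L e = n" | "outward_normal L e = - n" using normals by blast
      then show "L \<in> {K, K'}"
      proof cases
        case 1 then show ?thesis using eq_if_normal[OF K e, of L] L by (simp add: n_def)
      next
        case 2 then show ?thesis using eq_if_normal[OF K'(1) eK', of L] L on by simp
      qed
    qed
  qed (use K e K' eK' in auto)
  then show ?thesis using that neq on by (simp add: n_def)
qed

lemma finite_facets: "K \<in> \<T> \<Longrightarrow> finite (facets K)" and card_facets: "K \<in> \<T> \<Longrightarrow> card (facets K) \<le> CARD('d) + 1"
proof -
  assume K: "K \<in> \<T>"
  obtain C \<alpha> \<beta> where "simplex_coords K C \<alpha> \<beta>" using simplex_coords_exist[OF simplex_T[OF K]] .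
  then interpret simplex_coords K C \<alpha> \<beta> .
  show "finite (facets K)" using facets_F finite_C by simp
  show "card (facets K) \<le> CARD('d) + 1" using facets_F card_image_le[OF finite_C, of F] card_C by simp
qed

lemma finite_skeleton: "finite (skeleton \<T>)"
  unfolding skeleton_def using finite_T finite_facets by auto

lemma frontier_T_negligible: "K \<in> \<T> \<Longrightarrow> negligible (K - interior K)"
proof -
  assume K: "K \<in> \<T>"
  obtain C \<alpha> \<beta> where "simplex_coords K C \<alpha> \<beta>" using simplex_coords_exist[OF simplex_T[OF K]] .
  then interpret simplex_coords K C \<alpha> \<beta> .
  have "negligible (F a)" if "a \<in> C" for a
  proof (rule negligible_subset)
    show "negligible {x. \<alpha> a \<bullet> x = - \<beta> a}" using alpha_nonzero[OF that] by (intro negligible_hyperplane) auto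
    show "F a \<subseteq> {x. \<alpha> a \<bullet> x = - \<beta> a}" by (auto simp: F_def lam_def)
  qed
  then have "negligible (\<Union>b\<in>C. F b)" using finite_C by (intro negligible_Union) auto
  then show ?thesis using frontier_subset negligible_subset by blast
qed

text \<open>Summation by faces: a face that meets \<Omega> is visited from two sides with opposite
  normals and the same w and q, and on all other faces q vanishes.\<close>

lemma single_valued_flux:
  fixes q :: "real^'d \<Rightarrow> real^'d" and w :: "(real^'d) set \<Rightarrow> real^'d \<Rightarrow> real"
  assumes q: "continuous_on UNIV q" "\<And>x. x \<notin> \<Omega> \<Longrightarrow> q x = 0"
  shows "(\<Sum>K\<in>\<T>. \<Sum>e\<in>facets K. LINT x|face_measure e. w e x * (q x \<bullet> outward_normal K e)) = 0"
proof -
  let ?I = "\<lambda>K e. LINT x|face_measure e. w e x * (q x \<bullet> outward_normal K e)"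
  have "(\<Sum>K\<in>\<T>. \<Sum>e\<in>facets K. ?I K e) = (\<Sum>K\<in>\<T>. \<Sum>e\<in>{e\<in>skeleton \<T>. e \<in> facets K}. ?I K e)"
    by (intro sum.cong) (auto simp: skeleton_def)
  also have "\<dots> = (\<Sum>e\<in>skeleton \<T>. \<Sum>K\<in>{K\<in>\<T>. e \<in> facets K}. ?I K e)"
    by (rule sum.swap_restrict) (use finite_T finite_skeleton in auto)
  also have "\<dots> = 0"
  proof (rule sum.neutral, rule ballI)
    fix e assume "e \<in> skeleton \<T>"
    then obtain K where K: "K \<in> \<T>" "e \<in> facets K" by (auto simp: skeleton_def)
    show "(\<Sum>K\<in>{K\<in>\<T>. e \<in> facets K}. ?I K e) = 0"
    proof (cases "e \<inter> \<Omega> = {}")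
      case True
      have "?I L e = 0" for L
      proof -
        have "AE x in face_measure e. w e x * (q x \<bullet> outward_normal L e) = 0"
          using AE_face_measure[OF simplex_T[OF K(1)] K(2)] 
        proof eventually_elim
          case (elim x)
          then have "x \<notin> \<Omega>" using True by blast
          then show ?case by (simp add: q(2))
        qed
        then show ?thesis by (rule integral_eq_zero_AE)
      qed
      then show ?thesis by simp
    next
      case False
      then obtain K' where K': "K' \<noteq> K" "{L \<in> \<T>. e \<in> facets L} = {K, K'}" "outward_normal K' e = - outward_normal K e"
        using facets_shared[OF K] by blast
      show ?thesis unfolding K'(2) using K'(1,3) by simp
    qed
  qed
  finally show ?thesis .
qed

definition h :: real where "h = Max (diameter ` \<T>)"

lemma diameter_le_h: "K \<in> \<T> \<Longrightarrow> diameter K \<le> h"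
  unfolding h_def using finite_T by simp

lemma diameter_pos: "K \<in> \<T> \<Longrightarrow> 0 < diameter K"
proof -
  assume K: "K \<in> \<T>"
  obtain x r where "r > 0" "ball x r \<subseteq> K"
    using interior_T_nonempty[OF K] by (metis all_not_in_conv mem_interior)
  then have "diameter (ball x r) \<le> diameter K" using bounded_T[OF K] by (intro diameter_subset)
  then show ?thesis using \<open>r > 0\<close> by simp
qed

lemma h_pos: "0 < h"
proof -
  obtain K where "K \<in> \<T>" using nonempty_T by blast
  then show ?thesis using diameter_pos[of K] diameter_le_h[of K] by linarith
qed

lemma h_le: "h \<le> diameter (closure \<Omega>)"
  unfolding h_def using finite_T nonempty_T subset_T bounded_Omega
  by (auto intro!: diameter_subset bounded_closure)

lemma dist_le_h: "K \<in> \<T> \<Longrightarrow> x \<in> K \<Longrightarrow> y \<in> K \<Longrightarrow> dist x y \<le> h"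
  using diameter_bounded_bound[OF bounded_T, of K x y] diameter_le_h[of K] by linarith

end

section \<open>Volumes and counting in shape-regular, quasi-uniform meshes\<close>

lemma measure_cball_le: "measure lebesgue (cball (z :: real^'d) r) \<le> (2 * r) ^ CARD('d)" if "r \<ge> 0"
proof -
  have "measure lebesgue (cball z r) \<le> measure lebesgue (cbox (z - (\<chi> i. r)) (z + (\<chi> i. r)))"
  proof (rule measure_mono_fmeasurable)
    show "cball z r \<subseteq> cbox (z - (\<chi> i. r)) (z + (\<chi> i. r))"
    proof
      fix x assume "x \<in> cball z r"
      then have "\<bar>(x - z) $ i\<bar> \<le> r" for i
        using component_le_norm_cart[of "x - z" i] by (simp add: dist_norm norm_minus_commute)
      then show "x \<in> cbox (z - (\<chi> i. r)) (z + (\<chi> i. r))" by (auto simp: mem_box_cart abs_le_iff algebra_simps)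
    qed
  qed (auto simp: fmeasurable_compact)
  also have "\<dots> = (2 * r) ^ CARD('d)"
  proof -
    have "measure lborel (cbox (z - (\<chi> i. r)) (z + (\<chi> i. r))) = (\<Prod>i\<in>(UNIV :: 'd set). 2 * r)"
      using that by (subst content_cbox_cart) (auto simp: interval_ne_empty_cart)
    then show ?thesis by simp
  qed
  finally show ?thesis .
qed

locale regular_mesh = simplicial_mesh \<Omega> \<T> for \<Omega> :: "(real^'d) set" and \<T> +
  fixes \<kappa> A :: real
  assumes kappa: "\<kappa> > 0" and shape: "shape_regular \<kappa> \<T>" and quasi: "quasi_uniform A \<T>"
begin

lemma A_ge_1: "1 \<le> A"
proof -
  obtain K where "K \<in> \<T>" using nonempty_T by blast
  then show ?thesis using quasi diameter_pos[of K] by (auto simp: quasi_uniform_def dest!: bspec[of _ _ K])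
qed

lemma h_le_diameter: "K \<in> \<T> \<Longrightarrow> h \<le> A * diameter K"
proof -
  assume K: "K \<in> \<T>"
  have "h \<in> diameter ` \<T>" unfolding h_def using finite_T nonempty_T by (intro Max_in) auto
  then obtain L where L: "L \<in> \<T>" "h = diameter L" by blast
  then have "h / diameter K \<le> A" using quasi K by (auto simp: quasi_uniform_def)
  then show ?thesis using diameter_pos[OF K] by (simp add: field_simps)
qed

text \<open>Shape regularity bounds the volume of K below by \<kappa> times the d-th power of its
  own diameter; replacing that diameter by the mesh size costs \<open>A\<close> to the power
  d.\<close>

definition cvol :: real where "cvol = \<kappa> / A ^ CARD('d)"

lemma cvol_pos: "0 < cvol"
  using kappa A_ge_1 by (simp add: cvol_def)

lemma measure_T_ge: "K \<in> \<T> \<Longrightarrow> cvol * h ^ CARD('d) \<le> measure lebesgue K"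
proof -
  assume K: "K \<in> \<T>"
  have "cvol * h ^ CARD('d) \<le> cvol * (A * diameter K) ^ CARD('d)"
    using h_le_diameter[OF K] h_pos cvol_pos by (intro mult_left_mono power_mono) auto
  also have "\<dots> = \<kappa> * diameter K ^ CARD('d)" using A_ge_1 by (simp add: cvol_def power_mult_distrib)
  also have "\<dots> \<le> measure lebesgue K"
    using shape K diameter_pos[OF K] by (auto simp: shape_regular_def field_simps dest!: bspec[of _ _ K])
  finally show ?thesis .
qed

text \<open>A packing argument: the elements overlap in null sets only, and each has volume at least
  \<open>cvol\<close> times h^d.\<close>

lemma card_le:
  assumes "\<K> \<subseteq> \<T>" "\<And>K. K \<in> \<K> \<Longrightarrow> K \<subseteq> cball z R" "0 \<le> R"
  shows "real (card \<K>) \<le> (2 * R) ^ CARD('d) / (cvol * h ^ CARD('d))"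
proof -
  have fin: "finite \<K>" using assms(1) finite_T finite_subset by blast
  have "real (card \<K>) * (cvol * h ^ CARD('d)) = (\<Sum>K\<in>\<K>. cvol * h ^ CARD('d))" by simp
  also have "\<dots> \<le> (\<Sum>K\<in>\<K>. measure lebesgue K)"
    using assms(1) measure_T_ge by (intro sum_mono) auto
  also have "\<dots> = measure lebesgue (\<Union>\<K>)"
  proof (rule measure_negligible_finite_Union[symmetric, OF fin])
    show "S \<in> lmeasurable" if "S \<in> \<K>" for S using that assms(1) compact_T by (auto intro: fmeasurable_compact lmeasurable_compact)
    show "pairwise (\<lambda>S T. negligible (S \<inter> T)) \<K>" using assms(1) negligible_Int by (auto simp: pairwise_def)
  qed
  also have "\<dots> \<le> measure lebesgue (cball z R)"
    using assms(2) fin assms(1) borel_T by (intro measure_mono_fmeasurable) (auto intro!: sets.finite_Union)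
  also have "\<dots> \<le> (2 * R) ^ CARD('d)" by (rule measure_cball_le[OF assms(3)])
  finally show ?thesis using cvol_pos h_pos by (simp add: field_simps)
qed

lemma measure_T_le: "K \<in> \<T> \<Longrightarrow> measure lebesgue K \<le> (2 * h) ^ CARD('d)"
proof -
  assume K: "K \<in> \<T>"
  then obtain x where "x \<in> K" using interior_T_nonempty interior_subset by blast
  then have "K \<subseteq> cball x h" using dist_le_h[OF K] by auto
  then have "measure lebesgue K \<le> measure lebesgue (cball x h)"
    using borel_T[OF K] by (intro measure_mono_fmeasurable) auto
  also have "\<dots> \<le> (2 * h) ^ CARD('d)" using h_pos by (intro measure_cball_le) simp
  finally show ?thesis .
qed

lemma measure_facets_le:
  "K \<in> \<T> \<Longrightarrow> (\<Sum>e\<in>facets K. measure (face_measure e) UNIV) \<le> (real CARD('d) + 1) * (2 * h) ^ (CARD('d) - 1)"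
proof -
  assume K: "K \<in> \<T>"
  have "(\<Sum>e\<in>facets K. measure (face_measure e) UNIV) \<le> (\<Sum>e\<in>facets K. (2 * h) ^ (CARD('d) - 1))"
  proof (rule sum_mono)
    fix e assume e: "e \<in> facets K"
    have "measure (face_measure e) UNIV \<le> (2 * diameter K) ^ (CARD('d) - 1)"
      by (rule finite_face_measure(2)[OF simplex_T[OF K] e])
    also have "\<dots> \<le> (2 * h) ^ (CARD('d) - 1)"
      using diameter_le_h[OF K] diameter_pos[OF K] by (intro power_mono) auto
    finally show "measure (face_measure e) UNIV \<le> (2 * h) ^ (CARD('d) - 1)" .
  qed
  also have "\<dots> \<le> (real CARD('d) + 1) * (2 * h) ^ (CARD('d) - 1)"
    using card_facets[OF K] h_pos by (simp add: mult_right_mono del: of_nat_add)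
  finally show ?thesis .
qed

end

subsection \<open>Energy on single elements\<close>

lemma Cauchy_Schwarz_integral:
  fixes f g :: "'a \<Rightarrow> real"
  assumes f: "integrable N (\<lambda>x. (f x)\<^sup>2)" and g: "integrable N (\<lambda>x. (g x)\<^sup>2)" and fg: "integrable N (\<lambda>x. f x * g x)"
  shows "(LINT x|N. f x * g x)\<^sup>2 \<le> (LINT x|N. (f x)\<^sup>2) * (LINT x|N. (g x)\<^sup>2)"
proof -
  let ?F = "LINT x|N. (f x)\<^sup>2" and ?G = "LINT x|N. (g x)\<^sup>2" and ?X = "LINT x|N. f x * g x"
  have avg: "0 \<le> ?F - 2 * t * ?X + t\<^sup>2 * ?G" for t
  proof -
    have "0 \<le> (LINT x|N. (f x - t * g x)\<^sup>2)" by (rule Bochner_Integration.integral_nonneg) simp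
    also have "\<dots> = (LINT x|N. (f x)\<^sup>2 - 2 * t * (f x * g x) + t\<^sup>2 * (g x)\<^sup>2)"
      by (intro Bochner_Integration.integral_cong) (auto simp: power2_eq_square algebra_simps)
    also have "\<dots> = ?F - 2 * t * ?X + t\<^sup>2 * ?G" using f g fg by simp
    finally show ?thesis .
  qed
  have G0: "0 \<le> ?G" by (rule Bochner_Integration.integral_nonneg) simp
  show ?thesis
  proof (cases "?G = 0")
    case True
    have "?X = 0"
    proof (rule ccontr)
      assume "?X \<noteq> 0"
      then have "2 * ((?F + 1) / (2 * ?X)) * ?X = ?F + 1" by simp
      then show False using avg[of "(?F + 1) / (2 * ?X)"] True by simp
    qed
    then show ?thesis using True by simp
  next
    case False
    then have "0 < ?G" using le_neq_trans[OF G0] by metis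
    then show ?thesis using avg[of "?X / ?G"] by (simp add: field_simps power2_eq_square)
  qed
qed

lemma Cauchy_Schwarz_integral_abs:
  fixes f g :: "'a \<Rightarrow> real"
  assumes "integrable N (\<lambda>x. (f x)\<^sup>2)" "integrable N (\<lambda>x. (g x)\<^sup>2)" "integrable N (\<lambda>x. f x * g x)"
  shows "\<bar>LINT x|N. f x * g x\<bar> \<le> sqrt (LINT x|N. (f x)\<^sup>2) * sqrt (LINT x|N. (g x)\<^sup>2)"
  using real_sqrt_le_mono[OF Cauchy_Schwarz_integral[OF assms]] by (simp add: real_sqrt_mult)

lemma sum_sqrt_mult_le:
  fixes a b :: "'a \<Rightarrow> real"
  assumes "\<And>i. i \<in> I \<Longrightarrow> 0 \<le> a i" "\<And>i. i \<in> I \<Longrightarrow> 0 \<le> b i"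
  shows "(\<Sum>i\<in>I. sqrt (a i) * sqrt (b i)) \<le> sqrt (\<Sum>i\<in>I. a i) * sqrt (\<Sum>i\<in>I. b i)"
proof -
  have "(\<Sum>i\<in>I. sqrt (a i) * sqrt (b i))\<^sup>2 \<le> (\<Sum>i\<in>I. (sqrt (a i))\<^sup>2) * (\<Sum>i\<in>I. (sqrt (b i))\<^sup>2)"
    by (rule Cauchy_Schwarz_ineq_sum)
  also have "\<dots> = (\<Sum>i\<in>I. a i) * (\<Sum>i\<in>I. b i)" using assms by simp
  finally show ?thesis by (metis real_le_rsqrt real_sqrt_mult)
qed

text \<open>The mean value theorem bounds the difference quotients by B, and dominated convergence
  does the rest. Differentiability and bounds are required on a set X of full measure, because
  kernels are bounded only for points of an element.\<close>

lemma DERIV_integral: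
  fixes f f' :: "real \<Rightarrow> 'b \<Rightarrow> real"
  assumes N: "finite_measure N" and r: "r > 0"
    and int: "\<And>t. \<bar>t - t0\<bar> < r \<Longrightarrow> integrable N (f t)"
    and X: "AE x in N. x \<in> X"
    and D: "\<And>t x. \<bar>t - t0\<bar> < r \<Longrightarrow> x \<in> X \<Longrightarrow> DERIV (\<lambda>t. f t x) t :> f' t x"
    and B: "\<And>t x. \<bar>t - t0\<bar> < r \<Longrightarrow> x \<in> X \<Longrightarrow> \<bar>f' t x\<bar> \<le> B"
    and m: "f' t0 \<in> borel_measurable N"
  shows "DERIV (\<lambda>t. LINT x|N. f t x) t0 :> (LINT x|N. f' t0 x)"
  unfolding DERIV_def tendsto_at_iff_sequentially
proof (intro allI impI)
  fix Y :: "nat \<Rightarrow> real" assume Y: "\<forall>i. Y i \<in> UNIV - {0}" "Y \<longlonglongrightarrow> 0"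
  obtain n0 where n0: "\<And>n. n \<ge> n0 \<Longrightarrow> \<bar>Y n\<bar> < r"
    using Y(2) r unfolding LIMSEQ_def by (force simp: dist_norm)
  let ?Q = "\<lambda>n x. (f (t0 + Y (n + n0)) x - f t0 x) / Y (n + n0)"
  have Yn: "Y n \<noteq> 0" for n using Y(1) by auto
  have "(\<lambda>n. LINT x|N. ?Q n x) \<longlonglongrightarrow> (LINT x|N. f' t0 x)"
  proof (rule integral_dominated_convergence[where w = "\<lambda>_. B"])
    show "f' t0 \<in> borel_measurable N" by fact
    show "integrable N (\<lambda>_. B)" using N by (simp add: finite_measure.integrable_const)
    fix n
    have 1: "\<bar>t0 + Y (n + n0) - t0\<bar> < r" using n0[of "n + n0"] by simp
    show "?Q n \<in> borel_measurable N" using int[OF 1] int[of t0] r by auto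
    show "AE x in N. norm (?Q n x) \<le> B"
      using X
    proof eventually_elim
      case x: (elim x)
      have "norm (f (t0 + Y (n + n0)) x - f t0 x) \<le> B * norm (t0 + Y (n + n0) - t0)"
      proof (rule field_differentiable_bound[of "ball t0 r" "\<lambda>t. f t x" "\<lambda>t. f' t x"])
        fix t assume "t \<in> ball t0 r"
        then have "\<bar>t - t0\<bar> < r" by (simp add: dist_norm)
        then show "((\<lambda>t. f t x) has_field_derivative f' t x) (at t within ball t0 r)" "norm (f' t x) \<le> B"
          using D x B by (auto intro: has_field_derivative_at_within)
      qed (use 1 r in \<open>auto simp: dist_norm\<close>)
      then show ?case using Yn[of "n + n0"] by (simp add: divide_le_eq)
    qed
  next
    show "AE x in N. (\<lambda>n. ?Q n x) \<longlonglongrightarrow> f' t0 x"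
      using X
    proof eventually_elim
      case x: (elim x)
      have "(\<lambda>n. (f (t0 + Y n) x - f t0 x) / Y n) \<longlonglongrightarrow> f' t0 x"
        using D[of t0 x] x r Y unfolding DERIV_def tendsto_at_iff_sequentially o_def by simp
      then show ?case by (rule LIMSEQ_ignore_initial_segment)
    qed
  qed
  moreover have "(LINT x|N. ?Q n x) = ((LINT x|N. f (t0 + Y (n + n0)) x) - (LINT x|N. f t0 x)) / Y (n + n0)" for n
    using int[of "t0 + Y (n + n0)"] int[of t0] n0[of "n + n0"] r by simp
  ultimately have "(\<lambda>n. ((LINT x|N. f (t0 + Y (n + n0)) x) - (LINT x|N. f t0 x)) / Y (n + n0)) \<longlonglongrightarrow> (LINT x|N. f' t0 x)"
    by (simp only:)
  then show "((\<lambda>h. ((LINT x|N. f (t0 + h) x) - (LINT x|N. f t0 x)) / h) \<circ> Y) \<longlonglongrightarrow> (LINT x|N. f' t0 x)"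
    unfolding o_def by (rule LIMSEQ_offset)
qed

text \<open>Lebesgue measure on K in the same form as \<open>face_measure\<close>, so that an
  estimate for a general finite Borel measure covers elements and faces at once.\<close>

definition vol_measure :: "'a::euclidean_space set \<Rightarrow> 'a measure" where
  "vol_measure K = density lborel (indicator K)"

lemma sets_vol_measure[simp, measurable_cong]: "sets (vol_measure K) = sets borel"
  by (simp add: vol_measure_def)

lemma space_vol_measure[simp]: "space (vol_measure K) = UNIV"
  by (simp add: vol_measure_def)

lemma integral_vol_measure:
  fixes f :: "'a::euclidean_space \<Rightarrow> real"
  assumes [measurable]: "K \<in> sets borel" "f \<in> borel_measurable borel"
  shows "(LINT x|vol_measure K. f x) = (LINT x|lborel. indicator K x * f x)"
  unfolding vol_measure_def
  by (subst integral_density[where g = "indicator K", simplified ennreal_indicator]) auto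

lemma emeasure_vol_measure:
  "K \<in> sets borel \<Longrightarrow> X \<in> sets borel \<Longrightarrow> emeasure (vol_measure K) X = emeasure lborel (K \<inter> X)"
  by (simp add: vol_measure_def emeasure_density nn_integral_indicator flip: indicator_inter_arith)

lemma AE_vol_measure: "K \<in> sets borel \<Longrightarrow> AE x in vol_measure K. x \<in> K"
  by (rule AE_I[of _ _ "- K"]) (auto simp: emeasure_vol_measure)

lemma vol_measure_compact:
  assumes "compact K"
  shows "finite_measure (vol_measure K)" "measure (vol_measure K) UNIV = measure lebesgue K"
  using assms emeasure_bounded_finite[OF compact_imp_bounded[OF assms]]
  by (auto simp: borel_compact emeasure_vol_measure measure_def intro!: finite_measureI)

lemma integrable_vol_measure:
  fixes f :: "'a::euclidean_space \<Rightarrow> real"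
  assumes K: "compact K" and f: "continuous_on UNIV f"
  shows "integrable (vol_measure K) f"
proof -
  interpret finite_measure "vol_measure K" by (rule vol_measure_compact(1)[OF K])
  have "bounded (f ` K)" using K f
    by (intro compact_imp_bounded compact_continuous_image) (auto intro: continuous_on_subset)
  then obtain B where B: "\<And>x. x \<in> K \<Longrightarrow> \<bar>f x\<bar> \<le> B" by (auto simp: bounded_iff)
  show ?thesis
  proof (rule integrable_const_bound[of _ B])
    show "AE x in vol_measure K. norm (f x) \<le> B"
      using AE_vol_measure[of K] K by (auto simp: borel_compact elim!: eventually_mono intro: B)
    show "f \<in> borel_measurable (vol_measure K)" using borel_measurable_continuous_onI[OF f] by simp
  qed
qed

lemma Poly_sq_le_integral_vPoly:
  assumes inv: "\<And>v. v \<in> Poly k \<Longrightarrow> V * (v x)\<^sup>2 \<le> M * (LINT x|vol_measure K. (v x)\<^sup>2)"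
    and K: "compact K" and q: "(q :: real^'d \<Rightarrow> real^'d) \<in> vPoly k"
  shows "V * (norm (q x))\<^sup>2 \<le> M * (LINT x|vol_measure K. (norm (q x))\<^sup>2)"
proof -
  have n: "(norm (q x))\<^sup>2 = (\<Sum>i\<in>UNIV. (q x $ i)\<^sup>2)" for x
    by (simp add: norm_vec_def L2_set_def sum_nonneg)
  have P: "(\<lambda>x. q x $ i) \<in> Poly k" for i using q by (simp add: vPoly_def)
  have "V * (norm (q x))\<^sup>2 = (\<Sum>i\<in>UNIV. V * (q x $ i)\<^sup>2)" by (simp add: n sum_distrib_left)
  also have "\<dots> \<le> (\<Sum>i\<in>UNIV. M * (LINT x|vol_measure K. (q x $ i)\<^sup>2))"
    by (intro sum_mono inv[OF P])
  also have "\<dots> = M * (\<Sum>i\<in>UNIV. (LINT x|vol_measure K. (q x $ i)\<^sup>2))" by (simp add: sum_distrib_left)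
  also have "(\<Sum>i\<in>UNIV. (LINT x|vol_measure K. (q x $ i)\<^sup>2)) = (LINT x|vol_measure K. (norm (q x))\<^sup>2)"
    unfolding n
    by (intro Bochner_Integration.integral_sum[symmetric] integrable_vol_measure[OF K] continuous_intros vPoly_continuous[OF q])
  finally show ?thesis .
qed

text \<open>
  Only the first equation of the scheme enters here, integrated by parts on each element. The
  trace \<open>w\<close> is represented by polynomials on the whole space.
\<close>

locale hdg_discrete = regular_mesh \<Omega> \<T> \<kappa> A for \<Omega> :: "(real^'d) set" and \<T> \<kappa> A +
  fixes k :: nat and M :: real
    and p gu :: "(real^'d) set \<Rightarrow> real^'d \<Rightarrow> real^'d" and u w :: "(real^'d) set \<Rightarrow> real^'d \<Rightarrow> real"
  assumes M0: "0 \<le> M"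
    and inverse: "\<And>K v x. compact K \<Longrightarrow> convex K \<Longrightarrow> v \<in> Poly k \<Longrightarrow> x \<in> K \<Longrightarrow>
      measure lebesgue K * (v x)\<^sup>2 \<le> M * (LINT x:(K :: (real^'d) set)|lebesgue. (v x)\<^sup>2)"
    and p: "\<And>K. K \<in> \<T> \<Longrightarrow> p K \<in> vPoly k" and u: "\<And>K. K \<in> \<T> \<Longrightarrow> u K \<in> Poly k"
    and gu: "\<And>K. K \<in> \<T> \<Longrightarrow> gu K \<in> vPoly k" "\<And>K. K \<in> \<T> \<Longrightarrow> C1 (u K) (gu K)"
    and w: "\<And>e. e \<in> skeleton \<T> \<Longrightarrow> w e \<in> Poly k"
    and flux: "\<And>K q. K \<in> \<T> \<Longrightarrow> q \<in> vPoly k \<Longrightarrow>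
      (LINT x|vol_measure K. gu K x \<bullet> q x) + (LINT x|vol_measure K. p K x \<bullet> q x)
        = (\<Sum>e\<in>facets K. LINT x|face_measure e. (u K x - w e x) * (q x \<bullet> outward_normal K e))"
begin

lemma inverse_T:
  assumes "K \<in> \<T>" "v \<in> Poly k" "x \<in> K"
  shows "measure lebesgue K * (v x)\<^sup>2 \<le> M * (LINT x|vol_measure K. (v x)\<^sup>2)"
proof -
  have "(LINT x:K|lebesgue. (v x)\<^sup>2) = (LINT x|vol_measure K. (v x)\<^sup>2)"
    using borel_T[OF assms(1)] borel_measurable_continuous_onI[OF Poly_continuous[OF assms(2)]]
    by (subst set_integral_lebesgue_lborel) (auto simp: integral_vol_measure)
  then show ?thesis using inverse[OF compact_T convex_T assms(2,3)] assms(1) by simp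
qed

lemmas cont_p = vPoly_continuous[OF p] and cont_u = Poly_continuous[OF u]
  and cont_gu = vPoly_continuous[OF gu(1)]

lemma cont_w: "K \<in> \<T> \<Longrightarrow> e \<in> facets K \<Longrightarrow> continuous_on UNIV (w e)"
  using w Poly_continuous by (auto simp: skeleton_def)

lemmas face_int = integrable_face_measure[OF simplex_T]
lemmas vol_int = integrable_vol_measure[OF compact_T]

definition jump2 where "jump2 K = (\<Sum>e\<in>facets K. LINT x|face_measure e. (u K x - w e x)\<^sup>2)"
definition flux2 where "flux2 K = (LINT x|vol_measure K. (norm (p K x))\<^sup>2)"
definition en where "en K = flux2 K + jump2 K"
definition E where "E = sqrt (\<Sum>K\<in>\<T>. en K)"
text \<open>When a test field on K is split into a constant and a remainder, \<open>aK\<close>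
  multiplies the size of the remainder and \<open>bK\<close> that of the constant.\<close>

definition aK where "aK K = (LINT x|vol_measure K. norm (gu K x)) + (\<Sum>e\<in>facets K. LINT x|face_measure e. \<bar>u K x - w e x\<bar>)"
definition bK where "bK K = (LINT x|vol_measure K. norm (p K x))"

lemma jump2_nonneg: "0 \<le> jump2 K"
  unfolding jump2_def by (intro sum_nonneg Bochner_Integration.integral_nonneg) auto

lemma flux2_nonneg: "0 \<le> flux2 K"
  unfolding flux2_def by (intro Bochner_Integration.integral_nonneg) auto

lemma en_nonneg: "0 \<le> en K"
  using jump2_nonneg flux2_nonneg by (simp add: en_def)

lemma aK_nonneg: "0 \<le> aK K"
  unfolding aK_def by (intro add_nonneg_nonneg sum_nonneg Bochner_Integration.integral_nonneg) auto

lemma bK_nonneg: "0 \<le> bK K"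
  unfolding bK_def by (intro Bochner_Integration.integral_nonneg) auto

lemma bK_sq_le: 
  assumes K: "K \<in> \<T>"
  shows "(bK K)\<^sup>2 \<le> measure lebesgue K * flux2 K"
proof -
  have "(LINT x|vol_measure K. 1 * norm (p K x))\<^sup>2 \<le> (LINT x|vol_measure K. 1\<^sup>2) * (LINT x|vol_measure K. (norm (p K x))\<^sup>2)"
    by (intro Cauchy_Schwarz_integral vol_int[OF K] continuous_intros cont_p[OF K])
  then show ?thesis using vol_measure_compact[OF compact_T[OF K]] by (simp add: bK_def flux2_def)
qed

lemma bdry_L1_sq_le:
  assumes K: "K \<in> \<T>"
  shows "(\<Sum>e\<in>facets K. LINT x|face_measure e. \<bar>u K x - w e x\<bar>)\<^sup>2 \<le> (\<Sum>e\<in>facets K. measure (face_measure e) UNIV) * jump2 K"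
proof -
  let ?m = "\<lambda>e. measure (face_measure e) UNIV" and ?J = "\<lambda>e. LINT x|face_measure e. (u K x - w e x)\<^sup>2"
  have "(LINT x|face_measure e. \<bar>u K x - w e x\<bar>) \<le> sqrt (?m e) * sqrt (?J e)" if e: "e \<in> facets K" for e
  proof -
    have "\<bar>LINT x|face_measure e. 1 * \<bar>u K x - w e x\<bar>\<bar> \<le> sqrt (LINT x|face_measure e. 1\<^sup>2) * sqrt (LINT x|face_measure e. (\<bar>u K x - w e x\<bar>)\<^sup>2)"
      by (intro Cauchy_Schwarz_integral_abs face_int[OF K e] continuous_intros cont_u[OF K] cont_w[OF K e])
    then show ?thesis by simp
  qed
  then have "(\<Sum>e\<in>facets K. LINT x|face_measure e. \<bar>u K x - w e x\<bar>) \<le> (\<Sum>e\<in>facets K. sqrt (?m e) * sqrt (?J e))"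
    by (rule sum_mono)
  also have "\<dots> \<le> sqrt (\<Sum>e\<in>facets K. ?m e) * sqrt (\<Sum>e\<in>facets K. ?J e)"
    by (rule sum_sqrt_mult_le) (auto intro: Bochner_Integration.integral_nonneg)
  finally have le: "(\<Sum>e\<in>facets K. LINT x|face_measure e. \<bar>u K x - w e x\<bar>) \<le> sqrt (\<Sum>e\<in>facets K. ?m e) * sqrt (jump2 K)"
    by (simp add: jump2_def)
  have "(\<Sum>e\<in>facets K. LINT x|face_measure e. \<bar>u K x - w e x\<bar>)\<^sup>2 \<le> (sqrt (\<Sum>e\<in>facets K. ?m e) * sqrt (jump2 K))\<^sup>2"
    by (rule power_mono[OF le]) (auto intro!: sum_nonneg Bochner_Integration.integral_nonneg)
  then show ?thesis by (simp add: power_mult_distrib sum_nonneg jump2_nonneg)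
qed

text \<open>The flux identity is tested with the gradient of u itself. The facet terms are bounded
  by the inverse inequality, and this brings in the ratio of surface to volume, of order 1/h, in
  front of the jumps: the loss caused by the unweighted stabilization.\<close>

lemma grad_sq_le:
  assumes K: "K \<in> \<T>"
  defines "V \<equiv> measure lebesgue K" and "S \<equiv> (\<Sum>e\<in>facets K. measure (face_measure e) UNIV)"
  shows "V * (LINT x|vol_measure K. (norm (gu K x))\<^sup>2) \<le> 2 * V * flux2 K + 2 * S * M * jump2 K"
proof -
  define g2 where "g2 = (LINT x|vol_measure K. (norm (gu K x))\<^sup>2)"
  have V: "0 < V" using measure_T_ge[OF K] cvol_pos h_pos unfolding V_def
    by (smt (verit) mult_pos_pos zero_less_power)
  have S0: "0 \<le> S" unfolding S_def by (intro sum_nonneg) simp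
  have g0: "0 \<le> g2" unfolding g2_def by (rule Bochner_Integration.integral_nonneg) simp
  \<comment> \<open>The inverse inequality holds pointwise up to the boundary of K, so it bounds the
    normal trace of the gradient on the facets.\<close>
  have pt: "(norm (gu K x))\<^sup>2 \<le> M * g2 / V" if x: "x \<in> K" for x
    using Poly_sq_le_integral_vPoly[of k V x M K "gu K"] inverse_T[OF K _ x] compact_T[OF K] gu(1)[OF K] V
    by (simp add: V_def g2_def field_simps)
  have 1: "\<bar>LINT x|vol_measure K. p K x \<bullet> gu K x\<bar> \<le> sqrt (flux2 K) * sqrt g2"
  proof -
    have "\<bar>LINT x|vol_measure K. p K x \<bullet> gu K x\<bar> \<le> (LINT x|vol_measure K. norm (p K x) * norm (gu K x))"
      by (rule order_trans[OF integral_abs_bound])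
         (intro integral_mono vol_int[OF K] continuous_intros cont_p[OF K] cont_gu[OF K], rule Cauchy_Schwarz_ineq2)
    also have "\<dots> \<le> \<bar>LINT x|vol_measure K. norm (p K x) * norm (gu K x)\<bar>" by simp
    also have "\<dots> \<le> sqrt (flux2 K) * sqrt g2"
      unfolding flux2_def g2_def
      by (intro Cauchy_Schwarz_integral_abs vol_int[OF K] continuous_intros cont_p[OF K] cont_gu[OF K])
    finally show ?thesis .
  qed
  let ?n = "outward_normal K"
  let ?J = "\<lambda>e. LINT x|face_measure e. (u K x - w e x)\<^sup>2" and ?N = "\<lambda>e. LINT x|face_measure e. (gu K x \<bullet> ?n e)\<^sup>2"
  have 2: "\<bar>\<Sum>e\<in>facets K. LINT x|face_measure e. (u K x - w e x) * (gu K x \<bullet> ?n e)\<bar> \<le> sqrt (jump2 K) * sqrt (S * (M * g2 / V))"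
  proof -
    have "\<bar>\<Sum>e\<in>facets K. LINT x|face_measure e. (u K x - w e x) * (gu K x \<bullet> ?n e)\<bar>
      \<le> (\<Sum>e\<in>facets K. \<bar>LINT x|face_measure e. (u K x - w e x) * (gu K x \<bullet> ?n e)\<bar>)" by (rule sum_abs)
    also have "\<dots> \<le> (\<Sum>e\<in>facets K. sqrt (?J e) * sqrt (?N e))"
      by (intro sum_mono Cauchy_Schwarz_integral_abs)
         (auto intro!: face_int[OF K] continuous_intros cont_u[OF K] cont_w[OF K] cont_gu[OF K])
    also have "\<dots> \<le> sqrt (\<Sum>e\<in>facets K. ?J e) * sqrt (\<Sum>e\<in>facets K. ?N e)"
      by (rule sum_sqrt_mult_le) (auto intro: Bochner_Integration.integral_nonneg)
    also have "\<dots> \<le> sqrt (jump2 K) * sqrt (S * (M * g2 / V))"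
    proof (intro mult_mono real_sqrt_le_mono)
      show "(\<Sum>e\<in>facets K. ?N e) \<le> S * (M * g2 / V)"
        unfolding S_def sum_distrib_right
      proof (rule sum_mono)
        fix e assume e: "e \<in> facets K"
        have n1: "norm (?n e) = 1" using facet_props(4)[OF simplex_T[OF K] e] by auto
        interpret finite_measure "face_measure e" by (rule finite_face_measure(1)[OF simplex_T[OF K] e])
        have "?N e \<le> (LINT x|face_measure e. M * g2 / V)"
        proof (rule integral_mono_AE)
          show "AE x in face_measure e. (gu K x \<bullet> ?n e)\<^sup>2 \<le> M * g2 / V"
            using AE_face_measure[OF simplex_T[OF K] e]
          proof eventually_elim
            case (elim x)
            then have "x \<in> K" using facet_props(2)[OF simplex_T[OF K] e] by blast
            have "(gu K x \<bullet> ?n e)\<^sup>2 \<le> (norm (gu K x))\<^sup>2"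
              using Cauchy_Schwarz_ineq2[of "gu K x" "?n e"] n1 by (metis abs_le_square_iff abs_norm_cancel mult.right_neutral)
            then show ?case using pt[OF \<open>x \<in> K\<close>] by linarith
          qed
        qed (auto intro!: face_int[OF K e] continuous_intros cont_gu[OF K])
        then show "?N e \<le> measure (face_measure e) UNIV * (M * g2 / V)" by simp
      qed
    qed (auto simp: jump2_def jump2_nonneg intro!: sum_nonneg Bochner_Integration.integral_nonneg)
    finally show ?thesis .
  qed
  have "(LINT x|vol_measure K. gu K x \<bullet> gu K x) = g2" unfolding g2_def by (simp add: power2_norm_eq_inner)
  then have "g2 \<le> sqrt (flux2 K) * sqrt g2 + sqrt (jump2 K) * sqrt (S * (M * g2 / V))"
    using flux[OF K gu(1)[OF K]] 1 2 by linarith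
  also have "sqrt (S * (M * g2 / V)) = sqrt (S * M / V) * sqrt g2" by (simp add: real_sqrt_mult[symmetric])
  finally have "sqrt g2 * sqrt g2 \<le> (sqrt (flux2 K) + sqrt (jump2 K) * sqrt (S * M / V)) * sqrt g2"
    using g0 by (simp add: algebra_simps)
  then have "sqrt g2 \<le> sqrt (flux2 K) + sqrt (jump2 K) * sqrt (S * M / V)"
  proof (cases "g2 = 0")
    case True
    then show ?thesis using S0 M0 V jump2_nonneg flux2_nonneg by simp
  next
    case False
    then have "0 < sqrt g2" using g0 by simp
    then show ?thesis using \<open>sqrt g2 * sqrt g2 \<le> _\<close> by (rule mult_right_le_imp_le[rotated])
  qed
  then have "(sqrt g2)\<^sup>2 \<le> (sqrt (flux2 K) + sqrt (jump2 K) * sqrt (S * M / V))\<^sup>2"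
    using g0 by (intro power_mono) auto
  also have "\<dots> \<le> 2 * (sqrt (flux2 K))\<^sup>2 + 2 * (sqrt (jump2 K) * sqrt (S * M / V))\<^sup>2"
    using sum_squares_bound[of "sqrt (flux2 K)" "sqrt (jump2 K) * sqrt (S * M / V)"] by (simp add: power2_sum)
  finally have "g2 \<le> 2 * flux2 K + 2 * (jump2 K * (S * M / V))"
    using g0 S0 M0 V jump2_nonneg flux2_nonneg by (simp add: power_mult_distrib)
  then show ?thesis using V by (simp add: g2_def field_simps)
qed

end

subsection \<open>Dilated bump functions\<close>

context hdg_discrete
begin

lemma measure_T_pos: "K \<in> \<T> \<Longrightarrow> 0 < measure lebesgue K"
  using measure_T_ge[of K] cvol_pos h_pos by (smt (verit) mult_pos_pos zero_less_power)

lemma flux2_le_en: "flux2 K \<le> en K" and jump2_le_en: "jump2 K \<le> en K"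
  using jump2_nonneg[of K] flux2_nonneg[of K] by (auto simp: en_def)

text \<open>With H = (2h)^(d-1), the volume of an element is at most 2
  \<open>diameter (closure \<Omega>)\<close> H and the area of its facets at most (d + 1) H. The
  numbers 8, 4 M and 2 come from squaring the sum in \<open>aK\<close> and from
  \<open>grad_sq_le\<close>.\<close>

definition CA where "CA = 2 ^ (CARD('d) - 1) * (8 * diameter (closure \<Omega>) + (real CARD('d) + 1) * (4 * M + 2))"

lemma diameter_Omega_pos: "0 < diameter (closure \<Omega>)"
  using h_le h_pos by linarith

lemma CA_nonneg: "0 \<le> CA"
  using diameter_Omega_pos M0 by (simp add: CA_def)

text \<open>The passage from L1 to L2 contributes the volume, of order h^d, to the gradient term,
  and the loss 1/h turns this into h^(d-1); the jumps have the same order directly. This is one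
  power of h worse than the bound for \<open>bK\<close>.\<close>

lemma aK_sq_le:
  assumes K: "K \<in> \<T>"
  shows "(aK K)\<^sup>2 \<le> CA * h ^ (CARD('d) - 1) * en K"
proof -
  define V S where "V = measure lebesgue K" and "S = (\<Sum>e\<in>facets K. measure (face_measure e) UNIV)"
  define H where "H = (2 * h) ^ (CARD('d) - 1)"
  have H0: "0 \<le> H" using h_pos by (simp add: H_def)
  let ?g = "LINT x|vol_measure K. norm (gu K x)" and ?g2 = "LINT x|vol_measure K. (norm (gu K x))\<^sup>2"
  let ?b = "\<Sum>e\<in>facets K. LINT x|face_measure e. \<bar>u K x - w e x\<bar>"
  have S0: "0 \<le> S" unfolding S_def by (intro sum_nonneg) simp
  have "(LINT x|vol_measure K. 1 * norm (gu K x))\<^sup>2 \<le> (LINT x|vol_measure K. 1\<^sup>2) * (LINT x|vol_measure K. (norm (gu K x))\<^sup>2)"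
    by (intro Cauchy_Schwarz_integral vol_int[OF K] continuous_intros cont_gu[OF K])
  then have 1: "?g\<^sup>2 \<le> V * ?g2" using vol_measure_compact[OF compact_T[OF K]] by (simp add: V_def)
  have 2: "V * ?g2 \<le> 2 * V * flux2 K + 2 * S * M * jump2 K" using grad_sq_le[OF K] by (simp add: V_def S_def)
  have 3: "?b\<^sup>2 \<le> S * jump2 K" using bdry_L1_sq_le[OF K] by (simp add: S_def)
  have VH: "V \<le> 2 * diameter (closure \<Omega>) * H"
  proof -
    have "V \<le> (2 * h) ^ CARD('d)" using measure_T_le[OF K] by (simp add: V_def)
    also have "\<dots> = 2 * h * H" unfolding H_def by (subst power_Suc[symmetric]) simp
    also have "\<dots> \<le> 2 * diameter (closure \<Omega>) * H" using h_le H0 by (intro mult_right_mono) auto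
    finally show ?thesis .
  qed
  have SH: "S \<le> (real CARD('d) + 1) * H" using measure_facets_le[OF K] by (simp add: S_def H_def)
  have "(aK K)\<^sup>2 \<le> 2 * ?g\<^sup>2 + 2 * ?b\<^sup>2"
    using sum_squares_bound[of ?g ?b] by (simp add: aK_def power2_sum)
  also have "\<dots> \<le> 2 * (2 * V * flux2 K + 2 * S * M * jump2 K) + 2 * (S * jump2 K)"
    using order_trans[OF 1 2] 3 by (intro add_mono mult_left_mono) auto
  also have "\<dots> = 4 * V * flux2 K + S * (4 * M + 2) * jump2 K" by (simp add: algebra_simps)
  also have "\<dots> \<le> 4 * V * en K + S * (4 * M + 2) * en K"
    using flux2_le_en jump2_le_en S0 M0 by (intro add_mono mult_left_mono) (auto simp: V_def)
  also have "\<dots> \<le> 4 * (2 * diameter (closure \<Omega>) * H) * en K + ((real CARD('d) + 1) * H) * (4 * M + 2) * en K"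
    using VH SH en_nonneg M0 by (intro add_mono mult_right_mono mult_left_mono) auto
  also have "\<dots> = (8 * diameter (closure \<Omega>) + (real CARD('d) + 1) * (4 * M + 2)) * H * en K" by (simp add: algebra_simps)
  also have "\<dots> = CA * h ^ (CARD('d) - 1) * en K" by (simp add: CA_def H_def power_mult_distrib)
  finally show ?thesis .
qed

lemma bK_sq_le_en:
  assumes K: "K \<in> \<T>"
  shows "(bK K)\<^sup>2 \<le> (2 * h) ^ CARD('d) * en K"
proof -
  have "(bK K)\<^sup>2 \<le> measure lebesgue K * flux2 K" by (rule bK_sq_le[OF K])
  also have "\<dots> \<le> (2 * h) ^ CARD('d) * en K"
    using measure_T_le[OF K] flux2_le_en flux2_nonneg h_pos by (intro mult_mono) auto
  finally show ?thesis .
qed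

text \<open>Elementwise integration by parts. On the faces u is replaced by u - w, which is allowed
  since the single-valued trace w contributes nothing in total.\<close>

lemma weak_divergence:
  fixes q :: "real^'d \<Rightarrow> real^'d"
  assumes q: "\<And>i. C1 (\<lambda>x. q x $ i) (gq i)" and q0: "\<And>x. x \<notin> \<Omega> \<Longrightarrow> q x = 0"
  shows "(\<Sum>K\<in>\<T>. LINT x|vol_measure K. u K x * (\<Sum>i\<in>UNIV. gq i x $ i))
    = (\<Sum>K\<in>\<T>. (\<Sum>e\<in>facets K. LINT x|face_measure e. (u K x - w e x) * (q x \<bullet> outward_normal K e))
        - (LINT x|vol_measure K. gu K x \<bullet> q x))"
proof -
  have "continuous_on UNIV (\<lambda>x. \<chi> i. q x $ i)" by (intro continuous_on_vec_lambda C1_continuous[OF q])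
  then have cq: "continuous_on UNIV q" by simp
  have cgq: "continuous_on UNIV (\<lambda>x. \<Sum>i\<in>UNIV. gq i x $ i)"
    using q by (auto simp: C1_def intro!: continuous_intros)
  have elt: "(LINT x|vol_measure K. u K x * (\<Sum>i\<in>UNIV. gq i x $ i))
      = (\<Sum>e\<in>facets K. LINT x|face_measure e. (u K x - w e x) * (q x \<bullet> outward_normal K e)) - (LINT x|vol_measure K. gu K x \<bullet> q x)
        + (\<Sum>e\<in>facets K. LINT x|face_measure e. w e x * (q x \<bullet> outward_normal K e))" if K: "K \<in> \<T>" for K
  proof -
    have "(LINT x|vol_measure K. u K x * (\<Sum>i\<in>UNIV. gq i x $ i)) + (LINT x|vol_measure K. gu K x \<bullet> q x)
      = (\<Sum>e\<in>facets K. LINT x|face_measure e. u K x * (q x \<bullet> outward_normal K e))"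
      using gauss_product[OF simplex_T[OF K] gu(2)[OF K] q] borel_T[OF K] cont_u[OF K] cont_gu[OF K] cq cgq
      by (simp add: integral_vol_measure borel_measurable_continuous_onI continuous_on_mult continuous_on_inner)
    also have "\<dots> = (\<Sum>e\<in>facets K. (LINT x|face_measure e. (u K x - w e x) * (q x \<bullet> outward_normal K e))
        + (LINT x|face_measure e. w e x * (q x \<bullet> outward_normal K e)))"
    proof (rule sum.cong[OF refl])
      fix e assume e: "e \<in> facets K"
      have "(LINT x|face_measure e. u K x * (q x \<bullet> outward_normal K e))
        = (LINT x|face_measure e. (u K x - w e x) * (q x \<bullet> outward_normal K e) + w e x * (q x \<bullet> outward_normal K e))"
        by (intro Bochner_Integration.integral_cong) (auto simp: algebra_simps)
      also have "\<dots> = (LINT x|face_measure e. (u K x - w e x) * (q x \<bullet> outward_normal K e))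
        + (LINT x|face_measure e. w e x * (q x \<bullet> outward_normal K e))"
        by (intro Bochner_Integration.integral_add face_int[OF K e] continuous_intros cont_u[OF K] cont_w[OF K e] cq)
      finally show "(LINT x|face_measure e. u K x * (q x \<bullet> outward_normal K e))
        = (LINT x|face_measure e. (u K x - w e x) * (q x \<bullet> outward_normal K e))
        + (LINT x|face_measure e. w e x * (q x \<bullet> outward_normal K e))" .
    qed
    finally show ?thesis by (simp add: sum.distrib)
  qed
  show ?thesis using single_valued_flux[OF cq q0, of w] by (simp add: elt sum.distrib)
qed

lemma flux_pairing_le:
  fixes q :: "real^'d \<Rightarrow> real^'d"
  assumes K: "K \<in> \<T>" and cq: "continuous_on UNIV q"
  shows "\<bar>(\<Sum>e\<in>facets K. LINT x|face_measure e. (u K x - w e x) * (q x \<bullet> outward_normal K e)) - (LINT x|vol_measure K. gu K x \<bullet> q x)\<bar>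
    \<le> (\<Sum>e\<in>facets K. LINT x|face_measure e. \<bar>u K x - w e x\<bar> * norm (q x)) + (LINT x|vol_measure K. norm (gu K x) * norm (q x))"
proof -
  have "\<bar>LINT x|face_measure e. (u K x - w e x) * (q x \<bullet> outward_normal K e)\<bar> \<le> (LINT x|face_measure e. \<bar>u K x - w e x\<bar> * norm (q x))"
    if e: "e \<in> facets K" for e
  proof (rule order_trans[OF integral_abs_bound], rule integral_mono)
    have n1: "norm (outward_normal K e) = 1" using facet_props(4)[OF simplex_T[OF K] e] by auto
    show "\<bar>(u K x - w e x) * (q x \<bullet> outward_normal K e)\<bar> \<le> \<bar>u K x - w e x\<bar> * norm (q x)" for x
      using Cauchy_Schwarz_ineq2[of "q x" "outward_normal K e"] n1 by (simp add: abs_mult mult_left_mono)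
  qed (intro face_int[OF K e] continuous_intros cont_u[OF K] cont_w[OF K e] cq)+
  then have "\<bar>\<Sum>e\<in>facets K. LINT x|face_measure e. (u K x - w e x) * (q x \<bullet> outward_normal K e)\<bar> \<le> (\<Sum>e\<in>facets K. LINT x|face_measure e. \<bar>u K x - w e x\<bar> * norm (q x))"
    by (intro order_trans[OF sum_abs] sum_mono)
  moreover have "\<bar>LINT x|vol_measure K. gu K x \<bullet> q x\<bar> \<le> (LINT x|vol_measure K. norm (gu K x) * norm (q x))"
    by (rule order_trans[OF integral_abs_bound], rule integral_mono)
       (intro vol_int[OF K] continuous_intros cont_gu[OF K] cq | rule Cauchy_Schwarz_ineq2)+
  ultimately show ?thesis by linarith
qed

lemma weak_divergence_le:
  fixes q :: "real^'d \<Rightarrow> real^'d"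
  assumes q: "\<And>i. C1 (\<lambda>x. q x $ i) (gq i)" and q0: "\<And>x. x \<notin> \<Omega> \<Longrightarrow> q x = 0"
  shows "\<bar>\<Sum>K\<in>\<T>. LINT x|vol_measure K. u K x * (\<Sum>i\<in>UNIV. gq i x $ i)\<bar>
    \<le> (\<Sum>K\<in>\<T>. (\<Sum>e\<in>facets K. LINT x|face_measure e. \<bar>u K x - w e x\<bar> * norm (q x)) + (LINT x|vol_measure K. norm (gu K x) * norm (q x)))"
proof -
  have "continuous_on UNIV (\<lambda>x. \<chi> i. q x $ i)" by (intro continuous_on_vec_lambda C1_continuous[OF q])
  then have cq: "continuous_on UNIV q" by simp
  have eq: "(\<Sum>K\<in>\<T>. LINT x|vol_measure K. u K x * (\<Sum>i\<in>UNIV. gq i x $ i))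
    = (\<Sum>K\<in>\<T>. (\<Sum>e\<in>facets K. LINT x|face_measure e. (u K x - w e x) * (q x \<bullet> outward_normal K e))
        - (LINT x|vol_measure K. gu K x \<bullet> q x))"
    by (rule weak_divergence[OF q q0])
  show ?thesis
    by (subst eq, rule order_trans[OF sum_abs]) (intro sum_mono flux_pairing_le cq)
qed

text \<open>On every element a constant \<open>c K\<close> is subtracted from q. Constants are test
  functions of the scheme, so the flux identity converts their pairing with the gradient and the
  jumps into the pairing with p. Only the remainder, of size \<open>m K\<close>, meets
  \<open>aK\<close>.\<close>

lemma weak_divergence_le_osc:
  fixes q :: "real^'d \<Rightarrow> real^'d"
  assumes q: "\<And>i. C1 (\<lambda>x. q x $ i) (gq i)" and q0: "\<And>x. x \<notin> \<Omega> \<Longrightarrow> q x = 0"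
    and m: "\<And>K x. K \<in> \<T> \<Longrightarrow> x \<in> K \<Longrightarrow> norm (q x - c K) \<le> m K"
  shows "\<bar>\<Sum>K\<in>\<T>. LINT x|vol_measure K. u K x * (\<Sum>i\<in>UNIV. gq i x $ i)\<bar> \<le> (\<Sum>K\<in>\<T>. aK K * m K + bK K * norm (c K))"
proof -
  have "continuous_on UNIV (\<lambda>x. \<chi> i. q x $ i)" by (intro continuous_on_vec_lambda C1_continuous[OF q])
  then have cq: "continuous_on UNIV q" by simp
  have "\<bar>(\<Sum>e\<in>facets K. LINT x|face_measure e. (u K x - w e x) * (q x \<bullet> outward_normal K e)) - (LINT x|vol_measure K. gu K x \<bullet> q x)\<bar>
    \<le> aK K * m K + bK K * norm (c K)" if K: "K \<in> \<T>" for K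
  proof -
    let ?r = "\<lambda>x. q x - c K"
    have cr: "continuous_on UNIV ?r" by (intro continuous_intros cq)
    have 1: "(LINT x|vol_measure K. gu K x \<bullet> q x) = (LINT x|vol_measure K. gu K x \<bullet> ?r x) + (LINT x|vol_measure K. gu K x \<bullet> c K)"
      by (subst Bochner_Integration.integral_add[symmetric])
         (auto simp: inner_diff_right intro!: vol_int[OF K] continuous_intros cont_gu[OF K] cq)
    have 2: "(\<Sum>e\<in>facets K. LINT x|face_measure e. (u K x - w e x) * (q x \<bullet> outward_normal K e))
      = (\<Sum>e\<in>facets K. LINT x|face_measure e. (u K x - w e x) * (?r x \<bullet> outward_normal K e))
      + (\<Sum>e\<in>facets K. LINT x|face_measure e. (u K x - w e x) * (c K \<bullet> outward_normal K e))"
      unfolding sum.distrib[symmetric]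
    proof (rule sum.cong[OF refl])
      fix e assume e: "e \<in> facets K"
      show "(LINT x|face_measure e. (u K x - w e x) * (q x \<bullet> outward_normal K e))
        = (LINT x|face_measure e. (u K x - w e x) * (?r x \<bullet> outward_normal K e)) + (LINT x|face_measure e. (u K x - w e x) * (c K \<bullet> outward_normal K e))"
        by (subst Bochner_Integration.integral_add[symmetric])
           (auto simp: inner_diff_left algebra_simps intro!: face_int[OF K e] continuous_intros cont_u[OF K] cont_w[OF K e] cq)
    qed
    have 3: "(LINT x|vol_measure K. gu K x \<bullet> c K) + (LINT x|vol_measure K. p K x \<bullet> c K)
        = (\<Sum>e\<in>facets K. LINT x|face_measure e. (u K x - w e x) * (c K \<bullet> outward_normal K e))"
      by (rule flux[OF K vPoly_const])
    have 4: "\<bar>LINT x|vol_measure K. p K x \<bullet> c K\<bar> \<le> bK K * norm (c K)"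
    proof -
      have "\<bar>LINT x|vol_measure K. p K x \<bullet> c K\<bar> \<le> (LINT x|vol_measure K. norm (p K x) * norm (c K))"
        by (rule order_trans[OF integral_abs_bound], rule integral_mono)
           (intro vol_int[OF K] continuous_intros cont_p[OF K] | rule Cauchy_Schwarz_ineq2)+
      then show ?thesis by (simp add: bK_def)
    qed
    have 5: "(LINT x|vol_measure K. norm (gu K x) * norm (?r x)) \<le> (LINT x|vol_measure K. norm (gu K x)) * m K"
    proof -
      have "(LINT x|vol_measure K. norm (gu K x) * norm (?r x)) \<le> (LINT x|vol_measure K. norm (gu K x) * m K)"
      proof (rule integral_mono_AE)
        show "AE x in vol_measure K. norm (gu K x) * norm (?r x) \<le> norm (gu K x) * m K"
          using AE_vol_measure[OF borel_T[OF K]] by eventually_elim (intro mult_left_mono m[OF K], auto)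
      qed (intro vol_int[OF K] continuous_intros cont_gu[OF K] cq)+
      then show ?thesis by simp
    qed
    have 6: "(\<Sum>e\<in>facets K. LINT x|face_measure e. \<bar>u K x - w e x\<bar> * norm (?r x)) \<le> (\<Sum>e\<in>facets K. LINT x|face_measure e. \<bar>u K x - w e x\<bar>) * m K"
      unfolding sum_distrib_right
    proof (rule sum_mono)
      fix e assume e: "e \<in> facets K"
      have "(LINT x|face_measure e. \<bar>u K x - w e x\<bar> * norm (?r x)) \<le> (LINT x|face_measure e. \<bar>u K x - w e x\<bar> * m K)"
      proof (rule integral_mono_AE)
        show "AE x in face_measure e. \<bar>u K x - w e x\<bar> * norm (?r x) \<le> \<bar>u K x - w e x\<bar> * m K"
          using AE_face_measure[OF simplex_T[OF K] e] facet_props(2)[OF simplex_T[OF K] e]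
          by (auto elim!: eventually_mono intro!: mult_left_mono m[OF K])
      qed (intro face_int[OF K e] continuous_intros cont_u[OF K] cont_w[OF K e] cq)+
      then show "(LINT x|face_measure e. \<bar>u K x - w e x\<bar> * norm (?r x)) \<le> (LINT x|face_measure e. \<bar>u K x - w e x\<bar>) * m K" by simp
    qed
    have 7: "aK K * m K = (LINT x|vol_measure K. norm (gu K x)) * m K + (\<Sum>e\<in>facets K. LINT x|face_measure e. \<bar>u K x - w e x\<bar>) * m K"
      by (simp add: aK_def distrib_right)
    show ?thesis using flux_pairing_le[OF K cr] 1 2 3 4 5 6 7 by linarith
  qed
  note elt = this
  have eq: "(\<Sum>K\<in>\<T>. LINT x|vol_measure K. u K x * (\<Sum>i\<in>UNIV. gq i x $ i))
    = (\<Sum>K\<in>\<T>. (\<Sum>e\<in>facets K. LINT x|face_measure e. (u K x - w e x) * (q x \<bullet> outward_normal K e))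
        - (LINT x|vol_measure K. gu K x \<bullet> q x))"
    by (rule weak_divergence[OF q q0])
  show ?thesis
    by (subst eq, rule order_trans[OF sum_abs]) (intro sum_mono elt)
qed

end

section \<open>The kernel field of a dilated bump\<close>

lemma C1_affine:
  assumes "C1 f g"
  shows "C1 (\<lambda>z. f (c + t *\<^sub>R z)) (\<lambda>z. t *\<^sub>R g (c + t *\<^sub>R z))"
proof -
  have f: "(f has_derivative (\<lambda>h. g x \<bullet> h)) (at x)" and g: "continuous_on UNIV g" for x
    using assms by (auto simp: C1_def)
  have "((\<lambda>z. f (c + t *\<^sub>R z)) has_derivative (\<lambda>h. g (c + t *\<^sub>R z) \<bullet> (t *\<^sub>R h))) (at z)" for z
    by (rule has_derivative_compose[OF _ f]) (auto intro!: derivative_eq_intros)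
  moreover have "continuous_on UNIV (\<lambda>z. t *\<^sub>R g (c + t *\<^sub>R z))"
    by (intro continuous_intros continuous_on_compose2[OF g]) auto
  ultimately show ?thesis by (simp add: C1_def)
qed

lemma C1_component: "C1 (\<lambda>z. (z - x) $ i) (\<lambda>z. axis i 1)"
proof -
  have "((\<lambda>z :: real^'a. (z - x) $ i) has_derivative (\<lambda>h. (h - 0) $ i)) (at z)" for z
    by (intro bounded_linear.has_derivative[OF bounded_linear_vec_nth] derivative_intros)
  then show ?thesis by (simp add: C1_def inner_axis')
qed

text \<open>W bounds the bump, L its gradient, hence its Lipschitz constant, and D the diameter of
  S. These three numbers are all that later constants retain of S and the bump.\<close>

locale bump_kernel =
  fixes S :: "(real^'d) set" and \<omega> :: "real^'d \<Rightarrow> real" and g\<omega> :: "real^'d \<Rightarrow> real^'d" and W L D :: real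
  assumes S: "convex S" "compact S" and omega: "C1 \<omega> g\<omega>" and omega_nonneg: "\<And>y. 0 \<le> \<omega> y" and omega_le: "\<And>y. \<omega> y \<le> W"
    and gomega_le: "\<And>y. norm (g\<omega> y) \<le> L" and supp: "\<And>y. \<omega> y \<noteq> 0 \<Longrightarrow> y \<in> interior S"
    and omega_int: "(LINT y|lborel. \<omega> y) = 1" and D_pos: "0 < D" and D: "\<And>x y. x \<in> S \<Longrightarrow> y \<in> S \<Longrightarrow> dist x y \<le> D"
begin

lemma W_nonneg: "0 \<le> W" and L_nonneg: "0 \<le> L"
  using omega_nonneg[of 0] omega_le[of 0] gomega_le[of 0] norm_ge_zero[of "g\<omega> 0"] by linarith+

lemma omega_lipschitz: "\<bar>\<omega> y - \<omega> z\<bar> \<le> L * norm (y - z)"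
proof -
  have "norm (\<omega> y - \<omega> z) \<le> L * norm (y - z)"
  proof (rule differentiable_bound[where f' = "\<lambda>x h. g\<omega> x \<bullet> h" and S = UNIV])
    show "(\<omega> has_derivative (\<bullet>) (g\<omega> x)) (at x within UNIV)" for x using omega by (simp add: C1_def)
    show "onorm ((\<bullet>) (g\<omega> x)) \<le> L" for x
    proof (rule onorm_le)
      fix h
      have "norm (g\<omega> x \<bullet> h) \<le> norm (g\<omega> x) * norm h" using Cauchy_Schwarz_ineq2[of "g\<omega> x" h] by simp
      also have "\<dots> \<le> L * norm h" using gomega_le by (intro mult_right_mono) auto
      finally show "norm (g\<omega> x \<bullet> h) \<le> L * norm h" .
    qed
  qed auto
  then show ?thesis by simp
qed

lemma cont_omega: "continuous_on UNIV \<omega>"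
  using omega by (rule C1_continuous)

lemma cont_gomega: "continuous_on UNIV g\<omega>"
  using omega by (simp add: C1_def)

text \<open>
  \<open>G s x\<close> is the bump dilated by \<open>s\<close> about \<open>x\<close>. Its derivative in \<open>s\<close> is minus the divergence in \<open>z\<close> of
  the field \<open>kk s x\<close>, whose \<open>i\<close>-th component has the gradient \<open>gk s x i\<close>.
\<close>

definition yy :: "real \<Rightarrow> real^'d \<Rightarrow> real^'d \<Rightarrow> real^'d" where "yy s x z = x + (1 / s) *\<^sub>R (z - x)"
definition G :: "real \<Rightarrow> real^'d \<Rightarrow> real^'d \<Rightarrow> real" where "G s x z = \<omega> (yy s x z) / s ^ CARD('d)"
definition kk :: "real \<Rightarrow> real^'d \<Rightarrow> real^'d \<Rightarrow> real^'d" where "kk s x z = (G s x z / s) *\<^sub>R (z - x)"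
definition gk :: "real \<Rightarrow> real^'d \<Rightarrow> 'd \<Rightarrow> real^'d \<Rightarrow> real^'d" where
  "gk s x i z = (1 / s ^ (CARD('d) + 1)) *\<^sub>R (\<omega> (yy s x z) *\<^sub>R axis i 1 + (z - x) $ i *\<^sub>R ((1 / s) *\<^sub>R g\<omega> (yy s x z)))"

lemma yy_affine: "yy s x z = (x - (1 / s) *\<^sub>R x) + (1 / s) *\<^sub>R z"
  by (simp add: yy_def algebra_simps)

lemma C1_kk: "C1 (\<lambda>z. kk s x z $ i) (gk s x i)"
proof -
  have 1: "C1 (\<lambda>z. \<omega> (yy s x z)) (\<lambda>z. (1 / s) *\<^sub>R g\<omega> (yy s x z))"
    unfolding yy_affine by (rule C1_affine[OF omega])
  have "C1 (\<lambda>z. (1 / s ^ (CARD('d) + 1)) * (\<omega> (yy s x z) * (z - x) $ i)) (gk s x i)"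
    unfolding gk_def by (intro C1_cmult C1_mult 1 C1_component)
  moreover have "(\<lambda>z. kk s x z $ i) = (\<lambda>z. (1 / s ^ (CARD('d) + 1)) * (\<omega> (yy s x z) * (z - x) $ i))"
    by (simp add: kk_def G_def fun_eq_iff mult.commute)
  ultimately show ?thesis by simp
qed

lemma div_kk: "(\<Sum>i\<in>UNIV. gk s x i z $ i)
  = (1 / s ^ (CARD('d) + 1)) * (real CARD('d) * \<omega> (yy s x z) + (1 / s) * (g\<omega> (yy s x z) \<bullet> (z - x)))"
proof -
  have "(\<Sum>i\<in>UNIV. gk s x i z $ i)
    = (\<Sum>i\<in>UNIV. (1 / s ^ (CARD('d) + 1)) * (\<omega> (yy s x z) + (1 / s) * (g\<omega> (yy s x z) $ i * (z - x) $ i)))"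
    by (intro sum.cong) (auto simp: gk_def axis_def)
  also have "\<dots> = (1 / s ^ (CARD('d) + 1)) * (real CARD('d) * \<omega> (yy s x z) + (1 / s) * (g\<omega> (yy s x z) \<bullet> (z - x)))"
    unfolding inner_vec_def inner_real_def
    by (simp only: sum_distrib_left[symmetric] sum.distrib sum_constant)
  finally show ?thesis .
qed

text \<open>This is the continuity equation: under dilation about x the mass of the bump moves with
  velocity (z - x)/s, and \<open>kk\<close> is density times velocity.\<close>

lemma DERIV_G:
  assumes e: "0 < s"
  shows "DERIV (\<lambda>s. G s x z) s :> - (\<Sum>i\<in>UNIV. gk s x i z $ i)"
proof -
  let ?g = "g\<omega> (yy s x z) \<bullet> (z - x)" and ?o = "\<omega> (yy s x z)"
  have yd: "((\<lambda>s. yy s x z) has_derivative (\<lambda>t. (t * (- 1 / s\<^sup>2)) *\<^sub>R (z - x))) (at s)"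
    unfolding yy_def using e by (auto intro!: derivative_eq_intros simp: power2_eq_square field_simps)
  have og: "(\<omega> has_derivative (\<lambda>h. g\<omega> (yy s x z) \<bullet> h)) (at (yy s x z))"
    using omega by (simp add: C1_def)
  have hd: "((\<lambda>s. \<omega> (yy s x z)) has_derivative (\<lambda>t. g\<omega> (yy s x z) \<bullet> ((t * (- 1 / s\<^sup>2)) *\<^sub>R (z - x)))) (at s)"
    by (rule has_derivative_compose[OF yd og])
  have fe: "(\<lambda>t. g\<omega> (yy s x z) \<bullet> ((t * (- 1 / s\<^sup>2)) *\<^sub>R (z - x))) = (*) (- ?g / s\<^sup>2)"
    by (rule ext) (simp add: mult.commute)
  have 1: "DERIV (\<lambda>s. \<omega> (yy s x z)) s :> - ?g / s\<^sup>2"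
    using hd unfolding fe has_field_derivative_def .
  have 2: "DERIV (\<lambda>s. s ^ CARD('d)) s :> real CARD('d) * s ^ (CARD('d) - 1)"
    by (auto intro!: derivative_eq_intros)
  have e': "s ^ CARD('d) = s * s ^ (CARD('d) - 1)" by (subst power_Suc[symmetric]) simp
  have "DERIV (\<lambda>s. G s x z) s :> ((- ?g / s\<^sup>2) * s ^ CARD('d) - ?o * (real CARD('d) * s ^ (CARD('d) - 1))) / (s ^ CARD('d) * s ^ CARD('d))"
    unfolding G_def by (rule DERIV_divide[OF 1 2]) (use e in auto)
  moreover have "((- ?g / s\<^sup>2) * s ^ CARD('d) - ?o * (real CARD('d) * s ^ (CARD('d) - 1))) / (s ^ CARD('d) * s ^ CARD('d))
      = - (\<Sum>i\<in>UNIV. gk s x i z $ i)"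
    unfolding div_kk power_add e' using e by (simp add: power2_eq_square field_simps)
  ultimately show ?thesis by simp
qed

text \<open>Convexity enters here: a point of the support lies on the segment from x to a point in
  the interior of S and is different from x, hence is itself interior. So the kernel field vanishes
  outside \<Omega> and may be used as a test field.\<close>

lemma G_supp:
  assumes "x \<in> S" "0 < s" "s \<le> 1" "G s x z \<noteq> 0"
  shows "z \<in> interior S" "norm (z - x) \<le> D * s"
proof -
  have y: "yy s x z \<in> interior S" using assms(4) supp by (auto simp: G_def)
  have z: "z = x - s *\<^sub>R (x - yy s x z)" using assms(2) by (simp add: yy_def algebra_simps)
  show "z \<in> interior S"
    by (subst z) (rule mem_interior_convex_shrink[OF S(1) y assms(1,2,3)])
  have "norm (z - x) = s * dist x (yy s x z)"
    using assms(2) by (subst z) (simp add: dist_norm)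
  also have "\<dots> \<le> s * D" using D[OF assms(1)] y interior_subset[of S] assms(2) by (intro mult_left_mono) auto
  finally show "norm (z - x) \<le> D * s" by (simp add: mult.commute)
qed

lemma kk_supp:
  assumes "x \<in> S" "0 < s" "s \<le> 1" "kk s x z \<noteq> 0"
  shows "z \<in> interior S" "norm (z - x) \<le> D * s"
  using G_supp[OF assms(1-3), of z] assms(4) by (auto simp: kk_def)

lemma kk_le:
  assumes "x \<in> S" "0 < s" "s \<le> 1"
  shows "norm (kk s x z) \<le> D * W / s ^ CARD('d)"
proof (cases "kk s x z = 0")
  case True
  then show ?thesis using D_pos W_nonneg assms by simp
next
  case False
  have "norm (kk s x z) = (\<omega> (yy s x z) / s ^ CARD('d)) * (norm (z - x) / s)"
    using assms omega_nonneg by (simp add: kk_def G_def)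
  also have "\<dots> \<le> (W / s ^ CARD('d)) * D"
    using kk_supp[OF assms False] assms omega_le omega_nonneg W_nonneg
    by (intro mult_mono divide_right_mono) (auto simp: field_simps)
  finally show ?thesis by (simp add: field_simps)
qed

lemma kk_lipschitz:
  assumes x: "x \<in> S" and e: "0 < s" "s \<le> 1"
  shows "norm (kk s x z - kk s x z') \<le> (D * L + W) * norm (z - z') / s ^ (CARD('d) + 1)"
proof -
  have *: "norm (kk s x z - kk s x z') \<le> (D * L + W) * norm (z - z') / s ^ (CARD('d) + 1)" if nz: "kk s x z \<noteq> 0" for z z'
  proof -
    let ?y = "yy s x z" and ?y' = "yy s x z'"
    have yd: "norm (?y - ?y') = norm (z - z') / s"
    proof -
      have "?y - ?y' = (1 / s) *\<^sub>R (z - z')" by (simp add: yy_def algebra_simps)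
      then show ?thesis using e by simp
    qed
    have k: "kk s x z = (1 / s ^ CARD('d)) *\<^sub>R (\<omega> (yy s x z) *\<^sub>R ((1 / s) *\<^sub>R (z - x)))" for z
      by (simp add: kk_def G_def)
    \<comment> \<open>The splitting keeps z - x only next to the difference of the bump values. Its
      length is bounded because the field is nonzero at z; nothing is asked of z', and by symmetry
      one nonzero value suffices.\<close>
    have "kk s x z - kk s x z' = (1 / s ^ CARD('d)) *\<^sub>R ((\<omega> ?y - \<omega> ?y') *\<^sub>R ((1 / s) *\<^sub>R (z - x)) + \<omega> ?y' *\<^sub>R ((1 / s) *\<^sub>R (z - z')))"
      unfolding k by (simp add: algebra_simps)
    then have "norm (kk s x z - kk s x z') = (1 / s ^ CARD('d)) * norm ((\<omega> ?y - \<omega> ?y') *\<^sub>R ((1 / s) *\<^sub>R (z - x)) + \<omega> ?y' *\<^sub>R ((1 / s) *\<^sub>R (z - z')))"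
      using e by simp
    also have "\<dots> \<le> (1 / s ^ CARD('d)) * (\<bar>\<omega> ?y - \<omega> ?y'\<bar> * (norm (z - x) / s) + \<omega> ?y' * (norm (z - z') / s))"
      using e omega_nonneg by (intro mult_left_mono order_trans[OF norm_triangle_ineq]) auto
    also have "\<dots> \<le> (1 / s ^ CARD('d)) * ((L * (norm (z - z') / s)) * D + W * (norm (z - z') / s))"
    proof (intro mult_left_mono add_mono mult_mono)
      show "\<bar>\<omega> ?y - \<omega> ?y'\<bar> \<le> L * (norm (z - z') / s)" using omega_lipschitz[of ?y ?y'] yd by simp
      show "norm (z - x) / s \<le> D" using kk_supp(2)[OF x e nz] e by (simp add: field_simps)
    qed (use e L_nonneg W_nonneg omega_le omega_nonneg in auto)
    also have "\<dots> = (D * L + W) * norm (z - z') / s ^ (CARD('d) + 1)" using e by (simp add: field_simps)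
    finally show ?thesis .
  qed
  show ?thesis
  proof (cases "kk s x z = 0 \<and> kk s x z' = 0")
    case True
    then show ?thesis using D_pos L_nonneg W_nonneg e by simp
  next
    case False
    then show ?thesis using *[of z z'] *[of z' z] by (auto simp: norm_minus_commute)
  qed
qed

lemma G_nonneg: "0 < s \<Longrightarrow> 0 \<le> G s x z" and G_le: "0 < s \<Longrightarrow> G s x z \<le> W / s ^ CARD('d)"
  using omega_nonneg omega_le by (auto simp: G_def intro: divide_right_mono)

lemma cont_yy: "continuous_on UNIV (\<lambda>z. yy s x z)"
  unfolding yy_def by (intro continuous_intros)

lemma cont_G: "continuous_on UNIV (\<lambda>z. G s x z)"
  unfolding G_def divide_inverse by (intro continuous_intros continuous_on_compose2[OF cont_omega cont_yy]) auto

lemma cont_kk: "continuous_on UNIV (\<lambda>z. kk s x z)"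
  unfolding kk_def divide_inverse by (intro continuous_intros cont_G)

lemma cont_div_kk: "continuous_on UNIV (\<lambda>z. \<Sum>i\<in>UNIV. gk s x i z $ i)"
  unfolding div_kk
  by (intro continuous_intros continuous_on_compose2[OF cont_omega cont_yy] continuous_on_compose2[OF cont_gomega cont_yy]) auto

lemma omega_measurable[measurable]: "\<omega> \<in> borel_measurable borel" "g\<omega> \<in> borel_measurable borel"
  using cont_omega cont_gomega by (auto intro: borel_measurable_continuous_onI)

lemma G_measurable[measurable]: "(\<lambda>(x, z). G s x z) \<in> borel_measurable (borel \<Otimes>\<^sub>M borel)"
  unfolding G_def yy_def by measurable

lemma kk_measurable[measurable]: "(\<lambda>(x, z). kk s x z) \<in> borel_measurable (borel \<Otimes>\<^sub>M borel)"
  unfolding kk_def G_def yy_def by measurable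

lemma G_integrable_integral:
  assumes "0 < s"
  shows "integrable lborel (\<lambda>z. G s x z)" "(LINT z|lborel. G s x z) = 1"
proof -
  obtain r where r: "\<And>y. y \<in> S \<Longrightarrow> norm y \<le> r" using compact_imp_bounded[OF S(2)] unfolding bounded_iff by blast
  show "integrable lborel (\<lambda>z. G s x z)"
  proof (rule integrable_bounded_support[where S = "cball 0 (norm x + s * (r + norm x))" and B = "W / s ^ CARD('d)"])
    show "G s x \<in> borel_measurable borel" by measurable
    show "bounded (cball (0 :: real^'d) (norm x + s * (r + norm x)))" by simp
    show "\<bar>G s x z\<bar> \<le> W / s ^ CARD('d)" for z :: "real^'d" using G_nonneg[OF assms, of x z] G_le[OF assms, of x z] by simp
    fix z :: "real^'d" assume z: "z \<notin> cball 0 (norm x + s * (r + norm x))"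
    show "G s x z = 0"
    proof (rule ccontr)
      assume "G s x z \<noteq> 0"
      then have "yy s x z \<in> S" using supp interior_subset by (auto simp: G_def)
      then have yr: "norm (yy s x z) \<le> r" by (rule r)
      have "z = x + s *\<^sub>R (yy s x z - x)" using assms by (simp add: yy_def)
      then have "norm z \<le> norm x + s * norm (yy s x z - x)"
        using assms by (metis norm_triangle_ineq norm_scaleR abs_of_pos)
      also have "\<dots> \<le> norm x + s * (r + norm x)"
        using assms yr norm_triangle_ineq4[of "yy s x z" x] by (intro add_left_mono mult_left_mono) auto
      finally show False using z by simp
    qed
  qed
  have "(LINT y|lborel. \<omega> y) = \<bar>1 / s\<bar> ^ DIM(real^'d) * (LINT z|lborel. \<omega> ((x - (1 / s) *\<^sub>R x) + (1 / s) *\<^sub>R z))"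
    using assms by (intro integral_affine) auto
  also have "\<dots> = (LINT z|lborel. G s x z)"
    using assms by (simp add: G_def yy_affine power_divide)
  finally show "(LINT z|lborel. G s x z) = 1" using omega_int by simp
qed

end

section \<open>Means of the discrete solution and their dependence on the scale\<close>

lemma (in finite_measure) integrable_bounded_on:
  fixes f :: "'a \<Rightarrow> real"
  assumes "f \<in> borel_measurable M" "AE x in M. x \<in> X" "\<And>x. x \<in> X \<Longrightarrow> \<bar>f x\<bar> \<le> B"
  shows "integrable M f"
  using assms(2) by (intro integrable_const_bound[of _ B] assms(1)) (auto elim!: eventually_mono intro: assms(3))

lemma (in finite_measure) integral_le_bound_on:
  fixes f :: "'a \<Rightarrow> real"
  assumes "f \<in> borel_measurable M" "AE x in M. x \<in> X" "\<And>x. x \<in> X \<Longrightarrow> \<bar>f x\<bar> \<le> B"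
  shows "\<bar>LINT x|M. f x\<bar> \<le> measure M (space M) * B"
proof -
  have "\<bar>LINT x|M. f x\<bar> \<le> (LINT x|M. \<bar>f x\<bar>)" by (rule integral_abs_bound)
  also have "\<dots> \<le> (LINT x|M. B)"
    using assms(2) by (intro integral_mono_AE integrable_abs integrable_bounded_on[OF assms] integrable_const)
      (auto elim!: eventually_mono intro: assms(3))
  finally show ?thesis by simp
qed

lemma measurable_vol_integral:
  fixes f :: "real^'d \<Rightarrow> real^'d \<Rightarrow> real"
  assumes "(\<lambda>(x, z). f x z) \<in> borel_measurable (borel \<Otimes>\<^sub>M borel)" "finite_measure N" "sets N = sets borel"
  shows "(\<lambda>x. LINT z|N. f x z) \<in> borel_measurable borel"
proof -
  interpret finite_measure N by fact
  have "sets (borel \<Otimes>\<^sub>M N) = sets (borel \<Otimes>\<^sub>M (borel :: (real^'d) measure))"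
    by (rule sets_pair_measure_cong) (use assms(3) in auto)
  then have "(\<lambda>(x, z). f x z) \<in> borel_measurable (borel \<Otimes>\<^sub>M N)"
    using assms(1) measurable_cong_sets[of "borel \<Otimes>\<^sub>M N" "borel \<Otimes>\<^sub>M borel" borel borel] by blast
  then show ?thesis by (rule borel_measurable_lebesgue_integral)
qed

locale hdg_kernel = hdg_discrete \<Omega> \<T> \<kappa> A k M p gu u w + bump_kernel S \<omega> g\<omega> W L D
  for \<Omega> :: "(real^'d) set" and \<T> \<kappa> A k M p gu u w and S :: "(real^'d) set" and \<omega> g\<omega> W L D +
  assumes S_sub: "S \<subseteq> closure \<Omega>"
begin

lemma interior_S_sub: "interior S \<subseteq> \<Omega>"
  using interior_mono[OF S_sub] regular_Omega by simp

text \<open>\<open>avg s x\<close> is the mean m(s, x), and \<open>avg'\<close> minus its derivative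
  in s, written with the divergence of the kernel field. The limit s = 1 gives \<open>cS\<close>:
  there the dilated bump is the bump itself, whatever x is.\<close>

definition avg where "avg s x = (\<Sum>K\<in>\<T>. LINT z|vol_measure K. u K z * G s x z)"
definition avg' where "avg' s x = (\<Sum>K\<in>\<T>. LINT z|vol_measure K. u K z * (\<Sum>i\<in>UNIV. gk s x i z $ i))"
definition cS where "cS = (\<Sum>K\<in>\<T>. LINT z|vol_measure K. u K z * \<omega> z)"

lemma avg_1: "avg 1 x = cS"
  by (simp add: avg_def cS_def G_def yy_def)

text \<open>U depends on the discrete solution. Bounds of this kind justify differentiation under
  the integral and passage to the limit; they leave no trace in the estimates.\<close>

lemma u_bound:
  obtains U where "0 \<le> U" "\<And>K z. K \<in> \<T> \<Longrightarrow> z \<in> K \<Longrightarrow> \<bar>u K z\<bar> \<le> U"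
proof -
  have "\<exists>B. \<forall>z\<in>K. \<bar>u K z\<bar> \<le> B" if K: "K \<in> \<T>" for K
  proof -
    have "bounded (u K ` K)" using cont_u[OF K] compact_T[OF K]
      by (intro compact_imp_bounded compact_continuous_image) (auto intro: continuous_on_subset)
    then show ?thesis by (auto simp: bounded_iff)
  qed
  then obtain B where B: "\<And>K z. K \<in> \<T> \<Longrightarrow> z \<in> K \<Longrightarrow> \<bar>u K z\<bar> \<le> B K" by metis
  show ?thesis
  proof (rule that[of "\<Sum>K\<in>\<T>. \<bar>B K\<bar>"])
    show "0 \<le> (\<Sum>K\<in>\<T>. \<bar>B K\<bar>)" by (simp add: sum_nonneg)
    fix K z assume K: "K \<in> \<T>" "z \<in> K"
    have "\<bar>B K\<bar> \<le> (\<Sum>K\<in>\<T>. \<bar>B K\<bar>)" using K finite_T by (intro member_le_sum) auto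
    then show "\<bar>u K z\<bar> \<le> (\<Sum>K\<in>\<T>. \<bar>B K\<bar>)" using B[OF K] by linarith
  qed
qed

lemma u_measurable: "K \<in> \<T> \<Longrightarrow> u K \<in> borel_measurable borel"
  using cont_u by (rule borel_measurable_continuous_onI)

lemma udiv_measurable: "K \<in> \<T> \<Longrightarrow> (\<lambda>z. u K z * (\<Sum>i\<in>UNIV. gk s x i z $ i)) \<in> borel_measurable borel"
  by (intro borel_measurable_times u_measurable borel_measurable_continuous_onI[OF cont_div_kk])

lemma avg_measurable: "avg s \<in> borel_measurable borel"
proof -
  have "(\<lambda>x. LINT z|vol_measure K. u K z * G s x z) \<in> borel_measurable borel" if K: "K \<in> \<T>" for K
  proof (rule measurable_vol_integral)
    note [measurable] = u_measurable[OF K]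
    show "(\<lambda>(x, z). u K z * G s x z) \<in> borel_measurable (borel \<Otimes>\<^sub>M borel)" by measurable
  qed (use vol_measure_compact(1)[OF compact_T[OF K]] in auto)
  then show ?thesis unfolding avg_def[abs_def] by (rule borel_measurable_sum)
qed

lemma avg'_measurable: "avg' s \<in> borel_measurable borel"
proof -
  have "(\<lambda>x. LINT z|vol_measure K. u K z * (\<Sum>i\<in>UNIV. gk s x i z $ i)) \<in> borel_measurable borel" if K: "K \<in> \<T>" for K
  proof (rule measurable_vol_integral)
    note [measurable] = u_measurable[OF K]
    show "(\<lambda>(x, z). u K z * (\<Sum>i\<in>UNIV. gk s x i z $ i)) \<in> borel_measurable (borel \<Otimes>\<^sub>M borel)"
      unfolding div_kk yy_def by measurable
  qed (use vol_measure_compact(1)[OF compact_T[OF K]] in auto)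
  then show ?thesis unfolding avg'_def[abs_def] by (rule borel_measurable_sum)
qed

lemma div_kk_bound:
  assumes "0 < s0" "s0 \<le> s" "norm (z - x) \<le> R" "0 \<le> R"
  shows "\<bar>\<Sum>i\<in>UNIV. gk s x i z $ i\<bar> \<le> (1 / s0) ^ (CARD('d) + 1) * (real CARD('d) * W + (1 / s0) * (L * R))"
proof -
  have e: "0 < s" using assms by linarith
  have le: "1 / s \<le> 1 / s0" using assms by (simp add: frac_le)
  have "\<bar>\<Sum>i\<in>UNIV. gk s x i z $ i\<bar> = (1 / s) ^ (CARD('d) + 1) * \<bar>real CARD('d) * \<omega> (yy s x z) + (1 / s) * (g\<omega> (yy s x z) \<bullet> (z - x))\<bar>"
    using e by (simp add: div_kk abs_mult power_one_over)
  also have "\<dots> \<le> (1 / s0) ^ (CARD('d) + 1) * (real CARD('d) * W + (1 / s0) * (L * R))"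
  proof (intro mult_mono power_mono)
    have "\<bar>g\<omega> (yy s x z) \<bullet> (z - x)\<bar> \<le> L * R"
      using Cauchy_Schwarz_ineq2[of "g\<omega> (yy s x z)" "z - x"] mult_mono[OF gomega_le[of "yy s x z"] assms(3)] L_nonneg by simp
    then have "(1 / s) * \<bar>g\<omega> (yy s x z) \<bullet> (z - x)\<bar> \<le> (1 / s0) * (L * R)"
      using le e assms(1) by (intro mult_mono) auto
    moreover have "real CARD('d) * \<omega> (yy s x z) \<le> real CARD('d) * W" using omega_le by (intro mult_left_mono) auto
    moreover have "0 \<le> real CARD('d) * \<omega> (yy s x z)" using omega_nonneg by simp
    moreover have "\<bar>(1 / s) * (g\<omega> (yy s x z) \<bullet> (z - x))\<bar> = (1 / s) * \<bar>g\<omega> (yy s x z) \<bullet> (z - x)\<bar>"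
      using e by (simp add: abs_mult)
    ultimately show "\<bar>real CARD('d) * \<omega> (yy s x z) + (1 / s) * (g\<omega> (yy s x z) \<bullet> (z - x))\<bar> \<le> real CARD('d) * W + (1 / s0) * (L * R)"
      by linarith
  qed (use le e assms in auto)
  finally show ?thesis .
qed

lemma radius_bound:
  obtains R where "0 \<le> R" "\<And>K x z. K \<in> \<T> \<Longrightarrow> z \<in> K \<Longrightarrow> norm (z - x) \<le> R + norm x"
proof -
  have "bounded (\<Union>\<T>)" using Union_T bounded_Omega by (simp add: bounded_closure)
  then obtain R where R: "\<And>z. z \<in> \<Union>\<T> \<Longrightarrow> norm z \<le> R" unfolding bounded_iff by blast
  show ?thesis
  proof (rule that[of "\<bar>R\<bar>"])
    fix K x z assume "K \<in> \<T>" "z \<in> K"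
    then have "norm z \<le> R" using R by blast
    then show "norm (z - x) \<le> \<bar>R\<bar> + norm x" using norm_triangle_ineq4[of z x] by linarith
  qed simp
qed

lemma DERIV_avg:
  assumes e: "0 < s"
  shows "DERIV (\<lambda>s. avg s x) s :> - avg' s x"
proof -
  obtain U where U: "0 \<le> U" "\<And>K z. K \<in> \<T> \<Longrightarrow> z \<in> K \<Longrightarrow> \<bar>u K z\<bar> \<le> U" using u_bound by blast
  obtain R where R: "0 \<le> R" "\<And>K z. K \<in> \<T> \<Longrightarrow> z \<in> K \<Longrightarrow> norm (z - x) \<le> R + norm x" using radius_bound by metis
  have "DERIV (\<lambda>s. LINT z|vol_measure K. u K z * G s x z) s :> (LINT z|vol_measure K. u K z * - (\<Sum>i\<in>UNIV. gk s x i z $ i))" if K: "K \<in> \<T>" for K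
  \<comment> \<open>Within distance s/2 of s the scale stays above s/2, which keeps the divergence
    of the kernel field bounded.\<close>
  proof (rule DERIV_integral[where r = "s / 2" and X = K and B = "U * ((1 / (s/2)) ^ (CARD('d) + 1) * (real CARD('d) * W + (1 / (s/2)) * (L * (R + norm x))))"
        and f' = "\<lambda>t z. u K z * - (\<Sum>i\<in>UNIV. gk t x i z $ i)"])
    show "finite_measure (vol_measure K)" by (rule vol_measure_compact(1)[OF compact_T[OF K]])
    show "AE z in vol_measure K. z \<in> K" by (rule AE_vol_measure[OF borel_T[OF K]])
    show "integrable (vol_measure K) (\<lambda>z. u K z * G t x z)" for t by (intro vol_int[OF K] continuous_intros cont_u[OF K] cont_G)
    show "(\<lambda>z. u K z * - (\<Sum>i\<in>UNIV. gk s x i z $ i)) \<in> borel_measurable (vol_measure K)"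
      using borel_measurable_uminus[OF udiv_measurable[OF K, of s x]] by simp
    fix t z assume t: "\<bar>t - s\<bar> < s / 2" and z: "z \<in> K"
    then have t2: "s / 2 \<le> t" "0 < t" using e by linarith+
    show "DERIV (\<lambda>t. u K z * G t x z) t :> u K z * - (\<Sum>i\<in>UNIV. gk t x i z $ i)"
      by (rule DERIV_cmult[OF DERIV_G[OF t2(2)]])
    show "\<bar>u K z * - (\<Sum>i\<in>UNIV. gk t x i z $ i)\<bar> \<le> U * ((1 / (s/2)) ^ (CARD('d) + 1) * (real CARD('d) * W + (1 / (s/2)) * (L * (R + norm x))))"
      unfolding abs_mult abs_minus_cancel
      by (intro mult_mono U(2)[OF K z] div_kk_bound t2 R(2)[OF K z]) (use e R(1) U(1) in auto)
  qed (use e in auto)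
  then have "DERIV (\<lambda>s. \<Sum>K\<in>\<T>. LINT z|vol_measure K. u K z * G s x z) s :> (\<Sum>K\<in>\<T>. LINT z|vol_measure K. u K z * - (\<Sum>i\<in>UNIV. gk s x i z $ i))"
    by (rule DERIV_sum)
  then show ?thesis by (simp add: avg_def[abs_def] avg'_def sum_negf)
qed

text \<open>The dilated bumps are nonnegative with integral 1 at every scale. The bound is uniform
  down to s = 0 and so provides the majorant for the limit there.\<close>

lemma avg_bound:
  obtains B where "0 \<le> B" "\<And>s x. 0 < s \<Longrightarrow> \<bar>avg s x\<bar> \<le> B"
proof -
  obtain U where U: "0 \<le> U" "\<And>K z. K \<in> \<T> \<Longrightarrow> z \<in> K \<Longrightarrow> \<bar>u K z\<bar> \<le> U" using u_bound by blast
  have "\<bar>avg s x\<bar> \<le> (\<Sum>K\<in>\<T>. U)" if e: "0 < s" for s x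
    unfolding avg_def
  proof (rule order_trans[OF sum_abs], rule sum_mono)
    fix K assume K: "K \<in> \<T>"
    have "\<bar>LINT z|vol_measure K. u K z * G s x z\<bar> \<le> (LINT z|vol_measure K. \<bar>u K z * G s x z\<bar>)" by (rule integral_abs_bound)
    also have "\<dots> = (LINT z|lborel. indicator K z * \<bar>u K z * G s x z\<bar>)"
      using borel_T[OF K] cont_u[OF K] cont_G by (intro integral_vol_measure) (auto intro!: borel_measurable_continuous_onI continuous_intros)
    also have "\<dots> \<le> (LINT z|lborel. U * G s x z)"
    proof (rule integral_mono')
      show "integrable lborel (\<lambda>z. U * G s x z)" using G_integrable_integral(1)[OF e] by simp
      show "indicator K z * \<bar>u K z * G s x z\<bar> \<le> U * G s x z" for z
        using U(1) U(2)[OF K, of z] G_nonneg[OF e, of x z] by (auto simp: indicator_def abs_mult mult_right_mono)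
      show "0 \<le> U * G s x z" for z using U(1) G_nonneg[OF e] by simp
    qed
    also have "\<dots> = U" using G_integrable_integral[OF e] by simp
    finally show "\<bar>LINT z|vol_measure K. u K z * G s x z\<bar> \<le> U" .
  qed
  then show ?thesis using that[of "\<Sum>K\<in>\<T>. U"] U(1) by (simp add: sum_nonneg)
qed

text \<open>For small s the dilated bump about x is supported in the element that contains x in its
  interior, and there u is continuous. The scales 1/(j + 1) turn the limit into one along a
  sequence, as dominated convergence requires.\<close>

lemma avg_tendsto:
  assumes x: "x \<in> S" "x \<in> interior K" and K: "K \<in> \<T>"
  shows "(\<lambda>j. avg (1 / Suc j) x) \<longlonglongrightarrow> u K x"
proof (rule LIMSEQ_I)
  fix r :: real assume r: "0 < r"
  obtain \<delta>1 where d1: "\<delta>1 > 0" "ball x \<delta>1 \<subseteq> interior K" using x(2) open_contains_ball[of "interior K"] by auto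
  have "isCont (u K) x" using cont_u[OF K] by (simp add: continuous_on_eq_continuous_at)
  then obtain \<delta>2 where d2: "\<delta>2 > 0" "\<And>z. dist z x < \<delta>2 \<Longrightarrow> dist (u K z) (u K x) < r / 2"
    unfolding continuous_at_eps_delta using r by (meson half_gt_zero)
  define \<delta> where "\<delta> = min \<delta>1 \<delta>2"
  have dpos: "0 < \<delta>" using d1 d2 by (simp add: \<delta>_def)
  obtain N :: nat where N: "D / \<delta> < real N" using reals_Archimedean2 by blast
  have "norm (avg (1 / Suc j) x - u K x) < r" if j: "j \<ge> N" for j
  proof -
    let ?e = "1 / real (Suc j)"
    have e: "0 < ?e" "?e \<le> 1" by auto
    have De: "D * ?e < \<delta>"
    proof -
      have "D < \<delta> * real N" using N dpos by (simp add: field_simps)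
      also have "\<dots> \<le> \<delta> * real (Suc j)" using j dpos by (intro mult_left_mono) auto
      finally show ?thesis by (simp add: field_simps)
    qed
    have Gz: "z \<in> interior K \<and> \<bar>u K z - u K x\<bar> \<le> r / 2" if "G ?e x z \<noteq> 0" for z
    proof -
      have "dist z x < \<delta>" using G_supp(2)[OF x(1) e that] De by (simp add: dist_norm)
      then have "z \<in> ball x \<delta>1" "dist z x < \<delta>2" by (auto simp: \<delta>_def dist_commute)
      then show ?thesis using d1(2) d2(2)[of z] by (auto simp: dist_norm)
    qed
    have other: "(LINT z|vol_measure K'. u K' z * G ?e x z) = 0" if K': "K' \<in> \<T>" "K' \<noteq> K" for K'
    proof -
      have "G ?e x z = 0" if "z \<in> K'" for z
      proof (rule ccontr)
        assume "G ?e x z \<noteq> 0"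
        then have z: "z \<in> interior K" using Gz by blast
        \<comment> \<open>An interior point of K that lies in K' would be a relative interior point
          of K in the common face, which would then be all of K.\<close>
        have "K \<subseteq> K \<inter> K'"
        proof (rule subset_of_face_of[OF face_T[OF K K'(1)]])
          show "K \<inter> K' \<inter> rel_interior K \<noteq> {}" using z that interior_subset[of K] interior_subset_rel_interior[of K] by blast
        qed simp
        then show False using subset_eq_T[OF K K'(1)] K'(2) by blast
      qed
      then have "AE z in vol_measure K'. u K' z * G ?e x z = 0"
        using AE_vol_measure[OF borel_T[OF K'(1)]] by (auto elim!: eventually_mono)
      then show ?thesis by (rule integral_eq_zero_AE)
    qed
    have intG: "integrable lborel (\<lambda>z. u K z * G ?e x z)" "integrable lborel (\<lambda>z. G ?e x z)"
    proof -
      show i: "integrable lborel (\<lambda>z. G ?e x z)" by (rule G_integrable_integral(1)[OF e(1)])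
      have eq: "(\<lambda>z. u K z * G ?e x z) = (\<lambda>z. indicator K z * (u K z * G ?e x z))"
        using Gz interior_subset[of K] by (intro ext) (auto simp: indicator_def)
      show "integrable lborel (\<lambda>z. u K z * G ?e x z)"
        by (subst eq) (intro integrable_continuous_bounded_support borel_T[OF K] bounded_T[OF K] continuous_on_mult cont_u[OF K] cont_G)
    qed
    have "avg ?e x = (LINT z|vol_measure K. u K z * G ?e x z)"
      unfolding avg_def using other K finite_T by (subst sum.remove[OF _ K]) auto
    also have "\<dots> = (LINT z|lborel. indicator K z * (u K z * G ?e x z))"
      using borel_T[OF K] cont_u[OF K] cont_G by (intro integral_vol_measure) (auto intro!: borel_measurable_continuous_onI continuous_intros)
    also have "\<dots> = (LINT z|lborel. u K z * G ?e x z)"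
      using Gz interior_subset[of K] by (intro Bochner_Integration.integral_cong) (auto simp: indicator_def)
    finally have "avg ?e x - u K x = (LINT z|lborel. u K z * G ?e x z) - u K x * (LINT z|lborel. G ?e x z)"
      using G_integrable_integral(2)[OF e(1)] by simp
    also have "\<dots> = (LINT z|lborel. u K z * G ?e x z - u K x * G ?e x z)"
      using intG by simp
    also have "\<bar>\<dots>\<bar> \<le> (LINT z|lborel. (r / 2) * G ?e x z)"
    proof (rule order_trans[OF integral_abs_bound], rule integral_mono)
      show "\<bar>u K z * G ?e x z - u K x * G ?e x z\<bar> \<le> (r / 2) * G ?e x z" for z
        using Gz[of z] G_nonneg[OF e(1), of x z]
        by (cases "G ?e x z = 0") (auto simp: left_diff_distrib[symmetric] abs_mult mult_right_mono)
    qed (use intG in auto)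
    also have "\<dots> = r / 2" using G_integrable_integral[OF e(1)] by simp
    finally show ?thesis using r by simp
  qed
  then show "\<exists>no. \<forall>n\<ge>no. norm (avg (1 / real (Suc n)) x - u K x) < r" by blast
qed

lemma compact_KS: "K \<in> \<T> \<Longrightarrow> compact (K \<inter> S)" and borel_KS: "K \<in> \<T> \<Longrightarrow> K \<inter> S \<in> sets borel"
  using compact_T S(2) by (auto simp: compact_Int borel_compact)

lemma finite_KS: "K \<in> \<T> \<Longrightarrow> finite_measure (vol_measure (K \<inter> S))"
  by (rule vol_measure_compact(1)[OF compact_KS])

lemma AE_KS: "K \<in> \<T> \<Longrightarrow> AE x in vol_measure (K \<inter> S). x \<in> K \<inter> S"
  by (rule AE_vol_measure[OF borel_KS])

lemma AE_interior_KS: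
  assumes K: "K \<in> \<T>"
  shows "AE x in vol_measure (K \<inter> S). x \<in> S \<and> x \<in> interior K"
proof -
  have "K - interior K \<in> null_sets lborel"
    using frontier_T_negligible[OF K] borel_T[OF K] by (simp add: negligible_iff_emeasure0 null_sets_def)
  then have "AE x in lborel. x \<notin> K - interior K" by (rule AE_not_in)
  then have "AE x in vol_measure (K \<inter> S). x \<notin> K - interior K"
    unfolding vol_measure_def using borel_KS[OF K] by (subst AE_density) (auto elim!: eventually_mono)
  then show ?thesis using AE_KS[OF K] by eventually_elim auto
qed

text \<open>The difference between u and its mean is estimated by duality against a piecewise
  polynomial v. The family of elements is a parameter, so that v can live on all elements or on the
  boundary layer.\<close>

definition pairing where "pairing \<K> v s = (\<Sum>K\<in>\<K>. LINT x|vol_measure (K \<inter> S). v K x * avg s x)"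
definition pairing' where "pairing' \<K> v s = (\<Sum>K\<in>\<K>. LINT x|vol_measure (K \<inter> S). v K x * avg' s x)"

lemma v_bound:
  assumes "K \<in> \<T>" "v \<in> Poly k"
  obtains V where "0 \<le> V" "\<And>x. x \<in> K \<Longrightarrow> \<bar>v x\<bar> \<le> V"
proof -
  have "bounded (v ` K)" using Poly_continuous[OF assms(2)] compact_T[OF assms(1)]
    by (intro compact_imp_bounded compact_continuous_image) (auto intro: continuous_on_subset)
  then obtain V where V: "\<And>x. x \<in> K \<Longrightarrow> \<bar>v x\<bar> \<le> V" by (auto simp: bounded_iff)
  show ?thesis by (rule that[of "max V 0"]) (use V in \<open>auto intro: le_max_iff_disj[THEN iffD2]\<close>)
qed

lemma DERIV_pairing:
  assumes e: "0 < s" and KK: "\<K> \<subseteq> \<T>" and v: "\<And>K. K \<in> \<K> \<Longrightarrow> v K \<in> Poly k"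
  shows "DERIV (pairing \<K> v) s :> - pairing' \<K> v s"
proof -
  obtain U where U: "0 \<le> U" "\<And>K z. K \<in> \<T> \<Longrightarrow> z \<in> K \<Longrightarrow> \<bar>u K z\<bar> \<le> U" using u_bound by blast
  obtain R where R: "0 \<le> R" "\<And>K x z. K \<in> \<T> \<Longrightarrow> z \<in> K \<Longrightarrow> norm (z - x) \<le> R + norm x" using radius_bound by metis
  obtain Q where Q: "\<And>x. x \<in> S \<Longrightarrow> norm x \<le> Q" using compact_imp_bounded[OF S(2)] unfolding bounded_iff by blast
  obtain B where B: "0 \<le> B" "\<And>s x. 0 < s \<Longrightarrow> \<bar>avg s x\<bar> \<le> B" using avg_bound by blast
  define P where "P = (\<Sum>K\<in>\<T>. measure (vol_measure K) UNIV * (U * ((1 / (s/2)) ^ (CARD('d) + 1) * (real CARD('d) * W + (1 / (s/2)) * (L * (R + \<bar>Q\<bar>))))))"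
  have IIb: "\<bar>avg' t x\<bar> \<le> P" if t: "s / 2 \<le> t" and x: "x \<in> S" for t x
    unfolding avg'_def P_def
  proof (rule order_trans[OF sum_abs], rule sum_mono)
    fix K assume K: "K \<in> \<T>"
    interpret finite_measure "vol_measure K" by (rule vol_measure_compact(1)[OF compact_T[OF K]])
    have "\<bar>LINT z|vol_measure K. u K z * (\<Sum>i\<in>UNIV. gk t x i z $ i)\<bar> \<le> measure (vol_measure K) (space (vol_measure K)) *
      (U * ((1 / (s/2)) ^ (CARD('d) + 1) * (real CARD('d) * W + (1 / (s/2)) * (L * (R + \<bar>Q\<bar>)))))"
    proof (rule integral_le_bound_on[OF _ AE_vol_measure[OF borel_T[OF K]]])
      show "(\<lambda>z. u K z * (\<Sum>i\<in>UNIV. gk t x i z $ i)) \<in> borel_measurable (vol_measure K)"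
        using udiv_measurable[OF K, of t x] by simp
      fix z assume z: "z \<in> K"
      have "norm (z - x) \<le> R + \<bar>Q\<bar>" using R(2)[OF K z, of x] Q[OF x] by linarith
      then show "\<bar>u K z * (\<Sum>i\<in>UNIV. gk t x i z $ i)\<bar> \<le> U * ((1 / (s/2)) ^ (CARD('d) + 1) * (real CARD('d) * W + (1 / (s/2)) * (L * (R + \<bar>Q\<bar>))))"
        unfolding abs_mult by (intro mult_mono U(2)[OF K z] div_kk_bound) (use t e R(1) U(1) in auto)
    qed
    then show "\<bar>LINT z|vol_measure K. u K z * (\<Sum>i\<in>UNIV. gk t x i z $ i)\<bar> \<le> measure (vol_measure K) UNIV *
      (U * ((1 / (s/2)) ^ (CARD('d) + 1) * (real CARD('d) * W + (1 / (s/2)) * (L * (R + \<bar>Q\<bar>)))))" by simp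
  qed
  have "DERIV (\<lambda>t. LINT x|vol_measure (K \<inter> S). v K x * avg t x) s :> (LINT x|vol_measure (K \<inter> S). v K x * - avg' s x)" if KK': "K \<in> \<K>" for K
  proof -
    have K: "K \<in> \<T>" using KK KK' by blast
    obtain V where V: "0 \<le> V" "\<And>x. x \<in> K \<Longrightarrow> \<bar>v K x\<bar> \<le> V" using v_bound[OF K v[OF KK']] by blast
    have vm: "v K \<in> borel_measurable borel" using Poly_continuous[OF v[OF KK']] by (rule borel_measurable_continuous_onI)
    show ?thesis
    proof (rule DERIV_integral[where r = "s / 2" and X = "K \<inter> S" and B = "V * P" and f' = "\<lambda>t x. v K x * - avg' t x"])
      show "finite_measure (vol_measure (K \<inter> S))" by (rule finite_KS[OF K])
      show "AE x in vol_measure (K \<inter> S). x \<in> K \<inter> S" by (rule AE_KS[OF K])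
      show "(\<lambda>x. v K x * - avg' s x) \<in> borel_measurable (vol_measure (K \<inter> S))"
        using vm avg'_measurable by simp
      show "0 < s / 2" using e by simp
      fix t assume "\<bar>t - s\<bar> < s / 2"
      then have t: "s / 2 \<le> t" "0 < t" using e by linarith+
      show "integrable (vol_measure (K \<inter> S)) (\<lambda>x. v K x * avg t x)"
      proof (rule finite_measure.integrable_bounded_on[OF finite_KS[OF K] _ AE_KS[OF K]])
        show "(\<lambda>x. v K x * avg t x) \<in> borel_measurable (vol_measure (K \<inter> S))" using vm avg_measurable by simp
        show "\<bar>v K x * avg t x\<bar> \<le> V * B" if "x \<in> K \<inter> S" for x
          unfolding abs_mult using V B(2)[OF t(2)] that by (intro mult_mono) auto
      qed
      fix x assume x: "x \<in> K \<inter> S"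
      show "DERIV (\<lambda>t. v K x * avg t x) t :> v K x * - avg' t x" by (rule DERIV_cmult[OF DERIV_avg[OF t(2)]])
      show "\<bar>v K x * - avg' t x\<bar> \<le> V * P"
        unfolding abs_mult abs_minus_cancel using V IIb[OF t(1)] x by (intro mult_mono) auto
    qed
  qed
  then have "DERIV (\<lambda>t. \<Sum>K\<in>\<K>. LINT x|vol_measure (K \<inter> S). v K x * avg t x) s :> (\<Sum>K\<in>\<K>. LINT x|vol_measure (K \<inter> S). v K x * - avg' s x)"
    by (rule DERIV_sum)
  then show ?thesis by (simp add: pairing_def[abs_def] pairing'_def sum_negf)
qed

lemma pairing_tendsto:
  assumes KK: "\<K> \<subseteq> \<T>" and v: "\<And>K. K \<in> \<K> \<Longrightarrow> v K \<in> Poly k"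
  shows "(\<lambda>j. pairing \<K> v (1 / Suc j)) \<longlonglongrightarrow> (\<Sum>K\<in>\<K>. LINT x|vol_measure (K \<inter> S). v K x * u K x)"
  unfolding pairing_def
proof (rule tendsto_sum)
  fix K assume KK': "K \<in> \<K>"
  then have K: "K \<in> \<T>" using KK by blast
  obtain B where B: "0 \<le> B" "\<And>s x. 0 < s \<Longrightarrow> \<bar>avg s x\<bar> \<le> B" using avg_bound by blast
  obtain V where V: "0 \<le> V" "\<And>x. x \<in> K \<Longrightarrow> \<bar>v K x\<bar> \<le> V" using v_bound[OF K v[OF KK']] by blast
  have vm: "v K \<in> borel_measurable borel" using Poly_continuous[OF v[OF KK']] by (rule borel_measurable_continuous_onI)
  interpret finite_measure "vol_measure (K \<inter> S)" by (rule finite_KS[OF K])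
  show "(\<lambda>j. LINT x|vol_measure (K \<inter> S). v K x * avg (1 / Suc j) x) \<longlonglongrightarrow> (LINT x|vol_measure (K \<inter> S). v K x * u K x)"
  proof (rule integral_dominated_convergence[where w = "\<lambda>_. V * B"])
    show "(\<lambda>x. v K x * u K x) \<in> borel_measurable (vol_measure (K \<inter> S))" using vm u_measurable[OF K] by simp
    show "(\<lambda>x. v K x * avg (1 / Suc j) x) \<in> borel_measurable (vol_measure (K \<inter> S))" for j using vm avg_measurable by simp
    show "AE x in vol_measure (K \<inter> S). (\<lambda>j. v K x * avg (1 / Suc j) x) \<longlonglongrightarrow> v K x * u K x"
      using AE_interior_KS[OF K] by eventually_elim (intro tendsto_intros avg_tendsto[OF _ _ K], auto)
    show "AE x in vol_measure (K \<inter> S). norm (v K x * avg (1 / Suc j) x) \<le> V * B" for j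
      using AE_KS[OF K]
    proof eventually_elim
      case (elim x)
      then show ?case unfolding real_norm_def abs_mult using V B(2)[of "1 / Suc j" x] by (intro mult_mono) auto
    qed
  qed simp
qed

lemma pairing_1:
  assumes KK: "\<K> \<subseteq> \<T>"
  shows "pairing \<K> v 1 = (\<Sum>K\<in>\<K>. LINT x|vol_measure (K \<inter> S). v K x * cS)"
  by (simp add: pairing_def avg_1)

end

text \<open>Both g - f and g + f are nondecreasing. With an explicit antiderivative g, this takes
  the place of integrating the derivative of the pairing over s.\<close>

lemma DERIV_dominated_le:
  fixes f g :: "real \<Rightarrow> real"
  assumes "a \<le> b" and f: "\<And>x. a \<le> x \<Longrightarrow> x \<le> b \<Longrightarrow> DERIV f x :> f' x"
    and g: "\<And>x. a \<le> x \<Longrightarrow> x \<le> b \<Longrightarrow> DERIV g x :> g' x"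
    and le: "\<And>x. a \<le> x \<Longrightarrow> x \<le> b \<Longrightarrow> \<bar>f' x\<bar> \<le> g' x"
  shows "\<bar>f b - f a\<bar> \<le> g b - g a"
proof -
  have "g a - f a \<le> g b - f b"
    by (rule DERIV_nonneg_imp_nondecreasing[OF assms(1)]) (use f g le in \<open>force intro!: exI DERIV_diff simp: abs_le_iff\<close>)
  moreover have "g a + f a \<le> g b + f b"
  proof (rule DERIV_nonneg_imp_nondecreasing[OF assms(1)])
    fix x assume x: "a \<le> x" "x \<le> b"
    then have "0 \<le> g' x + f' x" using le[OF x] by linarith
    then show "\<exists>y. DERIV (\<lambda>x. g x + f x) x :> y \<and> 0 \<le> y" using DERIV_add[OF g[OF x] f[OF x]] by blast
  qed
  ultimately show ?thesis by linarith
qed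

section \<open>Scales above the mesh size\<close>

context hdg_kernel
begin

definition pt :: "(real^'d) set \<Rightarrow> real^'d" where "pt K = (SOME z. z \<in> K)"

lemma pt: "K \<in> \<T> \<Longrightarrow> pt K \<in> K"
  unfolding pt_def using interior_T_nonempty interior_subset by (metis some_in_eq subset_empty)

definition C0 where "C0 = D * W"
definition C1c where "C1c = D * L + W"

lemma C0_nonneg: "0 \<le> C0" and C1c_nonneg: "0 \<le> C1c"
  using D_pos W_nonneg L_nonneg by (auto simp: C0_def C1c_def)

text \<open>For scales s \<ge> h this ball contains every x whose kernel field meets K: the support
  has radius D s, and K lies within h \<le> s of its chosen point. \<open>cL\<close> bounds the
  contribution of K to \<open>avg'\<close> at such points.\<close>

definition Bq where "Bq s K = cball (pt K) ((D + 1) * s)"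
definition cL where "cL s K = aK K * (C1c * h / s ^ (CARD('d) + 1)) + bK K * (C0 / s ^ CARD('d))"

lemma cL_nonneg: "0 < s \<Longrightarrow> 0 \<le> cL s K"
  using aK_nonneg bK_nonneg C0_nonneg C1c_nonneg h_pos by (simp add: cL_def)

lemma kk_off: "x \<in> S \<Longrightarrow> 0 < s \<Longrightarrow> s \<le> 1 \<Longrightarrow> z \<notin> \<Omega> \<Longrightarrow> kk s x z = 0"
  using kk_supp(1) interior_S_sub by blast

text \<open>The constant subtracted on K is the kernel field at the chosen point of K; the Lipschitz
  bound controls the remainder. The indicators keep the information which elements act on which
  points, for the counting that follows.\<close>

lemma avg'_le_osc:
  assumes x: "x \<in> S" and e: "0 < s" "s \<le> 1" and he: "h \<le> s"
  shows "\<bar>avg' s x\<bar> \<le> (\<Sum>K\<in>\<T>. cL s K * indicator (Bq s K) x)"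
proof -
  have near: "x \<in> Bq s K" if K: "K \<in> \<T>" and z: "z \<in> K" and nz: "kk s x z \<noteq> 0" for K z
  proof -
    have "dist (pt K) x \<le> dist (pt K) z + dist z x" by (rule dist_triangle)
    also have "\<dots> \<le> h + D * s" using dist_le_h[OF K pt[OF K] z] kk_supp(2)[OF x e nz] by (simp add: dist_norm)
    also have "\<dots> \<le> (D + 1) * s" using he by (simp add: distrib_right)
    finally show ?thesis by (simp add: Bq_def)
  qed
  have "\<bar>avg' s x\<bar> \<le> (\<Sum>K\<in>\<T>. aK K * (C1c * h / s ^ (CARD('d) + 1) * indicator (Bq s K) x) + bK K * norm (kk s x (pt K)))"
    unfolding avg'_def
  proof (rule weak_divergence_le_osc[OF C1_kk kk_off[OF x e]])
    fix K z assume K: "K \<in> \<T>" "z \<in> K"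
    show "norm (kk s x z - kk s x (pt K)) \<le> C1c * h / s ^ (CARD('d) + 1) * indicator (Bq s K) x"
    proof (cases "x \<in> Bq s K")
      case True
      have "norm (kk s x z - kk s x (pt K)) \<le> (D * L + W) * norm (z - pt K) / s ^ (CARD('d) + 1)" by (rule kk_lipschitz[OF x e])
      also have "\<dots> \<le> C1c * h / s ^ (CARD('d) + 1)"
        using dist_le_h[OF K(1) K(2) pt[OF K(1)]] e D_pos L_nonneg W_nonneg unfolding C1c_def
        by (intro divide_right_mono mult_left_mono) (auto simp: dist_norm)
      finally show ?thesis using True by simp
    next
      case False
      then have "kk s x z = 0" "kk s x (pt K) = 0" using near[OF K] near[OF K(1) pt[OF K(1)]] by blast+
      then show ?thesis using False by simp
    qed
  qed
  also have "\<dots> \<le> (\<Sum>K\<in>\<T>. cL s K * indicator (Bq s K) x)"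
  proof (rule sum_mono)
    fix K assume K: "K \<in> \<T>"
    have "norm (kk s x (pt K)) \<le> C0 / s ^ CARD('d) * indicator (Bq s K) x"
    proof (cases "x \<in> Bq s K")
      case True
      then show ?thesis using kk_le[OF x e, of "pt K"] by (simp add: C0_def)
    next
      case False
      then have "kk s x (pt K) = 0" using near[OF K pt[OF K]] by blast
      then show ?thesis using False by simp
    qed
    then have "bK K * norm (kk s x (pt K)) \<le> bK K * (C0 / s ^ CARD('d) * indicator (Bq s K) x)"
      by (rule mult_left_mono) (rule bK_nonneg)
    then show "aK K * (C1c * h / s ^ (CARD('d) + 1) * indicator (Bq s K) x) + bK K * norm (kk s x (pt K)) \<le> cL s K * indicator (Bq s K) x"
      unfolding cL_def by (simp add: distrib_right mult.assoc)
  qed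
  finally show ?thesis .
qed

text \<open>The term with \<open>aK\<close> scales like h^(d-1) h^2 / s^(2d+2), the one with
  \<open>bK\<close> like h^d / s^(2d). Their ratio is h/s^2: the oscillation gains (h/s)^2 and the
  unweighted jumps lose 1/h.\<close>

lemma cL_sq_le:
  assumes K: "K \<in> \<T>" and e: "0 < s"
  shows "(cL s K)\<^sup>2 \<le> 2 * (CA * C1c\<^sup>2 + 2 ^ CARD('d) * C0\<^sup>2) * (h ^ CARD('d) / s ^ (2 * CARD('d))) * (h / s\<^sup>2 + 1) * en K"
proof -
  let ?d = "CARD('d)"
  have hd: "h ^ (?d - 1) * h\<^sup>2 = h ^ ?d * h"
  proof -
    have "h ^ ?d = h * h ^ (?d - 1)" by (subst power_Suc[symmetric]) simp
    then show ?thesis by (simp add: power2_eq_square)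
  qed
  have ed2: "(s ^ ?d)\<^sup>2 = s ^ (2 * ?d)" by (simp add: power_mult[symmetric] mult.commute)
  have "(s ^ (?d + 1))\<^sup>2 = (s ^ ?d)\<^sup>2 * s\<^sup>2" unfolding power_add power_mult_distrib by simp
  note ed = this[unfolded ed2] ed2
  have 1: "(aK K * (C1c * h / s ^ (?d + 1)))\<^sup>2 \<le> (CA * C1c\<^sup>2) * (h ^ ?d / s ^ (2 * ?d)) * (h / s\<^sup>2) * en K"
  proof -
    have "(aK K * (C1c * h / s ^ (?d + 1)))\<^sup>2 = (aK K)\<^sup>2 * (C1c\<^sup>2 * h\<^sup>2 / (s ^ (?d + 1))\<^sup>2)"
      by (simp add: power_mult_distrib power_divide)
    also have "\<dots> \<le> (CA * h ^ (?d - 1) * en K) * (C1c\<^sup>2 * h\<^sup>2 / (s ^ (?d + 1))\<^sup>2)"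
      by (rule mult_right_mono[OF aK_sq_le[OF K]]) simp
    also have "\<dots> = CA * C1c\<^sup>2 * (h ^ (?d - 1) * h\<^sup>2) * en K / (s ^ (2 * ?d) * s\<^sup>2)" unfolding ed by simp
    also have "\<dots> = (CA * C1c\<^sup>2) * (h ^ ?d / s ^ (2 * ?d)) * (h / s\<^sup>2) * en K" unfolding hd by simp
    finally show ?thesis .
  qed
  have 2: "(bK K * (C0 / s ^ ?d))\<^sup>2 \<le> (2 ^ ?d * C0\<^sup>2) * (h ^ ?d / s ^ (2 * ?d)) * 1 * en K"
  proof -
    have "(bK K * (C0 / s ^ ?d))\<^sup>2 = (bK K)\<^sup>2 * (C0\<^sup>2 / (s ^ ?d)\<^sup>2)" by (simp add: power_mult_distrib power_divide)
    also have "\<dots> \<le> ((2 * h) ^ ?d * en K) * (C0\<^sup>2 / (s ^ ?d)\<^sup>2)"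
      by (rule mult_right_mono[OF bK_sq_le_en[OF K]]) simp
    finally show ?thesis unfolding ed by (simp add: power_mult_distrib mult_ac)
  qed
  let ?X = "CA * C1c\<^sup>2" and ?Y = "2 ^ ?d * C0\<^sup>2" and ?h = "h ^ ?d / s ^ (2 * ?d)" and ?q = "h / s\<^sup>2"
  have avg: "0 \<le> ?X" "0 \<le> ?Y" "0 \<le> ?h" "0 \<le> ?q" "0 \<le> en K"
    using CA_nonneg h_pos e en_nonneg by auto
  have "(cL s K)\<^sup>2 \<le> 2 * (aK K * (C1c * h / s ^ (?d + 1)))\<^sup>2 + 2 * (bK K * (C0 / s ^ ?d))\<^sup>2"
    using sum_squares_bound[of "aK K * (C1c * h / s ^ (?d + 1))" "bK K * (C0 / s ^ ?d)"] by (simp add: cL_def power2_sum)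
  also have "\<dots> \<le> 2 * (?X * ?h * ?q * en K) + 2 * (?Y * ?h * 1 * en K)"
    using 1 2 by (intro add_mono mult_left_mono) auto
  also have "\<dots> \<le> 2 * (?X + ?Y) * ?h * (?q + 1) * en K"
  proof -
    have "2 * (X * H * q * n) + 2 * (Y * H * 1 * n) \<le> 2 * (X + Y) * H * (q + 1) * n"
      if "0 \<le> X" "0 \<le> Y" "0 \<le> H" "0 \<le> q" "0 \<le> n" for X Y H q n :: real
    proof -
      have "0 \<le> 2 * (X * H * n) + 2 * (Y * H * q * n)" using that by simp
      then show ?thesis by (simp add: algebra_simps)
    qed
    then show ?thesis using avg by blast
  qed
  finally show ?thesis .
qed

lemma E_sq: "E\<^sup>2 = (\<Sum>K\<in>\<T>. en K)"
  unfolding E_def by (rule real_sqrt_pow2) (simp add: sum_nonneg en_nonneg)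

lemma E_nonneg: "0 \<le> E"
  by (simp add: E_def sum_nonneg en_nonneg)

definition X2 :: "(real^'d) set set \<Rightarrow> ((real^'d) set \<Rightarrow> real^'d \<Rightarrow> real) \<Rightarrow> real" where "X2 \<K> v = (\<Sum>K\<in>\<K>. LINT x|vol_measure K. (v K x)\<^sup>2)"

lemma X2_nonneg: "0 \<le> X2 \<K> v"
  unfolding X2_def by (intro sum_nonneg Bochner_Integration.integral_nonneg) simp

text \<open>The three factors come from the layer volume in a ball of radius (D + 1) s, from
  \<open>cL_sq_le\<close>, and from the number of balls \<open>Bq s K\<close> that can contain a
  given point.\<close>

definition CL where "CL = (D + 1) ^ (CARD('d) - 1) * (2 * (CA * C1c\<^sup>2 + 2 ^ CARD('d) * C0\<^sup>2)) * ((2 * (D + 2)) ^ CARD('d) / cvol)"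

lemma CL_nonneg: "0 \<le> CL"
  using D_pos CA_nonneg cvol_pos by (auto simp: CL_def intro!: mult_nonneg_nonneg)

lemma KS_integrable:
  assumes "K \<in> \<T>" "f \<in> borel_measurable borel" "\<And>x. x \<in> K \<inter> S \<Longrightarrow> \<bar>f x\<bar> \<le> B"
  shows "integrable (vol_measure (K \<inter> S)) (f :: _ \<Rightarrow> real)"
  by (rule finite_measure.integrable_bounded_on[OF finite_KS[OF assms(1)] _ AE_KS[OF assms(1)] assms(3)]) (use assms(2) in auto)

lemma K_integrable:
  assumes "K \<in> \<T>" "f \<in> borel_measurable borel" "\<And>x. x \<in> K \<Longrightarrow> \<bar>f x\<bar> \<le> B"
  shows "integrable (vol_measure K) (f :: _ \<Rightarrow> real)"
  by (rule finite_measure.integrable_bounded_on[OF vol_measure_compact(1)[OF compact_T[OF assms(1)]] _ AE_vol_measure[OF borel_T[OF assms(1)]] assms(3)])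
     (use assms(2) in auto)

lemma integral_KS_le_K:
  assumes K: "K \<in> \<T>" and f: "f \<in> borel_measurable borel" "\<And>x. x \<in> K \<Longrightarrow> \<bar>f x\<bar> \<le> B" "\<And>x. 0 \<le> (f x :: real)"
  shows "(LINT x|vol_measure (K \<inter> S). f x) \<le> (LINT x|vol_measure K. f x)"
proof -
  have i: "integrable lborel (\<lambda>x. indicator K x * f x)"
  proof (rule integrable_bounded_support[OF _ bounded_T[OF K], where B = "max B 0"])
    show "(\<lambda>x. indicator K x * f x) \<in> borel_measurable borel" using borel_T[OF K] f(1) by measurable
    show "\<bar>indicator K x * f x\<bar> \<le> max B 0" for x using f(2)[of x] by (auto simp: indicator_def)
  qed auto
  have "(LINT x|vol_measure (K \<inter> S). f x) = (LINT x|lborel. indicator (K \<inter> S) x * f x)"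
    by (rule integral_vol_measure[OF borel_KS[OF K] f(1)])
  also have "\<dots> \<le> (LINT x|lborel. indicator K x * f x)"
    using i f(3) by (intro integral_mono') (auto simp: indicator_def)
  also have "\<dots> = (LINT x|vol_measure K. f x)" by (rule integral_vol_measure[OF borel_T[OF K] f(1), symmetric])
  finally show ?thesis .
qed

lemma pairing'_le:
  assumes KK: "\<K> \<subseteq> \<T>" and v: "\<And>K. K \<in> \<K> \<Longrightarrow> v K \<in> Poly k"
    and le: "\<And>x. x \<in> S \<Longrightarrow> \<bar>avg' s x\<bar> \<le> R x" and R: "R \<in> borel_measurable borel" "\<And>x. x \<in> S \<Longrightarrow> R x \<le> B"
  shows "\<bar>pairing' \<K> v s\<bar> \<le> (\<Sum>K\<in>\<K>. LINT x|vol_measure (K \<inter> S). \<bar>v K x\<bar> * R x)"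
  unfolding pairing'_def
proof (rule order_trans[OF sum_abs], rule sum_mono)
  fix K assume KK': "K \<in> \<K>"
  then have K: "K \<in> \<T>" using KK by blast
  obtain V where V: "0 \<le> V" "\<And>x. x \<in> K \<Longrightarrow> \<bar>v K x\<bar> \<le> V" using v_bound[OF K v[OF KK']] by blast
  have vm[measurable]: "v K \<in> borel_measurable borel" using Poly_continuous[OF v[OF KK']] by (rule borel_measurable_continuous_onI)
  note [measurable] = avg'_measurable R(1)
  have Rb: "\<bar>R x\<bar> \<le> B" "\<bar>avg' s x\<bar> \<le> B" if "x \<in> K \<inter> S" for x using le[of x] R(2)[of x] that by auto
  have "\<bar>LINT x|vol_measure (K \<inter> S). v K x * avg' s x\<bar> \<le> (LINT x|vol_measure (K \<inter> S). \<bar>v K x * avg' s x\<bar>)" by (rule integral_abs_bound)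
  also have "\<dots> \<le> (LINT x|vol_measure (K \<inter> S). \<bar>v K x\<bar> * R x)"
  proof (rule integral_mono_AE)
    show "integrable (vol_measure (K \<inter> S)) (\<lambda>x. \<bar>v K x * avg' s x\<bar>)"
      by (rule KS_integrable[OF K, where B = "V * B"], measurable) (use V Rb in \<open>auto simp: abs_mult intro!: mult_mono\<close>)
    show "integrable (vol_measure (K \<inter> S)) (\<lambda>x. \<bar>v K x\<bar> * R x)"
      by (rule KS_integrable[OF K, where B = "V * B"], measurable) (use V Rb in \<open>auto simp: abs_mult intro!: mult_mono\<close>)
    show "AE x in vol_measure (K \<inter> S). \<bar>v K x * avg' s x\<bar> \<le> \<bar>v K x\<bar> * R x"
      using AE_KS[OF K] by eventually_elim (auto simp: abs_mult intro!: mult_left_mono le)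
  qed
  finally show "\<bar>LINT x|vol_measure (K \<inter> S). v K x * avg' s x\<bar> \<le> (LINT x|vol_measure (K \<inter> S). \<bar>v K x\<bar> * R x)" .
qed

text \<open>Cauchy-Schwarz is used twice: on each ball \<open>Bq s K\<close>, where the layer
  hypothesis gives a volume of order \<delta> s^(d-1), and over the elements, where each point is in
  at most of order (s/h)^d balls. With h^d / s^(2d) from \<open>cL_sq_le\<close> the powers combine
  to \<delta>/s. The square root of the remaining factor is integrable over s from h to 1, uniformly
  in h.\<close>

lemma pairing'_large:
  assumes KK: "\<K> \<subseteq> \<T>" and v: "\<And>K. K \<in> \<K> \<Longrightarrow> v K \<in> Poly k" and e: "0 < s" "s \<le> 1" and he: "h \<le> s" and \<delta>: "0 \<le> \<delta>"
    and layer: "\<And>z r. 0 < r \<Longrightarrow> r \<le> D + 1 \<Longrightarrow> (\<Sum>K\<in>\<K>. measure lebesgue (K \<inter> S \<inter> cball z r)) \<le> \<delta> * r ^ (CARD('d) - 1)"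
  shows "(pairing' \<K> v s)\<^sup>2 \<le> CL * \<delta> * ((h / s\<^sup>2 + 1) / s) * E\<^sup>2 * X2 \<K> v"
proof -
  let ?d = "CARD('d)"
  have fin: "finite \<K>" using KK finite_T finite_subset by blast
  have vm: "v K \<in> borel_measurable borel" if "K \<in> \<K>" for K using Poly_continuous[OF v[OF that]] by (rule borel_measurable_continuous_onI)
  have Bm: "Bq s K \<in> sets borel" for K by (simp add: Bq_def)
  \<comment> \<open>\<open>t K\<close> is what the ball of K sees of v in L1, and
    \<open>Vq K\<close> what it sees of v squared. The former is localized to S, whereas the latter
    is taken over whole elements.\<close>
  define t where "t K = (\<Sum>K'\<in>\<K>. LINT x|vol_measure (K' \<inter> S). \<bar>v K' x\<bar> * indicator (Bq s K) x)" for K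
  define Vq where "Vq K = (\<Sum>K'\<in>\<K>. LINT x|vol_measure K'. (v K' x)\<^sup>2 * indicator (Bq s K) x)" for K
  have Vq0: "0 \<le> Vq K" for K unfolding Vq_def by (intro sum_nonneg Bochner_Integration.integral_nonneg) (auto simp: indicator_def)
  have "\<bar>pairing' \<K> v s\<bar> \<le> (\<Sum>K'\<in>\<K>. LINT x|vol_measure (K' \<inter> S). \<bar>v K' x\<bar> * (\<Sum>K\<in>\<T>. cL s K * indicator (Bq s K) x))"
  proof (rule pairing'_le[OF KK v])
    show "\<bar>avg' s x\<bar> \<le> (\<Sum>K\<in>\<T>. cL s K * indicator (Bq s K) x)" if "x \<in> S" for x by (rule avg'_le_osc[OF that e he])
    show "(\<lambda>x. \<Sum>K\<in>\<T>. cL s K * indicator (Bq s K) x) \<in> borel_measurable borel" using Bm by measurable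
    show "(\<Sum>K\<in>\<T>. cL s K * indicator (Bq s K) x) \<le> (\<Sum>K\<in>\<T>. cL s K)" for x
      using cL_nonneg[OF e(1)] by (intro sum_mono) (auto simp: indicator_def)
  qed
  also have "\<dots> = (\<Sum>K'\<in>\<K>. \<Sum>K\<in>\<T>. cL s K * (LINT x|vol_measure (K' \<inter> S). \<bar>v K' x\<bar> * indicator (Bq s K) x))"
  proof (rule sum.cong[OF refl])
    fix K' assume KK': "K' \<in> \<K>"
    then have K': "K' \<in> \<T>" using KK by blast
    obtain V where V: "0 \<le> V" "\<And>x. x \<in> K' \<Longrightarrow> \<bar>v K' x\<bar> \<le> V" using v_bound[OF K' v[OF KK']] by blast
    have int: "integrable (vol_measure (K' \<inter> S)) (\<lambda>x. \<bar>v K' x\<bar> * indicator (Bq s K) x)" for K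
    proof (rule KS_integrable[OF K', where B = V])
      show "(\<lambda>x. \<bar>v K' x\<bar> * indicator (Bq s K) x) \<in> borel_measurable borel" using vm[OF KK'] Bm by measurable
      show "\<bar>\<bar>v K' x\<bar> * indicator (Bq s K) x\<bar> \<le> V" if "x \<in> K' \<inter> S" for x using V that by (auto simp: indicator_def)
    qed
    have "(LINT x|vol_measure (K' \<inter> S). \<bar>v K' x\<bar> * (\<Sum>K\<in>\<T>. cL s K * indicator (Bq s K) x))
      = (LINT x|vol_measure (K' \<inter> S). (\<Sum>K\<in>\<T>. cL s K * (\<bar>v K' x\<bar> * indicator (Bq s K) x)))"
      by (intro Bochner_Integration.integral_cong) (auto simp: sum_distrib_left mult_ac)
    then show "(LINT x|vol_measure (K' \<inter> S). \<bar>v K' x\<bar> * (\<Sum>K\<in>\<T>. cL s K * indicator (Bq s K) x))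
      = (\<Sum>K\<in>\<T>. cL s K * (LINT x|vol_measure (K' \<inter> S). \<bar>v K' x\<bar> * indicator (Bq s K) x))"
      using int by simp
  qed
  also have "\<dots> = (\<Sum>K\<in>\<T>. cL s K * t K)" unfolding t_def sum_distrib_left by (rule sum.swap)
  also have "\<dots> \<le> (\<Sum>K\<in>\<T>. cL s K * (sqrt (\<delta> * ((D + 1) * s) ^ (?d - 1)) * sqrt (Vq K)))"
  proof (intro sum_mono mult_left_mono cL_nonneg[OF e(1)])
    fix K
    have "t K \<le> (\<Sum>K'\<in>\<K>. sqrt (measure lebesgue (K' \<inter> S \<inter> Bq s K)) * sqrt (LINT x|vol_measure K'. (v K' x)\<^sup>2 * indicator (Bq s K) x))"
      unfolding t_def
    proof (rule sum_mono)
      fix K' assume KK': "K' \<in> \<K>"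
      then have K': "K' \<in> \<T>" using KK by blast
      note [measurable] = vm[OF KK'] Bm
      obtain V where V: "0 \<le> V" "\<And>x. x \<in> K' \<Longrightarrow> \<bar>v K' x\<bar> \<le> V" using v_bound[OF K' v[OF KK']] by blast
      let ?i = "indicator (Bq s K) :: _ \<Rightarrow> real"
      have V2: "(v K' x)\<^sup>2 \<le> V\<^sup>2" if "x \<in> K'" for x using V(2)[OF that] V(1) by (metis abs_le_square_iff abs_of_nonneg)
      have "\<bar>LINT x|vol_measure (K' \<inter> S). ?i x * (\<bar>v K' x\<bar> * ?i x)\<bar> \<le> sqrt (LINT x|vol_measure (K' \<inter> S). (?i x)\<^sup>2) * sqrt (LINT x|vol_measure (K' \<inter> S). (\<bar>v K' x\<bar> * ?i x)\<^sup>2)"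
      proof (rule Cauchy_Schwarz_integral_abs)
        show "integrable (vol_measure (K' \<inter> S)) (\<lambda>x. (?i x)\<^sup>2)"
          by (rule KS_integrable[OF K', where B = 1], measurable) (auto simp: indicator_def)
        show "integrable (vol_measure (K' \<inter> S)) (\<lambda>x. (\<bar>v K' x\<bar> * ?i x)\<^sup>2)"
          by (rule KS_integrable[OF K', where B = "V\<^sup>2"], measurable) (use V2 in \<open>auto simp: indicator_def\<close>)
        show "integrable (vol_measure (K' \<inter> S)) (\<lambda>x. ?i x * (\<bar>v K' x\<bar> * ?i x))"
          by (rule KS_integrable[OF K', where B = V], measurable) (use V in \<open>auto simp: indicator_def\<close>)
      qed
      moreover have "(LINT x|vol_measure (K' \<inter> S). ?i x * (\<bar>v K' x\<bar> * ?i x)) = (LINT x|vol_measure (K' \<inter> S). \<bar>v K' x\<bar> * ?i x)"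
        by (intro Bochner_Integration.integral_cong) (auto simp: indicator_def)
      moreover have "(LINT x|vol_measure (K' \<inter> S). (?i x)\<^sup>2) = measure lebesgue (K' \<inter> S \<inter> Bq s K)"
      proof -
        have "(LINT x|vol_measure (K' \<inter> S). (?i x)\<^sup>2) = (LINT x|vol_measure (K' \<inter> S). ?i x)"
          by (intro Bochner_Integration.integral_cong) (auto simp: indicator_def)
        also have "\<dots> = measure (vol_measure (K' \<inter> S)) (Bq s K)" using Bm by simp
        also have "\<dots> = measure lborel (K' \<inter> S \<inter> Bq s K)"
          using emeasure_vol_measure[OF borel_KS[OF K'] Bm] by (simp add: measure_def)
        finally show ?thesis using borel_KS[OF K'] Bm by (simp add: measure_completion)
      qed
      moreover have "(LINT x|vol_measure (K' \<inter> S). (\<bar>v K' x\<bar> * ?i x)\<^sup>2) \<le> (LINT x|vol_measure K'. (v K' x)\<^sup>2 * ?i x)"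
      proof -
        have "(LINT x|vol_measure (K' \<inter> S). (\<bar>v K' x\<bar> * ?i x)\<^sup>2) = (LINT x|vol_measure (K' \<inter> S). (v K' x)\<^sup>2 * ?i x)"
          by (intro Bochner_Integration.integral_cong) (auto simp: indicator_def)
        also have "\<dots> \<le> (LINT x|vol_measure K'. (v K' x)\<^sup>2 * ?i x)"
          by (rule integral_KS_le_K[OF K', where B = "V\<^sup>2"], measurable) (use V2 in \<open>auto simp: indicator_def\<close>)
        finally show ?thesis .
      qed
      ultimately show "(LINT x|vol_measure (K' \<inter> S). \<bar>v K' x\<bar> * ?i x)
        \<le> sqrt (measure lebesgue (K' \<inter> S \<inter> Bq s K)) * sqrt (LINT x|vol_measure K'. (v K' x)\<^sup>2 * ?i x)"
        by (smt (verit) mult_left_mono real_sqrt_le_mono real_sqrt_ge_zero measure_nonneg)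
    qed
    also have "\<dots> \<le> sqrt (\<Sum>K'\<in>\<K>. measure lebesgue (K' \<inter> S \<inter> Bq s K)) * sqrt (Vq K)"
      unfolding Vq_def by (rule sum_sqrt_mult_le) (auto intro!: Bochner_Integration.integral_nonneg simp: indicator_def)
    also have "\<dots> \<le> sqrt (\<delta> * ((D + 1) * s) ^ (?d - 1)) * sqrt (Vq K)"
    proof (intro mult_right_mono real_sqrt_le_mono)
      \<comment> \<open>The layer hypothesis is available for radii up to D + 1, which covers all
        scales s \<le> 1.\<close>
      have "(D + 1) * s \<le> (D + 1) * 1" using D_pos e by (intro mult_left_mono) auto
      then show "(\<Sum>K'\<in>\<K>. measure lebesgue (K' \<inter> S \<inter> Bq s K)) \<le> \<delta> * ((D + 1) * s) ^ (?d - 1)"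
        unfolding Bq_def by (intro layer) (use D_pos e in auto)
    qed (simp add: Vq0)
    finally show "t K \<le> sqrt (\<delta> * ((D + 1) * s) ^ (?d - 1)) * sqrt (Vq K)" .
  qed
  also have "\<dots> = sqrt (\<delta> * ((D + 1) * s) ^ (?d - 1)) * (\<Sum>K\<in>\<T>. sqrt ((cL s K)\<^sup>2) * sqrt (Vq K))"
    using cL_nonneg[OF e(1)] by (simp add: sum_distrib_left mult_ac)
  also have "\<dots> \<le> sqrt (\<delta> * ((D + 1) * s) ^ (?d - 1)) * (sqrt (\<Sum>K\<in>\<T>. (cL s K)\<^sup>2) * sqrt (\<Sum>K\<in>\<T>. Vq K))"
    using Vq0 \<delta> D_pos e by (intro mult_left_mono sum_sqrt_mult_le) auto
  finally have m: "\<bar>pairing' \<K> v s\<bar> \<le> sqrt (\<delta> * ((D + 1) * s) ^ (?d - 1)) * (sqrt (\<Sum>K\<in>\<T>. (cL s K)\<^sup>2) * sqrt (\<Sum>K\<in>\<T>. Vq K))" .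
  have s0: "0 \<le> \<delta> * ((D + 1) * s) ^ (?d - 1)" using \<delta> D_pos e by simp
  have "(pairing' \<K> v s)\<^sup>2 \<le> (sqrt (\<delta> * ((D + 1) * s) ^ (?d - 1)) * (sqrt (\<Sum>K\<in>\<T>. (cL s K)\<^sup>2) * sqrt (\<Sum>K\<in>\<T>. Vq K)))\<^sup>2"
    using m by (metis abs_ge_zero power2_abs power_mono)
  also have "\<dots> = (\<delta> * ((D + 1) * s) ^ (?d - 1)) * ((\<Sum>K\<in>\<T>. (cL s K)\<^sup>2) * (\<Sum>K\<in>\<T>. Vq K))"
    using s0 Vq0 by (simp add: power_mult_distrib sum_nonneg)
  also have "\<dots> \<le> (\<delta> * ((D + 1) * s) ^ (?d - 1)) * ((2 * (CA * C1c\<^sup>2 + 2 ^ ?d * C0\<^sup>2) * (h ^ ?d / s ^ (2 * ?d)) * (h / s\<^sup>2 + 1) * E\<^sup>2)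
       * ((2 * (D + 2) * s) ^ ?d / (cvol * h ^ ?d) * X2 \<K> v))"
  proof (intro mult_left_mono mult_mono s0)
    show "(\<Sum>K\<in>\<T>. (cL s K)\<^sup>2) \<le> 2 * (CA * C1c\<^sup>2 + 2 ^ ?d * C0\<^sup>2) * (h ^ ?d / s ^ (2 * ?d)) * (h / s\<^sup>2 + 1) * E\<^sup>2"
      unfolding E_sq sum_distrib_left by (intro sum_mono cL_sq_le e(1))
    show "0 \<le> 2 * (CA * C1c\<^sup>2 + 2 ^ ?d * C0\<^sup>2) * (h ^ ?d / s ^ (2 * ?d)) * (h / s\<^sup>2 + 1) * E\<^sup>2"
      using CA_nonneg h_pos e by (auto intro!: mult_nonneg_nonneg add_nonneg_nonneg)
    \<comment> \<open>Elements whose ball contains x lie within (D + 2) s of x, so the packing bound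
      counts them.\<close>
    have cnt: "(\<Sum>K\<in>\<T>. indicator (Bq s K) x :: real) \<le> (2 * (D + 2) * s) ^ ?d / (cvol * h ^ ?d)" for x
    proof -
      have "(\<Sum>K\<in>\<T>. indicator (Bq s K) x :: real) = (\<Sum>K\<in>{K\<in>\<T>. x \<in> Bq s K}. 1)"
        using finite_T by (subst sum.inter_filter) (auto intro!: sum.cong)
      also have "\<dots> = real (card {K\<in>\<T>. x \<in> Bq s K})" by simp
      also have "\<dots> \<le> (2 * ((D + 2) * s)) ^ ?d / (cvol * h ^ ?d)"
      proof (rule card_le[of _ x])
        fix K assume K: "K \<in> {K\<in>\<T>. x \<in> Bq s K}"
        show "K \<subseteq> cball x ((D + 2) * s)"
        proof
          fix y assume y: "y \<in> K"
          have "dist x y \<le> dist x (pt K) + dist (pt K) y" by (rule dist_triangle)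
          also have "\<dots> \<le> (D + 1) * s + h"
            using K y dist_le_h[of K "pt K" y] pt[of K] by (auto simp: Bq_def dist_commute intro!: add_mono)
          also have "\<dots> \<le> (D + 2) * s" using he by (simp add: algebra_simps)
          finally show "y \<in> cball x ((D + 2) * s)" by simp
        qed
      qed (use D_pos e in auto)
      finally show ?thesis by (simp only: mult.assoc)
    qed
    have "(\<Sum>K\<in>\<T>. Vq K) = (\<Sum>K'\<in>\<K>. \<Sum>K\<in>\<T>. LINT x|vol_measure K'. (v K' x)\<^sup>2 * indicator (Bq s K) x)"
      unfolding Vq_def by (rule sum.swap)
    also have "\<dots> \<le> (\<Sum>K'\<in>\<K>. (2 * (D + 2) * s) ^ ?d / (cvol * h ^ ?d) * (LINT x|vol_measure K'. (v K' x)\<^sup>2))"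
    proof (rule sum_mono)
      fix K' assume KK': "K' \<in> \<K>"
      then have K': "K' \<in> \<T>" using KK by blast
      note [measurable] = vm[OF KK'] Bm
      obtain V where V: "0 \<le> V" "\<And>x. x \<in> K' \<Longrightarrow> \<bar>v K' x\<bar> \<le> V" using v_bound[OF K' v[OF KK']] by blast
      have V2: "(v K' x)\<^sup>2 \<le> V\<^sup>2" if "x \<in> K'" for x using V(2)[OF that] V(1) by (metis abs_le_square_iff abs_of_nonneg)
      have int: "integrable (vol_measure K') (\<lambda>x. (v K' x)\<^sup>2 * indicator (Bq s K) x)" for K
        by (rule K_integrable[OF K', where B = "V\<^sup>2"], measurable) (use V2 in \<open>auto simp: indicator_def\<close>)
      have int2: "integrable (vol_measure K') (\<lambda>x. (v K' x)\<^sup>2)"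
        by (intro vol_int[OF K'] continuous_intros Poly_continuous[OF v[OF KK']])
      have "(\<Sum>K\<in>\<T>. LINT x|vol_measure K'. (v K' x)\<^sup>2 * indicator (Bq s K) x) = (LINT x|vol_measure K'. (\<Sum>K\<in>\<T>. (v K' x)\<^sup>2 * indicator (Bq s K) x))"
        using int by simp
      also have "\<dots> \<le> (LINT x|vol_measure K'. (2 * (D + 2) * s) ^ ?d / (cvol * h ^ ?d) * (v K' x)\<^sup>2)"
      proof (rule integral_mono)
        show "(\<Sum>K\<in>\<T>. (v K' x)\<^sup>2 * indicator (Bq s K) x) \<le> (2 * (D + 2) * s) ^ ?d / (cvol * h ^ ?d) * (v K' x)\<^sup>2" for x
          using mult_left_mono[OF cnt[of x], of "(v K' x)\<^sup>2"] by (simp add: sum_distrib_left mult.commute)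
      qed (use int int2 in auto)
      finally show "(\<Sum>K\<in>\<T>. LINT x|vol_measure K'. (v K' x)\<^sup>2 * indicator (Bq s K) x) \<le> (2 * (D + 2) * s) ^ ?d / (cvol * h ^ ?d) * (LINT x|vol_measure K'. (v K' x)\<^sup>2)" by simp
    qed
    finally show "(\<Sum>K\<in>\<T>. Vq K) \<le> (2 * (D + 2) * s) ^ ?d / (cvol * h ^ ?d) * X2 \<K> v" by (simp add: X2_def sum_distrib_left)
    show "0 \<le> (\<Sum>K\<in>\<T>. Vq K)" using Vq0 by (simp add: sum_nonneg)
  qed
  also have "\<dots> = CL * \<delta> * ((h / s\<^sup>2 + 1) / s) * E\<^sup>2 * X2 \<K> v"
  proof -
    have e1: "s ^ (?d - 1) * s ^ ?d / s ^ (2 * ?d) = 1 / s"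
    proof -
      have "s ^ ?d = s * s ^ (?d - 1)" by (subst power_Suc[symmetric]) simp
      then show ?thesis using e by (simp add: mult_2 power_add)
    qed
    have "(\<delta> * ((D + 1) * s) ^ (?d - 1)) * ((2 * (CA * C1c\<^sup>2 + 2 ^ ?d * C0\<^sup>2) * (h ^ ?d / s ^ (2 * ?d)) * (h / s\<^sup>2 + 1) * E\<^sup>2)
       * ((2 * (D + 2) * s) ^ ?d / (cvol * h ^ ?d) * X2 \<K> v))
      = CL * \<delta> * (h / s\<^sup>2 + 1) * (s ^ (?d - 1) * s ^ ?d / s ^ (2 * ?d)) * (h ^ ?d / h ^ ?d) * E\<^sup>2 * X2 \<K> v"
      unfolding CL_def power_mult_distrib by (simp only: times_divide_eq_left times_divide_eq_right divide_divide_eq_left mult_ac)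
    then show ?thesis unfolding e1 using h_pos by simp
  qed
  finally show ?thesis .
qed

section \<open>Scales below the mesh size\<close>

definition Ck where "Ck = D * W * (2 * D) ^ CARD('d)"

lemma Ck_nonneg: "0 \<le> Ck"
  using D_pos W_nonneg by (simp add: Ck_def)

text \<open>Exchanging the integrals leaves the L1 norm of the kernel field in x. It is at most the
  supremum D W / s^d times the volume (2 D s)^d of a cube around the support, and the powers of s
  cancel; the result is \<open>Ck\<close>. The measure N stands for an element or a face.\<close>

lemma kernel_tonelli:
  fixes \<phi> :: "real^'d \<Rightarrow> real"
  assumes K': "K' \<in> \<T>" and v: "v \<in> Poly k" and V: "0 \<le> V" "\<And>x. x \<in> K' \<Longrightarrow> \<bar>v x\<bar> \<le> V"
    and e: "0 < s" "s \<le> 1" and N: "finite_measure N" "sets N = sets borel"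
    and \<phi>: "\<And>z. 0 \<le> \<phi> z" "continuous_on UNIV \<phi>" "integrable N \<phi>"
  shows "(LINT x|vol_measure (K' \<inter> S). \<bar>v x\<bar> * (LINT z|N. \<phi> z * norm (kk s x z))) \<le> V * Ck * (LINT z|N. \<phi> z)"
proof -
  interpret N: finite_measure N by fact
  interpret N1: finite_measure "vol_measure (K' \<inter> S)" by (rule finite_KS[OF K'])
  interpret P: pair_sigma_finite "vol_measure (K' \<inter> S)" N ..
  have vm[measurable]: "v \<in> borel_measurable borel" using Poly_continuous[OF v] by (rule borel_measurable_continuous_onI)
  have pm[measurable]: "\<phi> \<in> borel_measurable borel" using \<phi>(2) by (rule borel_measurable_continuous_onI)
  have spN: "space N = UNIV" using sets_eq_imp_space_eq[OF N(2)] by simp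
  note [measurable_cong] = N(2)
  let ?I = "LINT z|N. \<phi> z" and ?f = "\<lambda>x. LINT z|N. \<phi> z * norm (kk s x z)"
  let ?c = "V * (D * W / s ^ CARD('d))"
  have I0: "0 \<le> ?I" using \<phi>(1) by (intro Bochner_Integration.integral_nonneg)
  have c0: "0 \<le> ?c" using V D_pos W_nonneg e by simp
  have fm[measurable]: "?f \<in> borel_measurable borel"
    by (rule measurable_vol_integral[OF _ N]) measurable
  have inner: "ennreal (\<bar>v x\<bar> * ?f x) = (\<integral>\<^sup>+z. ennreal (\<bar>v x\<bar> * (\<phi> z * norm (kk s x z))) \<partial>N)" if x: "x \<in> K' \<inter> S" for x
  proof -
    have "integrable N (\<lambda>z. (D * W / s ^ CARD('d)) * \<phi> z)" using \<phi>(3) by simp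
    then have "integrable N (\<lambda>z. \<phi> z * norm (kk s x z))"
    proof (rule Bochner_Integration.integrable_bound)
      show "(\<lambda>z. \<phi> z * norm (kk s x z)) \<in> borel_measurable N" by measurable
      show "AE z in N. norm (\<phi> z * norm (kk s x z)) \<le> norm ((D * W / s ^ CARD('d)) * \<phi> z)"
      proof (rule AE_I2)
        fix z
        have "\<phi> z * norm (kk s x z) \<le> \<phi> z * (D * W / s ^ CARD('d))"
          using kk_le[of x s z] x e by (intro mult_left_mono \<phi>(1)) auto
        also have "\<dots> = norm ((D * W / s ^ CARD('d)) * \<phi> z)"
          using \<phi>(1)[of z] D_pos W_nonneg e by (simp add: abs_mult)
        finally show "norm (\<phi> z * norm (kk s x z)) \<le> norm ((D * W / s ^ CARD('d)) * \<phi> z)"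
          using \<phi>(1)[of z] by (simp add: abs_mult)
      qed
    qed
    then have "integrable N (\<lambda>z. \<bar>v x\<bar> * (\<phi> z * norm (kk s x z)))" by simp
    then have "(\<integral>\<^sup>+z. ennreal (\<bar>v x\<bar> * (\<phi> z * norm (kk s x z))) \<partial>N) = ennreal (LINT z|N. \<bar>v x\<bar> * (\<phi> z * norm (kk s x z)))"
      using \<phi>(1) by (intro nn_integral_eq_integral) auto
    then show ?thesis by simp
  qed
  have outer: "(\<integral>\<^sup>+x. ennreal (\<bar>v x\<bar> * (\<phi> z * norm (kk s x z))) \<partial>vol_measure (K' \<inter> S)) \<le> ennreal (V * Ck * \<phi> z)" for z
  proof -
    have "(\<integral>\<^sup>+x. ennreal (\<bar>v x\<bar> * (\<phi> z * norm (kk s x z))) \<partial>vol_measure (K' \<inter> S))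
      = (\<integral>\<^sup>+x. indicator (K' \<inter> S) x * ennreal (\<bar>v x\<bar> * (\<phi> z * norm (kk s x z))) \<partial>lborel)"
      unfolding vol_measure_def using borel_KS[OF K'] by (subst nn_integral_density) auto
    also have "\<dots> \<le> (\<integral>\<^sup>+x. ennreal (?c * \<phi> z) * indicator (cball z (D * s)) x \<partial>lborel)"
    proof (rule nn_integral_mono)
      fix x
      show "indicator (K' \<inter> S) x * ennreal (\<bar>v x\<bar> * (\<phi> z * norm (kk s x z))) \<le> ennreal (?c * \<phi> z) * indicator (cball z (D * s)) x"
      proof (cases "x \<in> K' \<inter> S \<and> kk s x z \<noteq> 0")
        case True
        then have "x \<in> cball z (D * s)" using kk_supp(2)[of x s z] e by (simp add: dist_norm)
        moreover have "\<bar>v x\<bar> * (\<phi> z * norm (kk s x z)) \<le> V * (\<phi> z * (D * W / s ^ CARD('d)))"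
          using True V kk_le[of x s z] e \<phi>(1) by (intro mult_mono mult_left_mono) auto
        ultimately show ?thesis using True by (simp add: mult_ac ennreal_leI)
      qed (auto simp: indicator_def)
    qed
    also have "\<dots> = ennreal (?c * \<phi> z) * emeasure lborel (cball z (D * s))" by (rule nn_integral_cmult_indicator) simp
    also have "\<dots> \<le> ennreal (?c * \<phi> z) * ennreal ((2 * (D * s)) ^ CARD('d))"
    proof (rule mult_left_mono)
      have "emeasure lborel (cball z (D * s)) = ennreal (measure lebesgue (cball z (D * s)))"
        using emeasure_lborel_cball_finite[of z "D * s"] by (simp add: measure_completion emeasure_eq_ennreal_measure less_top)
      also have "\<dots> \<le> ennreal ((2 * (D * s)) ^ CARD('d))"
        using D_pos e by (intro ennreal_leI measure_cball_le) simp
      finally show "emeasure lborel (cball z (D * s)) \<le> ennreal ((2 * (D * s)) ^ CARD('d))" .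
    qed simp
    also have "\<dots> = ennreal (?c * \<phi> z * (2 * (D * s)) ^ CARD('d))"
      using D_pos e by (intro ennreal_mult[symmetric] mult_nonneg_nonneg[OF c0 \<phi>(1)]) auto
    also have "?c * \<phi> z * (2 * (D * s)) ^ CARD('d) = V * Ck * \<phi> z"
      using e by (simp add: Ck_def power_mult_distrib)
    finally show ?thesis .
  qed
  have "(\<integral>\<^sup>+x. ennreal (\<bar>v x\<bar> * ?f x) \<partial>vol_measure (K' \<inter> S))
      = (\<integral>\<^sup>+x. (\<integral>\<^sup>+z. ennreal (\<bar>v x\<bar> * (\<phi> z * norm (kk s x z))) \<partial>N) \<partial>vol_measure (K' \<inter> S))"
  proof (rule nn_integral_cong_AE)
    show "AE x in vol_measure (K' \<inter> S). ennreal (\<bar>v x\<bar> * ?f x) = (\<integral>\<^sup>+z. ennreal (\<bar>v x\<bar> * (\<phi> z * norm (kk s x z))) \<partial>N)"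
      using AE_KS[OF K'] by (rule eventually_mono) (rule inner)
  qed
  also have "\<dots> = (\<integral>\<^sup>+z. (\<integral>\<^sup>+x. ennreal (\<bar>v x\<bar> * (\<phi> z * norm (kk s x z))) \<partial>vol_measure (K' \<inter> S)) \<partial>N)"
    by (rule P.Fubini'[symmetric]) measurable
  also have "\<dots> \<le> (\<integral>\<^sup>+z. ennreal (V * Ck * \<phi> z) \<partial>N)"
    by (intro nn_integral_mono outer)
  also have "\<dots> = ennreal (LINT z|N. V * Ck * \<phi> z)"
    using \<phi> V Ck_nonneg by (intro nn_integral_eq_integral) auto
  finally have le: "(\<integral>\<^sup>+x. ennreal (\<bar>v x\<bar> * ?f x) \<partial>vol_measure (K' \<inter> S)) \<le> ennreal (V * Ck * ?I)" by simp
  have "(LINT x|vol_measure (K' \<inter> S). \<bar>v x\<bar> * ?f x) = enn2real (\<integral>\<^sup>+x. ennreal (\<bar>v x\<bar> * ?f x) \<partial>vol_measure (K' \<inter> S))"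
    using \<phi>(1) by (intro integral_eq_nn_integral) (auto intro!: AE_I2 mult_nonneg_nonneg Bochner_Integration.integral_nonneg)
  also have "\<dots> \<le> V * Ck * ?I" using le V(1) Ck_nonneg I0 by (intro enn2real_leI) auto
  finally show ?thesis .
qed

definition near where "near K K' \<longleftrightarrow> (\<exists>z\<in>K. \<exists>x\<in>K'. norm (z - x) \<le> D * h)"

lemma near_sym: "near K K' \<longleftrightarrow> near K' K"
  unfolding near_def by (metis norm_minus_commute)

text \<open>Bounds the number of elements within reach D h of a given one. It is the packing bound
  with radius (D + 2) h, in which h cancels.\<close>

definition N0 where "N0 = (2 * (D + 2)) ^ CARD('d) / cvol"

lemma N0_nonneg: "0 \<le> N0"
  using D_pos cvol_pos by (simp add: N0_def)

lemma card_near: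
  assumes K': "K' \<in> \<T>" and KK: "\<K> \<subseteq> \<T>"
  shows "real (card {K \<in> \<K>. near K K'}) \<le> N0"
proof -
  have "real (card {K \<in> \<K>. near K K'}) \<le> (2 * ((D + 2) * h)) ^ CARD('d) / (cvol * h ^ CARD('d))"
  proof (rule card_le[of _ "pt K'"])
    fix K assume "K \<in> {K \<in> \<K>. near K K'}"
    then obtain z x where K: "K \<in> \<T>" and zx: "z \<in> K" "x \<in> K'" "norm (z - x) \<le> D * h" using KK by (auto simp: near_def)
    show "K \<subseteq> cball (pt K') ((D + 2) * h)"
    proof
      fix y assume y: "y \<in> K"
      have "dist (pt K') y \<le> dist (pt K') x + dist x z + dist z y"
        using dist_triangle[of "pt K'" y x] dist_triangle[of x y z] by linarith
      also have "\<dots> \<le> h + D * h + h"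
        using dist_le_h[OF K' pt[OF K'] zx(2)] dist_le_h[OF K zx(1) y] zx(3) by (simp add: dist_norm norm_minus_commute)
      finally show "y \<in> cball (pt K') ((D + 2) * h)" by (simp add: algebra_simps)
    qed
  qed (use KK D_pos h_pos in auto)
  also have "\<dots> = N0" unfolding N0_def mult.assoc[symmetric] power_mult_distrib[of _ h] using h_pos by simp
  finally show ?thesis .
qed

definition CS where "CS = Ck * N0 * sqrt (M * CA / cvol)"

lemma CS_nonneg: "0 \<le> CS"
  using Ck_nonneg N0_nonneg M0 CA_nonneg cvol_pos by (simp add: CS_def)

definition majorant where "majorant s x = (\<Sum>K\<in>\<T>. (\<Sum>e\<in>facets K. LINT z|face_measure e. \<bar>u K z - w e z\<bar> * norm (kk s x z)) + (LINT z|vol_measure K. norm (gu K z) * norm (kk s x z)))"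

text \<open>For s \<le> h the kernel field is not nearly constant on an element, and its whole size
  is paired with gradient and jumps. In exchange only neighbouring elements interact. The inverse
  inequality for v costs h^(-d/2) and \<open>aK\<close> is of order h^((d-1)/2), which leaves
  h^(-1/2), independent of s; over a range of scales of length h this amounts to sqrt h.\<close>

lemma pairing'_small:
  assumes KK: "\<K> \<subseteq> \<T>" and v: "\<And>K. K \<in> \<K> \<Longrightarrow> v K \<in> Poly k" and e: "0 < s" "s \<le> 1" and he: "s \<le> h"
  shows "\<bar>pairing' \<K> v s\<bar> \<le> CS * E * sqrt (X2 \<K> v) / sqrt h"
proof -
  let ?d = "CARD('d)"
  have fin: "finite \<K>" using KK finite_T finite_subset by blast
  have vm: "v K \<in> borel_measurable borel" if "K \<in> \<K>" for K using Poly_continuous[OF v[OF that]] by (rule borel_measurable_continuous_onI)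
  let ?F = "\<lambda>K e x. LINT z|face_measure e. \<bar>u K z - w e z\<bar> * norm (kk s x z)"
  let ?G = "\<lambda>K x. LINT z|vol_measure K. norm (gu K z) * norm (kk s x z)"
  let ?C = "D * W / s ^ ?d"
  have C0: "0 \<le> ?C" using D_pos W_nonneg e by simp
  have Fm: "?F K e' \<in> borel_measurable borel" if "K \<in> \<T>" "e' \<in> facets K" for K e'
  proof (rule measurable_vol_integral)
    have [measurable]: "u K \<in> borel_measurable borel" "w e' \<in> borel_measurable borel"
      using cont_u[OF that(1)] cont_w[OF that] by (auto intro: borel_measurable_continuous_onI)
    show "(\<lambda>(x, z). \<bar>u K z - w e' z\<bar> * norm (kk s x z)) \<in> borel_measurable (borel \<Otimes>\<^sub>M borel)" by measurable
  qed (use finite_face_measure(1)[OF simplex_T[OF that(1)] that(2)] in auto)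
  have Gm: "?G K \<in> borel_measurable borel" if "K \<in> \<T>" for K
  proof (rule measurable_vol_integral)
    have [measurable]: "gu K \<in> borel_measurable borel"
      using cont_gu[OF that(1)] by (auto intro: borel_measurable_continuous_onI)
    show "(\<lambda>(x, z). norm (gu K z) * norm (kk s x z)) \<in> borel_measurable (borel \<Otimes>\<^sub>M borel)" by measurable
  qed (use vol_measure_compact(1)[OF compact_T[OF that(1)]] in auto)
  have Fb: "0 \<le> ?F K e' x" "?F K e' x \<le> (LINT z|face_measure e'. \<bar>u K z - w e' z\<bar> * ?C)" if "K \<in> \<T>" "e' \<in> facets K" "x \<in> S" for K e' x
  proof -
    show "0 \<le> ?F K e' x" by (rule Bochner_Integration.integral_nonneg) simp
    show "?F K e' x \<le> (LINT z|face_measure e'. \<bar>u K z - w e' z\<bar> * ?C)"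
      using kk_le[OF that(3) e]
      by (intro integral_mono face_int[OF that(1,2)] continuous_intros cont_u[OF that(1)] cont_w[OF that(1,2)] cont_kk mult_left_mono) auto
  qed
  have Gb: "0 \<le> ?G K x" "?G K x \<le> (LINT z|vol_measure K. norm (gu K z) * ?C)" if "K \<in> \<T>" "x \<in> S" for K x
  proof -
    show "0 \<le> ?G K x" by (rule Bochner_Integration.integral_nonneg) simp
    show "?G K x \<le> (LINT z|vol_measure K. norm (gu K z) * ?C)"
      using kk_le[OF that(2) e]
      by (intro integral_mono vol_int[OF that(1)] continuous_intros cont_gu[OF that(1)] cont_kk mult_left_mono) auto
  qed
  have "\<bar>pairing' \<K> v s\<bar> \<le> (\<Sum>K'\<in>\<K>. LINT x|vol_measure (K' \<inter> S). \<bar>v K' x\<bar> * majorant s x)"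
  proof (rule pairing'_le[OF KK v])
    show "\<bar>avg' s x\<bar> \<le> majorant s x" if "x \<in> S" for x
      unfolding avg'_def majorant_def by (rule weak_divergence_le[OF C1_kk kk_off[OF that e]])
    show "majorant s \<in> borel_measurable borel" unfolding majorant_def[abs_def] using Fm Gm by (intro borel_measurable_sum borel_measurable_add) auto
    show "majorant s x \<le> (\<Sum>K\<in>\<T>. (\<Sum>e\<in>facets K. LINT z|face_measure e. \<bar>u K z - w e z\<bar> * ?C) + (LINT z|vol_measure K. norm (gu K z) * ?C))" if "x \<in> S" for x
      unfolding majorant_def using Fb Gb that by (intro sum_mono add_mono) auto
  qed
  also have "\<dots> \<le> (\<Sum>K'\<in>\<K>. \<Sum>K\<in>\<T>. if near K K' then sqrt (M * (LINT x|vol_measure K'. (v K' x)\<^sup>2) / (cvol * h ^ ?d)) * Ck * aK K else 0)"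
  proof (rule sum_mono)
    fix K' assume KK': "K' \<in> \<K>"
    then have K': "K' \<in> \<T>" using KK by blast
    let ?x2 = "LINT x|vol_measure K'. (v K' x)\<^sup>2"
    \<comment> \<open>The inverse inequality together with the lower bound for the volume turns the
      L2 norm of v on K' into a pointwise bound.\<close>
    define V where "V = sqrt (M * ?x2 / (cvol * h ^ ?d))"
    have x20: "0 \<le> ?x2" by (rule Bochner_Integration.integral_nonneg) simp
    have V0: "0 \<le> V" using x20 M0 cvol_pos h_pos by (simp add: V_def)
    have V: "\<bar>v K' x\<bar> \<le> V" if x: "x \<in> K'" for x
    proof -
      have "cvol * h ^ ?d * (v K' x)\<^sup>2 \<le> measure lebesgue K' * (v K' x)\<^sup>2"
        using measure_T_ge[OF K'] by (intro mult_right_mono) auto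
      also have "\<dots> \<le> M * ?x2" by (rule inverse_T[OF K' v[OF KK'] x])
      finally have "(v K' x)\<^sup>2 \<le> M * ?x2 / (cvol * h ^ ?d)" using cvol_pos h_pos by (simp add: field_simps)
      then show ?thesis unfolding V_def by (rule real_le_rsqrt[of "\<bar>v K' x\<bar>", unfolded power2_abs])
    qed
    note vmK[measurable] = vm[OF KK']
    have iF: "integrable (vol_measure (K' \<inter> S)) (\<lambda>x. \<bar>v K' x\<bar> * ?F K e' x)" if "K \<in> \<T>" "e' \<in> facets K" for K e'
    proof (rule KS_integrable[OF K'])
      show "(\<lambda>x. \<bar>v K' x\<bar> * ?F K e' x) \<in> borel_measurable borel" by (rule borel_measurable_times[OF _ Fm[OF that]]) measurable
      show "\<bar>\<bar>v K' x\<bar> * ?F K e' x\<bar> \<le> V * (LINT z|face_measure e'. \<bar>u K z - w e' z\<bar> * ?C)" if "x \<in> K' \<inter> S" for x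
      proof -
        have x: "x \<in> K'" "x \<in> S" using that by auto
        note F = Fb[OF \<open>K \<in> \<T>\<close> \<open>e' \<in> facets K\<close> x(2)]
        show ?thesis unfolding abs_mult abs_idempotent abs_of_nonneg[OF F(1)] by (rule mult_mono[OF V[OF x(1)] F(2) V0 F(1)])
      qed
    qed
    have iG: "integrable (vol_measure (K' \<inter> S)) (\<lambda>x. \<bar>v K' x\<bar> * ?G K x)" if "K \<in> \<T>" for K
    proof (rule KS_integrable[OF K'])
      show "(\<lambda>x. \<bar>v K' x\<bar> * ?G K x) \<in> borel_measurable borel" by (rule borel_measurable_times[OF _ Gm[OF that]]) measurable
      show "\<bar>\<bar>v K' x\<bar> * ?G K x\<bar> \<le> V * (LINT z|vol_measure K. norm (gu K z) * ?C)" if "x \<in> K' \<inter> S" for x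
      proof -
        have x: "x \<in> K'" "x \<in> S" using that by auto
        note F = Gb[OF \<open>K \<in> \<T>\<close> x(2)]
        show ?thesis unfolding abs_mult abs_idempotent abs_of_nonneg[OF F(1)] by (rule mult_mono[OF V[OF x(1)] F(2) V0 F(1)])
      qed
    qed
    have "(LINT x|vol_measure (K' \<inter> S). \<bar>v K' x\<bar> * majorant s x)
      = (LINT x|vol_measure (K' \<inter> S). (\<Sum>K\<in>\<T>. (\<Sum>e'\<in>facets K. \<bar>v K' x\<bar> * ?F K e' x) + \<bar>v K' x\<bar> * ?G K x))"
      by (intro Bochner_Integration.integral_cong) (auto simp: majorant_def sum_distrib_left distrib_left)
    also have "\<dots> = (\<Sum>K\<in>\<T>. (\<Sum>e'\<in>facets K. LINT x|vol_measure (K' \<inter> S). \<bar>v K' x\<bar> * ?F K e' x) + (LINT x|vol_measure (K' \<inter> S). \<bar>v K' x\<bar> * ?G K x))"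
      using iF iG by simp
    also have "\<dots> \<le> (\<Sum>K\<in>\<T>. if near K K' then V * Ck * aK K else 0)"
    proof (rule sum_mono)
      fix K assume K: "K \<in> \<T>"
      show "(\<Sum>e'\<in>facets K. LINT x|vol_measure (K' \<inter> S). \<bar>v K' x\<bar> * ?F K e' x) + (LINT x|vol_measure (K' \<inter> S). \<bar>v K' x\<bar> * ?G K x)
        \<le> (if near K K' then V * Ck * aK K else 0)"
      proof (cases "near K K'")
        case True
        have "(LINT x|vol_measure (K' \<inter> S). \<bar>v K' x\<bar> * ?F K e' x) \<le> V * Ck * (LINT z|face_measure e'. \<bar>u K z - w e' z\<bar>)" if e': "e' \<in> facets K" for e'
          by (rule kernel_tonelli[OF K' v[OF KK'] V0 V e finite_face_measure(1)[OF simplex_T[OF K] e']])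
             (auto intro!: face_int[OF K e'] continuous_intros cont_u[OF K] cont_w[OF K e'])
        moreover have "(LINT x|vol_measure (K' \<inter> S). \<bar>v K' x\<bar> * ?G K x) \<le> V * Ck * (LINT z|vol_measure K. norm (gu K z))"
          by (rule kernel_tonelli[OF K' v[OF KK'] V0 V e vol_measure_compact(1)[OF compact_T[OF K]]])
             (auto intro!: vol_int[OF K] continuous_intros cont_gu[OF K])
        ultimately have "(\<Sum>e'\<in>facets K. LINT x|vol_measure (K' \<inter> S). \<bar>v K' x\<bar> * ?F K e' x) + (LINT x|vol_measure (K' \<inter> S). \<bar>v K' x\<bar> * ?G K x)
          \<le> (\<Sum>e'\<in>facets K. V * Ck * (LINT z|face_measure e'. \<bar>u K z - w e' z\<bar>)) + V * Ck * (LINT z|vol_measure K. norm (gu K z))"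
          by (intro add_mono sum_mono) auto
        also have "\<dots> = V * Ck * aK K" by (simp add: aK_def distrib_left sum_distrib_left)
        finally show ?thesis using True by simp
      next
        case False
        have z: "kk s x z = 0" if "x \<in> K' \<inter> S" "z \<in> K" for x z
        proof (rule ccontr)
          assume "kk s x z \<noteq> 0"
          then have "norm (z - x) \<le> D * s" using kk_supp(2)[of x s z] that e by auto
          also have "\<dots> \<le> D * h" using he D_pos by (intro mult_left_mono) auto
          finally show False using False that by (auto simp: near_def)
        qed
        have F0: "?F K e' x = 0" if "e' \<in> facets K" "x \<in> K' \<inter> S" for e' x
          using AE_face_measure[OF simplex_T[OF K] that(1)] facet_props(2)[OF simplex_T[OF K] that(1)] z[OF that(2)]
          by (intro integral_eq_zero_AE) (auto elim!: eventually_mono)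
        have G0: "?G K x = 0" if "x \<in> K' \<inter> S" for x
          using AE_vol_measure[OF borel_T[OF K]] z[OF that] by (intro integral_eq_zero_AE) (auto elim!: eventually_mono)
        have "(LINT x|vol_measure (K' \<inter> S). \<bar>v K' x\<bar> * ?F K e' x) = 0" if "e' \<in> facets K" for e'
          by (rule integral_eq_zero_AE, rule eventually_mono[OF AE_KS[OF K']]) (simp add: F0[OF that])
        moreover have "(LINT x|vol_measure (K' \<inter> S). \<bar>v K' x\<bar> * ?G K x) = 0"
          by (rule integral_eq_zero_AE, rule eventually_mono[OF AE_KS[OF K']]) (simp add: G0)
        ultimately show ?thesis using False by simp
      qed
    qed
    finally show "(LINT x|vol_measure (K' \<inter> S). \<bar>v K' x\<bar> * majorant s x) \<le> (\<Sum>K\<in>\<T>. if near K K' then sqrt (M * ?x2 / (cvol * h ^ ?d)) * Ck * aK K else 0)"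
      unfolding V_def .
  qed
  also have "\<dots> = Ck * (\<Sum>(K', K)\<in>{(K', K) \<in> \<K> \<times> \<T>. near K K'}. sqrt (M * (LINT x|vol_measure K'. (v K' x)\<^sup>2) / (cvol * h ^ ?d)) * sqrt ((aK K)\<^sup>2))"
  proof -
    have "(\<Sum>(K', K)\<in>{(K', K) \<in> \<K> \<times> \<T>. near K K'}. sqrt (M * (LINT x|vol_measure K'. (v K' x)\<^sup>2) / (cvol * h ^ ?d)) * sqrt ((aK K)\<^sup>2))
      = (\<Sum>(K', K)\<in>\<K> \<times> \<T>. if near K K' then sqrt (M * (LINT x|vol_measure K'. (v K' x)\<^sup>2) / (cvol * h ^ ?d)) * aK K else 0)"
      using fin finite_T aK_nonneg by (intro sum.mono_neutral_cong_left) (auto split: if_splits)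
    then show ?thesis
      by (simp add: sum.cartesian_product[symmetric] sum_distrib_left if_distrib mult_ac cong: if_cong)
  qed
  also have "\<dots> \<le> Ck * (sqrt (N0 * (M * X2 \<K> v / (cvol * h ^ ?d))) * sqrt (N0 * (CA * h ^ (?d - 1) * E\<^sup>2)))"
  proof (rule mult_left_mono[OF _ Ck_nonneg])
    let ?P = "{(K', K) \<in> \<K> \<times> \<T>. near K K'}"
    let ?a = "\<lambda>K'. M * (LINT x|vol_measure K'. (v K' x)\<^sup>2) / (cvol * h ^ ?d)"
    have a0: "0 \<le> ?a K'" for K' using M0 cvol_pos h_pos by (auto intro!: divide_nonneg_nonneg mult_nonneg_nonneg Bochner_Integration.integral_nonneg)
    have "(\<Sum>p\<in>?P. sqrt (?a (fst p)) * sqrt ((aK (snd p))\<^sup>2)) \<le> sqrt (\<Sum>p\<in>?P. ?a (fst p)) * sqrt (\<Sum>p\<in>?P. (aK (snd p))\<^sup>2)"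
      by (rule sum_sqrt_mult_le) (use a0 in auto)
    also have "\<dots> \<le> sqrt (N0 * (M * X2 \<K> v / (cvol * h ^ ?d))) * sqrt (N0 * (CA * h ^ (?d - 1) * E\<^sup>2))"
    proof (intro mult_mono real_sqrt_le_mono)
      \<comment> \<open>The sum over interacting pairs is counted by the element that carries v here
        and, for the other factor, by the element that carries \<open>aK\<close>. Either has at most
        \<open>N0\<close> partners.\<close>
      have "(\<Sum>p\<in>?P. ?a (fst p)) = (\<Sum>K'\<in>\<K>. \<Sum>K\<in>{K\<in>\<T>. near K K'}. ?a K')"
      proof -
        have "?P = (SIGMA K':\<K>. {K\<in>\<T>. near K K'})" by auto
        then show ?thesis using fin finite_T by (subst sum.Sigma) (auto simp: split_def)
      qed
      also have "\<dots> = (\<Sum>K'\<in>\<K>. real (card {K\<in>\<T>. near K K'}) * ?a K')" by simp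
      also have "\<dots> \<le> (\<Sum>K'\<in>\<K>. N0 * ?a K')"
        using card_near[of _ \<T>] KK a0 by (intro sum_mono mult_right_mono) auto
      also have "\<dots> = N0 * (M * X2 \<K> v / (cvol * h ^ ?d))"
        by (simp add: X2_def sum_distrib_left sum_divide_distrib)
      finally show "(\<Sum>p\<in>?P. ?a (fst p)) \<le> N0 * (M * X2 \<K> v / (cvol * h ^ ?d))" .
      have "(\<Sum>p\<in>?P. (aK (snd p))\<^sup>2) = (\<Sum>K\<in>\<T>. \<Sum>K'\<in>{K'\<in>\<K>. near K' K}. (aK K)\<^sup>2)"
      proof -
        have "(\<Sum>p\<in>?P. (aK (snd p))\<^sup>2) = (\<Sum>p\<in>(SIGMA K:\<T>. {K'\<in>\<K>. near K' K}). (aK (fst p))\<^sup>2)"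
          by (rule sum.reindex_bij_witness[of _ prod.swap prod.swap]) (auto simp: near_sym)
        then show ?thesis using fin finite_T by (subst sum.Sigma) (auto simp: split_def)
      qed
      also have "\<dots> = (\<Sum>K\<in>\<T>. real (card {K'\<in>\<K>. near K' K}) * (aK K)\<^sup>2)" by simp
      also have "\<dots> \<le> (\<Sum>K\<in>\<T>. N0 * (CA * h ^ (?d - 1) * en K))"
        using card_near[OF _ KK] aK_sq_le N0_nonneg by (intro sum_mono mult_mono) auto
      also have "\<dots> = N0 * (CA * h ^ (?d - 1) * E\<^sup>2)" by (simp add: E_sq sum_distrib_left)
      finally show "(\<Sum>p\<in>?P. (aK (snd p))\<^sup>2) \<le> N0 * (CA * h ^ (?d - 1) * E\<^sup>2)" .
    qed (auto intro!: sum_nonneg N0_nonneg mult_nonneg_nonneg divide_nonneg_nonneg X2_nonneg M0 simp: cvol_pos h_pos less_imp_le)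
    finally show "(\<Sum>(K', K)\<in>?P. sqrt (?a K') * sqrt ((aK K)\<^sup>2)) \<le> sqrt (N0 * (M * X2 \<K> v / (cvol * h ^ ?d))) * sqrt (N0 * (CA * h ^ (?d - 1) * E\<^sup>2))"
      by (simp add: split_def)
  qed
  also have "\<dots> = CS * E * sqrt (X2 \<K> v) / sqrt h"
  proof -
    have "h ^ ?d = h * h ^ (?d - 1)" by (subst power_Suc[symmetric]) simp
    then have hh: "h ^ (?d - 1) / h ^ ?d = 1 / h" using h_pos by simp
    have "sqrt (N0 * (M * X2 \<K> v / (cvol * h ^ ?d))) * sqrt (N0 * (CA * h ^ (?d - 1) * E\<^sup>2))
       = sqrt (N0\<^sup>2 * (M * CA / cvol) * X2 \<K> v * (h ^ (?d - 1) / h ^ ?d) * E\<^sup>2)"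
      unfolding real_sqrt_mult[symmetric] by (simp add: power2_eq_square mult_ac)
    also have "\<dots> = N0 * sqrt (M * CA / cvol) * sqrt (X2 \<K> v) * (1 / sqrt h) * E"
      unfolding hh using N0_nonneg E_nonneg by (simp add: real_sqrt_mult real_sqrt_divide)
    finally show ?thesis by (simp add: CS_def)
  qed
  finally show ?thesis .
qed

section \<open>Integration over all scales\<close>

definition CKL where "CKL = 4 * sqrt CL + CS"

lemma CKL_nonneg: "0 \<le> CKL"
  using CL_nonneg CS_nonneg by (simp add: CKL_def)

lemma pairing_large_diff:
  assumes KK: "\<K> \<subseteq> \<T>" and v: "\<And>K. K \<in> \<K> \<Longrightarrow> v K \<in> Poly k" and h1: "h \<le> 1" and \<delta>: "0 \<le> \<delta>"
    and layer: "\<And>z r. 0 < r \<Longrightarrow> r \<le> D + 1 \<Longrightarrow> (\<Sum>K\<in>\<K>. measure lebesgue (K \<inter> S \<inter> cball z r)) \<le> \<delta> * r ^ (CARD('d) - 1)"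
  shows "\<bar>pairing \<K> v 1 - pairing \<K> v h\<bar> \<le> 4 * sqrt CL * sqrt \<delta> * E * sqrt (X2 \<K> v)"
proof -
  define c where "c = sqrt CL * sqrt \<delta> * E * sqrt (X2 \<K> v)"
  have c0: "0 \<le> c" using CL_nonneg \<delta> E_nonneg X2_nonneg by (simp add: c_def)
  \<comment> \<open>An antiderivative of c (1/sqrt s + sqrt h / (s sqrt s)). Its increment from h to
    1 is c (4 - 4 sqrt h), whence the 4 in \<open>CKL\<close>.\<close>
  let ?g = "\<lambda>s. c * (2 * sqrt s - 2 * sqrt h / sqrt s)"
  have "\<bar>pairing \<K> v 1 - pairing \<K> v h\<bar> \<le> ?g 1 - ?g h"
  proof (rule DERIV_dominated_le[OF h1, where f' = "\<lambda>s. - pairing' \<K> v s" and g' = "\<lambda>s. c * (1 / sqrt s + sqrt h / (s * sqrt s))"])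
    fix s assume e: "h \<le> s" "s \<le> 1"
    then have e0: "0 < s" using h_pos by linarith
    show "DERIV (pairing \<K> v) s :> - pairing' \<K> v s" by (rule DERIV_pairing[OF e0 KK v])
    have "DERIV (\<lambda>s. 2 * sqrt s - 2 * sqrt h / sqrt s) s :> 1 / sqrt s + sqrt h / (s * sqrt s)"
      using e0 by (auto intro!: derivative_eq_intros simp: field_simps)
    then show "DERIV ?g s :> c * (1 / sqrt s + sqrt h / (s * sqrt s))" by (rule DERIV_cmult)
    have "(pairing' \<K> v s)\<^sup>2 \<le> CL * \<delta> * ((h / s\<^sup>2 + 1) / s) * E\<^sup>2 * X2 \<K> v"
      by (rule pairing'_large[OF KK v e0 e(2,1) \<delta> layer])
    then have "\<bar>pairing' \<K> v s\<bar> \<le> sqrt (CL * \<delta> * ((h / s\<^sup>2 + 1) / s) * E\<^sup>2 * X2 \<K> v)"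
      by (intro real_le_rsqrt) simp
    also have "\<dots> = c * sqrt ((h / s\<^sup>2 + 1) / s)"
      by (simp only: real_sqrt_mult real_sqrt_abs abs_of_nonneg[OF E_nonneg] c_def mult_ac)
    also have "sqrt ((h / s\<^sup>2 + 1) / s) \<le> 1 / sqrt s + sqrt h / (s * sqrt s)"
    proof -
      have "sqrt (h / s\<^sup>2 + 1) \<le> sqrt (h / s\<^sup>2) + sqrt 1" using h_pos e0 by (intro sqrt_add_le_add_sqrt) auto
      also have "\<dots> = sqrt h / s + 1" using e0 by (simp add: real_sqrt_divide)
      finally have "sqrt (h / s\<^sup>2 + 1) / sqrt s \<le> (sqrt h / s + 1) / sqrt s" using e0 by (intro divide_right_mono) auto
      moreover have "(sqrt h / s + 1) / sqrt s = 1 / sqrt s + sqrt h / (s * sqrt s)"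
        by (simp add: add_divide_distrib)
      ultimately show ?thesis unfolding real_sqrt_divide[of "h / s\<^sup>2 + 1" s] by linarith
    qed
    finally show "\<bar>- pairing' \<K> v s\<bar> \<le> c * (1 / sqrt s + sqrt h / (s * sqrt s))"
      using c0 by (simp add: mult_left_mono)
  qed
  also have "\<dots> = c * (4 - 4 * sqrt h)" using h_pos by (simp add: algebra_simps)
  also have "\<dots> \<le> c * 4" using c0 h_pos by (intro mult_left_mono) auto
  finally show ?thesis by (simp add: c_def)
qed

lemma pairing_small_diff:
  assumes KK: "\<K> \<subseteq> \<T>" and v: "\<And>K. K \<in> \<K> \<Longrightarrow> v K \<in> Poly k" and a: "0 < a" "a \<le> b" "b \<le> 1" "b \<le> h"
  shows "\<bar>pairing \<K> v b - pairing \<K> v a\<bar> \<le> CS * sqrt h * E * sqrt (X2 \<K> v)"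
proof -
  define c where "c = CS * E * sqrt (X2 \<K> v) / sqrt h"
  have c0: "0 \<le> c" using CS_nonneg E_nonneg X2_nonneg h_pos by (simp add: c_def)
  have "\<bar>pairing \<K> v b - pairing \<K> v a\<bar> \<le> c * b - c * a"
  proof (rule DERIV_dominated_le[OF a(2), where f' = "\<lambda>s. - pairing' \<K> v s" and g' = "\<lambda>s. c"])
    fix s assume e: "a \<le> s" "s \<le> b"
    then have e0: "0 < s" "s \<le> 1" "s \<le> h" using a by linarith+
    show "DERIV (pairing \<K> v) s :> - pairing' \<K> v s" by (rule DERIV_pairing[OF e0(1) KK v])
    show "DERIV (\<lambda>s. c * s) s :> c" by (auto intro!: derivative_eq_intros)
    show "\<bar>- pairing' \<K> v s\<bar> \<le> c" using pairing'_small[OF KK v e0] by (simp add: c_def)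
  qed
  also have "\<dots> \<le> c * h" using c0 a by (simp add: mult_left_mono right_diff_distrib[symmetric])
  also have "\<dots> = CS * sqrt h * E * sqrt (X2 \<K> v)"
    using h_pos by (simp add: c_def field_simps)
  finally show ?thesis .
qed

text \<open>The pairing is followed from s = 1, where the mean is the constant \<open>cS\<close>,
  down to s = 0, where it has become u. Large scales contribute sqrt \<delta> and small ones sqrt h,
  which is no more because of h \<le> \<delta>.\<close>

theorem kernel_estimate:
  assumes KK: "\<K> \<subseteq> \<T>" and v: "\<And>K. K \<in> \<K> \<Longrightarrow> v K \<in> Poly k" and h\<delta>: "h \<le> \<delta>"
    and layer: "\<And>z r. 0 < r \<Longrightarrow> r \<le> D + 1 \<Longrightarrow> (\<Sum>K\<in>\<K>. measure lebesgue (K \<inter> S \<inter> cball z r)) \<le> \<delta> * r ^ (CARD('d) - 1)"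
  shows "\<bar>\<Sum>K\<in>\<K>. LINT x|vol_measure (K \<inter> S). v K x * (u K x - cS)\<bar> \<le> CKL * sqrt \<delta> * E * sqrt (X2 \<K> v)"
proof -
  \<comment> \<open>The mesh size may exceed 1, whereas the scales end at 1; then the range of large
    scales is empty.\<close>
  define \<eta> where "\<eta> = min h 1"
  have \<eta>: "0 < \<eta>" "\<eta> \<le> 1" "\<eta> \<le> h" using h_pos by (auto simp: \<eta>_def)
  have \<delta>: "0 \<le> \<delta>" using h_pos h\<delta> by linarith
  let ?B = "CKL * sqrt \<delta> * E * sqrt (X2 \<K> v)"
  have large: "\<bar>pairing \<K> v 1 - pairing \<K> v \<eta>\<bar> \<le> 4 * sqrt CL * sqrt \<delta> * E * sqrt (X2 \<K> v)"
  proof (cases "h \<le> 1")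
    case True
    then show ?thesis using pairing_large_diff[OF KK v True \<delta> layer] by (simp add: \<eta>_def)
  next
    case False
    then show ?thesis using CL_nonneg \<delta> E_nonneg X2_nonneg by (simp add: \<eta>_def)
  qed
  have bound: "\<bar>pairing \<K> v 1 - pairing \<K> v (1 / Suc j)\<bar> \<le> ?B" if j: "1 / real (Suc j) \<le> \<eta>" for j
  proof -
    have "\<bar>pairing \<K> v \<eta> - pairing \<K> v (1 / Suc j)\<bar> \<le> CS * sqrt h * E * sqrt (X2 \<K> v)"
      by (rule pairing_small_diff[OF KK v _ j \<eta>(2,3)]) (simp_all only: zero_less_divide_1_iff of_nat_0_less_iff zero_less_Suc)
    also have "\<dots> \<le> CS * sqrt \<delta> * E * sqrt (X2 \<K> v)"
      using h\<delta> CS_nonneg E_nonneg X2_nonneg by (intro mult_right_mono mult_left_mono) auto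
    finally have "\<bar>pairing \<K> v 1 - pairing \<K> v (1 / Suc j)\<bar> \<le> 4 * sqrt CL * sqrt \<delta> * E * sqrt (X2 \<K> v) + CS * sqrt \<delta> * E * sqrt (X2 \<K> v)"
      using large by linarith
    then show ?thesis by (simp add: CKL_def distrib_right)
  qed
  obtain N :: nat where N: "1 / \<eta> < real N" using reals_Archimedean2 by blast
  have "(\<lambda>j. \<bar>pairing \<K> v 1 - pairing \<K> v (1 / Suc j)\<bar>) \<longlonglongrightarrow> \<bar>pairing \<K> v 1 - (\<Sum>K\<in>\<K>. LINT x|vol_measure (K \<inter> S). v K x * u K x)\<bar>"
    by (intro tendsto_intros pairing_tendsto KK v)
  moreover have "\<exists>N. \<forall>j\<ge>N. \<bar>pairing \<K> v 1 - pairing \<K> v (1 / Suc j)\<bar> \<le> ?B"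
  proof (intro exI[of _ N] allI impI bound)
    fix j assume "N \<le> j"
    then have "1 / \<eta> \<le> real (Suc j)" using N by simp
    then show "1 / real (Suc j) \<le> \<eta>" using \<eta>(1) by (simp add: field_simps)
  qed
  ultimately have lim: "\<bar>pairing \<K> v 1 - (\<Sum>K\<in>\<K>. LINT x|vol_measure (K \<inter> S). v K x * u K x)\<bar> \<le> ?B"
    by (rule LIMSEQ_le_const2)
  have "(\<Sum>K\<in>\<K>. LINT x|vol_measure (K \<inter> S). v K x * (u K x - cS)) = (\<Sum>K\<in>\<K>. LINT x|vol_measure (K \<inter> S). v K x * u K x) - pairing \<K> v 1"
    unfolding pairing_1[OF KK] sum_subtractf[symmetric]
  proof (rule sum.cong[OF refl])
    fix K assume KK': "K \<in> \<K>"
    then have K: "K \<in> \<T>" using KK by blast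
    show "(LINT x|vol_measure (K \<inter> S). v K x * (u K x - cS)) = (LINT x|vol_measure (K \<inter> S). v K x * u K x) - (LINT x|vol_measure (K \<inter> S). v K x * cS)"
      unfolding right_diff_distrib
      by (intro Bochner_Integration.integral_diff integrable_vol_measure[OF compact_KS[OF K]] continuous_intros cont_u[OF K] Poly_continuous[OF v[OF KK']])
  qed
  then show ?thesis using lim by (simp add: abs_minus_commute)
qed

end

subsection \<open>Poincare inequality\<close>

text \<open>The bump is the normalized square of the positive part of \<rho>^2 - |y - x0|^2,
  supported in a ball inside S. All its parameters depend on S alone.\<close>

lemma bump_kernel_exists:
  fixes S :: "(real^'d) set"
  assumes S: "convex S" "compact S" and int: "interior S \<noteq> {}"
  obtains \<omega> g\<omega> W L D where "bump_kernel S \<omega> g\<omega> W L D"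
proof -
  obtain x0 where "x0 \<in> interior S" using int by blast
  then obtain \<rho> where \<rho>: "0 < \<rho>" "cball x0 \<rho> \<subseteq> interior S"
    using open_contains_cball[of "interior S"] by auto
  define t where "t y = \<rho>\<^sup>2 - (y - x0) \<bullet> (y - x0)" for y :: "real^'d"
  define \<psi> where "\<psi> y = (max 0 (t y))\<^sup>2" for y :: "real^'d"
  define g\<psi> where "g\<psi> y = (- 4 * max 0 (t y)) *\<^sub>R (y - x0)" for y :: "real^'d"
  have ct: "continuous_on UNIV t" unfolding t_def[abs_def] by (intro continuous_intros)
  have tpos: "norm (y - x0) < \<rho>" if "0 < t y" for y
    using that \<rho>(1) power_mono[of \<rho> "norm (y - x0)" 2] unfolding t_def by (fastforce simp: dot_square_norm)
  have t_le: "t y \<le> \<rho>\<^sup>2" for y by (simp add: t_def)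
  \<comment> \<open>The square of the positive part is differentiable also at 0, and its derivative
    is continuous; this makes the bump \<open>C1\<close>.\<close>
  have DM: "((\<lambda>s::real. (max 0 s)\<^sup>2) has_real_derivative 2 * max 0 s) (at s)" for s
  proof -
    consider "s < 0" | "s > 0" | "s = 0" by linarith
    then show ?thesis
    proof cases
      case 1
      have "eventually (\<lambda>s. (0::real) = (max 0 s)\<^sup>2) (nhds s)"
        using eventually_nhds_in_open[of "{..<0}" s] 1 by (auto elim!: eventually_mono)
      then have "((\<lambda>_. 0::real) has_real_derivative 0) (at s) \<longleftrightarrow> ((\<lambda>s::real. (max 0 s)\<^sup>2) has_real_derivative 0) (at s)"
        by (intro DERIV_cong_ev) auto
      then show ?thesis using 1 by simp
    next
      case 2
      have "eventually (\<lambda>s. s\<^sup>2 = (max 0 s)\<^sup>2) (nhds s)"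
        using eventually_nhds_in_open[of "{0<..}" s] 2 by (auto elim!: eventually_mono)
      then have "((\<lambda>s. s\<^sup>2) has_real_derivative 2 * s) (at s) \<longleftrightarrow> ((\<lambda>s::real. (max 0 s)\<^sup>2) has_real_derivative 2 * s) (at s)"
        by (intro DERIV_cong_ev) auto
      moreover have "((\<lambda>s. s\<^sup>2) has_real_derivative 2 * s) (at s)" by (auto intro!: derivative_eq_intros)
      ultimately show ?thesis using 2 by simp
    next
      case 3
      have lim: "((\<lambda>h::real. (max 0 h)\<^sup>2 / h) \<longlongrightarrow> 0) (at 0)"
      proof (rule Lim_null_comparison)
        show "\<forall>\<^sub>F h in at (0::real). norm ((max 0 h)\<^sup>2 / h) \<le> \<bar>h\<bar>"
          by (rule always_eventually) (auto simp: max_def power2_eq_square)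
        show "((\<lambda>h::real. \<bar>h\<bar>) \<longlongrightarrow> 0) (at 0)" by (intro tendsto_eq_intros) auto
      qed
      show ?thesis unfolding 3 DERIV_def using lim by simp
    qed
  qed
  have C\<psi>: "C1 \<psi> g\<psi>"
    unfolding C1_def
  proof (intro conjI allI)
    fix x
    have "(t has_derivative (\<lambda>h. - 2 * ((x - x0) \<bullet> h))) (at x)"
      unfolding t_def[abs_def] by (auto intro!: derivative_eq_intros simp: inner_commute)
    then have "((\<lambda>y. (max 0 (t y))\<^sup>2) has_derivative (\<lambda>h. (2 * max 0 (t x)) * (- 2 * ((x - x0) \<bullet> h)))) (at x)"
      by (rule has_derivative_compose[where f = t and g = "\<lambda>s. (max 0 s)\<^sup>2" and g' = "(*) (2 * max 0 (t x))"])
         (rule DM[of "t x", unfolded has_field_derivative_def])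
    then show "(\<psi> has_derivative (\<lambda>h. g\<psi> x \<bullet> h)) (at x)"
      unfolding \<psi>_def[abs_def] g\<psi>_def by (simp add: mult.assoc)
    show "continuous_on UNIV g\<psi>" unfolding g\<psi>_def[abs_def] by (intro continuous_intros ct)
  qed
  have supp: "y \<in> cball x0 \<rho>" if "\<psi> y \<noteq> 0" for y
    using tpos[of y] that by (auto simp: \<psi>_def max_def dist_norm norm_minus_commute split: if_splits)
  have \<psi>_le: "\<psi> y \<le> (\<rho>\<^sup>2)\<^sup>2" for y
    unfolding \<psi>_def using t_le by (intro power_mono) auto
  have g\<psi>_le: "norm (g\<psi> y) \<le> 4 * \<rho>\<^sup>2 * \<rho>" for y
  proof (cases "0 < t y")
    case True
    then show ?thesis using tpos[OF True] t_le[of y] \<rho>(1)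
      by (auto simp: g\<psi>_def intro!: mult_mono)
  qed (use \<rho>(1) in \<open>simp add: g\<psi>_def max_def\<close>)
  have cont: "continuous_on UNIV \<psi>" using C\<psi> by (rule C1_continuous)
  have eq: "\<psi> = (\<lambda>y. indicator (cball x0 \<rho>) y * \<psi> y)"
    using supp by (auto simp: indicator_def fun_eq_iff)
  have int\<psi>: "integrable lborel \<psi>"
    by (subst eq) (intro integrable_continuous_bounded_support cont, auto)
  define c where "c = (LINT y|lborel. \<psi> y)"
  have c: "0 < c"
  proof -
    \<comment> \<open>On the concentric ball of half the radius, \<open>t\<close> is at least
      \<rho>^2 - \<rho>^2 / 4.\<close>
    define a where "a = (3 / 4 * \<rho>\<^sup>2)\<^sup>2"
    have a: "0 < a" using \<rho>(1) by (simp add: a_def)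
    have "0 < measure lborel (cball x0 (\<rho> / 2))" using content_cball_pos[of "\<rho> / 2" x0] \<rho>(1) by simp
    then have "0 < a * measure lborel (cball x0 (\<rho> / 2))" using a by simp
    also have "\<dots> = (LINT y|lborel. indicator (cball x0 (\<rho> / 2)) y * a)" by simp
    also have "\<dots> \<le> c"
      unfolding c_def
    proof (rule integral_mono[OF _ int\<psi>])
      show "integrable lborel (\<lambda>y. indicator (cball x0 (\<rho> / 2)) y * a)"
        by (rule integrable_continuous_bounded_support) auto
      fix y
      show "indicator (cball x0 (\<rho> / 2)) y * a \<le> \<psi> y"
      proof (cases "y \<in> cball x0 (\<rho> / 2)")
        case True
        then have "(norm (y - x0))\<^sup>2 \<le> (\<rho> / 2)\<^sup>2"
          by (intro power_mono) (auto simp: dist_norm norm_minus_commute)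
        then have "3 / 4 * \<rho>\<^sup>2 \<le> t y" by (simp add: t_def dot_square_norm power_divide)
        then have "a \<le> \<psi> y" unfolding a_def \<psi>_def by (intro power_mono) auto
        then show ?thesis using True by simp
      qed (simp add: \<psi>_def)
    qed
    finally show ?thesis .
  qed
  have "bump_kernel S (\<lambda>y. (1 / c) * \<psi> y) (\<lambda>y. (1 / c) *\<^sub>R g\<psi> y) ((1 / c) * (\<rho>\<^sup>2)\<^sup>2) ((1 / c) * (4 * \<rho>\<^sup>2 * \<rho>)) (diameter S + 1)"
  proof
    show "convex S" "compact S" by fact+
    show "C1 (\<lambda>y. (1 / c) * \<psi> y) (\<lambda>y. (1 / c) *\<^sub>R g\<psi> y)" using C1_cmult[OF C\<psi>] .
    show "0 \<le> (1 / c) * \<psi> y" for y using c by (simp add: \<psi>_def)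
    show "(1 / c) * \<psi> y \<le> (1 / c) * (\<rho>\<^sup>2)\<^sup>2" for y using c \<psi>_le by (intro mult_left_mono) auto
    show "norm ((1 / c) *\<^sub>R g\<psi> y) \<le> (1 / c) * (4 * \<rho>\<^sup>2 * \<rho>)" for y
      using c mult_left_mono[OF g\<psi>_le[of y], of "1 / c"] by simp
    show "y \<in> interior S" if "(1 / c) * \<psi> y \<noteq> 0" for y using that supp[of y] \<rho>(2) by auto
    show "(LINT y|lborel. (1 / c) * \<psi> y) = 1" using c by (simp add: c_def)
    show "0 < diameter S + 1" using diameter_ge_0[OF compact_imp_bounded[OF S(2)]] by linarith
    show "dist x y \<le> diameter S + 1" if "x \<in> S" "y \<in> S" for x y
      using diameter_bounded_bound[OF compact_imp_bounded[OF S(2)] that] by linarith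
  qed
  then show ?thesis by (rule that)
qed

section \<open>Distances to constants on parts of the domain\<close>

lemma power2_diff_le: "(a - b)\<^sup>2 \<le> 2 * a\<^sup>2 + 2 * (b :: real)\<^sup>2"
  using zero_le_power2[of "a + b"] by (simp add: power2_sum power2_diff)

lemma integrable_vol_measure_iff:
  fixes f :: "'a::euclidean_space \<Rightarrow> real"
  assumes [measurable]: "B \<in> sets borel" "f \<in> borel_measurable borel"
  shows "integrable (vol_measure B) f \<longleftrightarrow> integrable lborel (\<lambda>x. indicator B x * f x)"
  unfolding vol_measure_def
  by (subst integrable_density[where g = "indicator B", simplified ennreal_indicator]) auto

lemma integrable_vol_measure_bounded:
  fixes f :: "real^'d \<Rightarrow> real"
  assumes "B \<in> sets borel" "bounded B" "continuous_on UNIV f"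
  shows "integrable (vol_measure B) f"
  using assms integrable_vol_measure_iff[OF assms(1) borel_measurable_continuous_onI[OF assms(3)]]
  by (simp add: integrable_continuous_bounded_support)

lemma vol_measure_bounded:
  fixes B :: "(real^'d) set"
  assumes "B \<in> sets borel" "bounded B"
  shows "finite_measure (vol_measure B)" "measure (vol_measure B) UNIV = measure lebesgue B"
  using assms emeasure_bounded_finite[OF assms(2)]
  by (auto simp: emeasure_vol_measure measure_def intro!: finite_measureI)

lemma vol_integral_mono_set:
  fixes f :: "real^'d \<Rightarrow> real"
  assumes B: "B \<in> sets borel" "B' \<in> sets borel" "bounded B'" "B \<subseteq> B'" and f: "continuous_on UNIV f" "\<And>x. 0 \<le> f x"
  shows "(LINT x|vol_measure B. f x) \<le> (LINT x|vol_measure B'. f x)"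
proof -
  have "bounded B" using B bounded_subset by blast
  show ?thesis
    unfolding integral_vol_measure[OF B(1) borel_measurable_continuous_onI[OF f(1)]] integral_vol_measure[OF B(2) borel_measurable_continuous_onI[OF f(1)]]
    by (rule integral_mono[OF integrable_continuous_bounded_support[OF B(1) \<open>bounded B\<close> f(1)] integrable_continuous_bounded_support[OF B(2,3) f(1)]])
         (use B f in \<open>auto simp: indicator_def\<close>)
qed

lemma vol_integral_Un_le:
  fixes f :: "real^'d \<Rightarrow> real"
  assumes B: "B \<in> sets borel" "B' \<in> sets borel" "bounded B" "bounded B'" and f: "continuous_on UNIV f" "\<And>x. 0 \<le> f x"
  shows "(LINT x|vol_measure (B \<union> B'). f x) \<le> (LINT x|vol_measure B. f x) + (LINT x|vol_measure B'. f x)"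
proof -
  have [measurable]: "f \<in> borel_measurable borel" by (rule borel_measurable_continuous_onI[OF f(1)])
  have i: "integrable lborel (\<lambda>x. indicator Z x * f x)" if "Z \<in> sets borel" "bounded Z" for Z
    using that f(1) by (rule integrable_continuous_bounded_support)
  have "(LINT x|lborel. indicator (B \<union> B') x * f x) \<le> (LINT x|lborel. indicator B x * f x + indicator B' x * f x)"
    by (intro integral_mono i Bochner_Integration.integrable_add) (use B f in \<open>auto simp: indicator_def\<close>)
  also have "\<dots> = (LINT x|lborel. indicator B x * f x) + (LINT x|lborel. indicator B' x * f x)"
    by (intro Bochner_Integration.integral_add i B)
  finally show ?thesis using B by (simp add: integral_vol_measure)
qed

context simplicial_mesh
begin

lemma AE_sum_indicator:
  assumes "\<K> \<subseteq> \<T>"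
  shows "AE x in lborel. (\<Sum>K\<in>\<K>. indicator K x) = (indicator (\<Union>\<K>) x :: real)"
proof -
  have fin: "finite \<K>" using assms finite_T finite_subset by blast
  define P where "P = {(K, K') \<in> \<K> \<times> \<K>. K \<noteq> K'}"
  have "finite P" using fin by (auto simp: P_def intro: finite_subset[of _ "\<K> \<times> \<K>"])
  then have "AE x in lborel. \<forall>(K, K')\<in>P. x \<notin> K \<inter> K'"
  proof (rule AE_finite_allI)
    fix KK assume "KK \<in> P"
    then obtain K K' where KK: "KK = (K, K')" "K \<in> \<T>" "K' \<in> \<T>" "K \<noteq> K'" using assms by (auto simp: P_def)
    have "K \<inter> K' \<in> null_sets lborel"
      using negligible_Int[OF KK(2-4)] borel_T KK by (simp add: negligible_iff_null_sets null_sets_completion_iff)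
    then show "AE x in lborel. case KK of (K, K') \<Rightarrow> x \<notin> K \<inter> K'" using KK AE_not_in by fastforce
  qed
  then show ?thesis
  proof eventually_elim
    case (elim x)
    show ?case
    proof (cases "x \<in> \<Union>\<K>")
      case True
      then obtain K where K: "K \<in> \<K>" "x \<in> K" by blast
      have "indicator L x = (if L = K then 1 else 0 :: real)" if "L \<in> \<K>" for L
        using elim K that by (auto simp: P_def indicator_def)
      then have "(\<Sum>L\<in>\<K>. indicator L x) = (\<Sum>L\<in>\<K>. if L = K then 1 else 0 :: real)" by (rule sum.cong[OF refl])
      also have "\<dots> = 1" using K(1) fin by simp
      finally show ?thesis using True by simp
    qed (auto simp: indicator_def intro!: sum.neutral)
  qed
qed

lemma integral_vol_split:
  assumes B: "B \<in> sets borel" "B \<subseteq> closure \<Omega>" and f: "f \<in> borel_measurable borel" "integrable (vol_measure B) f"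
  shows "(\<Sum>K\<in>\<T>. LINT x|vol_measure (K \<inter> B). f x) = (LINT x|vol_measure B. f x :: real)"
proof -
  note [measurable] = B(1) f(1) borel_T
  have i: "integrable lborel (\<lambda>x. indicator B x * f x)" using f B integrable_vol_measure_iff by blast
  have iK: "integrable lborel (\<lambda>x. indicator (K \<inter> B) x * f x)" if K[measurable]: "K \<in> \<T>" for K
  proof -
    have "integrable lborel (\<lambda>x. indicator K x *\<^sub>R (indicator B x * f x))"
      using borel_T[OF K] i by (intro integrable_mult_indicator) auto
    then show ?thesis by (simp add: indicator_inter_arith mult.assoc)
  qed
  have "(\<Sum>K\<in>\<T>. LINT x|vol_measure (K \<inter> B). f x) = (\<Sum>K\<in>\<T>. LINT x|lborel. indicator (K \<inter> B) x * f x)"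
    using B borel_T f by (intro sum.cong integral_vol_measure) auto
  also have "\<dots> = (LINT x|lborel. (\<Sum>K\<in>\<T>. indicator (K \<inter> B) x * f x))"
    by (rule Bochner_Integration.integral_sum[symmetric]) (rule iK)
  also have "\<dots> = (LINT x|lborel. indicator B x * f x)"
  proof (rule integral_cong_AE)
    show "(\<lambda>x. \<Sum>K\<in>\<T>. indicator (K \<inter> B) x * f x) \<in> borel_measurable lborel"
      by (intro borel_measurable_sum borel_measurable_integrable iK)
    show "AE x in lborel. (\<Sum>K\<in>\<T>. indicator (K \<inter> B) x * f x) = indicator B x * f x"
      using AE_sum_indicator[OF subset_refl]
    proof eventually_elim
      case (elim x)
      have "(\<Sum>K\<in>\<T>. indicator (K \<inter> B) x * f x) = (\<Sum>K\<in>\<T>. indicator K x) * (indicator B x * f x)"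
        by (simp add: sum_distrib_right indicator_inter_arith mult.assoc)
      then show ?case using elim B(2) Union_T by (auto simp: indicator_def)
    qed
  qed (use i in \<open>auto intro: borel_measurable_integrable\<close>)
  also have "\<dots> = (LINT x|vol_measure B. f x)" by (rule integral_vol_measure[symmetric]) fact+
  finally show ?thesis .
qed

lemma sum_measure_T_le:
  assumes "\<K> \<subseteq> \<T>" "U \<in> sets borel" "V \<in> sets borel" "bounded V" "\<And>K. K \<in> \<K> \<Longrightarrow> K \<inter> U \<subseteq> V"
  shows "(\<Sum>K\<in>\<K>. measure lebesgue (K \<inter> U)) \<le> measure lebesgue V"
proof -
  have fin: "finite \<K>" using assms(1) finite_T finite_subset by blast
  have lm: "K \<inter> U \<in> lmeasurable" if "K \<in> \<K>" for K
  proof -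
    have "K \<inter> U \<in> sets borel" "bounded (K \<inter> U)" using that assms(1,2) borel_T bounded_T by (auto intro: bounded_subset)
    then show ?thesis by (auto intro!: bounded_set_imp_lmeasurable)
  qed
  have "(\<Sum>K\<in>\<K>. measure lebesgue (K \<inter> U)) = measure lebesgue (\<Union>K\<in>\<K>. K \<inter> U)"
  proof (rule measure_negligible_finite_Union_image[symmetric, OF fin lm])
    show "pairwise (\<lambda>K K'. negligible (K \<inter> U \<inter> (K' \<inter> U))) \<K>"
      unfolding pairwise_def using assms(1) negligible_Int by (blast intro: negligible_subset)
  qed
  also have "\<dots> \<le> measure lebesgue V"
  proof (rule measure_mono_fmeasurable)
    show "(\<Union>K\<in>\<K>. K \<inter> U) \<subseteq> V" using assms(5) by blast
    show "(\<Union>K\<in>\<K>. K \<inter> U) \<in> sets lebesgue" by (rule sets.finite_UN[OF fin fmeasurableD[OF lm]])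
    show "V \<in> lmeasurable" using assms(3,4) by (intro bounded_set_imp_lmeasurable) auto
  qed
  finally show ?thesis .
qed

lemma measure_le_sum:
  assumes "U \<in> sets borel" "U \<subseteq> closure \<Omega>"
  shows "measure lebesgue U \<le> (\<Sum>K\<in>\<T>. measure lebesgue (K \<inter> U))"
proof -
  have "U = (\<Union>K\<in>\<T>. K \<inter> U)" using assms(2) Union_T by blast
  then have "measure lebesgue U = measure lebesgue (\<Union>K\<in>\<T>. K \<inter> U)" by simp
  also have "\<dots> \<le> (\<Sum>K\<in>\<T>. measure lebesgue (K \<inter> U))"
    using borel_T assms(1) by (intro measure_UNION_le finite_T) auto
  finally show ?thesis .
qed

end

text \<open>The squared L2 distance of u to the constant c on U, restricted to the listed elements:
  the whole mesh, or the boundary elements only.\<close>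

definition nrm2 :: "(real^'d) set set \<Rightarrow> (real^'d) set \<Rightarrow> ((real^'d) set \<Rightarrow> real^'d \<Rightarrow> real) \<Rightarrow> real \<Rightarrow> real" where
  "nrm2 \<T> U u c = (\<Sum>K\<in>\<T>. LINT x|vol_measure (K \<inter> U). (u K x - c)\<^sup>2)"

lemma nrm2_nonneg: "0 \<le> nrm2 \<T> U u c"
  unfolding nrm2_def by (intro sum_nonneg Bochner_Integration.integral_nonneg) simp

context hdg_discrete
begin

abbreviation "meas \<equiv> measure lebesgue (closure \<Omega>)"

lemma borel_closure: "closure \<Omega> \<in> sets borel" and bounded_closure_Omega: "bounded (closure \<Omega>)"
  using bounded_Omega by (auto intro: bounded_closure)

lemma borel_TI: "K \<in> \<T> \<Longrightarrow> U \<in> sets borel \<Longrightarrow> K \<inter> U \<in> sets borel" and bounded_TI: "K \<in> \<T> \<Longrightarrow> bounded (K \<inter> U)"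
  using borel_T bounded_T by (auto intro: bounded_subset)

lemma cont_uc: "K \<in> \<T> \<Longrightarrow> continuous_on UNIV (\<lambda>x. (u K x - c)\<^sup>2)"
  by (intro continuous_intros cont_u)

lemma int_TI: "K \<in> \<T> \<Longrightarrow> U \<in> sets borel \<Longrightarrow> continuous_on UNIV f \<Longrightarrow> integrable (vol_measure (K \<inter> U)) (f :: _ \<Rightarrow> real)"
  by (intro integrable_vol_measure_bounded borel_TI bounded_TI)

lemma sum_measure_le_meas: "U \<in> sets borel \<Longrightarrow> (\<Sum>K\<in>\<T>. measure lebesgue (K \<inter> U)) \<le> meas"
  using subset_T by (intro sum_measure_T_le borel_closure bounded_closure_Omega) auto

lemma nrm2_mono: "U \<in> sets borel \<Longrightarrow> V \<in> sets borel \<Longrightarrow> U \<subseteq> V \<Longrightarrow> nrm2 \<T> U u c \<le> nrm2 \<T> V u c"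
  unfolding nrm2_def by (intro sum_mono vol_integral_mono_set borel_TI bounded_TI cont_uc) auto

lemma nrm2_Un: "U \<in> sets borel \<Longrightarrow> V \<in> sets borel \<Longrightarrow> nrm2 \<T> (U \<union> V) u c \<le> nrm2 \<T> U u c + nrm2 \<T> V u c"
  unfolding nrm2_def sum.distrib[symmetric] Int_Un_distrib
  by (intro sum_mono vol_integral_Un_le borel_TI bounded_TI cont_uc) auto

lemma integral_const_TI: "K \<in> \<T> \<Longrightarrow> U \<in> sets borel \<Longrightarrow> (LINT x|vol_measure (K \<inter> U). c) = measure lebesgue (K \<inter> U) * (c :: real)"
proof -
  assume K: "K \<in> \<T>" "U \<in> sets borel"
  interpret finite_measure "vol_measure (K \<inter> U)" by (rule vol_measure_bounded(1)[OF borel_TI[OF K] bounded_TI[OF K(1)]])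
  show ?thesis using vol_measure_bounded(2)[OF borel_TI[OF K] bounded_TI[OF K(1)]] by simp
qed

lemma nrm2_change:
  assumes U: "U \<in> sets borel"
  shows "nrm2 \<T> U u c \<le> 2 * nrm2 \<T> U u c' + 2 * (c - c')\<^sup>2 * meas"
proof -
  have "nrm2 \<T> U u c \<le> (\<Sum>K\<in>\<T>. LINT x|vol_measure (K \<inter> U). 2 * (u K x - c')\<^sup>2 + 2 * (c - c')\<^sup>2)"
    unfolding nrm2_def
  proof (intro sum_mono integral_mono int_TI U continuous_intros cont_u)
    fix K x
    have "(u K x - c)\<^sup>2 = ((u K x - c') - (c - c'))\<^sup>2" by simp
    also have "\<dots> \<le> 2 * (u K x - c')\<^sup>2 + 2 * (c - c')\<^sup>2"
      by (rule power2_diff_le)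
    finally show "(u K x - c)\<^sup>2 \<le> 2 * (u K x - c')\<^sup>2 + 2 * (c - c')\<^sup>2" .
  qed
  also have "\<dots> = (\<Sum>K\<in>\<T>. 2 * (LINT x|vol_measure (K \<inter> U). (u K x - c')\<^sup>2) + measure lebesgue (K \<inter> U) * (2 * (c - c')\<^sup>2))"
  proof (rule sum.cong[OF refl])
    fix K assume K: "K \<in> \<T>"
    have "(LINT x|vol_measure (K \<inter> U). 2 * (u K x - c')\<^sup>2 + 2 * (c - c')\<^sup>2) = (LINT x|vol_measure (K \<inter> U). 2 * (u K x - c')\<^sup>2) + (LINT x|vol_measure (K \<inter> U). 2 * (c - c')\<^sup>2)"
      by (intro Bochner_Integration.integral_add int_TI[OF K U] continuous_intros cont_u[OF K])
    then show "(LINT x|vol_measure (K \<inter> U). 2 * (u K x - c')\<^sup>2 + 2 * (c - c')\<^sup>2) = 2 * (LINT x|vol_measure (K \<inter> U). (u K x - c')\<^sup>2) + measure lebesgue (K \<inter> U) * (2 * (c - c')\<^sup>2)"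
      using integral_const_TI[OF K U, of "2 * (c - c')\<^sup>2"] by simp
  qed
  also have "\<dots> = 2 * nrm2 \<T> U u c' + (\<Sum>K\<in>\<T>. measure lebesgue (K \<inter> U)) * (2 * (c - c')\<^sup>2)"
    by (simp add: nrm2_def sum.distrib sum_distrib_left sum_distrib_right)
  also have "\<dots> \<le> 2 * nrm2 \<T> U u c' + meas * (2 * (c - c')\<^sup>2)"
    using sum_measure_le_meas[OF U] by (intro add_left_mono mult_right_mono) auto
  finally show ?thesis by (simp add: mult.commute mult.left_commute)
qed

text \<open>If u is close to both constants on U, then they are close to each other. Applied to the
  overlap of two sets, this links their constants.\<close>

lemma const_diff_le:
  assumes U: "U \<in> sets borel" "U \<subseteq> closure \<Omega>"
  shows "measure lebesgue U * (c - c')\<^sup>2 \<le> 2 * nrm2 \<T> U u c + 2 * nrm2 \<T> U u c'"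
proof -
  have "measure lebesgue U * (c - c')\<^sup>2 \<le> (\<Sum>K\<in>\<T>. measure lebesgue (K \<inter> U)) * (c - c')\<^sup>2"
    by (intro mult_right_mono measure_le_sum U) simp
  also have "\<dots> = (\<Sum>K\<in>\<T>. LINT x|vol_measure (K \<inter> U). (c - c')\<^sup>2)"
    by (simp only: integral_const_TI[OF _ U(1)] sum_distrib_right cong: sum.cong)
  also have "\<dots> \<le> (\<Sum>K\<in>\<T>. LINT x|vol_measure (K \<inter> U). 2 * (u K x - c)\<^sup>2 + 2 * (u K x - c')\<^sup>2)"
  proof (intro sum_mono integral_mono int_TI U continuous_intros cont_u)
    fix K x
    have "(c - c')\<^sup>2 = ((u K x - c') - (u K x - c))\<^sup>2" by simp
    also have "\<dots> \<le> 2 * (u K x - c')\<^sup>2 + 2 * (u K x - c)\<^sup>2" by (rule power2_diff_le)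
    finally show "(c - c')\<^sup>2 \<le> 2 * (u K x - c)\<^sup>2 + 2 * (u K x - c')\<^sup>2" by simp
  qed
  also have "\<dots> = (\<Sum>K\<in>\<T>. 2 * (LINT x|vol_measure (K \<inter> U). (u K x - c)\<^sup>2) + 2 * (LINT x|vol_measure (K \<inter> U). (u K x - c')\<^sup>2))"
  proof (rule sum.cong[OF refl])
    fix K assume K: "K \<in> \<T>"
    have "(LINT x|vol_measure (K \<inter> U). 2 * (u K x - c)\<^sup>2 + 2 * (u K x - c')\<^sup>2) = (LINT x|vol_measure (K \<inter> U). 2 * (u K x - c)\<^sup>2) + (LINT x|vol_measure (K \<inter> U). 2 * (u K x - c')\<^sup>2)"
      by (intro Bochner_Integration.integral_add int_TI[OF K U(1)] continuous_intros cont_u[OF K])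
    then show "(LINT x|vol_measure (K \<inter> U). 2 * (u K x - c)\<^sup>2 + 2 * (u K x - c')\<^sup>2) = 2 * (LINT x|vol_measure (K \<inter> U). (u K x - c)\<^sup>2) + 2 * (LINT x|vol_measure (K \<inter> U). (u K x - c')\<^sup>2)"
      by simp
  qed
  also have "\<dots> = 2 * nrm2 \<T> U u c + 2 * nrm2 \<T> U u c'" by (simp add: nrm2_def sum.distrib sum_distrib_left)
  finally show ?thesis .
qed

lemma nrm2_closure: "nrm2 \<T> (closure \<Omega>) u c = nrm2 \<T> UNIV u c"
  unfolding nrm2_def using subset_T by (intro sum.cong refl) (simp add: Int_absorb2)

end

context hdg_kernel
begin

lemma borel_S: "S \<in> sets borel" and bounded_S: "bounded S"
  using S(2) by (auto simp: borel_compact compact_imp_bounded)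

lemma sum_integral_omega: "(\<Sum>K\<in>\<T>. LINT z|vol_measure K. \<omega> z) = 1"
proof -
  have m: "\<omega> \<in> borel_measurable borel" by (rule borel_measurable_continuous_onI[OF cont_omega])
  have "(\<Sum>K\<in>\<T>. LINT z|vol_measure K. \<omega> z) = (\<Sum>K\<in>\<T>. LINT z|vol_measure (K \<inter> closure \<Omega>). \<omega> z)"
    using subset_T by (intro sum.cong refl) (simp add: Int_absorb2)
  also have "\<dots> = (LINT z|vol_measure (closure \<Omega>). \<omega> z)"
    by (intro integral_vol_split borel_closure m integrable_vol_measure_bounded bounded_closure_Omega cont_omega) simp
  also have "\<dots> = (LINT z|lborel. indicator (closure \<Omega>) z * \<omega> z)"
    by (rule integral_vol_measure[OF borel_closure m])
  also have "\<dots> = (LINT z|lborel. \<omega> z)"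
  proof (rule Bochner_Integration.integral_cong[OF refl])
    fix z
    show "indicator (closure \<Omega>) z * \<omega> z = \<omega> z"
    proof (cases "\<omega> z = 0")
      case False
      then have "z \<in> closure \<Omega>" using supp interior_subset S_sub by blast
      then show ?thesis by simp
    qed simp
  qed
  also have "\<dots> = 1" by (rule omega_int)
  finally show ?thesis .
qed

text \<open>\<open>cS\<close> is a mean of u with weight \<omega>, and the weight has total mass 1
  because its support lies in \<Omega>. So c - \<open>cS\<close> is the weighted mean of c - u, to
  which Cauchy-Schwarz applies.\<close>

lemma cS_sq_le: "(c - cS)\<^sup>2 \<le> W\<^sup>2 * meas * nrm2 \<T> UNIV u c"
proof -
  have int: "integrable (vol_measure K) f" if "K \<in> \<T>" "continuous_on UNIV f" for K and f :: "real^'d \<Rightarrow> real"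
    using that by (rule vol_int)
  have "c - cS = (\<Sum>K\<in>\<T>. c * (LINT z|vol_measure K. \<omega> z)) - cS"
    using sum_integral_omega by (simp flip: sum_distrib_left)
  also have "\<dots> = (\<Sum>K\<in>\<T>. - (LINT z|vol_measure K. (u K z - c) * \<omega> z))"
    unfolding cS_def sum_subtractf[symmetric]
  proof (rule sum.cong[OF refl])
    fix K assume K: "K \<in> \<T>"
    have "(LINT z|vol_measure K. (u K z - c) * \<omega> z) = (LINT z|vol_measure K. u K z * \<omega> z - c * \<omega> z)"
      by (simp add: algebra_simps)
    also have "\<dots> = (LINT z|vol_measure K. u K z * \<omega> z) - (LINT z|vol_measure K. c * \<omega> z)"
      by (intro Bochner_Integration.integral_diff int[OF K] continuous_intros cont_u[OF K] cont_omega)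
    finally show "c * (LINT z|vol_measure K. \<omega> z) - (LINT z|vol_measure K. u K z * \<omega> z) = - (LINT z|vol_measure K. (u K z - c) * \<omega> z)"
      by simp
  qed
  finally have "\<bar>c - cS\<bar> = \<bar>\<Sum>K\<in>\<T>. - (LINT z|vol_measure K. (u K z - c) * \<omega> z)\<bar>" by simp
  also have "\<dots> \<le> (\<Sum>K\<in>\<T>. \<bar>LINT z|vol_measure K. (u K z - c) * \<omega> z\<bar>)"
    by (rule order_trans[OF sum_abs]) simp
  also have "\<dots> \<le> (\<Sum>K\<in>\<T>. sqrt (LINT z|vol_measure K. (u K z - c)\<^sup>2) * sqrt (LINT z|vol_measure K. (\<omega> z)\<^sup>2))"
    by (intro sum_mono Cauchy_Schwarz_integral_abs int continuous_intros cont_u cont_omega)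
  also have "\<dots> \<le> sqrt (\<Sum>K\<in>\<T>. LINT z|vol_measure K. (u K z - c)\<^sup>2) * sqrt (\<Sum>K\<in>\<T>. LINT z|vol_measure K. (\<omega> z)\<^sup>2)"
    by (rule sum_sqrt_mult_le) (auto intro: Bochner_Integration.integral_nonneg)
  also have "\<dots> \<le> sqrt (nrm2 \<T> UNIV u c) * sqrt (W\<^sup>2 * meas)"
  proof (intro mult_mono real_sqrt_le_mono)
    have "(\<Sum>K\<in>\<T>. LINT z|vol_measure K. (\<omega> z)\<^sup>2) \<le> (\<Sum>K\<in>\<T>. LINT z|vol_measure (K \<inter> UNIV). W\<^sup>2)"
    proof (rule sum_mono)
      fix K assume K: "K \<in> \<T>"
      have "(LINT z|vol_measure K. (\<omega> z)\<^sup>2) \<le> (LINT z|vol_measure K. W\<^sup>2)"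
        by (intro integral_mono int[OF K] continuous_intros cont_omega power_mono omega_le omega_nonneg)
      then show "(LINT z|vol_measure K. (\<omega> z)\<^sup>2) \<le> (LINT z|vol_measure (K \<inter> UNIV). W\<^sup>2)" by simp
    qed
    also have "\<dots> = (\<Sum>K\<in>\<T>. measure lebesgue (K \<inter> UNIV) * W\<^sup>2)"
      by (intro sum.cong refl integral_const_TI) auto
    also have "\<dots> = (\<Sum>K\<in>\<T>. measure lebesgue (K \<inter> UNIV)) * W\<^sup>2" by (rule sum_distrib_right[symmetric])
    also have "\<dots> \<le> meas * W\<^sup>2"
      by (intro mult_right_mono sum_measure_le_meas) auto
    finally show "(\<Sum>K\<in>\<T>. LINT z|vol_measure K. (\<omega> z)\<^sup>2) \<le> W\<^sup>2 * meas" by (simp add: mult.commute)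
  qed (auto simp: nrm2_def intro!: sum_nonneg Bochner_Integration.integral_nonneg)
  finally have "\<bar>c - cS\<bar>\<^sup>2 \<le> (sqrt (nrm2 \<T> UNIV u c) * sqrt (W\<^sup>2 * meas))\<^sup>2" by (intro power_mono) auto
  then show ?thesis using nrm2_nonneg[of \<T> UNIV u c] by (simp add: power_mult_distrib mult_ac)
qed

lemma nrm2_cS_le: "nrm2 \<T> UNIV u cS \<le> (2 + 2 * (W\<^sup>2 * meas * meas)) * nrm2 \<T> UNIV u c"
proof -
  have "(cS - c)\<^sup>2 * meas \<le> (W\<^sup>2 * meas * nrm2 \<T> UNIV u c) * meas"
    using cS_sq_le[of c] by (intro mult_right_mono) (auto simp: power2_commute)
  then show ?thesis using nrm2_change[of UNIV cS c] by (simp add: algebra_simps)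
qed

text \<open>\<open>kernel_estimate\<close> with v = u - \<open>cS\<close> on all elements. There is
  no thin layer here, and \<delta> is merely large enough to dominate h and the volume bound (2r)^d
  \<le> 2^d (D + 1) r^(d-1). The norm of v is taken over whole elements, also outside S, and this
  puts the norm over all of \<Omega> on the right.\<close>

lemma nrm2_convex_le:
  "nrm2 \<T> S u cS \<le> CKL * sqrt (max (2 ^ CARD('d) * (D + 1)) (diameter (closure \<Omega>))) * E
     * (sqrt (2 + 2 * (W\<^sup>2 * meas * meas)) * sqrt (nrm2 \<T> UNIV u c))"
proof -
  let ?\<delta> = "max (2 ^ CARD('d) * (D + 1)) (diameter (closure \<Omega>))"
  have "\<bar>\<Sum>K\<in>\<T>. LINT x|vol_measure (K \<inter> S). (u K x - cS) * (u K x - cS)\<bar> \<le> CKL * sqrt ?\<delta> * E * sqrt (X2 \<T> (\<lambda>K x. u K x - cS))"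
  proof (rule kernel_estimate)
    show "(\<lambda>x. u K x - cS) \<in> Poly k" if "K \<in> \<T>" for K using u[OF that] by (intro Poly_diff Poly_const)
    show "h \<le> ?\<delta>" using h_le by simp
    fix z :: "real^'d" and r :: real assume r: "0 < r" "r \<le> D + 1"
    have "(\<Sum>K\<in>\<T>. measure lebesgue (K \<inter> S \<inter> cball z r)) = (\<Sum>K\<in>\<T>. measure lebesgue (K \<inter> (S \<inter> cball z r)))"
      by (simp add: Int_assoc)
    also have "\<dots> \<le> measure lebesgue (cball z r)"
      using borel_S by (intro sum_measure_T_le) auto
    also have "\<dots> \<le> (2 * r) ^ CARD('d)" using r by (intro measure_cball_le) simp
    also have "\<dots> = 2 ^ CARD('d) * (r * r ^ (CARD('d) - 1))"
      by (simp add: power_mult_distrib power_eq_if[of r "CARD('d)"])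
    also have "\<dots> \<le> 2 ^ CARD('d) * ((D + 1) * r ^ (CARD('d) - 1))"
      using r by (intro mult_left_mono mult_right_mono) auto
    also have "\<dots> \<le> ?\<delta> * r ^ (CARD('d) - 1)"
      using r by (simp add: mult.assoc[symmetric] mult_right_mono)
    finally show "(\<Sum>K\<in>\<T>. measure lebesgue (K \<inter> S \<inter> cball z r)) \<le> ?\<delta> * r ^ (CARD('d) - 1)" .
  qed simp
  then have "nrm2 \<T> S u cS \<le> CKL * sqrt ?\<delta> * E * sqrt (nrm2 \<T> UNIV u cS)"
    by (simp add: nrm2_def X2_def power2_eq_square)
  also have "\<dots> \<le> CKL * sqrt ?\<delta> * E * (sqrt (2 + 2 * (W\<^sup>2 * meas * meas)) * sqrt (nrm2 \<T> UNIV u c))"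
  proof (intro mult_left_mono)
    show "sqrt (nrm2 \<T> UNIV u cS) \<le> sqrt (2 + 2 * (W\<^sup>2 * meas * meas)) * sqrt (nrm2 \<T> UNIV u c)"
      using nrm2_cS_le[of c] unfolding real_sqrt_mult[symmetric] by simp
    show "0 \<le> CKL * sqrt ?\<delta> * E" using CKL_nonneg E_nonneg diameter_Omega_pos by (simp add: le_max_iff_disj)
  qed
  finally show ?thesis .
qed

end

text \<open>
  The right-hand side contains the norm over all of \<open>\<Omega>\<close> with an arbitrary constant, so that these
  bounds survive unions; it is absorbed once \<open>U\<close> is all of \<open>\<Omega>\<close>.
\<close>

definition poincare_set :: "(real^'d) set \<Rightarrow> real \<Rightarrow> real \<Rightarrow> nat \<Rightarrow> real \<Rightarrow> (real^'d) set \<Rightarrow> bool" where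
  "poincare_set \<Omega> \<kappa> A k M U \<longleftrightarrow> U \<in> sets borel \<and> U \<subseteq> closure \<Omega> \<and>
    (\<exists>C\<ge>0. \<forall>\<T> p gu u w. hdg_discrete \<Omega> \<T> \<kappa> A k M p gu u w \<longrightarrow>
      (\<forall>c. \<exists>c'. nrm2 \<T> U u c' \<le> C * hdg_discrete.E \<T> p u w * sqrt (nrm2 \<T> UNIV u c)))"

lemma poincare_set_convex:
  fixes S :: "(real^'d) set"
  assumes S: "convex S" "compact S" "interior S \<noteq> {}" "S \<subseteq> closure \<Omega>"
  shows "poincare_set \<Omega> \<kappa> A k M S"
proof -
  obtain \<omega> g\<omega> W L D where bk: "bump_kernel S \<omega> g\<omega> W L D"
    using bump_kernel_exists[OF S(1-3)] .
  define m where "m = measure lebesgue (closure \<Omega>)"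
  \<comment> \<open>Outside its locale, \<open>hdg_kernel.CKL\<close> has the arguments \<Omega>,
    \<kappa>, \<open>A\<close>, M, W, L and D. This shows that it depends neither on the mesh nor on
    the discrete functions, so C can be fixed before them.\<close>
  define C where "C = hdg_kernel.CKL \<Omega> \<kappa> A M W L D * sqrt (max (2 ^ CARD('d) * (D + 1)) (diameter (closure \<Omega>))) * sqrt (2 + 2 * (W\<^sup>2 * m * m))"
  have *: "nrm2 \<T> S u (hdg_kernel.cS \<T> u \<omega>) \<le> C * hdg_discrete.E \<T> p u w * sqrt (nrm2 \<T> UNIV u c)"
    and E0: "0 \<le> hdg_discrete.E \<T> p u w"
    if "hdg_discrete \<Omega> \<T> \<kappa> A k M p gu u w" for \<T> p gu u w c
  proof -
    interpret hdg_kernel \<Omega> \<T> \<kappa> A k M p gu u w S \<omega> g\<omega> W L D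
      using that bk S(4) by (intro hdg_kernel.intro) (simp_all add: hdg_kernel_axioms_def)
    show "nrm2 \<T> S u cS \<le> C * E * sqrt (nrm2 \<T> UNIV u c)"
      using nrm2_convex_le[of c] unfolding C_def m_def by (simp only: mult_ac)
    show "0 \<le> E" by (rule E_nonneg)
  qed
  have "nrm2 \<T> S u (hdg_kernel.cS \<T> u \<omega>) \<le> max C 0 * hdg_discrete.E \<T> p u w * sqrt (nrm2 \<T> UNIV u c)"
    if "hdg_discrete \<Omega> \<T> \<kappa> A k M p gu u w" for \<T> p gu u w c
    using order_trans[OF *[OF that] mult_right_mono[OF mult_right_mono[of C "max C 0"]]] E0[OF that]
    by (simp add: nrm2_nonneg)
  then show ?thesis
    unfolding poincare_set_def using S borel_compact[OF S(2)] by (intro conjI exI[of _ "max C 0"]) (simp_all, blast)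
qed

text \<open>The two constants are compared on the intersection, whose measure is positive because
  the interiors meet. The constant of U then serves on V as well, at the price of the factor
  \<open>m / \<mu>\<close>.\<close>

lemma poincare_set_Un:
  fixes U V :: "(real^'d) set"
  assumes U: "poincare_set \<Omega> \<kappa> A k M U" and V: "poincare_set \<Omega> \<kappa> A k M V"
    and x: "x \<in> interior U" "x \<in> interior V"
  shows "poincare_set \<Omega> \<kappa> A k M (U \<union> V)"
proof -
  have Ub: "U \<in> sets borel" "U \<subseteq> closure \<Omega>" and Vb: "V \<in> sets borel" "V \<subseteq> closure \<Omega>"
    using U V by (auto simp: poincare_set_def)
  obtain C1 where C1: "0 \<le> C1" "\<And>\<T> p gu u w c. hdg_discrete \<Omega> \<T> \<kappa> A k M p gu u w \<Longrightarrow>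
      \<exists>c'. nrm2 \<T> U u c' \<le> C1 * hdg_discrete.E \<T> p u w * sqrt (nrm2 \<T> UNIV u c)"
    using U unfolding poincare_set_def by meson
  obtain C2 where C2: "0 \<le> C2" "\<And>\<T> p gu u w c. hdg_discrete \<Omega> \<T> \<kappa> A k M p gu u w \<Longrightarrow>
      \<exists>c'. nrm2 \<T> V u c' \<le> C2 * hdg_discrete.E \<T> p u w * sqrt (nrm2 \<T> UNIV u c)"
    using V unfolding poincare_set_def by meson
  define m where "m = measure lebesgue (closure \<Omega>)"
  define \<mu> where "\<mu> = measure lebesgue (U \<inter> V)"
  \<comment> \<open>C1 on U, twice C2 for changing the constant on V, and 2 m times the bound 2 (C1
    + C2) / \<mu> for the square of the difference of the constants.\<close>
  define C where "C = C1 + 2 * C2 + 4 * m / \<mu> * (C1 + C2)"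
  have C0: "0 \<le> C" using C1(1) C2(1) by (simp add: C_def m_def \<mu>_def)
  have "\<exists>c'. nrm2 \<T> (U \<union> V) u c' \<le> C * hdg_discrete.E \<T> p u w * sqrt (nrm2 \<T> UNIV u c)"
    if hd: "hdg_discrete \<Omega> \<T> \<kappa> A k M p gu u w" for \<T> p gu u w c
  proof -
    interpret hdg_discrete \<Omega> \<T> \<kappa> A k M p gu u w by fact
    define X where "X = E * sqrt (nrm2 \<T> UNIV u c)"
    obtain c1 where c1: "nrm2 \<T> U u c1 \<le> C1 * X" using C1(2)[OF hd, of c] by (auto simp: X_def mult.assoc)
    obtain c2 where c2: "nrm2 \<T> V u c2 \<le> C2 * X" using C2(2)[OF hd, of c] by (auto simp: X_def mult.assoc)
    have \<mu>: "0 < \<mu>"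
    proof -
      have "open (interior U \<inter> interior V)" "interior U \<inter> interior V \<noteq> {}" using x by auto
      then have "\<not> negligible (interior U \<inter> interior V)" using open_not_negligible by blast
      then have "\<not> negligible (U \<inter> V)" using interior_subset by (metis inf_mono negligible_subset)
      moreover have "U \<inter> V \<in> lmeasurable"
        using Ub Vb bounded_closure_Omega by (intro bounded_set_imp_lmeasurable) (auto intro: bounded_subset)
      ultimately show ?thesis unfolding \<mu>_def using negligible_iff_measure zero_less_measure_iff by blast
    qed
    have "nrm2 \<T> (U \<inter> V) u c1 \<le> C1 * X" "nrm2 \<T> (U \<inter> V) u c2 \<le> C2 * X"
      using nrm2_mono[of "U \<inter> V" U c1] nrm2_mono[of "U \<inter> V" V c2] Ub Vb c1 c2 by auto
    then have "\<mu> * (c1 - c2)\<^sup>2 \<le> 2 * (C1 * X) + 2 * (C2 * X)"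
      using const_diff_le[of "U \<inter> V" c1 c2] Ub Vb unfolding \<mu>_def by (auto simp: le_infI1)
    then have "(c1 - c2)\<^sup>2 \<le> (2 * (C1 * X) + 2 * (C2 * X)) / \<mu>"
      using \<mu> by (simp add: field_simps)
    then have "2 * (c1 - c2)\<^sup>2 * m \<le> 2 * ((2 * (C1 * X) + 2 * (C2 * X)) / \<mu>) * m"
      by (intro mult_right_mono mult_left_mono) (auto simp: m_def)
    moreover have "nrm2 \<T> (U \<union> V) u c1 \<le> nrm2 \<T> U u c1 + (2 * nrm2 \<T> V u c2 + 2 * (c1 - c2)\<^sup>2 * m)"
      using nrm2_Un[OF Ub(1) Vb(1), of c1] nrm2_change[OF Vb(1), of c1 c2] unfolding m_def by linarith
    ultimately have "nrm2 \<T> (U \<union> V) u c1 \<le> C1 * X + 2 * (C2 * X) + 2 * ((2 * (C1 * X) + 2 * (C2 * X)) / \<mu>) * m"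
      using c1 c2 by linarith
    also have "\<dots> = C * X" using \<mu> by (simp add: C_def field_simps)
    finally show ?thesis unfolding X_def by (auto simp: mult.assoc)
  qed
  then have "\<forall>\<T> p gu u w. hdg_discrete \<Omega> \<T> \<kappa> A k M p gu u w \<longrightarrow>
      (\<forall>c. \<exists>c'. nrm2 \<T> (U \<union> V) u c' \<le> C * hdg_discrete.E \<T> p u w * sqrt (nrm2 \<T> UNIV u c))" by blast
  moreover have "U \<union> V \<in> sets borel" "U \<union> V \<subseteq> closure \<Omega>" using Ub Vb by auto
  ultimately show ?thesis unfolding poincare_set_def using C0 by blast
qed

context simplicial_mesh
begin

text \<open>Lying in the interior of a common Poincare set is symmetric, transitive by
  \<open>poincare_set_Un\<close>, and holds locally because small balls are convex bodies. On a
  connected set such a relation holds between any two points.\<close>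

lemma poincare_chain:
  assumes ab: "a \<in> \<Omega>" "b \<in> \<Omega>"
  shows "\<exists>U. poincare_set \<Omega> \<kappa> A k M U \<and> a \<in> interior U \<and> b \<in> interior U"
proof -
  define R where "R x y \<longleftrightarrow> (\<exists>U. poincare_set \<Omega> \<kappa> A k M U \<and> x \<in> interior U \<and> y \<in> interior U)" for x y
  have "R a b"
  proof (rule connected_equivalence_relation[OF connected_Omega ab])
    show "R y x" if "R x y" for x y using that by (auto simp: R_def)
    show "R x z" if "R x y" "R y z" for x y z
    proof -
      obtain U V where UV: "poincare_set \<Omega> \<kappa> A k M U" "x \<in> interior U" "y \<in> interior U"
          "poincare_set \<Omega> \<kappa> A k M V" "y \<in> interior V" "z \<in> interior V"
        using \<open>R x y\<close> \<open>R y z\<close> by (auto simp: R_def)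
      have "poincare_set \<Omega> \<kappa> A k M (U \<union> V)" by (rule poincare_set_Un[OF UV(1,4,3,5)])
      moreover have "x \<in> interior (U \<union> V)" "z \<in> interior (U \<union> V)"
        using UV interior_mono[of U "U \<union> V"] interior_mono[of V "U \<union> V"] by auto
      ultimately show ?thesis by (auto simp: R_def)
    qed
    fix x assume x: "x \<in> \<Omega>"
    then obtain r where r: "0 < r" "cball x r \<subseteq> \<Omega>" using open_Omega open_contains_cball by blast
    have "poincare_set \<Omega> \<kappa> A k M (cball x r)"
      using r closure_subset by (intro poincare_set_convex) auto
    then have "R x y" if "y \<in> ball x r" for y
      unfolding R_def using that r by (intro exI[of _ "cball x r"]) auto
    moreover have "openin (top_of_set \<Omega>) (ball x r)"
      using r ball_subset_cball by (intro open_openin_trans[OF open_Omega open_ball]) blast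
    ultimately show "\<exists>T. openin (top_of_set \<Omega>) T \<and> x \<in> T \<and> (\<forall>y\<in>T. R x y)"
      using r by (intro exI[of _ "ball x r"]) auto
  qed
  then show ?thesis by (simp add: R_def)
qed

text \<open>Here the mesh is a reference mesh that supplies finitely many convex bodies covering the
  closed domain up to its boundary. They are attached one by one to the common point a by a chain
  that leads from a to an interior point of the element. The Poincare property itself speaks of all
  other meshes.\<close>

lemma poincare_set_closure: "poincare_set \<Omega> \<kappa> A k M (closure \<Omega>)"
proof -
  obtain a where a: "a \<in> \<Omega>" using nonempty_Omega by blast
  have "\<exists>U. poincare_set \<Omega> \<kappa> A k M U \<and> a \<in> interior U \<and> \<Union>\<S> \<subseteq> U" if "finite \<S>" "\<S> \<subseteq> \<T>" for \<S>
    using that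
  proof (induction \<S>)
    case empty
    then show ?case using poincare_chain[OF a a] by auto
  next
    case (insert S \<S>)
    then obtain U where U: "poincare_set \<Omega> \<kappa> A k M U" "a \<in> interior U" "\<Union>\<S> \<subseteq> U" by auto
    have S: "S \<in> \<T>" using insert by simp
    then obtain b where b: "b \<in> interior S" using interior_T_nonempty by blast
    then obtain V where V: "poincare_set \<Omega> \<kappa> A k M V" "a \<in> interior V" "b \<in> interior V"
      using poincare_chain[OF a, of b] interior_subset_T[OF S] by blast
    have "poincare_set \<Omega> \<kappa> A k M S"
      using S by (intro poincare_set_convex convex_T compact_T interior_T_nonempty subset_T)
    moreover have UV: "poincare_set \<Omega> \<kappa> A k M (U \<union> V)" by (rule poincare_set_Un[OF U(1) V(1) U(2) V(2)])
    moreover have i: "a \<in> interior (U \<union> V)" "b \<in> interior (U \<union> V)"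
      using U V interior_mono[of U "U \<union> V"] interior_mono[of V "U \<union> V"] by auto
    ultimately have "poincare_set \<Omega> \<kappa> A k M (U \<union> V \<union> S)" using b by (intro poincare_set_Un[of _ _ _ _ _ "U \<union> V" S b])
    moreover have "a \<in> interior (U \<union> V \<union> S)" using i interior_mono[of "U \<union> V" "U \<union> V \<union> S"] by auto
    ultimately show ?case using U(3) by (intro exI[of _ "U \<union> V \<union> S"]) auto
  qed
  from this[OF finite_T subset_refl] obtain U where U: "poincare_set \<Omega> \<kappa> A k M U" "closure \<Omega> \<subseteq> U"
    using Union_T by auto
  then have "U = closure \<Omega>" by (auto simp: poincare_set_def)
  then show ?thesis using U by simp
qed

text \<open>On the whole domain both sides contain the same norm up to the choice of the constant.
  The mean value minimizes it and serves on both sides: the bound becomes X^2 \<le> C E X, and one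
  factor X is cancelled.\<close>

lemma poincare:
  obtains C where "0 \<le> C" "\<And>\<T>' p gu u w. hdg_discrete \<Omega> \<T>' \<kappa> A k M p gu u w \<Longrightarrow>
    \<exists>c. nrm2 \<T>' UNIV u c \<le> C * (hdg_discrete.E \<T>' p u w)\<^sup>2"
proof -
  obtain C where C: "0 \<le> C" "\<And>\<T>' p gu u w c. hdg_discrete \<Omega> \<T>' \<kappa> A k M p gu u w \<Longrightarrow>
      \<exists>c'. nrm2 \<T>' (closure \<Omega>) u c' \<le> C * hdg_discrete.E \<T>' p u w * sqrt (nrm2 \<T>' UNIV u c)"
    using poincare_set_closure[of \<kappa> A k M] unfolding poincare_set_def by meson
  show ?thesis
  proof (rule that[of "C\<^sup>2"])
    fix \<T>' p gu u w assume hd: "hdg_discrete \<Omega> \<T>' \<kappa> A k M p gu u w"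
    interpret D: hdg_discrete \<Omega> \<T>' \<kappa> A k M p gu u w by fact
    define m where "m = (\<Sum>K\<in>\<T>'. measure lebesgue K)"
    define b where "b = (\<Sum>K\<in>\<T>'. LINT x|vol_measure K. u K x)"
    define q where "q = (\<Sum>K\<in>\<T>'. LINT x|vol_measure K. (u K x)\<^sup>2)"
    have m: "0 < m" unfolding m_def
      using D.finite_T D.nonempty_T D.measure_T_pos by (intro sum_pos) auto
    have quad: "nrm2 \<T>' UNIV u c = q - 2 * c * b + c\<^sup>2 * m" for c
    proof -
      have "(LINT x|vol_measure K. (u K x - c)\<^sup>2) = (LINT x|vol_measure K. (u K x)\<^sup>2) - 2 * c * (LINT x|vol_measure K. u K x) + c\<^sup>2 * measure lebesgue K" if K: "K \<in> \<T>'" for K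
      proof -
        have i: "integrable (vol_measure K) (\<lambda>x. (u K x)\<^sup>2)" "integrable (vol_measure K) (u K)"
          by (intro D.vol_int[OF K] continuous_intros D.cont_u[OF K])+
        interpret finite_measure "vol_measure K" by (rule vol_measure_compact(1)[OF D.compact_T[OF K]])
        have "(LINT x|vol_measure K. (u K x - c)\<^sup>2) = (LINT x|vol_measure K. (u K x)\<^sup>2 - 2 * c * u K x + c\<^sup>2)"
          by (intro Bochner_Integration.integral_cong) (auto simp: power2_diff)
        also have "\<dots> = (LINT x|vol_measure K. (u K x)\<^sup>2) - 2 * c * (LINT x|vol_measure K. u K x) + c\<^sup>2 * measure (vol_measure K) UNIV"
          using i by simp
        finally show ?thesis by (simp add: vol_measure_compact(2)[OF D.compact_T[OF K]])
      qed
      then show ?thesis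
        by (simp add: nrm2_def q_def b_def m_def sum.distrib sum_subtractf sum_distrib_left)
    qed
    \<comment> \<open>The mean value of u, the minimizer of the quadratic polynomial
      \<open>quad\<close>.\<close>
    define c0 where "c0 = b / m"
    have min: "nrm2 \<T>' UNIV u c0 \<le> nrm2 \<T>' UNIV u c" for c
    proof -
      have "nrm2 \<T>' UNIV u c - nrm2 \<T>' UNIV u c0 = m * (c - c0)\<^sup>2"
        unfolding quad c0_def using m by (simp add: power2_eq_square field_simps)
      then show ?thesis using m by (smt (verit) mult_nonneg_nonneg zero_le_power2)
    qed
    define X where "X = sqrt (nrm2 \<T>' UNIV u c0)"
    have X: "0 \<le> X" "X\<^sup>2 = nrm2 \<T>' UNIV u c0" using nrm2_nonneg by (auto simp: X_def)
    obtain c' where "nrm2 \<T>' (closure \<Omega>) u c' \<le> C * D.E * X" using C(2)[OF hd, of c0] by (auto simp: X_def)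
    then have le: "X * X \<le> (C * D.E) * X" using min[of c'] X by (simp add: D.nrm2_closure power2_eq_square)
    have "X \<le> C * D.E"
    proof (cases "X = 0")
      case True
      have "0 \<le> D.E" unfolding D.E_def by (simp add: sum_nonneg D.en_nonneg)
      then show ?thesis using True C(1) by simp
    qed (use le X(1) in auto)
    then have "X\<^sup>2 \<le> (C * D.E)\<^sup>2" using X(1) by (intro power_mono)
    then show "\<exists>c. nrm2 \<T>' UNIV u c \<le> C\<^sup>2 * (D.E)\<^sup>2"
      using X(2) by (auto simp: power_mult_distrib)
  qed simp
qed

end

subsection \<open>Boundary layer and traces\<close>

context simplicial_mesh
begin

lemma frontier_T_subset_facets: "S \<in> \<T> \<Longrightarrow> S - interior S \<subseteq> \<Union>(facets S)"
proof -
  assume S: "S \<in> \<T>"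
  obtain C \<alpha> \<beta> where "simplex_coords S C \<alpha> \<beta>" using simplex_coords_exist[OF simplex_T[OF S]] .
  then interpret simplex_coords S C \<alpha> \<beta> .
  show ?thesis using frontier_subset facets_F by auto
qed

text \<open>The frontier point y is not in the interior of S, so the segment from x to y meets the
  boundary of S. The facet met there spans a hyperplane no farther from x than y is.\<close>

lemma slab_of_close:
  assumes S: "S \<in> \<T>" and x: "x \<in> S" and y: "y \<in> frontier \<Omega>" "dist x y \<le> s"
  obtains e c where "e \<in> facets S" "e = S \<inter> {z. outward_normal S e \<bullet> z = c}" "\<bar>outward_normal S e \<bullet> x - c\<bar> \<le> s"
proof -
  have yi: "y \<notin> interior S"
    using y(1) interior_subset_T[OF S] open_Omega by (auto simp: frontier_def interior_open)
  obtain q where q: "q \<in> closed_segment x y" "q \<in> S - interior S"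
  proof (cases "y \<in> S")
    case True
    then show ?thesis using yi that[of y] by simp
  next
    case False
    have "closed_segment x y \<inter> frontier S \<noteq> {}"
      using x False by (intro connected_Int_frontier) (auto intro: convex_connected)
    then obtain q where "q \<in> closed_segment x y" "q \<in> frontier S" by blast
    then show ?thesis using that[of q] closed_T[OF S] by (simp add: frontier_def closure_closed)
  qed
  then obtain e where e: "e \<in> facets S" "q \<in> e" using frontier_T_subset_facets[OF S] by blast
  obtain c where c: "norm (outward_normal S e) = 1" "e = S \<inter> {z. outward_normal S e \<bullet> z = c}"
    using facet_props(4)[OF simplex_T[OF S] e(1)] by blast
  have "outward_normal S e \<bullet> q = c" using e(2) c(2) by blast
  then have "\<bar>outward_normal S e \<bullet> x - c\<bar> = \<bar>outward_normal S e \<bullet> (x - q)\<bar>" by (simp add: inner_diff_right)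
  also have "\<dots> \<le> norm (x - q)" using Cauchy_Schwarz_ineq2[of "outward_normal S e" "x - q"] c(1) by simp
  also have "\<dots> \<le> s" using segment_bound(1)[OF q(1)] y(2) by (simp add: dist_norm norm_minus_commute)
  finally show ?thesis using that[OF e(1) c(2)] by blast
qed

text \<open>Slabs of half-width s about the hyperplanes of all facets of S. Including the interior
  facets enlarges the set without harm to its order s and avoids asking which facet is near the
  frontier. The value c is unique, since facets are not empty.\<close>

definition layer :: "(real^'d) set \<Rightarrow> real \<Rightarrow> (real^'d) set" where
  "layer S s = (\<Union>e\<in>facets S. {y. \<exists>c. e = S \<inter> {z. outward_normal S e \<bullet> z = c} \<and> \<bar>outward_normal S e \<bullet> y - c\<bar> \<le> s})"

lemma measure_layer_le:
  assumes S: "S \<in> \<T>" and s: "0 \<le> s" and r: "0 \<le> r"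
  shows "layer S s \<inter> cball z r \<in> sets borel"
    "measure lebesgue (layer S s \<inter> cball z r) \<le> (real CARD('d) + 1) * (2 * s * (2 * r) ^ (CARD('d) - 1))"
proof -
  define Y where "Y e = {y. \<exists>c. e = S \<inter> {z. outward_normal S e \<bullet> z = c} \<and> \<bar>outward_normal S e \<bullet> y - c\<bar> \<le> s} \<inter> cball z r" for e
  have eq: "layer S s \<inter> cball z r = (\<Union>e\<in>facets S. Y e)" by (auto simp: layer_def Y_def)
  have Y: "Y e \<in> sets borel \<and> measure lebesgue (Y e) \<le> 2 * s * (2 * r) ^ (CARD('d) - 1)" if e: "e \<in> facets S" for e
  proof -
    define n where "n = outward_normal S e"
    obtain c where c: "norm n = 1" "e = S \<inter> {z. n \<bullet> z = c}"
      using facet_props(4)[OF simplex_T[OF S] e] unfolding n_def by blast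
    have "e \<noteq> {}" by (rule facet_props(3)[OF simplex_T[OF S] e])
    then have "c' = c" if "e = S \<inter> {z. n \<bullet> z = c'}" for c' using c(2) that by auto
    then have Ye: "Y e = {y. \<bar>n \<bullet> y - c\<bar> \<le> s} \<inter> cball z r"
      using c(2) unfolding Y_def n_def[symmetric] by blast
    have cl: "closed {y. \<bar>n \<bullet> y - c\<bar> \<le> s}" by (intro closed_Collect_le continuous_intros)
    have b: "Y e \<in> sets borel" unfolding Ye using cl by (intro sets.Int borel_closed) auto
    have "emeasure lebesgue (Y e) \<le> ennreal (2 * s * (2 * r) ^ (CARD('d) - 1))"
      using emeasure_slab_ball_le[OF c(1) s r, of c z] b by (simp add: Ye)
    then show ?thesis using b s r by (simp add: measure_def enn2real_leI)
  qed
  then show "layer S s \<inter> cball z r \<in> sets borel"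
    unfolding eq using finite_facets[OF S] by (intro sets.finite_UN) auto
  have "measure lebesgue (\<Union>e\<in>facets S. Y e) \<le> (\<Sum>e\<in>facets S. measure lebesgue (Y e))"
    using Y by (intro measure_UNION_le finite_facets[OF S]) auto
  also have "\<dots> \<le> (\<Sum>e\<in>facets S. 2 * s * (2 * r) ^ (CARD('d) - 1))" using Y by (intro sum_mono) blast
  also have "\<dots> = real (card (facets S)) * (2 * s * (2 * r) ^ (CARD('d) - 1))" by simp
  also have "\<dots> \<le> (real CARD('d) + 1) * (2 * s * (2 * r) ^ (CARD('d) - 1))"
    using card_facets[OF S] s r by (intro mult_right_mono) auto
  finally show "measure lebesgue (layer S s \<inter> cball z r) \<le> (real CARD('d) + 1) * (2 * s * (2 * r) ^ (CARD('d) - 1))"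
    unfolding eq .
qed

end

definition boundary_elements :: "(real^'d) set \<Rightarrow> (real^'d) set set \<Rightarrow> (real^'d) set set" where
  "boundary_elements \<Omega> \<T> = {K \<in> \<T>. \<exists>e\<in>facets K. e \<subseteq> frontier \<Omega>}"

lemma boundary_elements_subset: "boundary_elements \<Omega> \<T> \<subseteq> \<T>"
  by (auto simp: boundary_elements_def)

context hdg_kernel
begin

text \<open>One factor u - c is split into u - \<open>cS\<close>, to which
  \<open>kernel_estimate\<close> applies with the gain sqrt \<delta>, and the constant
  \<open>cS\<close> - c, which gains the same factor from the small volume of the layer. The other
  factor stays as the test function v.\<close>

lemma nrm2_layer_le:
  assumes KK: "\<K> \<subseteq> \<T>" and z: "z0 \<in> S" and he: "h \<le> \<delta>"
    and layer: "\<And>z r. 0 < r \<Longrightarrow> (\<Sum>K\<in>\<K>. measure lebesgue (K \<inter> S \<inter> cball z r)) \<le> \<delta> * r ^ (CARD('d) - 1)"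
  shows "nrm2 \<K> S u c \<le> sqrt \<delta> * (CKL * E + sqrt ((D + 1) ^ (CARD('d) - 1)) * (W * sqrt meas * sqrt (nrm2 \<T> UNIV u c)))
    * sqrt (nrm2 \<K> UNIV u c)"
proof -
  have d0: "0 \<le> \<delta>" using he h_pos by linarith
  have KT: "K \<in> \<T>" if "K \<in> \<K>" for K using KK that by blast
  define v where "v K x = u K x - c" for K x
  have v: "v K \<in> Poly k" if "K \<in> \<K>" for K
    unfolding v_def[abs_def] using u[OF KT[OF that]] by (intro Poly_diff Poly_const)
  have cv: "continuous_on UNIV (v K)" if "K \<in> \<K>" for K using Poly_continuous[OF v[OF that]] .
  have X: "X2 \<K> v = nrm2 \<K> UNIV u c" by (simp add: X2_def nrm2_def v_def)
  have int: "integrable (vol_measure (K \<inter> S)) f" if "K \<in> \<K>" "continuous_on UNIV f" for K and f :: "real^'d \<Rightarrow> real"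
    using KT[OF that(1)] borel_S that(2) by (rule int_TI)
  have "nrm2 \<K> S u c = (\<Sum>K\<in>\<K>. (LINT x|vol_measure (K \<inter> S). v K x * (u K x - cS)) + (LINT x|vol_measure (K \<inter> S). v K x * (cS - c)))"
    unfolding nrm2_def
  proof (rule sum.cong[OF refl])
    fix K assume K: "K \<in> \<K>"
    have "(LINT x|vol_measure (K \<inter> S). (u K x - c)\<^sup>2) = (LINT x|vol_measure (K \<inter> S). v K x * (u K x - cS) + v K x * (cS - c))"
      by (intro Bochner_Integration.integral_cong) (auto simp: v_def power2_eq_square algebra_simps)
    also have "\<dots> = (LINT x|vol_measure (K \<inter> S). v K x * (u K x - cS)) + (LINT x|vol_measure (K \<inter> S). v K x * (cS - c))"
      by (intro Bochner_Integration.integral_add int[OF K] continuous_intros cv[OF K] cont_u[OF KT[OF K]])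
    finally show "(LINT x|vol_measure (K \<inter> S). (u K x - c)\<^sup>2) = \<dots>" .
  qed
  also have "\<dots> \<le> \<bar>\<Sum>K\<in>\<K>. LINT x|vol_measure (K \<inter> S). v K x * (u K x - cS)\<bar> + (\<Sum>K\<in>\<K>. \<bar>LINT x|vol_measure (K \<inter> S). v K x * (cS - c)\<bar>)"
    unfolding sum.distrib by (intro add_mono sum_mono) auto
  also have "\<dots> \<le> CKL * sqrt \<delta> * E * sqrt (nrm2 \<K> UNIV u c)
      + sqrt (nrm2 \<K> UNIV u c) * (sqrt (\<delta> * (D + 1) ^ (CARD('d) - 1)) * (W * sqrt meas * sqrt (nrm2 \<T> UNIV u c)))"
  proof (rule add_mono)
    show "\<bar>\<Sum>K\<in>\<K>. LINT x|vol_measure (K \<inter> S). v K x * (u K x - cS)\<bar> \<le> CKL * sqrt \<delta> * E * sqrt (nrm2 \<K> UNIV u c)"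
      unfolding X[symmetric] by (rule kernel_estimate[OF KK v he layer])
    have "(\<Sum>K\<in>\<K>. \<bar>LINT x|vol_measure (K \<inter> S). v K x * (cS - c)\<bar>)
      \<le> (\<Sum>K\<in>\<K>. sqrt (LINT x|vol_measure K. (v K x)\<^sup>2) * sqrt (measure lebesgue (K \<inter> S) * (cS - c)\<^sup>2))"
    proof (rule sum_mono)
      fix K assume K: "K \<in> \<K>"
      have "\<bar>LINT x|vol_measure (K \<inter> S). v K x * (cS - c)\<bar> \<le> sqrt (LINT x|vol_measure (K \<inter> S). (v K x)\<^sup>2) * sqrt (LINT x|vol_measure (K \<inter> S). (cS - c)\<^sup>2)"
        by (intro Cauchy_Schwarz_integral_abs int[OF K] continuous_intros cv[OF K])
      also have "\<dots> \<le> sqrt (LINT x|vol_measure K. (v K x)\<^sup>2) * sqrt (measure lebesgue (K \<inter> S) * (cS - c)\<^sup>2)"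
      proof (intro mult_mono real_sqrt_le_mono)
        show "(LINT x|vol_measure (K \<inter> S). (v K x)\<^sup>2) \<le> (LINT x|vol_measure K. (v K x)\<^sup>2)"
          using borel_TI[OF KT[OF K] borel_S] borel_T[OF KT[OF K]] bounded_T[OF KT[OF K]]
          by (intro vol_integral_mono_set continuous_intros cv[OF K]) auto
        show "(LINT x|vol_measure (K \<inter> S). (cS - c)\<^sup>2) \<le> measure lebesgue (K \<inter> S) * (cS - c)\<^sup>2"
          using integral_const_TI[OF KT[OF K] borel_S, of "(cS - c)\<^sup>2"] by linarith
      qed (auto intro: Bochner_Integration.integral_nonneg)
      finally show "\<bar>LINT x|vol_measure (K \<inter> S). v K x * (cS - c)\<bar> \<le> \<dots>" .
    qed
    also have "\<dots> \<le> sqrt (\<Sum>K\<in>\<K>. LINT x|vol_measure K. (v K x)\<^sup>2) * sqrt (\<Sum>K\<in>\<K>. measure lebesgue (K \<inter> S) * (cS - c)\<^sup>2)"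
      by (rule sum_sqrt_mult_le) (auto intro: Bochner_Integration.integral_nonneg)
    also have "\<dots> \<le> sqrt (nrm2 \<K> UNIV u c) * sqrt ((\<delta> * (D + 1) ^ (CARD('d) - 1)) * (W\<^sup>2 * meas * nrm2 \<T> UNIV u c))"
    proof (intro mult_mono real_sqrt_le_mono)
      \<comment> \<open>S lies in the ball of radius D + 1 about any of its points, so the layer
        hypothesis bounds the whole volume in S.\<close>
      have "(\<Sum>K\<in>\<K>. measure lebesgue (K \<inter> S)) = (\<Sum>K\<in>\<K>. measure lebesgue (K \<inter> S \<inter> cball z0 (D + 1)))"
      proof (rule sum.cong[OF refl])
        fix K
        have "S \<subseteq> cball z0 (D + 1)" using D[OF z] by force
        then have "K \<inter> S \<inter> cball z0 (D + 1) = K \<inter> S" by blast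
        then show "measure lebesgue (K \<inter> S) = measure lebesgue (K \<inter> S \<inter> cball z0 (D + 1))" by simp
      qed
      also have "\<dots> \<le> \<delta> * (D + 1) ^ (CARD('d) - 1)" using D_pos by (intro layer) simp
      finally have le: "(\<Sum>K\<in>\<K>. measure lebesgue (K \<inter> S)) \<le> \<delta> * (D + 1) ^ (CARD('d) - 1)" .
      show "(\<Sum>K\<in>\<K>. measure lebesgue (K \<inter> S) * (cS - c)\<^sup>2) \<le> (\<delta> * (D + 1) ^ (CARD('d) - 1)) * (W\<^sup>2 * meas * nrm2 \<T> UNIV u c)"
        unfolding sum_distrib_right[symmetric] using le cS_sq_le[of c] d0 D_pos
        by (intro mult_mono) (auto simp: power2_commute[of cS c] sum_nonneg)
    qed (auto simp: X[symmetric] X2_def intro!: sum_nonneg Bochner_Integration.integral_nonneg)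
    also have "\<dots> = sqrt (nrm2 \<K> UNIV u c) * (sqrt (\<delta> * (D + 1) ^ (CARD('d) - 1)) * (W * sqrt meas * sqrt (nrm2 \<T> UNIV u c)))"
      using W_nonneg by (simp add: real_sqrt_mult)
    finally show "(\<Sum>K\<in>\<K>. \<bar>LINT x|vol_measure (K \<inter> S). v K x * (cS - c)\<bar>) \<le> \<dots>" .
  qed
  also have "\<dots> = sqrt \<delta> * (CKL * E + sqrt ((D + 1) ^ (CARD('d) - 1)) * (W * sqrt meas * sqrt (nrm2 \<T> UNIV u c))) * sqrt (nrm2 \<K> UNIV u c)"
    by (simp add: real_sqrt_mult algebra_simps)
  finally show ?thesis .
qed

end

context simplicial_mesh
begin

text \<open>S belongs to the reference mesh and the boundary elements to the given mesh. Every point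
  of a boundary element is within the mesh size of the frontier of \<Omega>, hence in one of at most
  d + 1 slabs of S.\<close>

lemma layer_sum_le:
  assumes S: "S \<in> \<T>" and T': "simplicial_mesh \<Omega> \<T>'" and r: "0 < r"
  defines "h' \<equiv> simplicial_mesh.h \<T>'"
  shows "(\<Sum>K\<in>boundary_elements \<Omega> \<T>'. measure lebesgue (K \<inter> S \<inter> cball z r)) \<le> (real CARD('d) + 1) * 2 ^ CARD('d) * h' * r ^ (CARD('d) - 1)"
proof -
  interpret T': simplicial_mesh \<Omega> \<T>' by fact
  have h'0: "0 < h'" using T'.h_pos by (simp add: h'_def)
  have "K \<inter> S \<subseteq> layer S h'" if K: "K \<in> boundary_elements \<Omega> \<T>'" for K
  proof
    fix x assume x: "x \<in> K \<inter> S"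
    obtain e where e: "K \<in> \<T>'" "e \<in> facets K" "e \<subseteq> frontier \<Omega>" using K by (auto simp: boundary_elements_def)
    obtain y where y: "y \<in> e" using facet_props(3)[OF T'.simplex_T[OF e(1)] e(2)] by blast
    then have "y \<in> K" using facet_props(2)[OF T'.simplex_T[OF e(1)] e(2)] by blast
    then have "dist x y \<le> h'" using T'.dist_le_h[OF e(1), of x y] x by (simp add: h'_def)
    then obtain e' c where "e' \<in> facets S" "e' = S \<inter> {z. outward_normal S e' \<bullet> z = c}" "\<bar>outward_normal S e' \<bullet> x - c\<bar> \<le> h'"
      using slab_of_close[OF S, of x y h'] x y e(3) by blast
    then show "x \<in> layer S h'" unfolding layer_def by blast
  qed
  then have "(\<Sum>K\<in>boundary_elements \<Omega> \<T>'. measure lebesgue (K \<inter> (S \<inter> cball z r))) \<le> measure lebesgue (layer S h' \<inter> cball z r)"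
    using measure_layer_le(1)[OF S, of h' r z] borel_T[OF S] h'0 r
    by (intro T'.sum_measure_T_le boundary_elements_subset) auto
  also have "\<dots> \<le> (real CARD('d) + 1) * (2 * h' * (2 * r) ^ (CARD('d) - 1))"
    using S h'0 r by (intro measure_layer_le) auto
  also have "\<dots> = (real CARD('d) + 1) * 2 ^ CARD('d) * h' * r ^ (CARD('d) - 1)"
    by (simp add: power_mult_distrib power_eq_if[of 2 "CARD('d)"])
  finally show ?thesis by (simp add: Int_assoc)
qed

text \<open>The Poincare bound for c is a hypothesis here, so that the constant found on \<Omega>
  can be retained in the layer.\<close>

lemma layer_piece:
  assumes S: "S \<in> \<T>"
  obtains C where "0 \<le> C" "\<And>\<T>' p gu u w c. hdg_discrete \<Omega> \<T>' \<kappa> A k M p gu u w \<Longrightarrow>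
    nrm2 \<T>' UNIV u c \<le> CP * (hdg_discrete.E \<T>' p u w)\<^sup>2 \<Longrightarrow>
    nrm2 (boundary_elements \<Omega> \<T>') S u c \<le> C * sqrt (simplicial_mesh.h \<T>') * hdg_discrete.E \<T>' p u w * sqrt (nrm2 (boundary_elements \<Omega> \<T>') UNIV u c)"
proof -
  obtain \<omega> g\<omega> W L D where bk: "bump_kernel S \<omega> g\<omega> W L D"
    using bump_kernel_exists[OF convex_T[OF S] compact_T[OF S] interior_T_nonempty[OF S]] .
  obtain z0 where z0: "z0 \<in> S" using interior_T_nonempty[OF S] interior_subset by blast
  define a where "a = (real CARD('d) + 1) * 2 ^ CARD('d)"
  \<comment> \<open>The layer thickness in use is a times the mesh size, and
    \<open>kernel_estimate\<close> asks that it dominate the mesh size.\<close>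
  have a: "1 \<le> a" unfolding a_def by (rule order_trans[of _ "1 * 1"]) (simp, intro mult_mono, auto)
  define m where "m = measure lebesgue (closure \<Omega>)"
  define C where "C = sqrt a * (hdg_kernel.CKL \<Omega> \<kappa> A M W L D + sqrt ((D + 1) ^ (CARD('d) - 1)) * (W * sqrt m * sqrt CP))"
  have *: "nrm2 (boundary_elements \<Omega> \<T>') S u c \<le> C * sqrt (simplicial_mesh.h \<T>') * hdg_discrete.E \<T>' p u w * sqrt (nrm2 (boundary_elements \<Omega> \<T>') UNIV u c)"
    and E0: "0 \<le> hdg_discrete.E \<T>' p u w" and h0: "0 \<le> simplicial_mesh.h \<T>'"
    if hd: "hdg_discrete \<Omega> \<T>' \<kappa> A k M p gu u w" and c: "nrm2 \<T>' UNIV u c \<le> CP * (hdg_discrete.E \<T>' p u w)\<^sup>2" for \<T>' p gu u w c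
  proof -
    interpret K: hdg_kernel \<Omega> \<T>' \<kappa> A k M p gu u w S \<omega> g\<omega> W L D
      using hd bk subset_T[OF S] by (intro hdg_kernel.intro) (simp_all add: hdg_kernel_axioms_def)
    show E0: "0 \<le> K.E" by (rule K.E_nonneg)
    show "0 \<le> K.h" using K.h_pos by simp
    have X0: "0 \<le> nrm2 (boundary_elements \<Omega> \<T>') UNIV u c" by (rule nrm2_nonneg)
    have "sqrt (nrm2 \<T>' UNIV u c) \<le> sqrt (CP * K.E\<^sup>2)" using c by (rule real_sqrt_le_mono)
    then have le: "sqrt (nrm2 \<T>' UNIV u c) \<le> sqrt CP * K.E" using E0 by (simp add: real_sqrt_mult)
    have "nrm2 (boundary_elements \<Omega> \<T>') S u c \<le> sqrt (a * K.h) * (K.CKL * K.E + sqrt ((D + 1) ^ (CARD('d) - 1)) * (W * sqrt m * sqrt (nrm2 \<T>' UNIV u c)))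
      * sqrt (nrm2 (boundary_elements \<Omega> \<T>') UNIV u c)"
      unfolding m_def
    proof (rule K.nrm2_layer_le[OF boundary_elements_subset z0])
      show "K.h \<le> a * K.h" using a K.h_pos by simp
      show "(\<Sum>K\<in>boundary_elements \<Omega> \<T>'. measure lebesgue (K \<inter> S \<inter> cball z r)) \<le> a * K.h * r ^ (CARD('d) - 1)" if "0 < r" for z r
        unfolding a_def by (rule layer_sum_le[OF S _ that]) (rule K.simplicial_mesh_axioms)
    qed
    also have "\<dots> \<le> sqrt (a * K.h) * (K.CKL * K.E + sqrt ((D + 1) ^ (CARD('d) - 1)) * (W * sqrt m * (sqrt CP * K.E)))
      * sqrt (nrm2 (boundary_elements \<Omega> \<T>') UNIV u c)"
      using le K.W_nonneg a K.h_pos X0 K.D_pos by (intro mult_right_mono mult_left_mono add_left_mono) (auto simp: m_def)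
    also have "\<dots> = C * sqrt K.h * K.E * sqrt (nrm2 (boundary_elements \<Omega> \<T>') UNIV u c)"
      by (simp add: C_def real_sqrt_mult algebra_simps)
    finally show "nrm2 (boundary_elements \<Omega> \<T>') S u c \<le> C * sqrt K.h * K.E * sqrt (nrm2 (boundary_elements \<Omega> \<T>') UNIV u c)" .
  qed
  show ?thesis
  proof (rule that[of "max C 0"])
    fix \<T>' p gu u w c
    assume hd: "hdg_discrete \<Omega> \<T>' \<kappa> A k M p gu u w" and c: "nrm2 \<T>' UNIV u c \<le> CP * (hdg_discrete.E \<T>' p u w)\<^sup>2"
    have "C * sqrt (simplicial_mesh.h \<T>') * hdg_discrete.E \<T>' p u w * sqrt (nrm2 (boundary_elements \<Omega> \<T>') UNIV u c)
      \<le> max C 0 * sqrt (simplicial_mesh.h \<T>') * hdg_discrete.E \<T>' p u w * sqrt (nrm2 (boundary_elements \<Omega> \<T>') UNIV u c)"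
      using E0[OF hd c] h0[OF hd c] nrm2_nonneg by (intro mult_right_mono) auto
    then show "nrm2 (boundary_elements \<Omega> \<T>') S u c \<le> max C 0 * sqrt (simplicial_mesh.h \<T>') * hdg_discrete.E \<T>' p u w * sqrt (nrm2 (boundary_elements \<Omega> \<T>') UNIV u c)"
      using *[OF hd c] by linarith
  qed simp
qed

text \<open>The bodies S of the reference mesh cover the layer. Summing their bounds gives the
  square of the layer norm on the left and the norm on the right; cancelling it and squaring turns
  sqrt h into h.\<close>

lemma layer_estimate:
  obtains C where "0 \<le> C" "\<And>\<T>' p gu u w c. hdg_discrete \<Omega> \<T>' \<kappa> A k M p gu u w \<Longrightarrow>
    nrm2 \<T>' UNIV u c \<le> CP * (hdg_discrete.E \<T>' p u w)\<^sup>2 \<Longrightarrow>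
    nrm2 (boundary_elements \<Omega> \<T>') UNIV u c \<le> C * simplicial_mesh.h \<T>' * (hdg_discrete.E \<T>' p u w)\<^sup>2"
proof -
  have "\<exists>C\<ge>0. \<forall>\<T>' p gu u w c. hdg_discrete \<Omega> \<T>' \<kappa> A k M p gu u w \<longrightarrow>
    nrm2 \<T>' UNIV u c \<le> CP * (hdg_discrete.E \<T>' p u w)\<^sup>2 \<longrightarrow>
    nrm2 (boundary_elements \<Omega> \<T>') S u c \<le> C * sqrt (simplicial_mesh.h \<T>') * hdg_discrete.E \<T>' p u w * sqrt (nrm2 (boundary_elements \<Omega> \<T>') UNIV u c)"
    if "S \<in> \<T>" for S
    using layer_piece[OF that, of \<kappa> A k M CP] by metis
  then obtain C where C: "\<And>S. S \<in> \<T> \<Longrightarrow> 0 \<le> C S" "\<And>S \<T>' p gu u w c. S \<in> \<T> \<Longrightarrow> hdg_discrete \<Omega> \<T>' \<kappa> A k M p gu u w \<Longrightarrow>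
    nrm2 \<T>' UNIV u c \<le> CP * (hdg_discrete.E \<T>' p u w)\<^sup>2 \<Longrightarrow>
    nrm2 (boundary_elements \<Omega> \<T>') S u c \<le> C S * sqrt (simplicial_mesh.h \<T>') * hdg_discrete.E \<T>' p u w * sqrt (nrm2 (boundary_elements \<Omega> \<T>') UNIV u c)"
    by metis
  define B where "B = (\<Sum>S\<in>\<T>. C S)"
  have B: "0 \<le> B" unfolding B_def using C(1) by (simp add: sum_nonneg)
  show ?thesis
  proof (rule that[of "B\<^sup>2"])
    fix \<T>' p gu u w c
    assume hd: "hdg_discrete \<Omega> \<T>' \<kappa> A k M p gu u w" and c: "nrm2 \<T>' UNIV u c \<le> CP * (hdg_discrete.E \<T>' p u w)\<^sup>2"
    interpret D: hdg_discrete \<Omega> \<T>' \<kappa> A k M p gu u w by fact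
    define \<K> where "\<K> = boundary_elements \<Omega> \<T>'"
    have KT: "K \<in> \<T>'" if "K \<in> \<K>" for K using that boundary_elements_subset by (auto simp: \<K>_def)
    define Y where "Y = sqrt (nrm2 \<K> UNIV u c)"
    have Y: "0 \<le> Y" "Y\<^sup>2 = nrm2 \<K> UNIV u c" using nrm2_nonneg by (auto simp: Y_def)
    have "nrm2 \<K> UNIV u c = (\<Sum>K\<in>\<K>. \<Sum>S\<in>\<T>. LINT x|vol_measure (S \<inter> K). (u K x - c)\<^sup>2)"
      unfolding nrm2_def
    proof (rule sum.cong[OF refl])
      fix K assume K: "K \<in> \<K>"
      have "(\<Sum>S\<in>\<T>. LINT x|vol_measure (S \<inter> K). (u K x - c)\<^sup>2) = (LINT x|vol_measure K. (u K x - c)\<^sup>2)"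
        using D.borel_T[OF KT[OF K]] D.subset_T[OF KT[OF K]] D.vol_int[OF KT[OF K] D.cont_uc[OF KT[OF K]]]
          borel_measurable_continuous_onI[OF D.cont_uc[OF KT[OF K]]]
        by (intro integral_vol_split)
      then show "(LINT x|vol_measure (K \<inter> UNIV). (u K x - c)\<^sup>2) = (\<Sum>S\<in>\<T>. LINT x|vol_measure (S \<inter> K). (u K x - c)\<^sup>2)" by simp
    qed
    also have "\<dots> = (\<Sum>S\<in>\<T>. nrm2 \<K> S u c)"
      unfolding nrm2_def by (subst sum.swap) (simp add: Int_commute)
    also have "\<dots> \<le> (\<Sum>S\<in>\<T>. C S * sqrt D.h * D.E * Y)"
      unfolding Y_def \<K>_def by (intro sum_mono C(2)[OF _ hd c])
    also have "\<dots> = B * sqrt D.h * D.E * Y" by (simp add: B_def sum_distrib_right)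
    finally have le: "Y * Y \<le> (B * sqrt D.h * D.E) * Y" using Y by (simp add: power2_eq_square)
    have E0: "0 \<le> D.E" unfolding D.E_def by (simp add: sum_nonneg D.en_nonneg)
    have "Y \<le> B * sqrt D.h * D.E"
    proof (cases "Y = 0")
      case True
      then show ?thesis using B E0 D.h_pos by simp
    qed (use le Y(1) in auto)
    then have "Y\<^sup>2 \<le> (B * sqrt D.h * D.E)\<^sup>2" using Y(1) by (intro power_mono)
    then show "nrm2 (boundary_elements \<Omega> \<T>') UNIV u c \<le> B\<^sup>2 * D.h * (D.E)\<^sup>2"
      using Y(2) D.h_pos by (simp add: power_mult_distrib \<K>_def)
  qed simp
qed

end

section \<open>From the boundary layer to the boundary\<close>

lemma sum_UN_le:
  fixes f :: "'b \<Rightarrow> real"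
  assumes "finite I" "\<And>i. i \<in> I \<Longrightarrow> finite (B i)" "\<And>x. 0 \<le> f x"
  shows "sum f (\<Union>i\<in>I. B i) \<le> (\<Sum>i\<in>I. sum f (B i))"
  using assms(1,2)
proof (induction I)
  case (insert i I)
  have "sum f (B i \<union> (\<Union>i\<in>I. B i)) \<le> sum f (B i) + sum f (\<Union>i\<in>I. B i)"
    using insert sum_Un[of "B i" "\<Union>i\<in>I. B i" f] sum_nonneg[of "B i \<inter> (\<Union>i\<in>I. B i)" f] assms(3) by simp
  then show ?case using insert by simp
qed simp

context hdg_discrete
begin

text \<open>The inverse inequality bounds u - c pointwise on the facets. The ratio of facet area to
  element volume, h^(d-1) to h^d, accounts for the factor 1/h.\<close>

lemma trace_le:
  assumes K: "K \<in> \<T>"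
  shows "(\<Sum>e\<in>facets K. LINT x|face_measure e. (u K x - c)\<^sup>2)
    \<le> (real CARD('d) + 1) * 2 ^ (CARD('d) - 1) * M / cvol / h * (LINT x|vol_measure K. (u K x - c)\<^sup>2)"
proof -
  define V where "V = measure lebesgue K"
  define Q where "Q = (LINT x|vol_measure K. (u K x - c)\<^sup>2)"
  have V: "0 < V" unfolding V_def by (rule measure_T_pos[OF K])
  have Q0: "0 \<le> Q" unfolding Q_def by (rule Bochner_Integration.integral_nonneg) simp
  have v: "(\<lambda>x. u K x - c) \<in> Poly k" using u[OF K] by (intro Poly_diff Poly_const)
  have "(\<Sum>e\<in>facets K. LINT x|face_measure e. (u K x - c)\<^sup>2) \<le> (\<Sum>e\<in>facets K. measure (face_measure e) UNIV * (M * Q / V))"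
  proof (rule sum_mono)
    fix e assume e: "e \<in> facets K"
    interpret finite_measure "face_measure e" by (rule finite_face_measure(1)[OF simplex_T[OF K] e])
    have "(LINT x|face_measure e. (u K x - c)\<^sup>2) \<le> (LINT x|face_measure e. M * Q / V)"
    proof (rule integral_mono_AE)
      show "AE x in face_measure e. (u K x - c)\<^sup>2 \<le> M * Q / V"
        using AE_face_measure[OF simplex_T[OF K] e]
      proof eventually_elim
        case (elim x)
        then have "x \<in> K" using facet_props(2)[OF simplex_T[OF K] e] by blast
        then show ?case using inverse_T[OF K v, of x] V by (simp add: V_def Q_def field_simps)
      qed
    qed (auto intro!: face_int[OF K e] cont_uc[OF K])
    then show "(LINT x|face_measure e. (u K x - c)\<^sup>2) \<le> measure (face_measure e) UNIV * (M * Q / V)" by simp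
  qed
  also have "\<dots> = (\<Sum>e\<in>facets K. measure (face_measure e) UNIV) * (M * Q / V)" by (rule sum_distrib_right[symmetric])
  also have "\<dots> \<le> ((real CARD('d) + 1) * (2 * h) ^ (CARD('d) - 1)) * (M * Q / (cvol * h ^ CARD('d)))"
    using measure_T_ge[OF K] cvol_pos h_pos M0 Q0 V
    by (intro mult_mono measure_facets_le[OF K] divide_left_mono) (auto simp: V_def)
  also have "\<dots> = (real CARD('d) + 1) * 2 ^ (CARD('d) - 1) * M / cvol / h * Q"
    using h_pos cvol_pos by (simp add: power_mult_distrib power_eq_if[of h "CARD('d)"])
  finally show ?thesis by (simp add: Q_def)
qed

text \<open>On a boundary face w - c is split into the jump, which the energy contains, and the
  trace of u - c. The factor h of the layer estimate cancels the 1/h of the trace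
  inequality.\<close>

lemma boundary_trace_le:
  assumes X: "nrm2 (boundary_elements \<Omega> \<T>) UNIV u c \<le> C * h * E\<^sup>2"
  shows "(\<Sum>e\<in>boundary_faces \<Omega> \<T>. LINT x|face_measure e. (w e x - c)\<^sup>2)
    \<le> (2 + 2 * ((real CARD('d) + 1) * 2 ^ (CARD('d) - 1) * M / cvol * C)) * E\<^sup>2"
proof -
  define \<K> where "\<K> = boundary_elements \<Omega> \<T>"
  define a where "a = (real CARD('d) + 1) * 2 ^ (CARD('d) - 1) * M / cvol"
  have a0: "0 \<le> a" using M0 cvol_pos by (simp add: a_def)
  have KT: "K \<in> \<T>" if "K \<in> \<K>" for K using that boundary_elements_subset by (auto simp: \<K>_def)
  have fin: "finite \<K>" using finite_subset[OF boundary_elements_subset finite_T] by (simp add: \<K>_def)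
  let ?f = "\<lambda>e. LINT x|face_measure e. (w e x - c)\<^sup>2"
  have f0: "0 \<le> ?f e" for e by (rule Bochner_Integration.integral_nonneg) simp
  have "boundary_faces \<Omega> \<T> \<subseteq> (\<Union>K\<in>\<K>. facets K)"
    by (auto simp: boundary_faces_def skeleton_def \<K>_def boundary_elements_def)
  then have "sum ?f (boundary_faces \<Omega> \<T>) \<le> sum ?f (\<Union>K\<in>\<K>. facets K)"
    using fin finite_facets KT f0 by (intro sum_mono2) auto
  also have "\<dots> \<le> (\<Sum>K\<in>\<K>. sum ?f (facets K))"
    using fin finite_facets KT f0 by (intro sum_UN_le) auto
  also have "\<dots> \<le> (\<Sum>K\<in>\<K>. 2 * jump2 K + 2 * (a / h * (LINT x|vol_measure K. (u K x - c)\<^sup>2)))"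
  proof (rule sum_mono)
    fix K assume "K \<in> \<K>"
    then have K: "K \<in> \<T>" by (rule KT)
    have "?f e \<le> 2 * (LINT x|face_measure e. (u K x - w e x)\<^sup>2) + 2 * (LINT x|face_measure e. (u K x - c)\<^sup>2)"
      if e: "e \<in> facets K" for e
    proof -
      have "?f e \<le> (LINT x|face_measure e. 2 * (u K x - w e x)\<^sup>2 + 2 * (u K x - c)\<^sup>2)"
      proof (intro integral_mono face_int[OF K e] continuous_intros cont_u[OF K] cont_w[OF K e])
        fix x
        have "(w e x - c)\<^sup>2 = ((u K x - c) - (u K x - w e x))\<^sup>2" by simp
        also have "\<dots> \<le> 2 * (u K x - c)\<^sup>2 + 2 * (u K x - w e x)\<^sup>2" by (rule power2_diff_le)
        finally show "(w e x - c)\<^sup>2 \<le> 2 * (u K x - w e x)\<^sup>2 + 2 * (u K x - c)\<^sup>2" by simp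
      qed
      also have "\<dots> = (LINT x|face_measure e. 2 * (u K x - w e x)\<^sup>2) + (LINT x|face_measure e. 2 * (u K x - c)\<^sup>2)"
        by (intro Bochner_Integration.integral_add face_int[OF K e] continuous_intros cont_u[OF K] cont_w[OF K e])
      finally show ?thesis by simp
    qed
    then have "sum ?f (facets K) \<le> (\<Sum>e\<in>facets K. 2 * (LINT x|face_measure e. (u K x - w e x)\<^sup>2) + 2 * (LINT x|face_measure e. (u K x - c)\<^sup>2))"
      by (rule sum_mono)
    also have "\<dots> = 2 * jump2 K + 2 * (\<Sum>e\<in>facets K. LINT x|face_measure e. (u K x - c)\<^sup>2)"
      by (simp add: jump2_def sum.distrib sum_distrib_left)
    also have "\<dots> \<le> 2 * jump2 K + 2 * (a / h * (LINT x|vol_measure K. (u K x - c)\<^sup>2))"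
      using trace_le[OF K, of c] by (simp add: a_def)
    finally show "sum ?f (facets K) \<le> \<dots>" .
  qed
  also have "\<dots> = 2 * (\<Sum>K\<in>\<K>. jump2 K) + 2 * (a / h * nrm2 \<K> UNIV u c)"
    by (simp add: nrm2_def sum.distrib sum_distrib_left)
  also have "\<dots> \<le> 2 * E\<^sup>2 + 2 * (a / h * (C * h * E\<^sup>2))"
  proof (intro add_mono mult_left_mono)
    have "(\<Sum>K\<in>\<K>. jump2 K) \<le> (\<Sum>K\<in>\<K>. en K)" by (intro sum_mono jump2_le_en)
    also have "\<dots> \<le> (\<Sum>K\<in>\<T>. en K)" using KT finite_T en_nonneg by (intro sum_mono2) auto
    also have "\<dots> = E\<^sup>2" unfolding E_def by (simp add: sum_nonneg en_nonneg)
    finally show "(\<Sum>K\<in>\<K>. jump2 K) \<le> E\<^sup>2" .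
    show "nrm2 \<K> UNIV u c \<le> C * h * E\<^sup>2" using X by (simp add: \<K>_def)
  qed (use a0 h_pos in auto)
  also have "\<dots> = (2 + 2 * (a * C)) * E\<^sup>2" using h_pos by (simp add: field_simps)
  finally show ?thesis by (simp add: a_def)
qed

end

text \<open>One and the same c has to serve inside and on the boundary, because the test functions
  for u and for its trace are shifted by a common constant.\<close>

lemma (in simplicial_mesh) poincare_trace:
  obtains C where "0 \<le> C" "\<And>\<T>' p gu u w. hdg_discrete \<Omega> \<T>' \<kappa> A k M p gu u w \<Longrightarrow>
    \<exists>c. nrm2 \<T>' UNIV u c \<le> C * (hdg_discrete.E \<T>' p u w)\<^sup>2 \<and>
      (\<Sum>e\<in>boundary_faces \<Omega> \<T>'. LINT x|face_measure e. (w e x - c)\<^sup>2) \<le> C * (hdg_discrete.E \<T>' p u w)\<^sup>2"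
proof -
  obtain CP where CP: "0 \<le> CP" "\<And>\<T>' p gu u w. hdg_discrete \<Omega> \<T>' \<kappa> A k M p gu u w \<Longrightarrow>
    \<exists>c. nrm2 \<T>' UNIV u c \<le> CP * (hdg_discrete.E \<T>' p u w)\<^sup>2"
    using poincare[of \<kappa> A k M] by metis
  obtain C where C: "0 \<le> C" "\<And>\<T>' p gu u w c. hdg_discrete \<Omega> \<T>' \<kappa> A k M p gu u w \<Longrightarrow>
    nrm2 \<T>' UNIV u c \<le> CP * (hdg_discrete.E \<T>' p u w)\<^sup>2 \<Longrightarrow>
    nrm2 (boundary_elements \<Omega> \<T>') UNIV u c \<le> C * simplicial_mesh.h \<T>' * (hdg_discrete.E \<T>' p u w)\<^sup>2"
    using layer_estimate[of \<kappa> A k M CP] by metis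
  define B where "B = 2 + 2 * ((real CARD('d) + 1) * 2 ^ (CARD('d) - 1) * M / regular_mesh.cvol TYPE('d) \<kappa> A * C)"
  show ?thesis
  proof (rule that[of "max CP B"])
    fix \<T>' p gu u w assume hd: "hdg_discrete \<Omega> \<T>' \<kappa> A k M p gu u w"
    interpret D: hdg_discrete \<Omega> \<T>' \<kappa> A k M p gu u w by fact
    obtain c where c: "nrm2 \<T>' UNIV u c \<le> CP * D.E\<^sup>2" using CP(2)[OF hd] by blast
    have "(\<Sum>e\<in>boundary_faces \<Omega> \<T>'. LINT x|face_measure e. (w e x - c)\<^sup>2) \<le> B * D.E\<^sup>2"
      unfolding B_def by (rule D.boundary_trace_le) (rule C(2)[OF hd c])
    moreover have "CP * D.E\<^sup>2 \<le> max CP B * D.E\<^sup>2" "B * D.E\<^sup>2 \<le> max CP B * D.E\<^sup>2" by (auto intro!: mult_right_mono)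
    ultimately show "\<exists>c. nrm2 \<T>' UNIV u c \<le> max CP B * D.E\<^sup>2 \<and>
      (\<Sum>e\<in>boundary_faces \<Omega> \<T>'. LINT x|face_measure e. (w e x - c)\<^sup>2) \<le> max CP B * D.E\<^sup>2"
      using c by (intro exI[of _ c]) linarith
  qed (use CP(1) in simp)
qed

subsection \<open>The scheme\<close>

lemma borel_measurable_AE_complete:
  fixes f g :: "'a \<Rightarrow> real"
  assumes N: "complete_measure N" and f: "f \<in> borel_measurable N" and eq: "AE x in N. f x = g x"
  shows "g \<in> borel_measurable N"
proof (rule measurableI)
  fix X :: "real set" assume X: "X \<in> sets borel"
  have "AE x in N. (x \<in> f -` X \<inter> space N) = (x \<in> g -` X \<inter> space N)"
    using eq by eventually_elim auto
  then show "g -` X \<inter> space N \<in> sets N"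
    by (rule complete_measure.in_sets_AE[OF N]) (use measurable_sets[OF f X] in auto)
qed simp

lemma abs_mult_le_sum_squares: "\<bar>a * b\<bar> \<le> a\<^sup>2 + (b :: real)\<^sup>2"
proof -
  have "2 * (a * b) \<le> a\<^sup>2 + b\<^sup>2" "- (2 * (a * b)) \<le> a\<^sup>2 + b\<^sup>2" "0 \<le> a\<^sup>2 + b\<^sup>2"
    using sum_squares_bound[of a b] sum_squares_bound[of "- a" b] by simp_all
  then show ?thesis by linarith
qed

text \<open>The pieces, closed elements or closed faces, lie in S only up to null sets, and f is
  unrestricted outside S. So f is cut off at S, and completeness of the measure transfers
  measurability from the cut-off integrand to the original one. The pieces overlap in null sets
  only, which keeps the sum of the squares below the norm of f.\<close>

lemma L2_pieces_le:
  fixes f :: "'a \<Rightarrow> real"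
  assumes N: "complete_measure N" and f: "L2_on N S f" and I: "finite I"
    and B: "\<And>i. i \<in> I \<Longrightarrow> B i \<in> sets N" "\<And>i. i \<in> I \<Longrightarrow> AE x in N. x \<in> B i \<longrightarrow> x \<in> S"
    and disj: "AE x in N. (\<Sum>i\<in>I. indicator (B i) x) \<le> (1::real)"
    and g: "\<And>i. i \<in> I \<Longrightarrow> set_borel_measurable N (B i) (g i)" "\<And>i. i \<in> I \<Longrightarrow> set_integrable N (B i) (\<lambda>x. (g i x)\<^sup>2)"
  shows "\<bar>\<Sum>i\<in>I. LINT x:B i|N. f x * g i x\<bar> \<le> L2norm_on N S f * sqrt (\<Sum>i\<in>I. LINT x:B i|N. (g i x)\<^sup>2)"
proof -
  define f0 where "f0 x = indicator S x * f x" for x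
  have f0_eq: "f0 = (\<lambda>x. indicator S x *\<^sub>R f x)" "(\<lambda>x. (f0 x)\<^sup>2) = (\<lambda>x. indicator S x *\<^sub>R (f x)\<^sup>2)"
    by (simp_all add: f0_def fun_eq_iff indicator_def)
  have "f0 \<in> borel_measurable N"
    using f unfolding L2_on_def set_borel_measurable_def f0_eq(1) by (rule conjunct1)
  moreover have "integrable N (\<lambda>x. (f0 x)\<^sup>2)"
    using f unfolding L2_on_def set_integrable_def f0_eq(2) by (rule conjunct2)
  ultimately have f0: "f0 \<in> borel_measurable N" "integrable N (\<lambda>x. (f0 x)\<^sup>2)" .
  define F where "F i x = indicator (B i) x * f0 x" for i x
  define G where "G i x = indicator (B i) x * g i x" for i x
  have sqF: "(F i x)\<^sup>2 = indicator (B i) x * (f0 x)\<^sup>2" for i x by (simp add: F_def indicator_def)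
  have sqG: "(G i x)\<^sup>2 = indicator (B i) x * (g i x)\<^sup>2" for i x by (simp add: G_def indicator_def)
  have mF: "F i \<in> borel_measurable N" and iF: "integrable N (\<lambda>x. (F i x)\<^sup>2)" if "i \<in> I" for i
  proof -
    note [measurable] = B(1)[OF that] f0(1)
    show "F i \<in> borel_measurable N" unfolding F_def[abs_def] by measurable
    show "integrable N (\<lambda>x. (F i x)\<^sup>2)"
      unfolding sqF using integrable_mult_indicator[OF B(1)[OF that] f0(2)] by simp
  qed
  have mG: "G i \<in> borel_measurable N" and iG: "integrable N (\<lambda>x. (G i x)\<^sup>2)" if "i \<in> I" for i
    using g[OF that] unfolding sqG by (simp_all add: set_borel_measurable_def set_integrable_def G_def[abs_def])
  have iFG: "integrable N (\<lambda>x. F i x * G i x)" if i: "i \<in> I" for i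
  proof (rule Bochner_Integration.integrable_bound)
    show "integrable N (\<lambda>x. (F i x)\<^sup>2 + (G i x)\<^sup>2)" using iF[OF i] iG[OF i] by simp
    show "(\<lambda>x. F i x * G i x) \<in> borel_measurable N" using mF[OF i] mG[OF i] by simp
    have "\<bar>F i x * G i x\<bar> \<le> (F i x)\<^sup>2 + (G i x)\<^sup>2" for x by (rule abs_mult_le_sum_squares)
    then show "AE x in N. norm (F i x * G i x) \<le> norm ((F i x)\<^sup>2 + (G i x)\<^sup>2)" by simp
  qed
  have "(LINT x:B i|N. f x * g i x) = (LINT x|N. F i x * G i x)" if i: "i \<in> I" for i
    unfolding set_lebesgue_integral_def
  proof (rule integral_cong_AE)
    have eq: "AE x in N. F i x * G i x = indicator (B i) x *\<^sub>R (f x * g i x)"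
      using B(2)[OF i] by eventually_elim (auto simp: F_def G_def f0_def indicator_def)
    show "(\<lambda>x. indicator (B i) x *\<^sub>R (f x * g i x)) \<in> borel_measurable N"
      by (rule borel_measurable_AE_complete[OF N borel_measurable_integrable[OF iFG[OF i]] eq])
    show "(\<lambda>x. F i x * G i x) \<in> borel_measurable N" by (rule borel_measurable_integrable[OF iFG[OF i]])
    show "AE x in N. indicator (B i) x *\<^sub>R (f x * g i x) = F i x * G i x" using eq by eventually_elim simp
  qed
  then have "\<bar>\<Sum>i\<in>I. LINT x:B i|N. f x * g i x\<bar> = \<bar>\<Sum>i\<in>I. LINT x|N. F i x * G i x\<bar>" by simp
  also have "\<dots> \<le> (\<Sum>i\<in>I. \<bar>LINT x|N. F i x * G i x\<bar>)" by (rule sum_abs)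
  also have "\<dots> \<le> (\<Sum>i\<in>I. sqrt (LINT x|N. (F i x)\<^sup>2) * sqrt (LINT x|N. (G i x)\<^sup>2))"
    by (intro sum_mono Cauchy_Schwarz_integral_abs iF iG iFG)
  also have "\<dots> \<le> sqrt (\<Sum>i\<in>I. LINT x|N. (F i x)\<^sup>2) * sqrt (\<Sum>i\<in>I. LINT x|N. (G i x)\<^sup>2)"
    by (rule sum_sqrt_mult_le) (auto intro: Bochner_Integration.integral_nonneg)
  also have "\<dots> \<le> L2norm_on N S f * sqrt (\<Sum>i\<in>I. LINT x:B i|N. (g i x)\<^sup>2)"
  proof (intro mult_mono)
    have "(\<Sum>i\<in>I. LINT x|N. (F i x)\<^sup>2) = (LINT x|N. (\<Sum>i\<in>I. (F i x)\<^sup>2))"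
      by (rule Bochner_Integration.integral_sum[symmetric]) (rule iF)
    also have "\<dots> \<le> (LINT x|N. (f0 x)\<^sup>2)"
    proof (rule integral_mono_AE)
      show "integrable N (\<lambda>x. \<Sum>i\<in>I. (F i x)\<^sup>2)" by (intro Bochner_Integration.integrable_sum iF)
      show "AE x in N. (\<Sum>i\<in>I. (F i x)\<^sup>2) \<le> (f0 x)\<^sup>2"
        using disj
      proof eventually_elim
        case (elim x)
        have "(\<Sum>i\<in>I. (F i x)\<^sup>2) = (\<Sum>i\<in>I. indicator (B i) x) * (f0 x)\<^sup>2" by (simp add: sqF sum_distrib_right)
        also have "\<dots> \<le> 1 * (f0 x)\<^sup>2" using elim by (rule mult_right_mono) simp
        finally show ?case by simp
      qed
    qed (rule f0(2))
    also have "\<dots> = (LINT x:S|N. (f x)\<^sup>2)"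
      unfolding set_lebesgue_integral_def by (intro Bochner_Integration.integral_cong) (auto simp: f0_def indicator_def)
    finally show "sqrt (\<Sum>i\<in>I. LINT x|N. (F i x)\<^sup>2) \<le> L2norm_on N S f" unfolding L2norm_on_def by simp
    show "sqrt (\<Sum>i\<in>I. LINT x|N. (G i x)\<^sup>2) \<le> sqrt (\<Sum>i\<in>I. LINT x:B i|N. (g i x)\<^sup>2)"
      unfolding sqG set_lebesgue_integral_def by simp
    show "0 \<le> L2norm_on N S f"
      unfolding L2norm_on_def set_lebesgue_integral_def by (simp add: Bochner_Integration.integral_nonneg)
  qed (auto intro!: sum_nonneg Bochner_Integration.integral_nonneg)
  finally show ?thesis .
qed

lemma L2norm_on_nonneg: "0 \<le> L2norm_on N S f"
  unfolding L2norm_on_def set_lebesgue_integral_def by (simp add: Bochner_Integration.integral_nonneg)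

text \<open>The plate over a convex set is convex, and the plate over the relative boundary lies in
  its frontier. The frontier of a convex set is a null set.\<close>

lemma relative_boundary_null:
  fixes e :: "(real^'d) set"
  assumes e: "convex e" "compact e" and n: "norm n = 1" "e \<subseteq> {x. n \<bullet> x = c}"
  shows "e - rel_interior e \<in> null_sets surface_measure"
proof -
  define H where "H = {x. n \<bullet> x = c}"
  have n0: "n \<noteq> 0" using n(1) by auto
  have avg: "n \<bullet> n = 1" using n(1) by (simp add: dot_square_norm)
  have H: "H \<in> hyperplanes"
    unfolding hyperplanes_def H_def using n0 by (simp add: affine_hyperplane aff_dim_hyperplane)
  have b: "e - rel_interior e \<in> sets borel"
  proof -
    have "rel_frontier e = e - rel_interior e" using e(2) by (simp add: rel_frontier_def compact_imp_closed)
    then show ?thesis using closed_rel_frontier[of e] borel_closed by metis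
  qed
  define cp where "cp y = y - (n \<bullet> y - c) *\<^sub>R n" for y
  have cp: "closest_point H y = cp y" for y
    unfolding H_def cp_def using closest_point_hyperplane[OF n0, of c y] avg by simp
  have "dist y (cp y) = \<bar>n \<bullet> y - c\<bar>" for y using n(1) by (simp add: cp_def dist_norm)
  then have plate: "plate H X = {y. cp y \<in> X \<and> \<bar>n \<bullet> y - c\<bar> \<le> 1/2}" for X
    by (simp add: plate_def cp)
  have conv: "convex (plate H e)"
  proof (rule convexI)
    fix y z and a b :: real assume yz: "y \<in> plate H e" "z \<in> plate H e" and ab: "0 \<le> a" "0 \<le> b" "a + b = 1"
    have cab: "a * c + b * c = c" using ab(3) by (metis distrib_right mult_1)
    have d: "n \<bullet> (a *\<^sub>R y + b *\<^sub>R z) - c = a * (n \<bullet> y - c) + b * (n \<bullet> z - c)"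
      using cab by (simp add: inner_add_right algebra_simps)
    have "cp (a *\<^sub>R y + b *\<^sub>R z) = a *\<^sub>R cp y + b *\<^sub>R cp z"
      unfolding cp_def d by (simp add: algebra_simps)
    then have 1: "cp (a *\<^sub>R y + b *\<^sub>R z) \<in> e"
      using convexD[OF e(1) _ _ ab] yz by (simp add: plate)
    have "\<bar>a * (n \<bullet> y - c) + b * (n \<bullet> z - c)\<bar> \<le> a * \<bar>n \<bullet> y - c\<bar> + b * \<bar>n \<bullet> z - c\<bar>"
      using ab abs_triangle_ineq[of "a * (n \<bullet> y - c)" "b * (n \<bullet> z - c)"] by (simp add: abs_mult)
    also have "\<dots> \<le> a * (1/2) + b * (1/2)"
      using yz ab by (intro add_mono mult_left_mono) (auto simp: plate)
    also have "\<dots> = 1/2" using ab(3) by (simp add: field_simps)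
    finally show "a *\<^sub>R y + b *\<^sub>R z \<in> plate H e" using 1 d by (simp add: plate)
  qed
  have sub: "plate H (e - rel_interior e) \<subseteq> frontier (plate H e)"
  proof
    fix y assume y: "y \<in> plate H (e - rel_interior e)"
    have "y \<notin> interior (plate H e)"
    proof
      assume "y \<in> interior (plate H e)"
      then obtain \<epsilon> where \<epsilon>: "0 < \<epsilon>" "ball y \<epsilon> \<subseteq> plate H e" using mem_interior by blast
      have ah: "affine hull e \<subseteq> H"
        using n(2) unfolding H_def by (intro hull_minimal) (auto simp: affine_hyperplane)
      have nc: "n \<bullet> cp y = c" by (simp add: cp_def inner_diff_right avg)
      \<comment> \<open>If y is moved parallel to the hyperplane, its projection moves by the same
        vector. A neighbourhood of y in the plate thus projects onto a neighbourhood of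
        \<open>cp y\<close> in the affine hull.\<close>
      have "ball (cp y) \<epsilon> \<inter> affine hull e \<subseteq> e"
      proof
        fix z assume z: "z \<in> ball (cp y) \<epsilon> \<inter> affine hull e"
        have nz: "n \<bullet> z = c" using z ah by (auto simp: H_def)
        define y' where "y' = y + (z - cp y)"
        have "y' \<in> ball y \<epsilon>" using z by (simp add: y'_def dist_norm norm_minus_commute)
        then have "cp y' \<in> e" using \<epsilon>(2) by (auto simp: plate)
        moreover have "n \<bullet> y' = n \<bullet> y" using nz nc by (simp add: y'_def inner_add_right inner_diff_right)
        then have "cp y' = z" by (simp add: cp_def y'_def)
        ultimately show "z \<in> e" by simp
      qed
      then have "cp y \<in> rel_interior e" using \<epsilon>(1) y by (auto simp: mem_rel_interior_ball plate)
      then show False using y by (simp add: plate)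
    qed
    moreover have "y \<in> plate H e" using y by (auto simp: plate)
    ultimately show "y \<in> frontier (plate H e)" using closure_subset by (auto simp: frontier_def)
  qed
  have "negligible (plate H (e - rel_interior e))"
    by (rule negligible_subset[OF negligible_convex_frontier[OF conv] sub])
  then have "emeasure lebesgue (plate H (e - rel_interior e)) = 0"
    by (simp only: negligible_iff_null_sets null_setsD1)
  then have "emeasure lborel (plate H (e - rel_interior e)) = 0"
    using plate_borel[OF H b] by simp
  then have "emeasure surface_measure (e - rel_interior e) = 0"
    using emeasure_surface_measure_hyperplane[OF b H] n(2) by (auto simp: H_def)
  moreover have "e - rel_interior e \<in> sets surface_measure"
    using b by (simp add: surface_measure_eq sets_surf0 sets_completionI_sets)
  ultimately show ?thesis by (simp add: null_setsI)
qed

lemma measurable_surface: "f \<in> borel_measurable borel \<Longrightarrow> f \<in> borel_measurable (surface_measure :: (real^'d) measure)"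
  for f :: "real^'d \<Rightarrow> real"
  unfolding surface_measure_eq
  by (rule measurable_completion) (simp add: measurable_cong_sets[OF sets_surf0 refl])

context simplicial_mesh
begin

lemma face_of_common:
  assumes K: "K \<in> \<T>" "K' \<in> \<T>" and e: "e \<in> facets K" "e' \<in> facets K'"
  shows "(e \<inter> e') face_of e"
proof -
  have f: "e face_of K" "e' face_of K'" using e by (auto simp: facets_def facet_of_def)
  have I: "(K \<inter> K') face_of K" "(K \<inter> K') face_of K'" using face_T[OF K] face_T[OF K(2,1)] by (simp_all add: Int_commute)
  have sub: "e \<subseteq> K" "e' \<subseteq> K'" using f face_of_imp_subset by auto
  have "(e' \<inter> (K \<inter> K')) face_of K'" using f(2) I(2) by (rule face_of_Int)
  then have "(e' \<inter> (K \<inter> K')) face_of (K \<inter> K')" by (rule face_of_subset) auto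
  then have "(e' \<inter> (K \<inter> K')) face_of K" using I(1) by (rule face_of_trans)
  then have "(e \<inter> (e' \<inter> (K \<inter> K'))) face_of K" using f(1) face_of_Int by blast
  moreover have "e \<inter> (e' \<inter> (K \<inter> K')) = e \<inter> e'" using sub by blast
  ultimately have "(e \<inter> e') face_of K" by simp
  then show ?thesis by (rule face_of_subset[OF _ _ sub(1)]) auto
qed

text \<open>Two faces meet in a common face. It cannot be all of e, since as a face of e' of the
  same dimension it would equal e'. A proper face misses the relative interior.\<close>

lemma faces_Int_subset:
  assumes e: "e \<in> skeleton \<T>" "e' \<in> skeleton \<T>" "e \<noteq> e'"
  shows "e \<inter> e' \<subseteq> e - rel_interior e"
proof -
  obtain K K' where K: "K \<in> \<T>" "K' \<in> \<T>" "e \<in> facets K" "e' \<in> facets K'"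
    using e by (auto simp: skeleton_def)
  have f: "(e \<inter> e') face_of e" "(e \<inter> e') face_of e'"
    using face_of_common[OF K] face_of_common[OF K(2,1,4,3)] by (simp_all add: Int_commute)
  have cv: "convex e" "convex e'" using K face_of_imp_convex by (auto simp: facets_def facet_of_def)
  have "aff_dim e = aff_dim e'"
    using K aff_dim_T by (simp add: facets_def facet_of_def)
  have "e \<inter> e' \<noteq> e"
  proof
    assume eq: "e \<inter> e' = e"
    then have "e face_of e'" using f(2) by simp
    then show False using face_of_aff_dim_lt[OF cv(2), of e] e(3) \<open>aff_dim e = aff_dim e'\<close> by auto
  qed
  then have "(e \<inter> e') \<inter> rel_interior e = {}" by (rule face_of_disjoint_rel_interior[OF f(1)])
  then show ?thesis by blast
qed

lemma face_boundary_null: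
  assumes "e \<in> skeleton \<T>"
  shows "e - rel_interior e \<in> null_sets surface_measure"
proof -
  obtain K where K: "K \<in> \<T>" "e \<in> facets K" using assms by (auto simp: skeleton_def)
  obtain n c where "norm n = 1" "e = K \<inter> {x. n \<bullet> x = c}"
    using facet_props(4)[OF simplex_T[OF K(1)] K(2)] by blast
  moreover have "convex e" using K face_of_imp_convex by (auto simp: facets_def facet_of_def)
  ultimately show ?thesis
    using facet_props(1)[OF simplex_T[OF K(1)] K(2)] by (intro relative_boundary_null[of e n c]) auto
qed

lemma faces_on_subset: "faces_on \<T> \<Gamma> \<subseteq> skeleton \<T>" and finite_faces_on: "finite (faces_on \<T> \<Gamma>)"
  using finite_skeleton by (auto simp: faces_on_def)

text \<open>Closed faces overlap, and stick out of \<Gamma>, in their relative boundaries at most,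
  and these are null sets.\<close>

lemma bdry_ip_le:
  assumes g: "L2_on surface_measure \<Gamma> g" and z: "z \<in> F_space \<T> k"
  shows "\<bar>bdry_ip \<T> \<Gamma> (\<lambda>e. g) z\<bar> \<le> L2norm_on surface_measure \<Gamma> g * sqrt (bdry_ip \<T> \<Gamma> z z)"
proof -
  have "\<bar>\<Sum>e\<in>faces_on \<T> \<Gamma>. LINT x:e|surface_measure. g x * z e x\<bar>
    \<le> L2norm_on surface_measure \<Gamma> g * sqrt (\<Sum>e\<in>faces_on \<T> \<Gamma>. LINT x:e|surface_measure. (z e x)\<^sup>2)"
  proof (rule L2_pieces_le[OF _ g finite_faces_on])
    show "complete_measure (surface_measure :: (real^'d) measure)"
      unfolding surface_measure_def by (rule completion.complete_measure_axioms)
    show "AE x in surface_measure. (\<Sum>e\<in>faces_on \<T> \<Gamma>. indicator e x) \<le> (1::real)"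
    proof -
      have "AE x in surface_measure. \<forall>e\<in>faces_on \<T> \<Gamma>. x \<notin> e - rel_interior e"
      proof (rule AE_finite_allI[OF finite_faces_on])
        fix e assume "e \<in> faces_on \<T> \<Gamma>"
        then have "e \<in> skeleton \<T>" using faces_on_subset by blast
        then show "AE x in surface_measure. x \<notin> e - rel_interior e" by (intro AE_not_in face_boundary_null)
      qed
      then show ?thesis
      proof eventually_elim
        case (elim x)
        show ?case
        proof (cases "\<exists>e\<in>faces_on \<T> \<Gamma>. x \<in> e")
          case True
          then obtain e where e: "e \<in> faces_on \<T> \<Gamma>" "x \<in> e" by blast
          have "indicator e' x = (if e' = e then 1 else 0 :: real)" if e': "e' \<in> faces_on \<T> \<Gamma>" for e'
          proof (cases "e' = e")
            case False
            then have "x \<notin> e'" using faces_Int_subset[of e e'] e e' elim faces_on_subset by blast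
            then show ?thesis using False by simp
          qed (use e in simp)
          then have "(\<Sum>e\<in>faces_on \<T> \<Gamma>. indicator e x) = (\<Sum>e'\<in>faces_on \<T> \<Gamma>. if e' = e then 1 else 0 :: real)"
            by (rule sum.cong[OF refl])
          also have "\<dots> = 1" using e(1) finite_faces_on by simp
          finally show ?thesis by simp
        next
          case False
          then have "(\<Sum>e\<in>faces_on \<T> \<Gamma>. indicator e x) = (0::real)" by (intro sum.neutral) auto
          then show ?thesis by simp
        qed
      qed
    qed
    fix e assume e: "e \<in> faces_on \<T> \<Gamma>"
    then have es: "e \<in> skeleton \<T>" using faces_on_subset by blast
    then obtain K where K: "K \<in> \<T>" "e \<in> facets K" by (auto simp: skeleton_def)
    have be: "e \<in> sets borel" using facet_props(1)[OF simplex_T[OF K(1)] K(2)] by (rule borel_compact)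
    obtain zp where zp: "zp \<in> Poly k" "\<And>x. x \<in> e \<Longrightarrow> z e x = zp x" using z es by (auto simp: F_space_def)
    have czp: "continuous_on UNIV zp" using zp(1) by (rule Poly_continuous)
    have eq: "(\<lambda>x. indicator e x *\<^sub>R z e x) = (\<lambda>x. indicator e x * zp x)"
      "(\<lambda>x. indicator e x *\<^sub>R (z e x)\<^sup>2) = (\<lambda>x. indicator e x * (zp x)\<^sup>2)"
      using zp(2) by (auto simp: fun_eq_iff indicator_def)
    have [measurable]: "zp \<in> borel_measurable borel" using borel_measurable_continuous_onI[OF czp] .
    note [measurable] = be
    show "e \<in> sets surface_measure" using be by (simp add: surface_measure_eq sets_surf0 sets_completionI_sets)
    have "AE x in surface_measure. x \<notin> e - rel_interior e" using face_boundary_null[OF es] by (rule AE_not_in)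
    then show "AE x in surface_measure. x \<in> e \<longrightarrow> x \<in> \<Gamma>"
      by eventually_elim (use e in \<open>auto simp: faces_on_def\<close>)
    show "set_borel_measurable surface_measure e (z e)"
      unfolding set_borel_measurable_def eq by (rule measurable_surface) measurable
    have "integrable (face_measure e) (\<lambda>x. (zp x)\<^sup>2)"
      by (intro integrable_face_measure[OF simplex_T[OF K(1)] K(2)] continuous_intros czp)
    then have "integrable surf0 (\<lambda>x. indicator e x * (zp x)\<^sup>2)"
      unfolding face_measure_def
      by (subst (asm) integrable_density[where g = "indicator e", simplified ennreal_indicator])
         (auto simp: measurable_cong_sets[OF sets_surf0 refl])
    moreover have "(\<lambda>x. indicator e x * (zp x)\<^sup>2) \<in> borel_measurable surf0"
      unfolding measurable_cong_sets[OF sets_surf0 refl] by measurable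
    ultimately show "set_integrable surface_measure e (\<lambda>x. (z e x)\<^sup>2)"
      unfolding set_integrable_def eq surface_measure_eq by (simp add: integrable_completion)
  qed
  then show ?thesis by (simp add: bdry_ip_def power2_eq_square)
qed

lemma vol_ip_le:
  assumes f: "L2_on lebesgue \<Omega> f" and v: "\<And>K. K \<in> \<T> \<Longrightarrow> continuous_on UNIV (v K)"
  shows "\<bar>vol_ip \<T> (\<lambda>K. f) v\<bar> \<le> L2norm_on lebesgue \<Omega> f * sqrt (vol_ip \<T> v v)"
proof -
  have "\<bar>\<Sum>K\<in>\<T>. LINT x:K|lebesgue. f x * v K x\<bar>
    \<le> L2norm_on lebesgue \<Omega> f * sqrt (\<Sum>K\<in>\<T>. LINT x:K|lebesgue. (v K x)\<^sup>2)"
  proof (rule L2_pieces_le[OF _ f finite_T])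
    show "complete_measure (lebesgue :: (real^'d) measure)" by (rule completion.complete_measure_axioms)
    have "AE x in lebesgue. (\<Sum>K\<in>\<T>. indicator K x) = (indicator (\<Union>\<T>) x :: real)"
      by (rule AE_completion[OF AE_sum_indicator[OF subset_refl]])
    then show "AE x in lebesgue. (\<Sum>K\<in>\<T>. indicator K x) \<le> (1::real)"
      by eventually_elim (simp add: indicator_def)
    fix K assume K: "K \<in> \<T>"
    show "K \<in> sets lebesgue" using borel_T[OF K] by simp
    have "frontier K \<in> null_sets lebesgue"
      using negligible_convex_frontier[OF convex_T[OF K]] by (simp add: negligible_iff_null_sets)
    then have "AE x in lebesgue. x \<notin> frontier K" by (rule AE_not_in)
    then show "AE x in lebesgue. x \<in> K \<longrightarrow> x \<in> \<Omega>"
      by eventually_elim (use interior_subset_T[OF K] closure_subset in \<open>auto simp: frontier_def\<close>)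
    note [measurable] = borel_T[OF K] borel_measurable_continuous_onI[OF v[OF K]]
    show "set_borel_measurable lebesgue K (v K)"
      unfolding set_borel_measurable_def by (rule measurable_completion) measurable
    have "integrable lborel (\<lambda>x. indicator K x * (v K x)\<^sup>2)"
      by (intro integrable_continuous_bounded_support borel_T[OF K] bounded_T[OF K] continuous_intros v[OF K])
    then show "set_integrable lebesgue K (\<lambda>x. (v K x)\<^sup>2)"
      unfolding set_integrable_def by (subst integrable_completion) auto
  qed
  then show ?thesis by (simp add: vol_ip_def power2_eq_square)
qed

lemma vol_conv: "K \<in> \<T> \<Longrightarrow> continuous_on UNIV f \<Longrightarrow> (LINT x:K|lebesgue. f x) = (LINT x|vol_measure K. f x :: real)"
  using borel_T[of K] borel_measurable_continuous_onI[of f]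
  by (subst set_integral_lebesgue_lborel) (auto simp: integral_vol_measure)

lemma gauss_T:
  assumes K: "K \<in> \<T>" and u: "C1 u gu" and q: "q \<in> vPoly k"
  shows "(LINT x|vol_measure K. u x * divergence q x) + (LINT x|vol_measure K. gu x \<bullet> q x)
    = (\<Sum>e\<in>facets K. LINT x|face_measure e. u x * (q x \<bullet> outward_normal K e))"
    and "continuous_on UNIV (divergence q)"
proof -
  obtain gq where gq: "\<And>i. gq i \<in> vPoly k" "\<And>i. C1 (\<lambda>x. q x $ i) (gq i)" using vPoly_C1[OF q] by metis
  have div: "divergence q = (\<lambda>x. \<Sum>i\<in>UNIV. gq i x $ i)" using divergence_C1[OF gq(2)] by (simp add: fun_eq_iff)
  show cd: "continuous_on UNIV (divergence q)"
    unfolding div by (intro continuous_intros vPoly_continuous[OF gq(1)])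
  have cg: "continuous_on UNIV gu" using u by (simp add: C1_def)
  have "(\<lambda>x. u x * divergence q x) \<in> borel_measurable borel" "(\<lambda>x. gu x \<bullet> q x) \<in> borel_measurable borel"
    by (intro borel_measurable_continuous_onI continuous_intros cd cg C1_continuous[OF u] vPoly_continuous[OF q])+
  then show "(LINT x|vol_measure K. u x * divergence q x) + (LINT x|vol_measure K. gu x \<bullet> q x)
    = (\<Sum>e\<in>facets K. LINT x|face_measure e. u x * (q x \<bullet> outward_normal K e))"
    using gauss_product[OF simplex_T[OF K] u gq(2)] borel_T[OF K] by (simp add: integral_vol_measure div)
qed

lemma divergence_zero: "divergence (\<lambda>x. 0) x = 0"
  by (simp add: divergence_def)

text \<open>The first equation of the scheme with a test field that vanishes on all elements but K,
  after integration by parts of the term with the divergence.\<close>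

lemma hdg_flux:
  assumes hdg: "hdg_solution \<T> \<Gamma>\<^sub>D \<Gamma>\<^sub>N k \<tau> f u\<^sub>D u\<^sub>N p u w"
    and wp: "\<And>e. e \<in> skeleton \<T> \<Longrightarrow> wp e \<in> Poly k" "\<And>e x. e \<in> skeleton \<T> \<Longrightarrow> x \<in> e \<Longrightarrow> w e x = wp e x"
    and K: "K \<in> \<T>" and gu: "C1 (u K) gu" and q: "q \<in> vPoly k"
  shows "(LINT x|vol_measure K. gu x \<bullet> q x) + (LINT x|vol_measure K. p K x \<bullet> q x)
    = (\<Sum>e\<in>facets K. LINT x|face_measure e. (u K x - wp e x) * (q x \<bullet> outward_normal K e))"
proof -
  define Q where "Q L = (if L = K then q else (\<lambda>x. 0))" for L
  have QV: "Q \<in> V_space \<T> k" using q vPoly_const[of "0 :: real^'d" k] by (simp add: V_space_def Q_def)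
  have uU: "u \<in> U_space \<T> k" and wF: "w \<in> F_space \<T> k" and pV: "p \<in> V_space \<T> k" using hdg by (auto simp: hdg_solution_def)
  have cp: "continuous_on UNIV (p K)" and cu: "continuous_on UNIV (u K)" and cq: "continuous_on UNIV q"
    using pV uU K q by (auto simp: V_space_def U_space_def intro: vPoly_continuous Poly_continuous)
  have sk: "e \<in> skeleton \<T>" if "e \<in> facets K" for e using that K by (auto simp: skeleton_def)
  have cw: "continuous_on UNIV (wp e)" if "e \<in> facets K" for e using wp(1)[OF sk[OF that]] by (rule Poly_continuous)
  note cd = gauss_T(2)[OF K gu q]
  have single: "(\<Sum>L\<in>\<T>. F L) = F K" if "\<And>L. L \<in> \<T> \<Longrightarrow> L \<noteq> K \<Longrightarrow> F L = 0" for F :: "(real^'d) set \<Rightarrow> real"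
    using that K finite_T by (subst sum.remove[OF finite_T K]) (auto intro!: sum.neutral)
  have "vol_ip \<T> p Q = vol_ip \<T> u (\<lambda>K. divergence (Q K)) - skel_ip \<T> (\<lambda>K. w) (normal_trace Q)"
    using hdg QV uU wF unfolding hdg_solution_def by blast
  moreover have "vol_ip \<T> p Q = (LINT x|vol_measure K. p K x \<bullet> q x)"
    unfolding vol_ip_def by (subst single) (auto simp: Q_def set_lebesgue_integral_def[symmetric] intro!: vol_conv K continuous_intros cp cq)
  moreover have "vol_ip \<T> u (\<lambda>K. divergence (Q K)) = (LINT x|vol_measure K. u K x * divergence q x)"
    unfolding vol_ip_def by (subst single) (auto simp: Q_def divergence_zero intro!: vol_conv K continuous_intros cu cd)
  moreover have "skel_ip \<T> (\<lambda>K. w) (normal_trace Q) = (\<Sum>e\<in>facets K. LINT x|face_measure e. wp e x * (q x \<bullet> outward_normal K e))"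
    unfolding skel_ip_def
    by (subst single) (auto simp: Q_def normal_trace_def wp(2)[OF sk] intro!: sum.cong surface_integral_face_cong[OF simplex_T[OF K]] continuous_intros cw cq)
  moreover have "(\<Sum>e\<in>facets K. LINT x|face_measure e. (u K x - wp e x) * (q x \<bullet> outward_normal K e))
    = (\<Sum>e\<in>facets K. LINT x|face_measure e. u K x * (q x \<bullet> outward_normal K e)) - (\<Sum>e\<in>facets K. LINT x|face_measure e. wp e x * (q x \<bullet> outward_normal K e))"
    unfolding sum_subtractf[symmetric] left_diff_distrib
    by (intro sum.cong refl Bochner_Integration.integral_diff integrable_face_measure[OF simplex_T[OF K]] continuous_intros cu cq cw)
  ultimately show ?thesis using gauss_T(1)[OF K gu q] by linarith
qed

text \<open>The shift leaves the jumps unchanged and drops out of the terms with p, since on each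
  element the integral of the divergence of p equals its outward flux. The remaining terms are the
  square of the norm of p by the first equation tested with p. As the left side is free of c, the
  constant may afterwards be adapted to the Poincare estimate.\<close>

lemma hdg_energy:
  assumes hdg: "hdg_solution \<T> \<Gamma>\<^sub>D \<Gamma>\<^sub>N k \<tau> f u\<^sub>D u\<^sub>N p u w"
    and wp: "\<And>e. e \<in> skeleton \<T> \<Longrightarrow> wp e \<in> Poly k" "\<And>e x. e \<in> skeleton \<T> \<Longrightarrow> x \<in> e \<Longrightarrow> w e x = wp e x"
  shows "vol_ip \<T> p p + \<tau> * skel_ip \<T> (jump u w) (jump u w)
    = vol_ip \<T> (\<lambda>K. f) (\<lambda>K x. u K x - c) + bdry_ip \<T> \<Gamma>\<^sub>N (\<lambda>e. u\<^sub>N) (\<lambda>e x. w e x - c)"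
proof -
  have uU: "u \<in> U_space \<T> k" and wF: "w \<in> F_space \<T> k" and pV: "p \<in> V_space \<T> k" using hdg by (auto simp: hdg_solution_def)
  define v where "v K x = u K x - c" for K x
  define z where "z e x = w e x - c" for e x
  have vU: "v \<in> U_space \<T> k" using uU unfolding U_space_def v_def[abs_def] by (auto intro: Poly_diff Poly_const)
  have zF: "z \<in> F_space \<T> k"
    unfolding F_space_def
  proof (intro CollectI ballI)
    fix e assume e: "e \<in> skeleton \<T>"
    show "\<exists>p\<in>Poly k. \<forall>x\<in>e. z e x = p x"
      using wp[OF e] by (intro bexI[of _ "\<lambda>x. wp e x - c"]) (auto simp: z_def intro: Poly_diff Poly_const)
  qed
  have J: "jump v z = jump u w" by (simp add: fun_eq_iff jump_def v_def z_def)
  have 1: "vol_ip \<T> p p = vol_ip \<T> u (\<lambda>K. divergence (p K)) - skel_ip \<T> (\<lambda>K. w) (normal_trace p)"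
    using hdg pV uU wF unfolding hdg_solution_def by blast
  have 2: "\<tau> * skel_ip \<T> (jump u w) (jump u w) + vol_ip \<T> (\<lambda>K. divergence (p K)) v - skel_ip \<T> (normal_trace p) (\<lambda>K. z)
      = vol_ip \<T> (\<lambda>K. f) v + bdry_ip \<T> \<Gamma>\<^sub>N (\<lambda>e. u\<^sub>N) z"
    using hdg pV vU zF unfolding hdg_solution_def J[symmetric] by blast
  define dp where "dp K = (LINT x|vol_measure K. divergence (p K) x)" for K
  have K: "(LINT x:K|lebesgue. divergence (p K) x \<bullet> v K x) = (LINT x:K|lebesgue. u K x \<bullet> divergence (p K) x) - c * dp K"
    "(\<Sum>e\<in>facets K. LINT x:e|surface_measure. normal_trace p K e x * z e x)
      = (\<Sum>e\<in>facets K. LINT x:e|surface_measure. w e x * normal_trace p K e x) - c * dp K" if K: "K \<in> \<T>" for K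
  proof -
    have cp: "continuous_on UNIV (p K)" and cu: "continuous_on UNIV (u K)" and pK: "p K \<in> vPoly k"
      using pV uU K by (auto simp: V_space_def U_space_def intro: vPoly_continuous Poly_continuous)
    note G = gauss_T[OF K C1_const[of 1] pK]
    have cw: "continuous_on UNIV (wp e)" and weq: "x \<in> e \<Longrightarrow> w e x = wp e x" if "e \<in> facets K" for e x
      using that K wp(2)[of e x] Poly_continuous[OF wp(1)[of e]] by (auto simp: skeleton_def)
    have "(LINT x:K|lebesgue. divergence (p K) x \<bullet> v K x) = (LINT x|vol_measure K. u K x * divergence (p K) x - c * divergence (p K) x)"
      using vol_conv[OF K, of "\<lambda>x. u K x * divergence (p K) x - c * divergence (p K) x"] G(2) cu
      by (simp add: v_def algebra_simps continuous_intros)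
    also have "\<dots> = (LINT x|vol_measure K. u K x * divergence (p K) x) - (LINT x|vol_measure K. c * divergence (p K) x)"
      by (intro Bochner_Integration.integral_diff integrable_vol_measure[OF compact_T[OF K]] continuous_intros cu G(2))
    also have "(LINT x|vol_measure K. u K x * divergence (p K) x) = (LINT x:K|lebesgue. u K x \<bullet> divergence (p K) x)"
      unfolding inner_real_def by (rule vol_conv[OF K, symmetric]) (intro continuous_intros cu G(2))
    finally show "(LINT x:K|lebesgue. divergence (p K) x \<bullet> v K x) = (LINT x:K|lebesgue. u K x \<bullet> divergence (p K) x) - c * dp K"
      by (simp add: dp_def)
    have e: "(LINT x:e|surface_measure. normal_trace p K e x * z e x)
      = (LINT x:e|surface_measure. w e x * normal_trace p K e x) - c * (LINT x|face_measure e. p K x \<bullet> outward_normal K e)"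
      if e: "e \<in> facets K" for e
    proof -
      have "(LINT x:e|surface_measure. normal_trace p K e x * z e x)
        = (LINT x|face_measure e. wp e x * (p K x \<bullet> outward_normal K e) - c * (p K x \<bullet> outward_normal K e))"
        by (rule surface_integral_face_cong[OF simplex_T[OF K] e])
          (intro continuous_intros cw[OF e] cp, simp add: normal_trace_def z_def weq[OF e] algebra_simps)
      also have "\<dots> = (LINT x|face_measure e. wp e x * (p K x \<bullet> outward_normal K e)) - (LINT x|face_measure e. c * (p K x \<bullet> outward_normal K e))"
        by (intro Bochner_Integration.integral_diff integrable_face_measure[OF simplex_T[OF K] e] continuous_intros cw[OF e] cp)
      also have "(LINT x|face_measure e. wp e x * (p K x \<bullet> outward_normal K e)) = (LINT x:e|surface_measure. w e x * normal_trace p K e x)"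
        by (rule surface_integral_face_cong[OF simplex_T[OF K] e, symmetric])
          (intro continuous_intros cw[OF e] cp, simp add: normal_trace_def weq[OF e])
      finally show ?thesis by simp
    qed
    have "(\<Sum>e\<in>facets K. LINT x|face_measure e. p K x \<bullet> outward_normal K e) = dp K"
      using G(1) by (simp add: dp_def)
    then show "(\<Sum>e\<in>facets K. LINT x:e|surface_measure. normal_trace p K e x * z e x)
      = (\<Sum>e\<in>facets K. LINT x:e|surface_measure. w e x * normal_trace p K e x) - c * dp K"
      by (simp add: e sum_subtractf flip: sum_distrib_left)
  qed
  have "vol_ip \<T> (\<lambda>K. divergence (p K)) v - skel_ip \<T> (normal_trace p) (\<lambda>K. z)
    = vol_ip \<T> u (\<lambda>K. divergence (p K)) - skel_ip \<T> (\<lambda>K. w) (normal_trace p)"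
    unfolding vol_ip_def skel_ip_def sum_subtractf[symmetric]
  proof (rule sum.cong[OF refl])
    fix L assume "L \<in> \<T>"
    from K[OF this] show "(LINT x:L|lebesgue. divergence (p L) x \<bullet> v L x) - (\<Sum>e\<in>facets L. LINT x:e|surface_measure. normal_trace p L e x * z e x)
      = (LINT x:L|lebesgue. u L x \<bullet> divergence (p L) x) - (\<Sum>e\<in>facets L. LINT x:e|surface_measure. w e x * normal_trace p L e x)"
      by linarith
  qed
  then show ?thesis using 1 2 unfolding v_def[abs_def] z_def[abs_def] by linarith
qed

end

lemma vol_ip_nonneg: "0 \<le> vol_ip \<T> f f" and skel_ip_nonneg: "0 \<le> skel_ip \<T> g g" and bdry_ip_nonneg: "0 \<le> bdry_ip \<T> \<Gamma> v v"
  unfolding vol_ip_def skel_ip_def bdry_ip_def set_lebesgue_integral_def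
  by (intro sum_nonneg Bochner_Integration.integral_nonneg; simp)+

text \<open>A face is the closure of its relative interior, and the frontier is closed.\<close>

lemma (in simplicial_mesh) faces_on_boundary:
  assumes "\<Gamma> \<subseteq> frontier \<Omega>"
  shows "faces_on \<T> \<Gamma> \<subseteq> boundary_faces \<Omega> \<T>"
proof
  fix e assume e: "e \<in> faces_on \<T> \<Gamma>"
  then obtain K where K: "K \<in> \<T>" "e \<in> facets K" by (auto simp: faces_on_def skeleton_def)
  have "convex e" using K face_of_imp_convex by (auto simp: facets_def facet_of_def)
  then have "e \<subseteq> closure (rel_interior e)"
    using convex_closure_rel_interior[of e] closure_subset by auto
  also have "\<dots> \<subseteq> frontier \<Omega>"
    using e assms by (intro closure_minimal) (auto simp: faces_on_def)
  finally show "e \<in> boundary_faces \<Omega> \<T>" using e by (auto simp: boundary_faces_def faces_on_def)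
qed

text \<open>The third equation tested with w itself, followed by Cauchy-Schwarz and division by the
  norm of w.\<close>

lemma (in simplicial_mesh) hdg_dirichlet:
  assumes hdg: "hdg_solution \<T> \<Gamma>\<^sub>D \<Gamma>\<^sub>N k \<tau> f u\<^sub>D u\<^sub>N p u w" and uD: "L2_on surface_measure \<Gamma>\<^sub>D u\<^sub>D"
  shows "bdry_ip \<T> \<Gamma>\<^sub>D w w \<le> (L2norm_on surface_measure \<Gamma>\<^sub>D u\<^sub>D)\<^sup>2"
proof -
  have F: "p \<in> V_space \<T> k" "u \<in> U_space \<T> k" "w \<in> F_space \<T> k" using hdg by (auto simp: hdg_solution_def)
  have "bdry_ip \<T> \<Gamma>\<^sub>D w w = bdry_ip \<T> \<Gamma>\<^sub>D (\<lambda>e. u\<^sub>D) w" using hdg F unfolding hdg_solution_def by blast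
  then have *: "bdry_ip \<T> \<Gamma>\<^sub>D w w \<le> L2norm_on surface_measure \<Gamma>\<^sub>D u\<^sub>D * sqrt (bdry_ip \<T> \<Gamma>\<^sub>D w w)"
    using bdry_ip_le[OF uD F(3)] by simp
  define N where "N = sqrt (bdry_ip \<T> \<Gamma>\<^sub>D w w)"
  have N: "0 \<le> N" "bdry_ip \<T> \<Gamma>\<^sub>D w w = N\<^sup>2" using bdry_ip_nonneg[of \<T> \<Gamma>\<^sub>D w] by (auto simp: N_def)
  have le: "N * N \<le> L2norm_on surface_measure \<Gamma>\<^sub>D u\<^sub>D * N"
    using * unfolding N_def[symmetric] unfolding N(2) power2_eq_square .
  have "N \<le> L2norm_on surface_measure \<Gamma>\<^sub>D u\<^sub>D"
  proof (cases "N = 0")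
    case True
    then show ?thesis by (simp add: L2norm_on_nonneg)
  qed (use le N(1) in auto)
  then show ?thesis unfolding N(2) using N(1) by (rule power_mono)
qed

text \<open>The energy identity bounds the weighted energy \<open>G\<close> by the data times the
  Poincare norm, that is by a sqrt C E, while the square of E is at most t times \<open>G\<close>.
  Hence E \<le> t a sqrt C, and inserting this gives the bound for \<open>G\<close>.\<close>

lemma (in regular_mesh) hdg_stability:
  assumes hdg: "hdg_solution \<T> \<Gamma>\<^sub>D \<Gamma>\<^sub>N k \<tau> f u\<^sub>D u\<^sub>N p u w" and tau: "0 < \<tau>"
    and f: "L2_on lebesgue \<Omega> f" and uN: "L2_on surface_measure \<Gamma>\<^sub>N u\<^sub>N" and GN: "\<Gamma>\<^sub>N \<subseteq> frontier \<Omega>"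
    and M: "0 \<le> M" "\<And>K v x. compact (K :: (real^'d) set) \<Longrightarrow> convex K \<Longrightarrow> v \<in> Poly k \<Longrightarrow> x \<in> K \<Longrightarrow>
      measure lebesgue K * (v x)\<^sup>2 \<le> M * (LINT x:K|lebesgue. (v x)\<^sup>2)"
    and C: "0 \<le> C" "\<And>p gu u w. hdg_discrete \<Omega> \<T> \<kappa> A k M p gu u w \<Longrightarrow>
      \<exists>c. nrm2 \<T> UNIV u c \<le> C * (hdg_discrete.E \<T> p u w)\<^sup>2 \<and>
        (\<Sum>e\<in>boundary_faces \<Omega> \<T>. LINT x|face_measure e. (w e x - c)\<^sup>2) \<le> C * (hdg_discrete.E \<T> p u w)\<^sup>2"
  shows "vol_ip \<T> p p + \<tau> * skel_ip \<T> (jump u w) (jump u w)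
    \<le> (L2norm_on lebesgue \<Omega> f + L2norm_on surface_measure \<Gamma>\<^sub>N u\<^sub>N)\<^sup>2 * max 1 (1 / \<tau>) * C"
proof -
  have pV: "p K \<in> vPoly k" and uU: "u K \<in> Poly k" if "K \<in> \<T>" for K
    using hdg that by (auto simp: hdg_solution_def V_space_def U_space_def)
  have wF: "w \<in> F_space \<T> k" using hdg by (simp add: hdg_solution_def)
  then have "\<forall>e\<in>skeleton \<T>. \<exists>q. q \<in> Poly k \<and> (\<forall>x\<in>e. w e x = q x)" by (auto simp: F_space_def)
  from bchoice[OF this] obtain wp where
    wp: "\<And>e. e \<in> skeleton \<T> \<Longrightarrow> wp e \<in> Poly k" "\<And>e x. e \<in> skeleton \<T> \<Longrightarrow> x \<in> e \<Longrightarrow> w e x = wp e x"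
    by blast
  have "\<forall>K\<in>\<T>. \<exists>g. g \<in> vPoly k \<and> C1 (u K) g" using Poly_C1[OF uU] by metis
  then obtain gu where gu: "\<And>K. K \<in> \<T> \<Longrightarrow> gu K \<in> vPoly k" "\<And>K. K \<in> \<T> \<Longrightarrow> C1 (u K) (gu K)"
    by (auto dest!: bchoice)
  have flux: "(LINT x|vol_measure K. gu K x \<bullet> q x) + (LINT x|vol_measure K. p K x \<bullet> q x)
    = (\<Sum>e\<in>facets K. LINT x|face_measure e. (u K x - wp e x) * (q x \<bullet> outward_normal K e))"
    if "K \<in> \<T>" "q \<in> vPoly k" for K q
    by (rule hdg_flux[OF hdg wp that(1) gu(2)[OF that(1)] that(2)])
  interpret D: hdg_discrete \<Omega> \<T> \<kappa> A k M p gu u wp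
    by unfold_locales (fact M pV uU gu wp(1) flux)+
  have vp: "vol_ip \<T> p p = (\<Sum>K\<in>\<T>. D.flux2 K)"
    unfolding vol_ip_def D.flux2_def power2_norm_eq_inner
    by (intro sum.cong refl vol_conv continuous_intros D.cont_p)
  have sk: "e \<in> skeleton \<T>" if "K \<in> \<T>" "e \<in> facets K" for K e using that by (auto simp: skeleton_def)
  have jj: "skel_ip \<T> (jump u w) (jump u w) = (\<Sum>K\<in>\<T>. D.jump2 K)"
    unfolding skel_ip_def D.jump2_def
  proof (intro sum.cong refl)
    fix K e assume K: "K \<in> \<T>" "e \<in> facets K"
    show "(LINT x:e|surface_measure. jump u w K e x * jump u w K e x) = (LINT x|face_measure e. (u K x - wp e x)\<^sup>2)"
      using wp(2)[OF sk[OF K]]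
      by (intro surface_integral_face_cong[OF simplex_T[OF K(1)] K(2)] continuous_intros D.cont_u[OF K(1)] D.cont_w[OF K])
         (simp add: jump_def power2_eq_square)
  qed
  define G where "G = vol_ip \<T> p p + \<tau> * skel_ip \<T> (jump u w) (jump u w)"
  \<comment> \<open>E carries the jumps with weight 1 and \<open>G\<close> with weight \<tau>; t is
    the price for passing from one to the other.\<close>
  define t where "t = max 1 (1 / \<tau>)"
  define a where "a = L2norm_on lebesgue \<Omega> f + L2norm_on surface_measure \<Gamma>\<^sub>N u\<^sub>N"
  have a0: "0 \<le> a" by (simp add: a_def L2norm_on_nonneg)
  have E0: "0 \<le> D.E" unfolding D.E_def by (simp add: sum_nonneg D.en_nonneg)
  have E2: "D.E\<^sup>2 = vol_ip \<T> p p + skel_ip \<T> (jump u w) (jump u w)"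
    unfolding D.E_def vp jj by (simp add: D.en_def sum.distrib sum_nonneg D.flux2_nonneg D.jump2_nonneg)
  have "1 * vol_ip \<T> p p \<le> t * vol_ip \<T> p p"
    by (rule mult_right_mono[OF _ vol_ip_nonneg]) (simp add: t_def)
  moreover have "1 * skel_ip \<T> (jump u w) (jump u w) \<le> (t * \<tau>) * skel_ip \<T> (jump u w) (jump u w)"
  proof (rule mult_right_mono[OF _ skel_ip_nonneg])
    have "1 / \<tau> \<le> t" by (simp add: t_def)
    then show "1 \<le> t * \<tau>" using tau by (simp add: field_simps)
  qed
  ultimately have E2G: "D.E\<^sup>2 \<le> t * G" unfolding E2 G_def by (simp add: algebra_simps)
  obtain c where c: "nrm2 \<T> UNIV u c \<le> C * D.E\<^sup>2"
      "(\<Sum>e\<in>boundary_faces \<Omega> \<T>. LINT x|face_measure e. (wp e x - c)\<^sup>2) \<le> C * D.E\<^sup>2"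
    using C(2)[OF D.hdg_discrete_axioms] by blast
  have sqE: "sqrt (C * D.E\<^sup>2) = sqrt C * D.E" using E0 by (simp add: real_sqrt_mult)
  have 1: "vol_ip \<T> (\<lambda>K. f) (\<lambda>K x. u K x - c) \<le> L2norm_on lebesgue \<Omega> f * (sqrt C * D.E)"
  proof -
    have cu: "continuous_on UNIV (\<lambda>x. u K x - c)" if "K \<in> \<T>" for K
      by (intro continuous_intros D.cont_u[OF that])
    have "vol_ip \<T> (\<lambda>K x. u K x - c) (\<lambda>K x. u K x - c) = nrm2 \<T> UNIV u c"
      unfolding vol_ip_def nrm2_def inner_real_def power2_eq_square Int_UNIV_right
      by (intro sum.cong refl vol_conv continuous_on_mult cu)
    then have "\<bar>vol_ip \<T> (\<lambda>K. f) (\<lambda>K x. u K x - c)\<bar> \<le> L2norm_on lebesgue \<Omega> f * sqrt (nrm2 \<T> UNIV u c)"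
      using vol_ip_le[OF f, of "\<lambda>K x. u K x - c", OF cu] by simp
    also have "\<dots> \<le> L2norm_on lebesgue \<Omega> f * (sqrt C * D.E)"
      unfolding sqE[symmetric] using c(1) by (intro mult_left_mono real_sqrt_le_mono L2norm_on_nonneg)
    finally show ?thesis by linarith
  qed
  have 2: "bdry_ip \<T> \<Gamma>\<^sub>N (\<lambda>e. u\<^sub>N) (\<lambda>e x. w e x - c) \<le> L2norm_on surface_measure \<Gamma>\<^sub>N u\<^sub>N * (sqrt C * D.E)"
  proof -
    have zF: "(\<lambda>e x. w e x - c) \<in> F_space \<T> k"
      unfolding F_space_def
    proof (intro CollectI ballI)
      fix e assume e: "e \<in> skeleton \<T>"
      show "\<exists>p\<in>Poly k. \<forall>x\<in>e. w e x - c = p x"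
        using wp[OF e] by (intro bexI[of _ "\<lambda>x. wp e x - c"]) (auto intro: Poly_diff Poly_const)
    qed
    have "bdry_ip \<T> \<Gamma>\<^sub>N (\<lambda>e x. w e x - c) (\<lambda>e x. w e x - c) = (\<Sum>e\<in>faces_on \<T> \<Gamma>\<^sub>N. LINT x|face_measure e. (wp e x - c)\<^sup>2)"
      unfolding bdry_ip_def
    proof (rule sum.cong[OF refl])
      fix e assume "e \<in> faces_on \<T> \<Gamma>\<^sub>N"
      then have e: "e \<in> skeleton \<T>" using faces_on_subset by blast
      then obtain K where K: "K \<in> \<T>" "e \<in> facets K" by (auto simp: skeleton_def)
      show "(LINT x:e|surface_measure. (w e x - c) * (w e x - c)) = (LINT x|face_measure e. (wp e x - c)\<^sup>2)"
        using wp(2)[OF e]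
        by (intro surface_integral_face_cong[OF simplex_T[OF K(1)] K(2)] continuous_intros D.cont_w[OF K])
           (simp add: power2_eq_square)
    qed
    also have "\<dots> \<le> (\<Sum>e\<in>boundary_faces \<Omega> \<T>. LINT x|face_measure e. (wp e x - c)\<^sup>2)"
    proof (rule sum_mono2)
      show "finite (boundary_faces \<Omega> \<T>)" using finite_skeleton by (simp add: boundary_faces_def)
      show "faces_on \<T> \<Gamma>\<^sub>N \<subseteq> boundary_faces \<Omega> \<T>" by (rule faces_on_boundary[OF GN])
    qed (auto intro: Bochner_Integration.integral_nonneg)
    also have "\<dots> \<le> C * D.E\<^sup>2" by (rule c(2))
    finally have le: "bdry_ip \<T> \<Gamma>\<^sub>N (\<lambda>e x. w e x - c) (\<lambda>e x. w e x - c) \<le> C * D.E\<^sup>2" .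
    have "\<bar>bdry_ip \<T> \<Gamma>\<^sub>N (\<lambda>e. u\<^sub>N) (\<lambda>e x. w e x - c)\<bar> \<le> L2norm_on surface_measure \<Gamma>\<^sub>N u\<^sub>N * sqrt (bdry_ip \<T> \<Gamma>\<^sub>N (\<lambda>e x. w e x - c) (\<lambda>e x. w e x - c))"
      by (rule bdry_ip_le[OF uN zF])
    also have "\<dots> \<le> L2norm_on surface_measure \<Gamma>\<^sub>N u\<^sub>N * (sqrt C * D.E)"
      unfolding sqE[symmetric] using le by (intro mult_left_mono real_sqrt_le_mono L2norm_on_nonneg)
    finally show ?thesis by linarith
  qed
  have Gle: "G \<le> a * (sqrt C * D.E)"
    using 1 2 hdg_energy[OF hdg wp, of c] unfolding G_def a_def by (simp add: distrib_right)
  have t0: "0 \<le> t" by (simp add: t_def)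
  have "D.E * D.E \<le> (t * a * sqrt C) * D.E"
    using E2G mult_left_mono[OF Gle t0] by (simp add: power2_eq_square algebra_simps)
  then have "D.E \<le> t * a * sqrt C"
  proof (cases "D.E = 0")
    case True
    then show ?thesis using t0 a0 C(1) by simp
  qed (use E0 in auto)
  then have "a * (sqrt C * D.E) \<le> a * (sqrt C * (t * a * sqrt C))"
    using a0 C(1) by (intro mult_left_mono) auto
  also have "\<dots> = a\<^sup>2 * t * (sqrt C * sqrt C)" by (simp add: power2_eq_square)
  also have "\<dots> = a\<^sup>2 * t * C" using C(1) by simp
  finally show ?thesis using Gle unfolding G_def a_def t_def by linarith
qed

theorem theorem5p8:
  fixes \<Omega> \<Gamma>\<^sub>D \<Gamma>\<^sub>N :: "(real^'d) set" and k :: nat and \<tau> \<kappa> A :: real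
  assumes "CARD('d) \<in> {2, 3}"
    and "polyhedral_domain \<Omega>"
    and "frontier \<Omega> = closure \<Gamma>\<^sub>D \<union> closure \<Gamma>\<^sub>N" and "\<Gamma>\<^sub>D \<inter> \<Gamma>\<^sub>N = {}"
    and "\<tau> > 0" and "\<kappa> > 0"
  shows "\<exists>C :: real \<Rightarrow> real \<Rightarrow> real \<Rightarrow> real. \<forall>\<T>.
    mesh \<Omega> \<T> \<and> shape_regular \<kappa> \<T> \<and> quasi_uniform A \<T> \<and>
    resolves \<Omega> \<T> \<Gamma>\<^sub>D \<and> resolves \<Omega> \<T> \<Gamma>\<^sub>N \<longrightarrow>
    (\<forall>f u\<^sub>D u\<^sub>N p u w.
       L2_on lebesgue \<Omega> f \<and> L2_on surface_measure \<Gamma>\<^sub>D u\<^sub>D \<and> L2_on surface_measure \<Gamma>\<^sub>N u\<^sub>N \<and>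
       hdg_solution \<T> \<Gamma>\<^sub>D \<Gamma>\<^sub>N k \<tau> f u\<^sub>D u\<^sub>N p u w \<longrightarrow>
       (vol_norm \<T> p)\<^sup>2 + \<tau> * (skel_norm \<T> (jump u w))\<^sup>2 + (bdry_norm \<T> \<Gamma>\<^sub>D w)\<^sup>2
         \<le> C (L2norm_on lebesgue \<Omega> f) (L2norm_on surface_measure \<Gamma>\<^sub>D u\<^sub>D)
             (L2norm_on surface_measure \<Gamma>\<^sub>N u\<^sub>N))"
proof (cases "\<exists>\<T>. mesh \<Omega> \<T>")
  \<comment> \<open>One mesh is fixed as the reference mesh. Its elements are the convex bodies that
    cover the closed domain, whichever mesh is considered later. If \<Omega> admits no mesh, the
    claim is vacuous.\<close>
  case True
  then obtain \<T>\<^sub>0 where "mesh \<Omega> \<T>\<^sub>0" by blast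
  then interpret T0: simplicial_mesh \<Omega> \<T>\<^sub>0 using assms(2) by unfold_locales
  obtain M where M0: "0 \<le> M" and "\<forall>(K :: (real^'d) set) v x. compact K \<longrightarrow> convex K \<longrightarrow> v \<in> Poly k \<longrightarrow> x \<in> K \<longrightarrow>
      measure lebesgue K * (v x)\<^sup>2 \<le> M * (LINT x:K|lebesgue. (v x)\<^sup>2)"
    using poly_inverse_inequality[of k] by (elim exE conjE)
  then have M: "measure lebesgue K * (v x)\<^sup>2 \<le> M * (LINT x:K|lebesgue. (v x)\<^sup>2)"
    if "compact (K :: (real^'d) set)" "convex K" "v \<in> Poly k" "x \<in> K" for K v x
    using that by simp
  obtain C where C: "0 \<le> C" "\<And>\<T> p gu u w. hdg_discrete \<Omega> \<T> \<kappa> A k M p gu u w \<Longrightarrow>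
      \<exists>c. nrm2 \<T> UNIV u c \<le> C * (hdg_discrete.E \<T> p u w)\<^sup>2 \<and>
        (\<Sum>e\<in>boundary_faces \<Omega> \<T>. LINT x|face_measure e. (w e x - c)\<^sup>2) \<le> C * (hdg_discrete.E \<T> p u w)\<^sup>2"
    by (rule T0.poincare_trace[of \<kappa> A k M]) (rule that)
  have GN: "\<Gamma>\<^sub>N \<subseteq> frontier \<Omega>" using assms(3) closure_subset by blast
  show ?thesis
  \<comment> \<open>The first summand bounds p and the jumps, the second the trace on the Dirichlet
    part. Both M and C were obtained before \<T>: M for the given d and k, and C for the given
    \<Omega>, \<kappa>, \<open>A\<close>, k and M.\<close>
  proof (intro exI[of _ "\<lambda>a b c. (a + c)\<^sup>2 * max 1 (1 / \<tau>) * C + b\<^sup>2"] allI impI)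
    fix \<T> f u\<^sub>D u\<^sub>N p u w
    assume T: "mesh \<Omega> \<T> \<and> shape_regular \<kappa> \<T> \<and> quasi_uniform A \<T> \<and> resolves \<Omega> \<T> \<Gamma>\<^sub>D \<and> resolves \<Omega> \<T> \<Gamma>\<^sub>N"
      and sol: "L2_on lebesgue \<Omega> f \<and> L2_on surface_measure \<Gamma>\<^sub>D u\<^sub>D \<and> L2_on surface_measure \<Gamma>\<^sub>N u\<^sub>N \<and>
        hdg_solution \<T> \<Gamma>\<^sub>D \<Gamma>\<^sub>N k \<tau> f u\<^sub>D u\<^sub>N p u w"
    then have f: "L2_on lebesgue \<Omega> f" and uD: "L2_on surface_measure \<Gamma>\<^sub>D u\<^sub>D" and uN: "L2_on surface_measure \<Gamma>\<^sub>N u\<^sub>N"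
      and hdg: "hdg_solution \<T> \<Gamma>\<^sub>D \<Gamma>\<^sub>N k \<tau> f u\<^sub>D u\<^sub>N p u w" by blast+
    interpret regular_mesh \<Omega> \<T> \<kappa> A using T assms(2,6) by unfold_locales auto
    have "vol_ip \<T> p p + \<tau> * skel_ip \<T> (jump u w) (jump u w)
        \<le> (L2norm_on lebesgue \<Omega> f + L2norm_on surface_measure \<Gamma>\<^sub>N u\<^sub>N)\<^sup>2 * max 1 (1 / \<tau>) * C"
      by (rule hdg_stability[OF hdg assms(5) f uN GN M0 M C])
    moreover have "bdry_ip \<T> \<Gamma>\<^sub>D w w \<le> (L2norm_on surface_measure \<Gamma>\<^sub>D u\<^sub>D)\<^sup>2"
      by (rule hdg_dirichlet[OF hdg uD])
    ultimately show "(vol_norm \<T> p)\<^sup>2 + \<tau> * (skel_norm \<T> (jump u w))\<^sup>2 + (bdry_norm \<T> \<Gamma>\<^sub>D w)\<^sup>2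
         \<le> (L2norm_on lebesgue \<Omega> f + L2norm_on surface_measure \<Gamma>\<^sub>N u\<^sub>N)\<^sup>2 * max 1 (1 / \<tau>) * C
           + (L2norm_on surface_measure \<Gamma>\<^sub>D u\<^sub>D)\<^sup>2"
      by (simp add: vol_norm_def skel_norm_def bdry_norm_def vol_ip_nonneg skel_ip_nonneg bdry_ip_nonneg)
  qed
qed blast

end
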